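(* Assume $1<p<N$, $p+m-3>0$, and that $g\in C([0,+\infty))\cap C^1((0,+\infty))$, $g(0)=0$, $g(s)>0$ for $s>0$, satisfies, for given $0<\alpha_1\le\alpha_2<p$, $$\alpha_1\frac{g(s)}{s}\le g'(s)\le\alpha_2\frac{g(s)}{s},\qquad s>0.$$ Let $f(x)=e^{g(|x|)}$ and let $u$ be a strong solution to the Cauchy problem $$f(x)\,\frac{\partial u}{\partial t}-\operatorname{div}\big(f(x)u^{m-1}|\nabla u|^{p-2}\nabla u\big)=0\ \text{ in } S_\infty=\mathbb R^N\times(0,+\infty),\qquad u(x,0)=u_0(x),\ x\in\mathbb R^N,$$ with compactly supported and bounded initial data $u_0\ge0$. Then there exist constants $t_0>1$ and $C_*,r_0,\varGamma>0$ such that the function $\widetilde u$ (defined in the context) is a supersolution to the equation and $$u(x,t)\le\widetilde u(x,t),\qquad (x,t)\in S_\infty.$$ Moreover, for a suitable constant $\gamma>0$, $$\operatorname{supp}u(t)\subset B_{R(t)}(0),\qquad R(t)=\gamma\,g^{(-1)}(\log t),\qquad t>t_0.$$ The constants here depend on the parameters appearing in the assumptions (i.e. on $N,p,m,\alpha_1,\alpha_2$ and $g$), on $\sup_{\mathbb R^N}u_0$, and on $\bar R(0)=\inf\{r>0:\operatorname{supp}u_0\subset B_r(0)\}$.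
   Context: $g^{(-1)}$ is the inverse function of $g$. $L^1_f(\mathbb R^N)$ is the $L^1$ space with respect to the measure $f(x)\,dx$, and $L^1_{f,\mathrm{loc}}$ its local version. Barrier function. $G(r)=\int_0^r\frac{g(s)}{s}\,ds$ for $r\ge0$; $G^{(-1)}$ is the inverse function of $G$; $J(r)=\frac{r^p}{G(r)}$ for $r>0$; $\tau=\varGamma\log(t+t_0)$ for $t\ge0$; $E(\tau)=J(G^{(-1)}(\tau))=\frac{G^{(-1)}(\tau)^p}{\tau}$ for $\tau>0$; and $$I(r)=\nu_0\Big(\frac{r^p}{G(r_0)}\Big)^{\frac1{p-1}}+(1-\nu_0)J(r_0)^{\frac1{p-1}}.$$ With $r=|x|$ and $[\cdot]_+$ the positive part, $$\widetilde u(x,t)=\frac{C_*}{(t+t_0)^{\frac1{p+m-3}}}\Big[E(\tau)^{\frac1{p-1}}-J(r)^{\frac1{p-1}}\Big]_+^{\frac{p-1}{p+m-3}},\quad r\ge r_0,$$ $$\widetilde u(x,t)=\frac{C_*}{(t+t_0)^{\frac1{p+m-3}}}\Big[E(\tau)^{\frac1{p-1}}-I(r)\Big]_+^{\frac{p-1}{p+m-3}},\quad r<r_0.$$ The constant $\nu_0\in(0,1)$ is selected so that $\widetilde u$ and $\widetilde u_r$ are continuous also at $r=r_0$, namely $\nu_0=1-\frac{r_0G'(r_0)}{p\,G(r_0)}$. Solutions. A function $u\ge0$ is a weak solution to the equation if $u\in C([0,+\infty);L^1_f(\mathbb R^N))\cap L^\infty(\mathbb R^N\times(\bar t,+\infty))$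 for all $\bar t>0$, $\nabla u^{\frac{p+m-2}{p-1}}\in L^p_{\mathrm{loc}}(S_\infty)$, and for all $\eta\in C_0^\infty(S_\infty)$ $$\int_0^{+\infty}\!\!\int_{\mathbb R^N}\{-u\eta_t+u^{m-1}|\nabla u|^{p-2}\nabla u\cdot\nabla\eta\}f(x)\,dx\,dt=0.$$ If moreover $u_t\in L^\infty_{\mathrm{loc}}((0,+\infty);L^1_{f,\mathrm{loc}}(\mathbb R^N))$, then $u$ is a strong solution. Supersolutions [subsolutions] are defined similarly, requiring for all $\eta\ge0$ the inequality sign $\ge$ [$\le$] in place of equality in the integral identity. Solutions to the Cauchy problem are solutions to the equation with $u(0)=u_0$ in the sense of $C([0,+\infty);L^1_f(\mathbb R^N))$. *)

theory Defs
  imports "HOL-Analysis.Analysis" "HOL-Probability.Essential_Supremum"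
begin

section \<open>Function spaces\<close>

definition S_inf :: "('a::euclidean_space \<times> real) set" where
  "S_inf = UNIV \<times> {0<..}"

primrec C_k :: "nat \<Rightarrow> ('b::euclidean_space \<Rightarrow> real) \<Rightarrow> bool" where
  "C_k 0 h \<longleftrightarrow> continuous_on UNIV h"
| "C_k (Suc k) h \<longleftrightarrow>
     (\<forall>z. h differentiable (at z)) \<and> (\<forall>v. C_k k (\<lambda>z. frechet_derivative h (at z) v))"

text \<open>Test functions \<open>C\<^sub>0\<^sup>\<infinity>(S)\<close> for open \<open>S\<close>, extended by zero to the whole space.\<close>

definition test_functions :: "('b::euclidean_space) set \<Rightarrow> ('b \<Rightarrow> real) set" where
  "test_functions S =
     {\<eta>. (\<forall>k. C_k k \<eta>) \<and> compact (closure {z. \<eta> z \<noteq> 0}) \<and> closure {z. \<eta> z \<noteq> 0} \<subseteq> S}"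

definition time_deriv :: "('a::euclidean_space \<times> real \<Rightarrow> real) \<Rightarrow> 'a \<times> real \<Rightarrow> real" where
  "time_deriv \<eta> z = frechet_derivative \<eta> (at z) (0, 1)"

definition space_grad :: "('a::euclidean_space \<times> real \<Rightarrow> real) \<Rightarrow> 'a \<times> real \<Rightarrow> 'a" where
  "space_grad \<eta> z = (\<Sum>i\<in>Basis. frechet_derivative \<eta> (at z) (i, 0) *\<^sub>R i)"

definition locally_integrable ::
    "('b::euclidean_space) set \<Rightarrow> ('b \<Rightarrow> 'c::euclidean_space) \<Rightarrow> bool" where
  "locally_integrable S h \<longleftrightarrow> (\<forall>K. compact K \<and> K \<subseteq> S \<longrightarrow> h absolutely_integrable_on K)"

definition has_weak_space_grad ::
    "('a::euclidean_space \<times> real \<Rightarrow> real) \<Rightarrow> ('a \<times> real \<Rightarrow> 'a) \<Rightarrow> bool" where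
  "has_weak_space_grad w W \<longleftrightarrow>
     locally_integrable S_inf w \<and> locally_integrable S_inf W \<and>
     (\<forall>\<eta>\<in>test_functions S_inf.
        (LINT z:S_inf|lebesgue. w z *\<^sub>R space_grad \<eta> z) = - (LINT z:S_inf|lebesgue. \<eta> z *\<^sub>R W z))"

definition has_weak_time_deriv ::
    "('a::euclidean_space \<times> real \<Rightarrow> real) \<Rightarrow> ('a \<times> real \<Rightarrow> real) \<Rightarrow> bool" where
  "has_weak_time_deriv w w' \<longleftrightarrow>
     locally_integrable S_inf w \<and> locally_integrable S_inf w' \<and>
     (\<forall>\<eta>\<in>test_functions S_inf.
        (LINT z:S_inf|lebesgue. w z * time_deriv \<eta> z) = - (LINT z:S_inf|lebesgue. \<eta> z * w' z))"

definition weighted :: "('a::euclidean_space \<Rightarrow> real) \<Rightarrow> 'a measure" where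
  "weighted f = density lebesgue (\<lambda>x. ennreal (f x))"

definition continuous_into_L1 ::
    "('a::euclidean_space \<Rightarrow> real) \<Rightarrow> ('a \<times> real \<Rightarrow> real) \<Rightarrow> bool" where
  "continuous_into_L1 f u \<longleftrightarrow>
     (\<forall>t\<ge>0. integrable (weighted f) (\<lambda>x. u (x, t))) \<and>
     (\<forall>t\<ge>0. ((\<lambda>s. LINT x|weighted f. \<bar>u (x, s) - u (x, t)\<bar>) \<longlongrightarrow> 0) (at t within {0..}))"

definition bounded_after_positive_times :: "('a::euclidean_space \<times> real \<Rightarrow> real) \<Rightarrow> bool" where
  "bounded_after_positive_times u \<longleftrightarrow>
     (\<forall>t0>0. u \<in> borel_measurable (lebesgue_on (UNIV \<times> {t0<..})) \<and>
        (\<exists>C. AE z in lebesgue_on (UNIV \<times> {t0<..}). \<bar>u z\<bar> \<le> C))"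

text \<open>The support of a function given up to null sets.\<close>

definition ess_supp :: "('a::euclidean_space \<Rightarrow> real) \<Rightarrow> 'a set" where
  "ess_supp h = - \<Union>{U. open U \<and> (AE x in lebesgue. x \<in> U \<longrightarrow> h x = 0)}"

definition support_radius :: "('a::euclidean_space \<Rightarrow> real) \<Rightarrow> real" where
  "support_radius h = Inf {r. r > 0 \<and> ess_supp h \<subseteq> ball 0 r}"


section \<open>Solutions\<close>

text \<open>
  The regularity class controls only the weak gradient \<open>W\<close> of \<open>u\<^sup>q\<close>, where
  \<open>q = (p + m - 2) / (p - 1)\<close>. As usual for doubly degenerate equations, \<open>\<nabla>u\<close> is understood
  through the chain rule \<open>\<nabla>(u\<^sup>q) = q u\<^sup>q\<^sup>-\<^sup>1 \<nabla>u\<close>; it is \<open>0\<close> where \<open>u = 0\<close>, since \<open>0 powr a = 0\<close>.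
\<close>

definition grad_exponent :: "real \<Rightarrow> real \<Rightarrow> real" where
  "grad_exponent p m = (p + m - 2) / (p - 1)"

definition grad_from_power ::
    "real \<Rightarrow> ('a::euclidean_space \<times> real \<Rightarrow> real) \<Rightarrow> ('a \<times> real \<Rightarrow> 'a) \<Rightarrow> 'a \<times> real \<Rightarrow> 'a" where
  "grad_from_power q u W z = (u z powr (1 - q) / q) *\<^sub>R W z"

definition solution_class ::
    "real \<Rightarrow> real \<Rightarrow> ('a::euclidean_space \<Rightarrow> real) \<Rightarrow>
     ('a \<times> real \<Rightarrow> real) \<Rightarrow> ('a \<times> real \<Rightarrow> 'a) \<Rightarrow> bool" where
  "solution_class p m f u W \<longleftrightarrow>
     (\<forall>t\<ge>0. AE x in lebesgue. 0 \<le> u (x, t)) \<and>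
     continuous_into_L1 f u \<and>
     bounded_after_positive_times u \<and>
     has_weak_space_grad (\<lambda>z. u z powr grad_exponent p m) W \<and>
     locally_integrable S_inf (\<lambda>z. norm (W z) powr p)"

definition weak_form ::
    "real \<Rightarrow> real \<Rightarrow> ('a::euclidean_space \<Rightarrow> real) \<Rightarrow>
     ('a \<times> real \<Rightarrow> real) \<Rightarrow> ('a \<times> real \<Rightarrow> 'a) \<Rightarrow> ('a \<times> real \<Rightarrow> real) \<Rightarrow> real" where
  "weak_form p m f u Du \<eta> =
     (LINT z:S_inf|lebesgue.
        (- u z * time_deriv \<eta> z
         + (u z powr (m - 1) * norm (Du z) powr (p - 2)) *\<^sub>R Du z \<bullet> space_grad \<eta> z) * f (fst z))"

definition weak_solution ::
    "real \<Rightarrow> real \<Rightarrow> ('a::euclidean_space \<Rightarrow> real) \<Rightarrow> ('a \<times> real \<Rightarrow> real) \<Rightarrow> bool" where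
  "weak_solution p m f u \<longleftrightarrow>
     (\<exists>W. solution_class p m f u W \<and>
        (\<forall>\<eta>\<in>test_functions S_inf.
           weak_form p m f u (grad_from_power (grad_exponent p m) u W) \<eta> = 0))"

definition weak_supersolution ::
    "real \<Rightarrow> real \<Rightarrow> ('a::euclidean_space \<Rightarrow> real) \<Rightarrow> ('a \<times> real \<Rightarrow> real) \<Rightarrow> bool" where
  "weak_supersolution p m f u \<longleftrightarrow>
     (\<exists>W. solution_class p m f u W \<and>
        (\<forall>\<eta>\<in>test_functions S_inf. (\<forall>z. 0 \<le> \<eta> z) \<longrightarrow>
           weak_form p m f u (grad_from_power (grad_exponent p m) u W) \<eta> \<ge> 0))"

text \<open>The last conjunct is \<open>u\<^sub>t \<in> L\<^sup>\<infinity>\<^sub>l\<^sub>o\<^sub>c((0,\<infinity>); L\<^sup>1\<^sub>f\<^sub>,\<^sub>l\<^sub>o\<^sub>c)\<close>.\<close>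

definition strong_solution ::
    "real \<Rightarrow> real \<Rightarrow> ('a::euclidean_space \<Rightarrow> real) \<Rightarrow> ('a \<times> real \<Rightarrow> real) \<Rightarrow> bool" where
  "strong_solution p m f u \<longleftrightarrow>
     weak_solution p m f u \<and>
     (\<exists>ut. has_weak_time_deriv u ut \<and>
        (\<forall>a b K. 0 < a \<and> compact K \<longrightarrow>
           (\<exists>C. AE t in lebesgue_on {a..b}.
              set_integrable (weighted f) K (\<lambda>x. ut (x, t)) \<and>
              (LINT x:K|weighted f. \<bar>ut (x, t)\<bar>) \<le> C)))"

definition strong_Cauchy_solution ::
    "real \<Rightarrow> real \<Rightarrow> ('a::euclidean_space \<Rightarrow> real) \<Rightarrow> ('a \<Rightarrow> real) \<Rightarrow> ('a \<times> real \<Rightarrow> real) \<Rightarrow> bool" where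
  "strong_Cauchy_solution p m f u0 u \<longleftrightarrow>
     strong_solution p m f u \<and> (AE x in lebesgue. u (x, 0) = u0 x)"


section \<open>The barrier\<close>

definition weight :: "(real \<Rightarrow> real) \<Rightarrow> 'a::euclidean_space \<Rightarrow> real" where
  "weight g x = exp (g (norm x))"

definition inverse_on_halfline :: "(real \<Rightarrow> real) \<Rightarrow> real \<Rightarrow> real" where
  "inverse_on_halfline h = the_inv_into {0..} h"

definition barrier_G :: "(real \<Rightarrow> real) \<Rightarrow> real \<Rightarrow> real" where
  "barrier_G g r = (LBINT s:{0..r}. g s / s)"

definition barrier_J :: "real \<Rightarrow> (real \<Rightarrow> real) \<Rightarrow> real \<Rightarrow> real" where
  "barrier_J p g r = r powr p / barrier_G g r"

definition barrier_E :: "real \<Rightarrow> (real \<Rightarrow> real) \<Rightarrow> real \<Rightarrow> real" where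
  "barrier_E p g \<tau> = barrier_J p g (inverse_on_halfline (barrier_G g) \<tau>)"

definition barrier_nu :: "real \<Rightarrow> (real \<Rightarrow> real) \<Rightarrow> real \<Rightarrow> real" where
  "barrier_nu p g r0 = 1 - r0 * deriv (barrier_G g) r0 / (p * barrier_G g r0)"

definition barrier_I :: "real \<Rightarrow> (real \<Rightarrow> real) \<Rightarrow> real \<Rightarrow> real \<Rightarrow> real" where
  "barrier_I p g r0 r =
     barrier_nu p g r0 * (r powr p / barrier_G g r0) powr (1 / (p - 1))
     + (1 - barrier_nu p g r0) * barrier_J p g r0 powr (1 / (p - 1))"

definition barrier ::
    "real \<Rightarrow> real \<Rightarrow> (real \<Rightarrow> real) \<Rightarrow> real \<Rightarrow> real \<Rightarrow> real \<Rightarrow> real \<Rightarrow>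
     'a::euclidean_space \<times> real \<Rightarrow> real" where
  "barrier p m g t0 C r0 \<Gamma> = (\<lambda>(x, t).
     let r = norm x; \<tau> = \<Gamma> * ln (t + t0) in
     C / (t + t0) powr (1 / (p + m - 3)) *
     (max 0 (barrier_E p g \<tau> powr (1 / (p - 1))
             - (if r \<ge> r0 then barrier_J p g r powr (1 / (p - 1)) else barrier_I p g r0 r)))
       powr ((p - 1) / (p + m - 3)))"

end

theory Submission
  imports Defs
begin

text \<open>
 Two independent facts are combined: a comparison principle for strong solutions against explicit
 compactly supported weak supersolutions, and the supersolution property of the barrier.

 Comparison: with \<open>w = u\<^sup>q\<close> and an increasing \<open>h\<close> of class \<open>C\<^sup>1\<close> vanishing on \<open>(-\<infinity>, 0]\<close>, test both inequalities with
 \<open>h (w\<^sub>u - w\<^sub>v)\<close> times a cutoff in space and a bump in time. Where the space cutoff is constant the flux term is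
 nonnegative by monotonicity of \<open>W \<mapsto> |W|\<^sup>p\<^sup>-\<^sup>2 W\<close>; far out, where the supersolution vanishes, Young's inequality
 bounds it by \<open>R\<^sup>-\<^sup>p \<integral> f u\<close>. Letting \<open>R \<rightarrow> \<infinity>\<close> and then \<open>h\<close> tend to the Heaviside function shows that the weighted
 integral of \<open>(u - v)\<^sub>+\<close> is nonincreasing in time. Mollification justifies test functions of class \<open>C\<^sup>1\<close> and the
 weak chain rules.

 Barrier: write \<open>X\<close> for the bracket in its definition. Its flux is \<open>X\<^sub>+\<^sup>b\<close> times a Lipschitz radial field, so
 both parts of the weak form can be integrated by parts once \<open>X\<^sub>+\<^sup>b\<close> is regularised, and the integrand becomes
 \<open>L(X) A + L'(X) B\<close>, where \<open>A\<close> is the divergence of the field minus a constant and \<open>B\<close> compares the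
 motion of the front with the radial slope. A large \<open>r\<^sub>0\<close> and \<open>C\<close> give \<open>A >= 0\<close>; where the profile is below half of
 the height, \<open>X A + (b + 1) B >= 0\<close>, and elsewhere a large \<open>\<Gamma>\<close> gives \<open>B >= 0\<close>.
\<close>

text \<open>Only the gradient of u^q is controlled, and only locally in L^p, while the weight is at
  least the exponential of a power of |x|. The only quantity known to be integrable over all of
  space is f u; this is why the remainder in Young's inequality must be of order u. The time
  derivative of u is integrable only locally, so far out it is integrated by parts while the cutoff
  is still present. This fixes the order of limits: the cutoff radius goes to infinity first, the
  approximation of the step function afterwards. The barrier carries the power b of a positive part,
  and b may be below 1. Its time derivative can then blow up at the free boundary, and its local
  integrability comes from Fatou's lemma instead of a pointwise bound; v^q, in contrast, is always
  of class one. The constants are fixed in the order r0, C (both from the structure alone), the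
  height required at time 0, and \<Gamma>. The supremum of u0 and its support radius enter through
  the required height. The choice t0 = e makes ln t0 = 1.\<close>

abbreviation (input) fd where "fd h z == frechet_derivative h (at z)"

abbreviation (input) L1 where "L1 f == integrable lebesgue f"

abbreviation (input) conton where "conton == continuous_on UNIV"

abbreviation (input) borm where "borm == borel_measurable borel"

abbreviation (input) LIMSEQ' (infix "~~>" 60) where "X ~~> l == X \<longlonglongrightarrow> l"

lemmas Lint_bound = Bochner_Integration.integrable_bound
  and Lint_add = Bochner_Integration.integrable_add
  and Lint_cong = Bochner_Integration.integral_cong

abbreviation (input) lebm where "lebm == borel_measurable lebesgue"

abbreviation (input) lebesgue_LI (binder "LI " 60) where "lebesgue_LI f == lebesgue_integral lebesgue f"

subsection \<open>Smooth bump functions\<close>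

lemma C_k_SucI:
 assumes "!!z. (h has_derivative h' z) (at z)" and "!!v. C_k k (%z. h' z v)"
 shows "C_k (Suc k) h"
proof -
 have "fd h z = h' z" for z
  using frechet_derivative_at[OF assms(1)] by simp
 thus ?thesis using assms by (auto simp: differentiable_def)
qed

lemma C_k_SucD: "C_k (Suc k) h ==> C_k k h"
proof (induction k arbitrary: h)
 case 0
 thus ?case
  by (auto intro!: continuous_at_imp_continuous_on differentiable_imp_continuous_within)
next
 case (Suc k)
 hence "\<forall>v. C_k (Suc k) (%z. fd h z v)" by simp
 with Suc show ?case by simp
qed

lemma C_k_imp_C_1: "C_k (Suc k) h ==> C_k 1 h"
 by (induction k arbitrary: h) (auto dest: C_k_SucD simp del: C_k.simps(2))

lemma C_k_imp_continuous_on: "C_k k h ==> continuous_on A h"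
proof (induction k arbitrary: h)
 case 0
 thus ?case by (auto intro: continuous_on_subset)
next
 case (Suc k)
 thus ?case using C_k_SucD by blast
qed

lemma C_k_Suc_has_derivative:
 "C_k (Suc k) h ==> (h has_derivative fd h z) (at z)"
 by (simp add: frechet_derivative_works)

lemma C_k_const: "C_k k (%z. c)"
 by (induction k arbitrary: c) auto

lemma C_k_linear: "bounded_linear h ==> C_k k h"
 by (cases k) (auto intro!: C_k_SucI C_k_const linear_continuous_on
   dest: bounded_linear.has_derivative[OF _ has_derivative_ident] simp del: C_k.simps(2))

lemma C_k_add: "C_k k f ==> C_k k h ==> C_k k (%z. f z + h z)"
proof (induction k arbitrary: f h)
 case 0
 thus ?case by (simp add: continuous_on_add)
next
 case (Suc k)
 show ?case
 proof (rule C_k_SucI)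
  show "((%z. f z + h z) has_derivative
    (%v. fd f z v + fd h z v)) (at z)" for z
   using Suc.prems by (intro has_derivative_add C_k_Suc_has_derivative)
 qed (use Suc in auto)
qed

lemma C_k_mult: "C_k k f ==> C_k k h ==> C_k k (%z. f z * h z)"
proof (induction k arbitrary: f h)
 case 0
 thus ?case by (simp add: continuous_on_mult)
next
 case (Suc k)
 show ?case
 proof (rule C_k_SucI)
  show "((%z. f z * h z) has_derivative
    (%v. f z * fd h z v + fd f z v * h z)) (at z)" for z
   using Suc.prems by (intro has_derivative_mult C_k_Suc_has_derivative)
  show "C_k k (%z. f z * fd h z v + fd f z v * h z)" for v
   using Suc.prems C_k_SucD[OF Suc.prems(1)] C_k_SucD[OF Suc.prems(2)]
   by (intro C_k_add Suc.IH) auto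
 qed
qed

lemma C_k_cmult: "C_k k f ==> C_k k (%z. c * f z)"
 by (intro C_k_mult C_k_const)

lemma C_k_diff: "C_k k f ==> C_k k h ==> C_k k (%z. f z - h z)"
 using C_k_add[of k f "%z. (-1) * h z"] C_k_cmult[of k h "-1"] by simp

lemma C_k_sum: "(!!i. i : I ==> C_k k (f i)) ==> C_k k (%z. \<Sum>i\<in>I. f i z)"
 by (induction I rule: infinite_finite_induct) (auto intro: C_k_const C_k_add)

lemma C_k_compose_affine:
 assumes "bounded_linear L"
 shows "C_k k h ==> C_k k (%z. h (c + L z))"
proof (induction k arbitrary: h)
 case 0
 have "conton (%z. c + L z)"
  using assms by (intro continuous_on_add continuous_on_const linear_continuous_on)
 with 0 show ?case
  by (simp add: continuous_on_compose2[of UNIV h UNIV "%z. c + L z"])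
next
 case (Suc k)
 show ?case
 proof (rule C_k_SucI)
  show "((%z. h (c + L z)) has_derivative (%v. fd h (c + L z) (L v))) (at z)" for z
   by (rule has_derivative_compose[of "%z. c + L z" L, OF _ C_k_Suc_has_derivative[OF Suc.prems]])
    (auto intro!: derivative_eq_intros bounded_linear.has_derivative[OF assms])
  show "C_k k (%z. fd h (c + L z) (L v))" for v
   using Suc.prems by (intro Suc.IH[of "%z. fd h z (L v)"]) auto
 qed
qed

text \<open>The family exp(-1/x)/x^n is closed under differentiation up to linear combinations, so a
  single induction over the order of differentiability, for all n at once, yields
  smoothness.\<close>

definition flat_exp :: "nat => real => real" where
 "flat_exp n x = (if x > 0 then exp (- 1 / x) / x ^ n else 0)"

lemma flat_exp_nonneg: "flat_exp n x >= 0"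
 by (simp add: flat_exp_def)

lemma power_div_fact_le_exp:
 fixes y :: real
 assumes "y >= 0"
 shows "y ^ n / fact n <= exp y"
proof -
 have "(\<Sum>k\<in>{n}. y ^ k /\<^sub>R fact k) <= (\<Sum>k. y ^ k /\<^sub>R fact k)"
  using assms summable_exp_generic[of y] by (intro sum_le_suminf) auto
 thus ?thesis by (simp add: exp_def divide_inverse mult.commute)
qed

text \<open>One term of the exponential series gives exp(1/x) >= x^-(n+1)/(n+1)!. A linear bound is
  enough: the difference quotient of \<open>flat_exp n\<close> at 0 is
  \<open>flat_exp (Suc n)\<close>, and it only has to tend to 0.\<close>

lemma flat_exp_bound: "\<bar>flat_exp n x\<bar> <= fact (Suc n) * \<bar>x\<bar>"
proof (cases "x > 0")
 case True
 have "(1 / x) ^ Suc n / fact (Suc n) <= exp (1 / x)"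
  using True by (intro power_div_fact_le_exp) auto
 hence "1 <= exp (1 / x) * (fact (Suc n) * x ^ Suc n)"
  using True by (simp add: field_simps del: fact_Suc power_Suc)
 hence "exp (- (1 / x)) * 1 <= exp (- (1 / x)) * (exp (1 / x) * (fact (Suc n) * x ^ Suc n))"
  by (intro mult_left_mono) auto
 hence "exp (- (1 / x)) <= fact (Suc n) * x ^ Suc n"
  by (simp add: exp_minus field_simps del: fact_Suc power_Suc)
 hence "exp (- (1 / x)) / x ^ n <= fact (Suc n) * x"
  using True by (simp add: divide_simps mult.assoc del: fact_Suc)
 thus ?thesis using True by (simp add: flat_exp_def del: fact_Suc)
next
 case False
 hence "flat_exp n x = 0" by (simp add: flat_exp_def)
 thus ?thesis by (metis abs_zero abs_ge_zero fact_ge_zero mult_nonneg_nonneg)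
qed

lemma flat_exp_has_derivative:
 "(flat_exp n has_real_derivative flat_exp (n + 2) x - real n * flat_exp (n + 1) x) (at x)"
proof (cases x "0 :: real" rule: linorder_cases)
 case less
 have "((%x. 0) has_real_derivative 0) (at x)" by simp
 hence "(flat_exp n has_real_derivative 0) (at x)"
  by (rule has_field_derivative_transform_within_open[of _ _ _ "{..<0}"])
   (use less in "auto simp: flat_exp_def")
 thus ?thesis using less by (simp add: flat_exp_def)
next
 case greater
 have "((%x. exp (- 1 / x) / x ^ n) has_real_derivative
  flat_exp (n + 2) x - real n * flat_exp (n + 1) x) (at x)"
  using greater
 proof (cases n)
  case (Suc k)
  thus ?thesis using greater
   by (auto intro!: derivative_eq_intros simp: flat_exp_def simp del: power_Suc)
    (simp add: divide_simps power2_eq_square algebra_simps)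
 qed (auto intro!: derivative_eq_intros simp: flat_exp_def field_simps power2_eq_square)
 thus ?thesis
  by (rule has_field_derivative_transform_within_open[of _ _ _ "{0<..}"])
   (use greater in "auto simp: flat_exp_def")
next
 case equal
 have "(%h. (flat_exp n (0 + h) - flat_exp n 0) / h) = flat_exp (Suc n)"
  by (auto simp: flat_exp_def fun_eq_iff)
 moreover have "flat_exp (Suc n) \<midarrow>0\<rightarrow> 0"
 proof (rule Lim_null_comparison)
  show "((%x::real. fact (Suc (Suc n)) * \<bar>x\<bar>) \<longlongrightarrow> 0) (at 0)"
   by (auto intro!: tendsto_eq_intros)
  show "\<forall>\<^sub>F x in at 0. norm (flat_exp (Suc n) x) <= fact (Suc (Suc n)) * \<bar>x\<bar>"
   using flat_exp_bound[of "Suc n"] by (simp del: fact_Suc)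
 qed
 ultimately have "(flat_exp n has_real_derivative 0) (at 0)"
  unfolding DERIV_def by simp
 thus ?thesis using equal by (simp add: flat_exp_def)
qed

lemma C_k_flat_exp_compose:
 assumes "!!k. C_k k h"
 shows "C_k k (%z. flat_exp n (h z))"
proof (induction k arbitrary: n)
 case 0
 have "conton (flat_exp n)"
  using flat_exp_has_derivative DERIV_isCont continuous_at_imp_continuous_on by blast
 with assms[of 0] show ?case by (auto intro: continuous_on_compose2)
next
 case (Suc k)
 show ?case
 proof (rule C_k_SucI)
  show "((%z. flat_exp n (h z)) has_derivative
   (%v. (flat_exp (n + 2) (h z) - real n * flat_exp (n + 1) (h z)) *
    fd h z v)) (at z)" for z
   using has_derivative_compose[OF C_k_Suc_has_derivative[OF assms[of "Suc k"]],
    OF flat_exp_has_derivative[unfolded has_field_derivative_def]] by simp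
  show "C_k k (%z. (flat_exp (n + 2) (h z) - real n * flat_exp (n + 1) (h z)) *
    fd h z v)" for v
   using assms[of "Suc k"] by (intro C_k_mult C_k_diff C_k_cmult Suc) auto
 qed
qed

lemma C_k_norm_square: "C_k k (%z::'b::euclidean_space. z \<bullet> z)"
proof -
 have "C_k k (%z::'b. \<Sum>i\<in>Basis. (z \<bullet> i) * (z \<bullet> i))"
  by (intro C_k_sum C_k_mult C_k_linear bounded_linear_inner_left)
 thus ?thesis by (simp flip: euclidean_inner)
qed

definition bump :: "real => 'b::euclidean_space => real" where
 "bump d z = flat_exp 0 (1 - (z \<bullet> z) / d\<^sup>2)"

definition mollifier :: "real => 'b::euclidean_space => real" where
 "mollifier d z = bump d z / (LINT y|lborel. bump d (y::'b))"

lemma C_k_bump: "C_k k (bump d)"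
 unfolding bump_def
 by (rule C_k_flat_exp_compose)
  (use C_k_diff[OF C_k_const C_k_cmult[OF C_k_norm_square, of _ "1 / d\<^sup>2"]] in simp)

lemma bump_eq_0: "d > 0 ==> norm z >= d ==> bump d z = 0"
 using power_mono[of d "norm z" 2]
 by (simp add: bump_def flat_exp_def power2_norm_eq_inner[symmetric] divide_simps not_less)

lemma integrable_continuous_bounded_support:
 fixes h :: "'b::euclidean_space => real"
 assumes "conton h" and "!!z. norm z > R ==> h z = 0"
 shows "integrable lborel h"
proof -
 have "set_integrable lborel (cball 0 R) h"
  unfolding set_integrable_def using assms
  by (intro borel_integrable_compact) (auto intro: continuous_on_subset)
 moreover have "(%z. indicator (cball 0 R) z *\<^sub>R h z) = h"
  using assms(2) by (auto simp: fun_eq_iff indicator_def not_le)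
 ultimately show ?thesis by (simp add: set_integrable_def)
qed

text \<open>Otherwise \<open>bump d\<close> would vanish almost everywhere, although it is nonzero
  on the whole open ball of radius d.\<close>

lemma bump_integral_pos:
 assumes "d > 0"
 shows "(LINT y|lborel. bump d (y::'b::euclidean_space)) > 0"
proof -
 have cont: "conton (bump d :: 'b => real)"
  using C_k_bump[of 0] by simp
 have int: "integrable lborel (bump d :: 'b => real)"
  using integrable_continuous_bounded_support[OF cont, of d] bump_eq_0 assms by force
 have nonneg: "bump d (y::'b) >= 0" for y by (simp add: bump_def flat_exp_nonneg)
 have "(LINT y|lborel. bump d (y::'b)) ~= 0"
 proof
  assume "(LINT y|lborel. bump d (y::'b)) = 0"
  hence "AE y in lborel. bump d (y::'b) = 0"
   using integral_nonneg_eq_0_iff_AE[OF int] nonneg by simp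
  moreover have "{y::'b. bump d y ~= 0} = ball 0 d"
   using assms bump_eq_0[OF assms]
   by (auto simp: bump_def flat_exp_def power2_norm_eq_inner[symmetric] not_less[symmetric]
     field_simps dest: power_less_imp_less_base intro!: power_strict_mono)
  hence "y \<notin> ball 0 d \<longleftrightarrow> bump d y = 0" for y :: 'b by blast
  ultimately have "AE y::'b in lborel. y \<notin> ball 0 d" by simp
  hence "ball (0::'b) d : null_sets lborel" by (simp add: AE_iff_null_sets)
  thus False using open_not_negligible[of "ball (0::'b) d"] assms
   by (simp add: negligible_iff_null_sets null_sets_completionI)
 qed
 moreover have "(LINT y|lborel. bump d (y::'b)) >= 0"
  using nonneg by (intro integral_nonneg_AE) auto
 ultimately show ?thesis by simp
qed

lemma mollifier_nonneg: "mollifier d z >= 0"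
 by (simp add: mollifier_def bump_def flat_exp_nonneg)

lemma mollifier_eq_0: "d > 0 ==> norm z >= d ==> mollifier d z = 0"
 by (simp add: mollifier_def bump_eq_0)

lemma C_k_mollifier: "C_k k (mollifier d)"
 using C_k_cmult[OF C_k_bump, of k "1 / (LINT y|lborel. bump d (y::'a))" d]
 by (simp add: mollifier_def[abs_def])

lemma integral_mollifier: "d > 0 ==> (LINT y|lborel. mollifier d (y::'b::euclidean_space)) = 1"
 using bump_integral_pos[of d, where 'b='b] by (simp add: mollifier_def)

subsection \<open>Integration by parts\<close>

lemma lborel_integral_translate:
 fixes f :: "'b::euclidean_space => real"
 assumes [measurable]: "f : borm"
 shows "(LINT z|lborel. f (z + a)) = (LINT z|lborel. f z)"
  and "integrable lborel (%z. f (z + a)) \<longleftrightarrow> integrable lborel f"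
proof -
 have "(LINT z|lborel. f z) = (LINT z|distr lborel borel ((+) a). f z)"
  by (simp add: lborel_distr_plus)
 also have "... = (LINT z|lborel. f (a + z))" by (subst integral_distr) auto
 finally show "(LINT z|lborel. f (z + a)) = (LINT z|lborel. f z)" by (simp add: add.commute)
 have "integrable lborel f \<longleftrightarrow> integrable (distr lborel borel ((+) a)) f"
  by (simp add: lborel_distr_plus)
 also have "... \<longleftrightarrow> integrable lborel (%z. f (a + z))" by (subst integrable_distr_eq) auto
 finally show "integrable lborel (%z. f (z + a)) \<longleftrightarrow> integrable lborel f" by (simp add: add.commute)
qed

lemma lborel_reflect: "lborel = distr lborel borel (%y::'b::euclidean_space. z - y)"
 using lborel_affine[of "-1" z] by (simp add: density_1)

lemma lborel_integral_reflect:
 fixes f :: "'b::euclidean_space => real"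
 assumes [measurable]: "f : borm"
 shows "(LINT y|lborel. f (z - y)) = (LINT y|lborel. f y)"
 by (subst (2) lborel_reflect[of z], subst integral_distr) auto

lemma integrable_lebesgue_of_borel:
 fixes f :: "'b::euclidean_space => real"
 assumes "f : borm"
 shows "L1 f \<longleftrightarrow> integrable lborel f"
  and "(LI z. f z) = (LINT z|lborel. f z)"
 using assms by (auto simp: integrable_completion integral_completion)

lemma borel_measurable_lebesgue: "f : borm ==> f : lebm"
 by (simp add: measurable_completion)

lemma borel_measurable_AE_limit:
 fixes g :: "nat => 'b::euclidean_space => real"
 assumes [measurable]: "!!n. g n : lebm"
  and "AE z in lebesgue. (%n. g n z) ~~> D z"
 shows "D : lebm"
proof (rule borel_measurable_AE)
 show "(%z. lim (%n. g n z)) : lebm" by measurable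
 show "AE z in lebesgue. lim (%n. g n z) = D z"
  using assms(2) by eventually_elim (auto intro: limI)
qed

text \<open>The difference quotients have integral zero by translation invariance, and the Lipschitz
  bound along v together with the bounded support dominates them on a fixed ball. The derivative is
  asked for only almost everywhere, which later admits radial fields with a kink.\<close>

lemma integral_directional_derivative_zero:
 fixes \<psi> D :: "'b::euclidean_space => real"
 assumes [measurable]: "\<psi> : borm" and int: "integrable lborel \<psi>"
  and supp: "!!z. norm z > R ==> \<psi> z = 0"
  and lip: "!!z s. \<bar>s\<bar> <= 1 ==> \<bar>\<psi> (z + s *\<^sub>R v) - \<psi> z\<bar> <= L * \<bar>s\<bar>"
  and der: "AE z in lebesgue. ((%s. \<psi> (z + s *\<^sub>R v)) has_real_derivative D z) (at 0)"
 shows "L1 D" and "(LI z. D z) = 0"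
proof -
 define s where "s n = 1 / real (Suc n)" for n
 define g where "g n z = (\<psi> (z + s n *\<^sub>R v) - \<psi> z) / s n" for n z
 have s: "0 < s n" "s n <= 1" for n by (auto simp: s_def)
 have s0: "s ~~> 0" unfolding s_def by (rule LIMSEQ_Suc[OF lim_1_over_n])
 have gm[measurable]: "g n : borm" for n unfolding g_def by measurable
 have "L >= 0" using lip[of 1 0] by simp
 have bound: "\<bar>g n z\<bar> <= L * indicator (cball 0 (R + norm v)) z" for n z
 proof (cases "norm z <= R + norm v")
  case True
  have "\<bar>g n z\<bar> <= L" unfolding g_def using lip[of "s n" z] s[of n] by (simp add: abs_divide divide_le_eq)
  thus ?thesis using True by simp
 next
  case False
  have "norm (s n *\<^sub>R v) <= norm v" using s[of n] by (simp add: mult_left_le_one_le)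
  moreover have "norm z <= norm (z + s n *\<^sub>R v) + norm (s n *\<^sub>R v)"
   using norm_triangle_ineq4[of "z + s n *\<^sub>R v" "s n *\<^sub>R v"] by simp
  ultimately have "norm (z + s n *\<^sub>R v) > R" using False by linarith
  moreover have "norm z > R" using False norm_ge_zero[of v] by linarith
  ultimately show ?thesis using supp \<open>L >= 0\<close> by (simp add: g_def)
 qed
 have lim: "AE z in lebesgue. (%n. g n z) ~~> D z"
  using der
 proof eventually_elim
  case (elim z)
  hence "(%h. (\<psi> (z + h *\<^sub>R v) - \<psi> z) / h) \<midarrow>0\<rightarrow> D z" by (simp add: DERIV_def)
  moreover have "filterlim s (at 0) sequentially"
   using s0 s by (auto simp: filterlim_at intro!: always_eventually less_imp_neq[symmetric])
  ultimately show ?case unfolding g_def by (rule filterlim_compose)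
 qed
 have Dm: "D : lebm"
  using borel_measurable_AE_limit[OF _ lim] borel_measurable_lebesgue[OF gm] by blast
 have wi: "L1 (%z::'b. L * indicator (cball 0 (R + norm v)) z)"
  by (intro integrable_mult_right integrable_real_indicator)
   (use emeasure_lborel_cball_finite[of "0::'b" "R + norm v"] in auto)
 note dct = Dm borel_measurable_lebesgue[OF gm] wi lim
 show "L1 D"
  by (rule integrable_dominated_convergence[OF dct]) (use bound in auto)
 have "(%n. LI z. g n z) ~~> (LI z. D z)"
  by (rule integral_dominated_convergence[OF dct]) (use bound in auto)
 moreover have "(LI z. g n z) = 0" for n
 proof -
  have "(LINT z|lborel. \<psi> (z + s n *\<^sub>R v)) = (LINT z|lborel. \<psi> z)"
   "integrable lborel (%z. \<psi> (z + s n *\<^sub>R v))"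
   using int by (auto simp: lborel_integral_translate)
  thus ?thesis using int by (simp add: g_def integral_completion)
 qed
 ultimately show "(LI z. D z) = 0" by (simp add: LIMSEQ_const_iff)
qed

lemma frechet_derivative_eq_0_outside:
 assumes "closed K" and "!!z. z \<notin> K ==> h z = 0" and "z \<notin> K"
 shows "fd h z = (%v. 0)"
proof -
 have "(h has_derivative (%v. 0)) (at z)"
  by (rule has_derivative_transform_within_open[OF has_derivative_const, of "- K" z]) (use assms in auto)
 thus ?thesis by (rule frechet_derivative_at[symmetric])
qed

lemma C_1_lipschitz:
 fixes h :: "'b::euclidean_space => real"
 assumes h: "C_k 1 h" and supp: "!!z. norm z > R ==> h z = 0"
 obtains L where "L >= 0" "!!x y. \<bar>h x - h y\<bar> <= L * norm (x - y)"
  "!!x v. \<bar>fd h x v\<bar> <= L * norm v"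
proof -
 have der: "(h has_derivative fd h z) (at z)" for z
  using h C_k_Suc_has_derivative[of 0] by simp
 have "\<exists>B\<ge>0. \<forall>z. \<bar>fd h z i\<bar> <= B" for i
 proof -
  have "continuous_on (cball 0 R) (%z. fd h z i)"
   using h by (auto intro: continuous_on_subset)
  hence "bounded ((%z. fd h z i) ` cball 0 R)"
   by (intro compact_imp_bounded compact_continuous_image) auto
  then obtain B where "\<forall>z\<in>cball 0 R. \<bar>fd h z i\<bar> <= B"
   by (auto simp: bounded_iff)
  hence B: "norm z <= R ==> \<bar>fd h z i\<bar> <= B" for z by auto
  have "\<bar>fd h z i\<bar> <= max B 0" for z
   using B[of z] frechet_derivative_eq_0_outside[of "cball 0 R" h z] supp
   by (cases "norm z <= R") auto
  thus ?thesis by (intro exI[of _ "max B 0"]) auto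
 qed
 then obtain B where B: "!!i. B i >= 0" "!!i z. \<bar>fd h z i\<bar> <= B i" by metis
 define L where "L = (\<Sum>i\<in>(Basis::'b set). B i)"
 have bd: "\<bar>fd h x v\<bar> <= L * norm v" for x v
 proof -
  have lin: "linear (fd h x)"
   using der has_derivative_linear by blast
  have "\<bar>fd h x v\<bar> = \<bar>\<Sum>i\<in>Basis. (v \<bullet> i) * fd h x i\<bar>"
   by (subst euclidean_representation[of v, symmetric])
    (simp add: linear_sum[OF lin] linear_scale[OF lin])
  also have "... <= (\<Sum>i\<in>Basis. norm v * B i)"
   by (intro sum_abs[THEN order_trans] sum_mono)
    (auto simp: abs_mult intro!: mult_mono B Basis_le_norm)
  also have "... = L * norm v" unfolding L_def sum_distrib_left[symmetric] by (rule mult.commute)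
  finally show ?thesis .
 qed
 have "\<bar>h x - h y\<bar> <= L * norm (x - y)" for x y
 proof -
  have "norm (h x - h y) <= L * norm (x - y)"
   by (rule differentiable_bound[of UNIV h "%z. fd h z"])
    (use der bd in "auto intro!: onorm_le")
  thus ?thesis by simp
 qed
 moreover have "L >= 0" unfolding L_def by (intro sum_nonneg B)
 ultimately show ?thesis using that bd by blast
qed

lemma has_derivative_imp_directional:
 fixes h :: "'b::real_normed_vector => real"
 assumes "(h has_derivative h') (at z)"
 shows "((%s. h (z + s *\<^sub>R v)) has_real_derivative h' v) (at 0)"
proof -
 have "((%s::real. z + s *\<^sub>R v) has_derivative (%s. s *\<^sub>R v)) (at 0)"
  by (auto intro!: derivative_eq_intros)
 hence "((%s. h (z + s *\<^sub>R v)) has_derivative (%s. h' (s *\<^sub>R v))) (at 0)"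
  using assms by (intro has_derivative_compose[of "%s. z + s *\<^sub>R v" _ 0 UNIV h h']) auto
 thus ?thesis
  by (simp add: has_field_derivative_def linear_scale[OF has_derivative_linear[OF assms]]
    mult.commute[of _ "h' v"])
qed

lemma C_0_integrable_lebesgue:
 fixes h :: "'b::euclidean_space => real"
 assumes "conton h" and "!!z. norm z > R ==> h z = 0"
 shows "L1 h"
 using integrable_continuous_bounded_support[OF assms] integrable_lebesgue_of_borel(1)[of h]
  borel_measurable_continuous_onI[OF assms(1)] by blast

lemma C_1_integral_derivative:
 fixes h :: "'b::euclidean_space => real"
 assumes h: "C_k 1 h" and supp: "!!z. norm z > R ==> h z = 0"
 shows "(LI z. fd h z v) = 0"
proof -
 obtain L where L: "L >= 0" "!!x y. \<bar>h x - h y\<bar> <= L * norm (x - y)"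
  using C_1_lipschitz[OF assms] by metis
 have c: "conton h" using h C_k_imp_continuous_on by blast
 show ?thesis
 proof (rule integral_directional_derivative_zero(2))
  show "h : borm" using c by (rule borel_measurable_continuous_onI)
  show "integrable lborel h" using integrable_continuous_bounded_support[OF c supp] by auto
  show "\<bar>h (z + s *\<^sub>R v) - h z\<bar> <= L * norm v * \<bar>s\<bar>" for z s
   using L(2)[of "z + s *\<^sub>R v" z] by (simp add: mult_ac)
  show "AE z in lebesgue.
   ((%s. h (z + s *\<^sub>R v)) has_real_derivative fd h z v) (at 0)"
   using h by (intro always_eventually allI has_derivative_imp_directional)
    (simp add: frechet_derivative_works)
 qed (rule supp)
qed

lemma frechet_derivative_mult_real:
 fixes f h :: "'b::real_normed_vector => real"
 assumes "f differentiable (at z)" and "h differentiable (at z)"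
 shows "fd (%z. f z * h z) z v =
  f z * fd h z v + fd f z v * h z"
 using frechet_derivative_at[OF has_derivative_mult[OF
   assms(1)[unfolded frechet_derivative_works] assms(2)[unfolded frechet_derivative_works]]]
 by metis

lemma C_1_integration_by_parts:
 fixes f h :: "'b::euclidean_space => real"
 assumes f: "C_k 1 f" and h: "C_k 1 h" and supp: "!!z. norm z > R ==> f z = 0"
 shows "(LI z. f z * fd h z v) =
  - (LI z. fd f z v * h z)"
proof -
 have cont: "conton f" "conton h"
  "conton (%z. fd f z v)"
  "conton (%z. fd h z v)"
  using C_k_imp_continuous_on[OF f] C_k_imp_continuous_on[OF h] f h by auto
 have f0: "norm z > R ==> fd f z v = 0" for z
  using frechet_derivative_eq_0_outside[of "cball 0 R" f z] supp by auto
 have 1: "L1 (%z. f z * fd h z v)"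
  using supp by (intro C_0_integrable_lebesgue[of _ R] continuous_on_mult cont) auto
 have 2: "L1 (%z. fd f z v * h z)"
  using f0 by (intro C_0_integrable_lebesgue[of _ R] continuous_on_mult cont) auto
 have "0 = (LI z. fd (%z. f z * h z) z v)"
  by (rule C_1_integral_derivative[symmetric, of _ R, OF C_k_mult[OF f h]]) (use supp in auto)
 also have "... = (LI z. f z * fd h z v +
   fd f z v * h z)"
  using f h by (subst frechet_derivative_mult_real) auto
 also have "... = (LI z. f z * fd h z v) +
   (LI z. fd f z v * h z)"
  using 1 2 by (rule Bochner_Integration.integral_add)
 finally show ?thesis by simp
qed

subsection \<open>Mollification\<close>

definition conv :: "('b::euclidean_space => real) => ('b => real) => 'b => real" where
 "conv u \<kappa> z = (LI y. u y * \<kappa> (z - y))"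

lemma continuous_bounded_support_bounded:
 fixes h :: "'b::euclidean_space => real"
 assumes "conton h" and "!!z. norm z > R ==> h z = 0"
 obtains B where "B >= 0" "!!z. \<bar>h z\<bar> <= B"
proof -
 have "bounded (h ` cball 0 R)"
  using assms(1) by (intro compact_imp_bounded compact_continuous_image)
   (auto intro: continuous_on_subset)
 then obtain B where "\<forall>z\<in>cball 0 R. \<bar>h z\<bar> <= B" by (auto simp: bounded_iff)
 hence B: "norm z <= R ==> \<bar>h z\<bar> <= B" for z by auto
 have "\<bar>h z\<bar> <= max B 0" for z using B[of z] assms(2)[of z] by (cases "norm z <= R") auto
 thus ?thesis using that[of "max B 0"] by auto
qed

lemma conv_integrable:
 fixes \<kappa> :: "'b::euclidean_space => real"
 assumes "L1 u" and c: "conton \<kappa>" and "!!z. norm z > R ==> \<kappa> z = 0"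
 shows "L1 (%y. u y * \<kappa> (z - y))"
proof -
 obtain B where B: "B >= 0" "!!z. \<bar>\<kappa> z\<bar> <= B"
  using continuous_bounded_support_bounded[OF c assms(3)] by blast
 have "conton (%y. \<kappa> (z - y))"
  by (rule continuous_on_compose2[OF c]) (auto intro!: continuous_intros)
 hence m: "(%y. \<kappa> (z - y)) : lebm"
  by (intro borel_measurable_lebesgue borel_measurable_continuous_onI)
 show ?thesis
 proof (rule Lint_bound[of _ "%y. B * u y"])
  show "(%y. u y * \<kappa> (z - y)) : lebm"
   using m assms(1) by measurable
  show "AE y in lebesgue. norm (u y * \<kappa> (z - y)) <= norm (B * u y)"
   using B by (auto simp: abs_mult mult.commute[of "\<bar>u _\<bar>"] intro!: mult_right_mono)
 qed (use assms(1) in auto)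
qed

lemma conv_continuous:
 fixes \<kappa> :: "'b::euclidean_space => real"
 assumes u: "L1 u" and c: "conton \<kappa>" and supp: "!!z. norm z > R ==> \<kappa> z = 0"
 shows "conton (conv u \<kappa>)"
 unfolding continuous_on_sequentially
proof (intro allI ballI impI, elim conjE)
 fix x and z assume lim: "x ~~> (z::'b)"
 obtain B where B: "B >= 0" "!!z. \<bar>\<kappa> z\<bar> <= B"
  using continuous_bounded_support_bounded[OF c supp] by blast
 have [measurable]: "u : lebm" using u by auto
 have "(%n. conv u \<kappa> (x n)) ~~> conv u \<kappa> z"
  unfolding conv_def
 proof (rule integral_dominated_convergence[where w="%y. \<bar>u y\<bar> * B"])
  show "(%y. u y * \<kappa> (z - y)) : lebm"
   "(%y. u y * \<kappa> (x n - y)) : lebm" for n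
   using conv_integrable[OF u c supp] by auto
  show "AE y in lebesgue. (%n. u y * \<kappa> (x n - y)) ~~> u y * \<kappa> (z - y)"
   using c by (intro always_eventually allI tendsto_mult tendsto_const
     continuous_on_tendsto_compose[OF c] tendsto_diff lim) auto
  show "AE y in lebesgue. norm (u y * \<kappa> (x n - y)) <= \<bar>u y\<bar> * B" for n
   using B by (auto simp: abs_mult intro!: mult_left_mono)
 qed (use u in auto)
 thus "(conv u \<kappa> \<circ> x) ~~> conv u \<kappa> z" by (simp add: o_def)
qed

text \<open>The derivative falls on the kernel. Along any sequence tending to 0 the remainder
  quotients of the kernel tend to 0 pointwise and are at most 2L, so 2L|u| dominates them.\<close>

lemma conv_has_derivative:
 fixes \<kappa> :: "'b::euclidean_space => real"
 assumes u: "L1 u" and \<kappa>: "C_k 1 \<kappa>" and supp: "!!z. norm z > R ==> \<kappa> z = 0"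
 shows "(conv u \<kappa> has_derivative (%v. conv u (%z. fd \<kappa> z v) z)) (at z)"
proof -
 let ?D = "%x v. fd \<kappa> x v"
 obtain L where L: "L >= 0" "!!x y. \<bar>\<kappa> x - \<kappa> y\<bar> <= L * norm (x - y)" "!!x v. \<bar>?D x v\<bar> <= L * norm v"
  using C_1_lipschitz[OF \<kappa> supp] by metis
 have der: "(\<kappa> has_derivative ?D x) (at x)" for x using \<kappa> C_k_Suc_has_derivative[of 0] by simp
 have c: "conton \<kappa>" "conton (%z. ?D z v)" for v
  using C_k_imp_continuous_on[OF \<kappa>] \<kappa> by auto
 have D0: "norm z > R ==> ?D z v = 0" for z v
  using frechet_derivative_eq_0_outside[of "cball 0 R" \<kappa> z] supp by auto
 note int1 = conv_integrable[OF u c(1) supp, where z=z for z]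
 note int2 = conv_integrable[OF u c(2) D0, where z=z for z]
 have lin: "linear (?D x)" for x using der has_derivative_linear by blast
 have bl: "bounded_linear (%v. conv u (%z. ?D z v) z)"
 proof
  show "conv u (%z. ?D z (v + v')) z = conv u (%z. ?D z v) z + conv u (%z. ?D z v') z" for v v'
   unfolding conv_def using int2
   by (subst Bochner_Integration.integral_add[symmetric]) (auto simp: linear_add[OF lin] algebra_simps)
  show "conv u (%z. ?D z (r *\<^sub>R v)) z = r *\<^sub>R conv u (%z. ?D z v) z" for r v
   unfolding conv_def by (simp add: linear_scale[OF lin] mult.left_commute)
  show "\<exists>K. \<forall>v. norm (conv u (%z. ?D z v) z) <= norm v * K"
  proof (intro exI allI)
   fix v
   have "norm (conv u (%z. ?D z v) z) <= (LI y. norm (u y * ?D (z - y) v))"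
    unfolding conv_def by (rule integral_norm_bound)
   also have "... <= (LI y. norm v * (L * \<bar>u y\<bar>))"
    using u int2 L(3) by (intro integral_mono integrable_norm integrable_mult_right integrable_abs)
     (auto simp: abs_mult mult.assoc[symmetric] mult.commute[of "\<bar>u _\<bar>"]
      mult.commute[of "norm v"] intro!: mult_right_mono)
   finally show "norm (conv u (%z. ?D z v) z) <= norm v * (LI y. L * \<bar>u y\<bar>)" by simp
  qed
 qed
 have "((%h. norm (conv u \<kappa> (z + h) - conv u \<kappa> z - conv u (%z. ?D z h) z) / norm h) \<longlongrightarrow> 0) (at 0)"
  unfolding tendsto_at_iff_sequentially
 proof (intro allI impI, simp add: o_def)
  fix h :: "nat => 'b" assume h: "\<forall>i. h i ~= 0" "h ~~> 0"
  let ?g = "%n y. u y * ((\<kappa> (z - y + h n) - \<kappa> (z - y) - ?D (z - y) (h n)) / norm (h n))"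
  have "(%n. LI y. ?g n y) ~~> (LINT y|(lebesgue :: 'b measure). (0 :: real))"
  proof (rule integral_dominated_convergence[where w="%y. \<bar>u y\<bar> * (2 * L)" and s="?g" and f="%y. 0"])
   show "?g n : lebm" for n
   proof -
    have "?g n = (%y. (u y * \<kappa> (z + h n - y) - u y * \<kappa> (z - y) - u y * ?D (z - y) (h n)) / norm (h n))"
     by (auto simp: fun_eq_iff algebra_simps)
    moreover have "(%y. u y * \<kappa> (z + h n - y)) : lebm"
     "(%y. u y * \<kappa> (z - y)) : lebm"
     "(%y. u y * ?D (z - y) (h n)) : lebm"
     using int1 int2 by auto
    ultimately show ?thesis by simp
   qed
   show "AE y in lebesgue. (%n. ?g n y) ~~> 0"
   proof (intro always_eventually allI tendsto_mult_right_zero)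
    fix y
    have "((%h. norm (\<kappa> (z - y + h) - \<kappa> (z - y) - ?D (z - y) h) / norm h) \<longlongrightarrow> 0) (at 0)"
     using der[of "z - y"] by (simp add: has_derivative_at)
    hence "(%n. norm (\<kappa> (z - y + h n) - \<kappa> (z - y) - ?D (z - y) (h n)) / norm (h n)) ~~> 0"
     using h by (auto simp: tendsto_at_iff_sequentially o_def)
    hence "(%n. \<bar>(\<kappa> (z - y + h n) - \<kappa> (z - y) - ?D (z - y) (h n)) / norm (h n)\<bar>) ~~> 0"
     by (simp add: abs_divide)
    thus "(%n. (\<kappa> (z - y + h n) - \<kappa> (z - y) - ?D (z - y) (h n)) / norm (h n)) ~~> 0"
     by (rule tendsto_rabs_zero_cancel)
   qed
   show "AE y in lebesgue. norm (?g n y) <= \<bar>u y\<bar> * (2 * L)" for n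
   proof (intro always_eventually allI)
    fix y
    have "\<bar>\<kappa> (z - y + h n) - \<kappa> (z - y) - ?D (z - y) (h n)\<bar> <= 2 * L * norm (h n)"
     using L(2)[of "z - y + h n" "z - y"] L(3)[of "z - y" "h n"] by (simp add: abs_le_iff)
    hence "\<bar>(\<kappa> (z - y + h n) - \<kappa> (z - y) - ?D (z - y) (h n)) / norm (h n)\<bar> <= 2 * L"
     using h by (simp add: abs_divide divide_le_eq)
    thus "norm (?g n y) <= \<bar>u y\<bar> * (2 * L)"
     by (simp add: abs_mult mult_left_mono del: times_divide_eq_right)
   qed
  qed (use u in auto)
  moreover have "(LI y. ?g n y) =
   (conv u \<kappa> (z + h n) - conv u \<kappa> z - conv u (%z. ?D z (h n)) z) / norm (h n)" for n
  proof -
   have "?g n = (%y. (u y * \<kappa> (z + h n - y) - u y * \<kappa> (z - y) - u y * ?D (z - y) (h n)) / norm (h n))"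
    by (auto simp: fun_eq_iff algebra_simps)
   thus ?thesis unfolding conv_def using int1 int2 by simp
  qed
  ultimately have "(%n. (conv u \<kappa> (z + h n) - conv u \<kappa> z - conv u (%z. ?D z (h n)) z) / norm (h n)) ~~> 0"
   by (simp only: Bochner_Integration.integral_zero)
  from tendsto_rabs_zero[OF this]
  show "(%n. \<bar>conv u \<kappa> (z + h n) - conv u \<kappa> z - conv u (%z. ?D z (h n)) z\<bar> / norm (h n)) ~~> 0"
   by (simp add: abs_divide)
 qed
 with bl show ?thesis by (simp add: has_derivative_at)
qed

text \<open>Induction with the kernel kept general: differentiating a convolution gives the
  convolution with the differentiated kernel, which vanishes outside the same ball.\<close>

lemma C_k_conv:
 fixes \<kappa> :: "'b::euclidean_space => real"
 assumes u: "L1 u" and "C_k k \<kappa>" and "!!z. norm z > R ==> \<kappa> z = 0"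
 shows "C_k k (conv u \<kappa>)"
 using assms(2,3)
proof (induction k arbitrary: \<kappa>)
 case 0
 thus ?case using conv_continuous[OF u _ 0(2)] by simp
next
 case (Suc k)
 show ?case
 proof (rule C_k_SucI)
  show "(conv u \<kappa> has_derivative (%v. conv u (%z. fd \<kappa> z v) z)) (at z)" for z
   using Suc.prems by (intro conv_has_derivative[OF u C_k_imp_C_1])
  show "C_k k (%z. conv u (%z. fd \<kappa> z v) z)" for v
   using Suc.prems frechet_derivative_eq_0_outside[of "cball 0 R" \<kappa>]
   by (intro Suc.IH) auto
 qed
qed

lemma frechet_derivative_conv:
 fixes \<kappa> :: "'b::euclidean_space => real"
 assumes "L1 u" and "C_k 1 \<kappa>" and "!!z. norm z > R ==> \<kappa> z = 0"
 shows "fd (conv u \<kappa>) z v = conv u (%z. fd \<kappa> z v) z"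
 using frechet_derivative_at[OF conv_has_derivative[OF assms]] by metis

lemma integrable_lebesgue_borel_representative:
 fixes u :: "'b::euclidean_space => real"
 assumes "u : lebm"
 obtains u' where "u' : borm" "AE y in lebesgue. u y = u' y"
proof -
 obtain u' where "u' : borel_measurable lborel" "AE y in lborel. u y = u' y"
  using completion_ex_borel_measurable_real[OF assms] by blast
 thus ?thesis using that[of u'] AE_completion by auto
qed

text \<open>Tonelli's theorem. A Borel representative u' replaces u, so that
  \<open>u' y * \<kappa> (z - y)\<close> is jointly measurable.\<close>

lemma conv_L1:
 fixes \<kappa> :: "'b::euclidean_space => real"
 assumes u: "L1 u" and c: "conton \<kappa>"
  and supp: "!!z. norm z > R ==> \<kappa> z = 0" and pos: "!!z. \<kappa> z >= 0"
  and int1: "(LINT z|lborel. \<kappa> z) = 1"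
 shows "L1 (conv u \<kappa>)"
  and "(LI z. \<bar>conv u \<kappa> z\<bar>) <= (LI z. \<bar>u z\<bar>)"
proof -
 obtain u' where [measurable]: "u' : borm" and eq: "AE y in lebesgue. u y = u' y"
  using integrable_lebesgue_borel_representative[of u] u by blast
 have u': "integrable lborel u'"
 proof -
  have "L1 u'"
   using u eq borel_measurable_lebesgue[of u'] integrable_cong_AE[of u lebesgue u'] by auto
  thus ?thesis by (simp add: integrable_lebesgue_of_borel)
 qed
 have [measurable]: "\<kappa> : borm" using c by (rule borel_measurable_continuous_onI)
 have conv_eq: "conv u \<kappa> z = (LINT y|lborel. u' y * \<kappa> (z - y))" for z
 proof -
  have m: "(%y. \<kappa> (z - y)) : borm" "(%y. u' y * \<kappa> (z - y)) : borm"
   by measurable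
  have "conv u \<kappa> z = (LI y. u' y * \<kappa> (z - y))"
   unfolding conv_def using eq u borel_measurable_lebesgue[OF m(1)] borel_measurable_lebesgue[OF m(2)]
   by (intro integral_cong_AE) auto
  thus ?thesis using m(2) by (simp add: integrable_lebesgue_of_borel)
 qed
 have intk: "(\<integral>\<^sup>+z. ennreal (\<kappa> (z - y)) \<partial>lborel) = 1" for y
 proof -
  have "(\<integral>\<^sup>+z. ennreal (\<kappa> (z - y)) \<partial>lborel) = (\<integral>\<^sup>+z. ennreal (\<kappa> z) \<partial>distr lborel borel ((+) (- y)))"
   by (subst nn_integral_distr) auto
  also have "... = (\<integral>\<^sup>+z. ennreal (\<kappa> z) \<partial>lborel)" by (simp add: lborel_distr_plus)
  also have "... = ennreal (LINT z|lborel. \<kappa> z)"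
   using integrable_continuous_bounded_support[OF c supp] pos by (intro nn_integral_eq_integral) auto
  finally show ?thesis using int1 by simp
 qed
 have bound: "(\<integral>\<^sup>+z. ennreal \<bar>conv u \<kappa> z\<bar> \<partial>lborel) <= (\<integral>\<^sup>+y. ennreal \<bar>u' y\<bar> \<partial>lborel)"
 proof -
  have "(\<integral>\<^sup>+z. ennreal \<bar>conv u \<kappa> z\<bar> \<partial>lborel) \<le>
    (\<integral>\<^sup>+z. (\<integral>\<^sup>+y. ennreal (\<bar>u' y\<bar> * \<kappa> (z - y)) \<partial>lborel) \<partial>lborel)"
  proof (rule nn_integral_mono)
   fix z
   have "ennreal \<bar>conv u \<kappa> z\<bar> <= (\<integral>\<^sup>+y. ennreal (norm (u' y * \<kappa> (z - y))) \<partial>lborel)"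
    using integral_norm_bound_ennreal[of lborel "%y. u' y * \<kappa> (z - y)"]
    unfolding conv_eq real_norm_def[symmetric]
    by (cases "integrable lborel (%y. u' y * \<kappa> (z - y))")
     (simp_all add: not_integrable_integral_eq)
   thus "ennreal \<bar>conv u \<kappa> z\<bar> <= (\<integral>\<^sup>+y. ennreal (\<bar>u' y\<bar> * \<kappa> (z - y)) \<partial>lborel)"
    using pos by (simp add: abs_mult)
  qed
  also have "... = (\<integral>\<^sup>+y. (\<integral>\<^sup>+z. ennreal (\<bar>u' y\<bar> * \<kappa> (z - y)) \<partial>lborel) \<partial>lborel)"
   by (rule lborel_pair.Fubini'[symmetric]) measurable
  also have "... = (\<integral>\<^sup>+y. ennreal \<bar>u' y\<bar> \<partial>lborel)"
   by (subst ennreal_mult'') (auto simp: pos intk nn_integral_cmult)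
  finally show ?thesis .
 qed
 have [measurable]: "conv u \<kappa> : borm"
  using conv_continuous[OF u c supp] by (rule borel_measurable_continuous_onI)
 have fin: "(\<integral>\<^sup>+y. ennreal \<bar>u' y\<bar> \<partial>lborel) = ennreal (LINT y|lborel. \<bar>u' y\<bar>)"
  using u' by (intro nn_integral_eq_integral) auto
 have i: "integrable lborel (conv u \<kappa>)"
  using bound fin by (intro integrableI_bounded) (auto simp: top.not_eq_extremum intro: le_less_trans)
 thus "L1 (conv u \<kappa>)" by (simp add: integrable_lebesgue_of_borel)
 have "ennreal (LINT z|lborel. \<bar>conv u \<kappa> z\<bar>) <= ennreal (LINT y|lborel. \<bar>u' y\<bar>)"
  using bound fin i by (subst nn_integral_eq_integral[symmetric]) auto
 hence "(LINT z|lborel. \<bar>conv u \<kappa> z\<bar>) <= (LINT y|lborel. \<bar>u' y\<bar>)"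
  by (subst (asm) ennreal_le_iff) auto
 also have "... = (LI y. \<bar>u' y\<bar>)" by (subst integrable_lebesgue_of_borel(2)) auto
 also have "... = (LI y. \<bar>u y\<bar>)"
  using eq u by (intro integral_cong_AE) (auto intro!: borel_measurable_abs borel_measurable_lebesgue)
 finally show "(LI z. \<bar>conv u \<kappa> z\<bar>) <= (LI z. \<bar>u z\<bar>)"
  by (subst integrable_lebesgue_of_borel(2)) auto
qed

text \<open>Truncate u in value and in space, then approximate the truncation almost everywhere by
  continuous functions. These are clipped at the same level and multiplied by a continuous cutoff,
  which leaves the limit unchanged and supplies a dominating function.\<close>

lemma L1_approx_continuous:
 fixes u :: "'b::euclidean_space => real"
 assumes u: "L1 u" and e: "e > 0"
 obtains \<phi> R where "conton \<phi>" "!!z. norm z > R ==> \<phi> z = 0"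
  "(LI z. \<bar>u z - \<phi> z\<bar>) < e"
proof -
 have [measurable]: "u : lebm" using u by auto
 define clip where "clip n s = max (- real n) (min (real n) s)" for n s
 have clip_cont: "conton (clip n)" for n unfolding clip_def by (intro continuous_intros)
 define t where "t n z = clip n (u z) * indicator (cball 0 (real n)) z" for n z
 have [measurable]: "cball 0 (real n) : sets (lebesgue :: 'b measure)" for n by simp
 have tm[measurable]: "t n : lebm" for n unfolding t_def clip_def by measurable
 have "(%n. LI z. \<bar>u z - t n z\<bar>) ~~> (LI z. \<bar>u z - u z\<bar>)"
 proof (rule integral_dominated_convergence[where w="%z. 2 * \<bar>u z\<bar>"])
  show "AE z in lebesgue. (%n. \<bar>u z - t n z\<bar>) ~~> \<bar>u z - u z\<bar>"
  proof (intro always_eventually allI tendsto_intros)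
   fix z
   obtain N where N: "real N >= max \<bar>u z\<bar> (norm z)" using real_arch_simple by blast
   have "\<forall>\<^sub>F n in sequentially. t n z = u z"
    using eventually_ge_at_top[of N]
   proof eventually_elim
    case (elim n)
    hence "real n >= max \<bar>u z\<bar> (norm z)" using N by linarith
    thus ?case by (auto simp: t_def clip_def)
   qed
   thus "(%n. t n z) ~~> u z" by (rule tendsto_eventually)
  qed
  show "AE z in lebesgue. norm \<bar>u z - t n z\<bar> <= 2 * \<bar>u z\<bar>" for n
   by (intro always_eventually allI) (auto simp: t_def clip_def indicator_def)
 qed (use u in auto)
 hence "\<forall>\<^sub>F n in sequentially. (LI z. \<bar>u z - t n z\<bar>) < e / 2"
  using e by (intro order_tendstoD(2)) auto
 then obtain n where n: "(LI z. \<bar>u z - t n z\<bar>) < e / 2"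
  using eventually_happens'[OF sequentially_bot] by blast
 define c where "c z = max 0 (min 1 (real n + 1 - norm z))" for z :: 'b
 have c: "conton c" unfolding c_def by (intro continuous_intros)
 have "t n measurable_on UNIV" by (rule lebesgue_measurable_imp_measurable_on) auto
 then obtain N g where N: "negligible N" and g: "!!j. conton (g j)"
  and lim: "!!z. z \<notin> N ==> (%j. g j z) ~~> t n z"
  unfolding measurable_on_def by auto
 define h where "h j z = clip n (g j z) * c z" for j :: nat and z
 have hc: "conton (h j)" for j unfolding h_def
  by (intro continuous_intros c continuous_on_compose2[OF clip_cont g]) auto
 have [measurable]: "h j : lebm" for j
  by (intro borel_measurable_lebesgue borel_measurable_continuous_onI hc)
 have c0: "norm z > real n + 1 ==> c z = 0" for z by (simp add: c_def)
 have h0: "norm z > real n + 1 ==> h j z = 0" for j z by (simp add: h_def c0)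
 have c01: "0 <= c z" "c z <= 1" for z by (auto simp: c_def)
 have clipn: "\<bar>clip n s\<bar> <= real n" for s by (auto simp: clip_def)
 have tn: "\<bar>t n z\<bar> <= real n * indicator (cball 0 (real n + 1)) z" for z
  using clipn[of "u z"] by (auto simp: t_def indicator_def)
 have "(%j. LI z. \<bar>t n z - h j z\<bar>) ~~> (LI z. \<bar>t n z - t n z\<bar>)"
 proof (rule integral_dominated_convergence[where w="%z. 2 * real n * indicator (cball 0 (real n + 1)) z"])
  show "AE z in lebesgue. (%j. \<bar>t n z - h j z\<bar>) ~~> \<bar>t n z - t n z\<bar>"
  proof (rule AE_I')
   show "N : null_sets lebesgue" using N by (simp add: negligible_iff_null_sets)
   have "(%j. h j z) ~~> t n z" if "z \<notin> N" for z
   proof -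
    have "(%j. h j z) ~~> clip n (t n z) * c z"
     unfolding h_def clip_def by (intro tendsto_intros lim that)
    moreover have "clip n (t n z) * c z = t n z"
     by (auto simp: t_def clip_def c_def indicator_def)
    ultimately show ?thesis by simp
   qed
   note \<open>!!z. z \<notin> N ==> (%j. h j z) ~~> t n z\<close>
   show "{z : space lebesgue. \<not> (%j. \<bar>t n z - h j z\<bar>) ~~> \<bar>t n z - t n z\<bar>} \<subseteq> N"
   proof (intro subsetI, rule ccontr)
    fix z assume z: "z : {z : space lebesgue. \<not> (%j. \<bar>t n z - h j z\<bar>) ~~> \<bar>t n z - t n z\<bar>}" "z \<notin> N"
    have "(%j. \<bar>t n z - h j z\<bar>) ~~> \<bar>t n z - t n z\<bar>"
     using \<open>!!z. z \<notin> N ==> (%j. h j z) ~~> t n z\<close>[OF z(2)] by (intro tendsto_intros)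
    with z(1) show False by simp
   qed
  qed
  have hn: "\<bar>h j z\<bar> <= real n * indicator (cball 0 (real n + 1)) z" for j z
  proof (cases "norm z <= real n + 1")
   case True
   have "\<bar>h j z\<bar> <= real n * 1" unfolding h_def abs_mult
    using clipn c01[of z] by (intro mult_mono) auto
   thus ?thesis using True by simp
  qed (simp add: h0)
  show "AE z in lebesgue. norm \<bar>t n z - h j z\<bar> <= 2 * real n * indicator (cball 0 (real n + 1)) z" for j
  proof (intro always_eventually allI)
   fix z
   show "norm \<bar>t n z - h j z\<bar> <= 2 * real n * indicator (cball 0 (real n + 1)) z"
    using tn[of z] hn[of j z] abs_triangle_ineq4[of "t n z" "h j z"] by simp
  qed
  show "L1 (%z::'b. 2 * real n * indicator (cball 0 (real n + 1)) z)"
   by (intro integrable_mult_right integrable_real_indicator)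
    (use emeasure_lborel_cball_finite[of "0::'b" "real n + 1"] in auto)
 qed auto
 hence "\<forall>\<^sub>F j in sequentially. (LI z. \<bar>t n z - h j z\<bar>) < e / 2"
  using e by (intro order_tendstoD(2)) auto
 then obtain j where j: "(LI z. \<bar>t n z - h j z\<bar>) < e / 2"
  using eventually_happens'[OF sequentially_bot] by blast
 have ih: "L1 (h j)" using C_0_integrable_lebesgue[OF hc h0] .
 have it: "L1 (t n)"
  by (rule Lint_bound[OF u]) (auto simp: t_def clip_def indicator_def)
 have "(LI z. \<bar>u z - h j z\<bar>) <= (LI z. \<bar>u z - t n z\<bar> + \<bar>t n z - h j z\<bar>)"
  using u ih it by (intro integral_mono) auto
 also have "... = (LI z. \<bar>u z - t n z\<bar>) + (LI z. \<bar>t n z - h j z\<bar>)"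
  using u ih it by (intro Bochner_Integration.integral_add) auto
 also have "... < e" using n j by simp
 finally show ?thesis using that[OF hc h0] by blast
qed

definition moll :: "nat => 'b::euclidean_space => real" where
 "moll n = mollifier (1 / real (Suc n))"

lemma moll_nonneg: "moll n z >= 0"
 by (simp add: moll_def mollifier_nonneg)

lemma C_k_moll: "C_k k (moll n)"
 by (simp add: moll_def C_k_mollifier)

lemma moll_eq_0: "norm z >= 1 / real (Suc n) ==> moll n z = 0"
 unfolding moll_def by (rule mollifier_eq_0) auto

lemma moll_eq_0_1:
 assumes "norm z > 1"
 shows "moll n z = 0"
proof (rule moll_eq_0)
 have "1 / real (Suc n) <= 1" by simp
 thus "1 / real (Suc n) <= norm z" using assms by linarith
qed

lemma moll_continuous: "conton (moll n)"
 using C_k_moll[of 0] by simp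

lemma integral_moll: "(LINT z|lborel. moll n (z::'b::euclidean_space)) = 1"
 unfolding moll_def by (rule integral_mollifier) auto

lemma moll_measurable [measurable]: "moll n : borm"
 by (rule borel_measurable_continuous_onI[OF moll_continuous])

lemma moll_integrable: "L1 (%y. moll n (z - y))"
proof (rule C_0_integrable_lebesgue[of _ "norm z + 1"])
 show "conton (%y. moll n (z - y))"
  by (rule continuous_on_compose2[OF moll_continuous]) (auto intro!: continuous_intros)
 show "norm y > norm z + 1 ==> moll n (z - y) = 0" for y
  using norm_triangle_ineq2[of y z] by (intro moll_eq_0_1) (simp add: norm_minus_commute)
qed

lemma integral_moll_reflect: "(LI y. moll n (z - y)) = 1"
proof -
 have "(LI y. moll n (z - y)) = (LINT y|lborel. moll n (z - y))"
  by (intro integrable_lebesgue_of_borel(2)) measurable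
 thus ?thesis by (simp add: lborel_integral_reflect integral_moll)
qed

text \<open>A mollified value is an average over a small ball. With c = 0 this preserves sup bounds,
  with c = u z it gives uniform convergence for continuous functions.\<close>

lemma conv_moll_bound:
 assumes u: "L1 u" and "!!y. norm (z - y) < 1 / real (Suc n) ==> \<bar>u y - c\<bar> <= e"
 shows "\<bar>conv u (moll n) z - c\<bar> <= e"
proof -
 have i: "L1 (%y. u y * moll n (z - y))"
  using conv_integrable[OF u moll_continuous moll_eq_0_1] .
 have "conv u (moll n) z - c = (LI y. u y * moll n (z - y)) - c * (LI y. moll n (z - y))"
  by (simp add: conv_def integral_moll_reflect)
 also have "... = (LI y. (u y - c) * moll n (z - y))"
  using i moll_integrable[of n z]
  by (simp add: left_diff_distrib Bochner_Integration.integral_diff)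
 also have "\<bar>...\<bar> <= (LI y. \<bar>(u y - c) * moll n (z - y)\<bar>)"
  using integral_norm_bound[of lebesgue "%y. (u y - c) * moll n (z - y)"] by simp
 also have "... <= (LI y. e * moll n (z - y))"
 proof (rule integral_mono)
  show "L1 (%y. \<bar>(u y - c) * moll n (z - y)\<bar>)"
   using i moll_integrable[of n z] by (simp add: left_diff_distrib)
  show "L1 (%y. e * moll n (z - y))"
   by (intro integrable_mult_right moll_integrable)
  show "\<bar>(u y - c) * moll n (z - y)\<bar> <= e * moll n (z - y)" for y
   using assms(2)[of y] moll_eq_0[of n "z - y"] moll_nonneg[of n "z - y"]
   by (cases "norm (z - y) < 1 / real (Suc n)") (auto simp: abs_mult mult_right_mono)
 qed
 also have "... = e" by (simp add: integral_moll_reflect)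
 finally show ?thesis .
qed

lemma uniformly_continuous_bounded_support:
 fixes h :: "'b::euclidean_space => real"
 assumes "conton h" and supp: "!!z. norm z > R ==> h z = 0" and e: "e > 0"
 obtains d where "d > 0" "!!y z. norm (z - y) < d ==> \<bar>h y - h z\<bar> < e"
proof -
 have "uniformly_continuous_on (cball 0 (R + 1)) h"
  using assms(1) by (intro compact_uniformly_continuous) (auto intro: continuous_on_subset)
 then obtain d where d: "d > 0"
  "!!y z. y : cball 0 (R + 1) ==> z : cball 0 (R + 1) ==> dist y z < d ==> dist (h y) (h z) < e"
  using e unfolding uniformly_continuous_on_def by meson
 have "\<bar>h y - h z\<bar> < e" if "norm (z - y) < min d 1" for y z
 proof (cases "norm y <= R + 1 \<and> norm z <= R + 1")
  case True
  thus ?thesis using d(2)[of y z] that by (auto simp: dist_norm norm_minus_commute)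
 next
  case False
  hence "norm y > R" "norm z > R"
   using that norm_triangle_ineq2[of y z] norm_triangle_ineq2[of z y] by (auto simp: norm_minus_commute)
  thus ?thesis using supp e by simp
 qed
 thus ?thesis using that[of "min d 1"] d(1) by auto
qed

lemma conv_moll_uniform:
 fixes h :: "'b::euclidean_space => real"
 assumes c: "conton h" and supp: "!!z. norm z > R ==> h z = 0" and e: "e > 0"
 shows "\<forall>\<^sub>F n in sequentially. \<forall>z. \<bar>conv h (moll n) z - h z\<bar> <= e"
proof -
 obtain d where d: "d > 0" "!!y z. norm (z - y) < d ==> \<bar>h y - h z\<bar> < e"
  using uniformly_continuous_bounded_support[OF assms] by blast
 have "\<forall>\<^sub>F n in sequentially. 1 / real (Suc n) < d"
  using LIMSEQ_Suc[OF lim_1_over_n] d(1) by (intro order_tendstoD(2)) auto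
 thus ?thesis
 proof eventually_elim
  case (elim n)
  thus ?case
   using d(2) by (intro allI conv_moll_bound[OF C_0_integrable_lebesgue[OF c supp]]) (force intro: less_imp_le)+
 qed
qed

lemma conv_eq_0_outside:
 assumes "!!z. norm z > R ==> h z = 0" and "norm z > R + 1"
 shows "conv h (moll n) z = 0"
proof -
 have "h y * moll n (z - y) = 0" for y
 proof (cases "norm y > R")
  case False
  hence "norm (z - y) > 1" using assms(2) norm_triangle_ineq2[of z y] by linarith
  thus ?thesis by (simp add: moll_eq_0_1)
 qed (simp add: assms(1))
 thus ?thesis unfolding conv_def by (simp only: Bochner_Integration.integral_zero)
qed

lemma conv_diff:
 assumes "L1 u" and "L1 w"
  and "conton \<kappa>" and "!!z. norm z > R ==> \<kappa> z = 0"
 shows "conv (%y. u y - w y) \<kappa> z = conv u \<kappa> z - conv w \<kappa> z"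
 unfolding conv_def using conv_integrable[OF assms(1,3,4)] conv_integrable[OF assms(2,3,4)]
 by (simp add: left_diff_distrib)

lemma conv_moll_diff:
 assumes "L1 u" and "L1 w"
 shows "conv (%y. u y - w y) (moll n) z = conv u (moll n) z - conv w (moll n) z"
 by (rule conv_diff[OF assms moll_continuous, of 1]) (rule moll_eq_0_1)

lemma conv_moll_L1:
 fixes u :: "'b::euclidean_space => real"
 assumes "L1 u"
 shows "L1 (conv u (moll n))"
  and "(LI z. \<bar>conv u (moll n) z\<bar>) <= (LI z. \<bar>u z\<bar>)"
 using conv_L1[OF assms moll_continuous _ moll_nonneg integral_moll, where R = 1] moll_eq_0_1
 by blast+

text \<open>Splitting through a continuous \<phi> close to u: mollification contracts L^1, and on
  \<phi> it converges uniformly with all supports in one ball.\<close>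

lemma mollification_L1:
 fixes u :: "'b::euclidean_space => real"
 assumes u: "L1 u"
 shows "(%n. LI z. \<bar>conv u (moll n) z - u z\<bar>) ~~> 0"
proof (rule LIMSEQ_I)
 fix e :: real assume e: "e > 0"
 obtain \<phi> R where \<phi>: "conton \<phi>" and R: "!!z. norm z > R ==> \<phi> z = 0"
  and close: "(LI z. \<bar>u z - \<phi> z\<bar>) < e / 3"
  using L1_approx_continuous[OF u, of "e / 3"] e by auto
 define A where "A = measure lebesgue (cball (0::'b) (R + 1))"
 \<comment> \<open>A is the volume of the ball containing all supports, so a uniform error e' costs
   at most e' A < e/3; the summand 1 guards the division.\<close>
 define e' where "e' = e / (3 * (A + 1))"
 have A: "A >= 0" and e': "e' > 0" using e by (auto simp: A_def e'_def intro!: divide_pos_pos add_nonneg_pos)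
 have i\<phi>: "L1 \<phi>" using C_0_integrable_lebesgue[OF \<phi> R] .
 note cL = conv_moll_L1
 have "\<forall>\<^sub>F n in sequentially. (LI z. \<bar>conv u (moll n) z - u z\<bar>) < e"
  using conv_moll_uniform[of \<phi> R e', OF \<phi> R e']
 proof (rule eventually_mono)
  fix n assume elim: "\<forall>z. \<bar>conv \<phi> (moll n) z - \<phi> z\<bar> <= e'"
  let ?c = "%u. conv u (moll n)"
  have 1: "(LI z. \<bar>?c u z - ?c \<phi> z\<bar>) < e / 3"
   using cL(2)[of "%z. u z - \<phi> z" n] u i\<phi> close
   by (simp add: conv_moll_diff[OF u i\<phi>])
  have "(LI z. \<bar>?c \<phi> z - \<phi> z\<bar>) <= (LI z. e' * indicator (cball (0::'b) (R + 1)) z)"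
  proof (rule integral_mono)
   show "L1 (%z. \<bar>?c \<phi> z - \<phi> z\<bar>)" using cL(1)[OF i\<phi>] i\<phi> by auto
   show "L1 (%z. e' * indicator (cball (0::'b) (R + 1)) z)"
    using emeasure_lborel_cball_finite[of "0::'b" "R + 1"]
    by (intro integrable_mult_right integrable_real_indicator) auto
   show "\<bar>?c \<phi> z - \<phi> z\<bar> <= e' * indicator (cball 0 (R + 1)) z" for z
    using elim conv_eq_0_outside[of R \<phi> z n] R by (cases "norm z <= R + 1") auto
  qed
  also have "... = e' * A" by (simp add: A_def)
  also have "... < e / 3" using A e by (simp add: e'_def divide_simps)
  finally have 2: "(LI z. \<bar>?c \<phi> z - \<phi> z\<bar>) < e / 3" .
  have i: "L1 (%z. \<bar>?c u z - ?c \<phi> z\<bar>)" "L1 (%z. \<bar>?c \<phi> z - \<phi> z\<bar>)"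
   "L1 (%z. \<bar>u z - \<phi> z\<bar>)" "L1 (%z. \<bar>?c u z - u z\<bar>)"
   using cL(1)[OF u] cL(1)[OF i\<phi>] u i\<phi> by auto
  have "(LI z. \<bar>?c u z - u z\<bar>) \<le>
    (LI z. \<bar>?c u z - ?c \<phi> z\<bar> + \<bar>?c \<phi> z - \<phi> z\<bar> + \<bar>u z - \<phi> z\<bar>)"
   using i by (intro integral_mono Lint_add) auto
  also have "... = (LI z. \<bar>?c u z - ?c \<phi> z\<bar>) + (LI z. \<bar>?c \<phi> z - \<phi> z\<bar>)
    + (LI z. \<bar>u z - \<phi> z\<bar>)"
   using i by (simp add: Bochner_Integration.integral_add)
  also have "... < e" using 1 2 close by simp
  finally show "(LI z. \<bar>?c u z - u z\<bar>) < e" .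
 qed
 thus "\<exists>N. \<forall>n\<ge>N. norm ((LI z. \<bar>conv u (moll n) z - u z\<bar>) - 0) < e"
  by (auto simp: eventually_sequentially)
qed

text \<open>The tangent of s^p at c lies below the graph. This is Young's inequality for the product
  of s and c^(p-1), and integrating it gives Jensen's inequality below.\<close>

lemma tangent_powr_le:
 fixes s c p :: real
 assumes "p > 1" and "s >= 0" and "c >= 0"
 shows "c powr p + p * c powr (p - 1) * (s - c) <= s powr p"
proof (cases "c = 0")
 case True
 thus ?thesis using assms by simp
next
 case False
 define p' where "p' = p / (p - 1)"
 have p': "p' > 1" "1 / p + 1 / p' = 1" "p' * (p - 1) = p" using assms by (auto simp: p'_def field_simps)
 have "s * c powr (p - 1) <= s powr p / p + (c powr (p - 1)) powr p' / p'"
  using assms p' by (intro Youngs_inequality) auto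
 also have "(c powr (p - 1)) powr p' = c powr p" using p'(3) by (simp add: powr_powr mult.commute)
 finally have "p * (s * c powr (p - 1)) <= s powr p + (p - 1) * c powr p"
  using assms by (simp add: p'_def field_simps)
 moreover have "c powr (p - 1) * c = c powr p" using False assms by (simp add: powr_mult_base[of c "p - 1"] mult.commute)
 ultimately show ?thesis by (simp add: algebra_simps)
qed

lemma conv_moll_integrable:
 "L1 u ==> L1 (%y. u y * moll n (z - y))"
 using conv_integrable[OF _ moll_continuous, of u 1 n z] moll_eq_0_1 by blast

text \<open>The tangent inequality at the mollified value c of |u|, integrated against the
  probability density \<open>moll n\<close>: the linear term drops out.\<close>

lemma conv_moll_jensen:
 assumes u: "L1 u" and up: "L1 (%y. \<bar>u y\<bar> powr p)" and p: "p > 1"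
 shows "\<bar>conv u (moll n) z\<bar> powr p <= conv (%y. \<bar>u y\<bar> powr p) (moll n) z"
proof -
 define c where "c = conv (%y. \<bar>u y\<bar>) (moll n) z"
 have i1: "L1 (%y. \<bar>u y\<bar> * moll n (z - y))"
  using u by (intro conv_moll_integrable) auto
 have i2: "L1 (%y. \<bar>u y\<bar> powr p * moll n (z - y))"
  using up by (rule conv_moll_integrable)
 have "\<bar>conv u (moll n) z\<bar> <= (LI y. \<bar>u y * moll n (z - y)\<bar>)"
  unfolding conv_def using integral_norm_bound[of lebesgue "%y. u y * moll n (z - y)"] by simp
 also have "... = c" unfolding c_def conv_def by (simp add: abs_mult moll_nonneg)
 finally have le: "\<bar>conv u (moll n) z\<bar> <= c" .
 hence c0: "c >= 0" by linarith
 have "c powr p = (LI y. c powr p * moll n (z - y) + p * c powr (p - 1) *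
   (\<bar>u y\<bar> * moll n (z - y) - c * moll n (z - y)))"
  using i1 moll_integrable[of n z]
  by (simp add: integral_moll_reflect Bochner_Integration.integral_add Bochner_Integration.integral_diff
    c_def[unfolded conv_def, symmetric])
 also have "... <= (LI y. \<bar>u y\<bar> powr p * moll n (z - y))"
 proof (rule integral_mono)
  show "L1 (%y. c powr p * moll n (z - y) + p * c powr (p - 1) *
   (\<bar>u y\<bar> * moll n (z - y) - c * moll n (z - y)))"
   by (intro Lint_add Bochner_Integration.integrable_diff
     integrable_mult_right i1 moll_integrable)
  show "c powr p * moll n (z - y) + p * c powr (p - 1) * (\<bar>u y\<bar> * moll n (z - y) - c * moll n (z - y))
   <= \<bar>u y\<bar> powr p * moll n (z - y)" for y
   using mult_right_mono[OF tangent_powr_le[OF p _ c0, of "\<bar>u y\<bar>"] moll_nonneg[of n "z - y"]]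
   by (simp add: algebra_simps)
 qed (rule i2)
 finally have "c powr p <= conv (%y. \<bar>u y\<bar> powr p) (moll n) z" by (simp add: conv_def)
 moreover have "\<bar>conv u (moll n) z\<bar> powr p <= c powr p"
  using le p by (intro powr_mono2) auto
 ultimately show ?thesis by simp
qed

text \<open>Passing from L^1 to almost everywhere convergence for the sum of all errors yields one
  subsequence that serves every member of the family.\<close>

lemma moll_AE_subseq:
 fixes u :: "'j => 'b::euclidean_space => real"
 assumes J: "finite J" and u: "!!j. j : J ==> L1 (u j)"
 obtains r where "strict_mono r"
  "AE z in lebesgue. \<forall>j\<in>J. (%n. conv (u j) (moll (r n)) z) ~~> u j z"
proof -
 let ?g = "%n z. \<Sum>j\<in>J. \<bar>conv (u j) (moll n) z - u j z\<bar>"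
 have i: "j : J ==> L1 (%z. \<bar>conv (u j) (moll n) z - u j z\<bar>)" for j n
  using u conv_moll_L1(1)[OF u] by auto
 have "(%n. \<Sum>j\<in>J. LI z. \<bar>conv (u j) (moll n) z - u j z\<bar>) ~~> (\<Sum>j\<in>J. 0)"
  by (intro tendsto_sum mollification_L1 u)
 moreover have "(LI z. norm (?g n z)) = (\<Sum>j\<in>J. LI z. \<bar>conv (u j) (moll n) z - u j z\<bar>)" for n
 proof -
  have "norm (?g n z) = ?g n z" for z by (simp add: sum_nonneg)
  thus ?thesis using i by (simp add: Bochner_Integration.integral_sum)
 qed
 ultimately have "(%n. LI z. norm (?g n z)) ~~> 0" by simp
 then obtain r where r: "strict_mono r" "AE z in lebesgue. (%n. ?g (r n) z) ~~> 0"
  using tendsto_L1_AE_subseq[of lebesgue ?g, OF Bochner_Integration.integrable_sum] i by blast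
 from r(2) have "AE z in lebesgue. \<forall>j\<in>J. (%n. conv (u j) (moll (r n)) z) ~~> u j z"
 proof eventually_elim
  case (elim z)
  show ?case
  proof
   fix j assume j: "j : J"
   have "(%n. conv (u j) (moll (r n)) z - u j z) ~~> 0"
   proof (rule Lim_null_comparison[OF _ elim])
    show "\<forall>\<^sub>F n in sequentially. norm (conv (u j) (moll (r n)) z - u j z) <= ?g (r n) z"
     using J j by (intro always_eventually allI)
      (auto intro: member_le_sum[of j J "%j. \<bar>conv (u j) (moll (r _)) z - u j z\<bar>"])
   qed
   thus "(%n. conv (u j) (moll (r n)) z) ~~> u j z" by (simp add: LIM_zero_iff)
  qed
 qed
 with r(1) that show ?thesis by blast
qed

text \<open>The dominating functions vary with n. Clipping \<open>F n\<close> at |g| gives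
  \<open>H n\<close>, to which the usual theorem applies, and the clipped part is at most |G n - g|,
  which is small in L^1.\<close>

lemma integral_dominated_convergence_L1:
 fixes f :: "'m => real"
 assumes [measurable]: "f : borel_measurable M" "!!n. F n : borel_measurable M"
  and g: "integrable M g" and gn: "!!n. integrable M (G n)"
  and L1: "(%n. LINT z|M. \<bar>G n z - g z\<bar>) ~~> 0"
  and Gg: "AE z in M. (%n. G n z) ~~> g z" and lim: "AE z in M. (%n. F n z) ~~> f z"
  and bound: "!!n. AE z in M. \<bar>F n z\<bar> <= G n z"
 shows "integrable M f" and "(%n. LINT z|M. F n z) ~~> (LINT z|M. f z)"
proof -
 have [measurable]: "g : borel_measurable M" using g by auto
 define H where "H n z = max (- \<bar>g z\<bar>) (min \<bar>g z\<bar> (F n z))" for n z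
 have [measurable]: "H n : borel_measurable M" for n unfolding H_def by measurable
 have bd: "AE z in M. \<forall>n. \<bar>F n z\<bar> <= G n z" using bound by (simp add: AE_all_countable)
 have fg: "AE z in M. \<bar>f z\<bar> <= g z"
  using bd Gg lim
 proof eventually_elim
  case (elim z)
  from tendsto_rabs[OF elim(3)] elim(2) elim(1) show ?case by (intro LIMSEQ_le) auto
 qed
 show "integrable M f"
  by (rule Lint_bound[OF g]) (use fg in auto)
 have HL: "AE z in M. (%n. H n z) ~~> f z"
  using fg lim
 proof eventually_elim
  case (elim z)
  have "(%n. H n z) ~~> max (- \<bar>g z\<bar>) (min \<bar>g z\<bar> (f z))"
   unfolding H_def by (intro tendsto_intros elim)
  moreover have "max (- \<bar>g z\<bar>) (min \<bar>g z\<bar> (f z)) = f z" using elim(1) by auto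
  ultimately show ?case by simp
 qed
 have Hb: "AE z in M. norm (H n z) <= \<bar>g z\<bar>" for n by (auto simp: H_def)
 have ig: "integrable M (%z. \<bar>g z\<bar>)" using g by auto
 have 1: "(%n. LINT z|M. H n z) ~~> (LINT z|M. f z)"
  by (rule integral_dominated_convergence[where w="%z. \<bar>g z\<bar>"]) (use HL Hb ig in auto)
 have iH: "integrable M (H n)" for n
  by (rule Lint_bound[OF ig]) (use Hb[of n] in auto)
 have iF: "integrable M (F n)" for n
  by (rule Lint_bound[OF gn[of n]]) (use bound[of n] in auto)
 have 2: "(%n. (LINT z|M. F n z) - (LINT z|M. H n z)) ~~> 0"
 proof (rule Lim_null_comparison[OF _ L1], intro always_eventually allI)
  fix n
  have "norm ((LINT z|M. F n z) - (LINT z|M. H n z)) = norm (LINT z|M. F n z - H n z)"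
   using iF iH by simp
  also have "... <= (LINT z|M. norm (F n z - H n z))" by (rule integral_norm_bound)
  also have "... <= (LINT z|M. \<bar>G n z - g z\<bar>)"
  proof (rule integral_mono_AE)
   show "AE z in M. norm (F n z - H n z) <= \<bar>G n z - g z\<bar>"
    using bound[of n] fg by eventually_elim (auto simp: H_def max_def min_def)
  qed (use iF iH gn g in auto)
  finally show "norm ((LINT z|M. F n z) - (LINT z|M. H n z)) <= (LINT z|M. \<bar>G n z - g z\<bar>)" .
 qed
 show "(%n. LINT z|M. F n z) ~~> (LINT z|M. f z)"
  using tendsto_add[OF 1 2] by simp
qed

subsection \<open>Weak derivatives and test functions of class one\<close>

definition C1_tests :: "'b::euclidean_space set => ('b => real) set" where
 "C1_tests S = {eta. C_k 1 eta \<and> (\<exists>K. compact K \<and> K \<subseteq> S \<and> (\<forall>z. z \<notin> K --> eta z = 0))}"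

lemma compact_support_iff:
 fixes eta :: "'b::euclidean_space => real"
 shows "compact (closure {z. eta z ~= 0}) \<and> closure {z. eta z ~= 0} \<subseteq> S \<longleftrightarrow>
  (\<exists>K. compact K \<and> K \<subseteq> S \<and> (\<forall>z. z \<notin> K --> eta z = 0))" (is "?L \<longleftrightarrow> ?R")
proof
 assume ?L
 moreover have "z \<notin> closure {z. eta z ~= 0} --> eta z = 0" for z
  using closure_subset[of "{z. eta z ~= 0}"] by blast
 ultimately show ?R by blast
next
 assume ?R
 then obtain K where K: "compact K" "K \<subseteq> S" "!!z. z \<notin> K ==> eta z = 0" by blast
 have "closure {z. eta z ~= 0} \<subseteq> K"
  using K(1,3) by (intro closure_minimal compact_imp_closed) auto
 with K show ?L using closed_closure compact_Int_closed[of K "closure {z. eta z ~= 0}"]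
  by (metis inf.absorb2 order_trans)
qed

lemma test_functions_iff:
 "eta : test_functions S \<longleftrightarrow>
  (\<forall>k. C_k k eta) \<and> (\<exists>K. compact K \<and> K \<subseteq> S \<and> (\<forall>z. z \<notin> K --> eta z = 0))"
 unfolding test_functions_def using compact_support_iff[of eta S] by auto

lemma test_functions_C1_tests: "eta : test_functions S ==> eta : C1_tests S"
 unfolding test_functions_iff C1_tests_def by blast

lemma C1_testsE:
 assumes "eta : C1_tests S"
 obtains K B where "C_k 1 eta" "compact K" "K \<subseteq> S" "!!z. z \<notin> K ==> eta z = 0"
  "!!z. z \<notin> K ==> fd eta z = (%v. 0)" "B >= 0" "!!z. \<bar>eta z\<bar> <= B"
  "!!z v. \<bar>fd eta z v\<bar> <= B * norm v" "!!z. linear (fd eta z)"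
proof -
 obtain K where K: "C_k 1 eta" "compact K" "K \<subseteq> S" "!!z. z \<notin> K ==> eta z = 0"
  using assms unfolding C1_tests_def by blast
 obtain R where "\<forall>z\<in>K. norm z <= R"
  using compact_imp_bounded[OF K(2)] unfolding bounded_iff by blast
 hence R: "norm z > R ==> eta z = 0" for z using K(4)[of z] by force
 obtain L where L: "L >= 0" "!!x y. \<bar>eta x - eta y\<bar> <= L * norm (x - y)"
  "!!x v. \<bar>fd eta x v\<bar> <= L * norm v"
  by (rule C_1_lipschitz[of eta R, OF K(1)], erule R, rule that)
 obtain B where B: "B >= 0" "!!z. \<bar>eta z\<bar> <= B"
  by (rule continuous_bounded_support_bounded[of eta R, OF C_k_imp_continuous_on[OF K(1)]], erule R, rule that)
 have "\<bar>fd eta x v\<bar> <= max B L * norm v" for x v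
  by (rule order_trans[OF L(3)]) (auto intro!: mult_right_mono)
 moreover have "\<bar>eta z\<bar> <= max B L" for z using B(2)[of z] by linarith
 moreover have "linear (fd eta z)" for z
  using K(1) by (intro linear_frechet_derivative) simp
 moreover have "fd eta z = (%v. 0)" if "z \<notin> K" for z
  using compact_imp_closed[OF K(2)] K(4) that by (rule frechet_derivative_eq_0_outside)
 moreover have "max B L >= 0" using B(1) by simp
 ultimately show ?thesis by (intro that[OF K])
qed

lemma compact_neighbourhood:
 fixes K :: "'b::euclidean_space set"
 assumes "compact K" "open S" "K \<subseteq> S"
 obtains K' e where "e > 0" "compact K'" "K' \<subseteq> S" "K \<subseteq> K'" "!!z y. z : K ==> norm (y - z) <= e ==> y : K'"
proof -
 obtain e where e: "e > 0" "(\<Union>x\<in>K. cball x e) \<subseteq> S"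
  using compact_subset_open_imp_cball_epsilon_subset[OF assms] by blast
 have "(\<Union>x\<in>K. cball x e) = {x + y | x y. x : K \<and> y : cball 0 e}"
 proof (intro equalityI subsetI)
  fix z assume "z : (\<Union>x\<in>K. cball x e)"
  then obtain x where "x : K" "dist x z <= e" by auto
  thus "z : {x + y | x y. x : K \<and> y : cball 0 e}"
   by (intro CollectI exI[of _ x] exI[of _ "z - x"]) (auto simp: dist_norm norm_minus_commute)
 qed (force simp: dist_norm)
 hence "compact (\<Union>x\<in>K. cball x e)" using compact_sums[OF assms(1) compact_cball, of 0 e] by simp
 moreover have "z : K ==> norm (y - z) <= e ==> y : (\<Union>x\<in>K. cball x e)" for z y
  by (auto simp: dist_norm norm_minus_commute)
 moreover have "K \<subseteq> (\<Union>x\<in>K. cball x e)" using e(1) by force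
 ultimately show ?thesis using that e by metis
qed

lemma locally_integrableD:
 assumes "locally_integrable S a" "compact K" "K \<subseteq> S"
 shows "L1 (%z. indicator K z *\<^sub>R a z)"
 using assms by (auto simp: locally_integrable_def set_integrable_def)

lemma locally_integrable_mult:
 fixes a :: "'b::euclidean_space => real"
 assumes "locally_integrable S a" "compact K" "K \<subseteq> S" and [measurable]: "eta : lebm"
  and "!!z. \<bar>eta z\<bar> <= B" "!!z. z \<notin> K ==> eta z = 0"
 shows "L1 (%z. a z * eta z)"
proof -
 have i: "L1 (%z. indicator K z * a z)" using locally_integrableD[OF assms(1-3)] by simp
 have "L1 (%z. (indicator K z * a z) * eta z)"
 proof (rule Lint_bound[of _ "%z. B * (indicator K z * a z)"])
  show "(%z. (indicator K z * a z) * eta z) : lebm"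
   by (intro borel_measurable_times borel_measurable_integrable[OF i]) measurable
  show "AE z in lebesgue. norm (indicator K z * a z * eta z) <= norm (B * (indicator K z * a z))"
  proof (intro always_eventually allI)
   fix z
   have "\<bar>eta z\<bar> <= \<bar>B\<bar>" using assms(5)[of z] by linarith
   thus "norm (indicator K z * a z * eta z) <= norm (B * (indicator K z * a z))"
    by (simp add: abs_mult mult.commute[of "\<bar>B\<bar>"] mult_left_mono)
  qed
 qed (use i in auto)
 moreover have "(%z. (indicator K z * a z) * eta z) = (%z. a z * eta z)"
  using assms(6) by (auto simp: fun_eq_iff indicator_def)
 ultimately show ?thesis by simp
qed

lemma set_lebesgue_integral_eq_UNIV:
 fixes F :: "'b => 'c::euclidean_space"
 assumes "!!z. z \<notin> S ==> F z = 0"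
 shows "(LINT z:S|M. F z) = (LINT z|M. F z)"
proof -
 have "(%z. indicator S z *\<^sub>R F z) = F" using assms by (auto simp: fun_eq_iff indicator_def)
 thus ?thesis by (simp add: set_lebesgue_integral_def)
qed

text \<open>The direction v is arbitrary, so one set of lemmas serves the spatial partial
  derivatives (i, 0) and the time derivative (0, 1).\<close>

definition has_weak_deriv ::
 "'b::euclidean_space set => 'b => ('b => real) => ('b => real) => bool" where
 "has_weak_deriv S v u u' \<longleftrightarrow> locally_integrable S u \<and> locally_integrable S u' \<and>
  (\<forall>eta\<in>test_functions S.
   (LI z. u z * fd eta z v) = - (LI z. u' z * eta z))"

text \<open>The reflected and shifted kernel is itself a test function supported in K, so the
  definition of the weak derivative applies to it, and multiplying by the indicator of K changes
  nothing near z.\<close>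

lemma frechet_derivative_conv_indicator:
 assumes wd: "has_weak_deriv S v u u'" and K: "compact K" "K \<subseteq> S"
  and z: "!!y. norm (y - z) <= 1 / real (Suc n) ==> y : K"
 shows "fd (conv (%y. indicator K y * u y) (moll n)) z v =
  conv (%y. indicator K y * u' y) (moll n) z"
proof -
 define eta where "eta y = moll n (z + - y)" for y
 have C: "C_k k eta" for k
  unfolding eta_def by (intro C_k_compose_affine[OF _ C_k_moll] bounded_linear_minus bounded_linear_ident)
 have eta0: "eta y = 0" if "y \<notin> K" for y
  using z[of y] that moll_eq_0[of n "z - y"]
  by (cases "norm (y - z) <= 1 / real (Suc n)") (auto simp: eta_def norm_minus_commute[of y z])
 have D: "fd eta y v = - fd (moll n) (z - y) v" for y
 proof -
  have d: "(moll n has_derivative fd (moll n) (z - y)) (at (z - y))"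
   by (rule C_k_Suc_has_derivative[OF C_k_moll])
  have "((%y. z - y) has_derivative (%v. - v)) (at y)" by (auto intro!: derivative_eq_intros)
  hence "(eta has_derivative (%v. fd (moll n) (z - y) (- v))) (at y)"
   using has_derivative_compose[of "%y. z - y" "%v. - v" y UNIV "moll n"] d by (simp add: eta_def[abs_def])
  hence "fd eta y v = fd (moll n) (z - y) (- v)"
   using frechet_derivative_at by metis
  thus ?thesis using linear_neg[OF has_derivative_linear[OF d]] by simp
 qed
 have test: "eta : test_functions S" unfolding test_functions_iff using C K eta0 by blast
 have D0: "fd eta y v = 0" if "y \<notin> K" for y
  using frechet_derivative_eq_0_outside[OF compact_imp_closed[OF K(1)] eta0 that] by simp
 have li: "L1 (%y. indicator K y * u y)"
  using wd locally_integrableD[OF _ K, of u] by (simp add: has_weak_deriv_def)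
 have "fd (conv (%y. indicator K y * u y) (moll n)) z v =
   (LI y. indicator K y * u y * fd (moll n) (z - y) v)"
  by (subst frechet_derivative_conv[OF li C_k_moll, of 1]) (simp_all add: conv_def moll_eq_0_1)
 also have "(%y. indicator K y * u y * fd (moll n) (z - y) v) =
   (%y. - (u y * fd eta y v))"
  using D D0 by (force simp: fun_eq_iff indicator_def)
 also have "(LI y. - (u y * fd eta y v)) = (LI y. u' y * eta y)"
  using wd test by (simp add: has_weak_deriv_def)
 also have "(%y. u' y * eta y) = (%y. indicator K y * u' y * moll n (z - y))"
  using eta0 by (force simp: fun_eq_iff indicator_def eta_def)
 finally show ?thesis by (simp add: conv_def[of "%y. indicator K y * u' y"])
qed

text \<open>Smooth tests approximating one of class one: supports stay in one compact K', the bounds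
  stay the same, and derivatives converge because a classical derivative is also a weak one, so that
  differentiation commutes with mollification.\<close>

lemma conv_C1_tests:
 assumes eta: "eta : C1_tests S" and S: "open S"
 obtains K' N B where "compact K'" "K' \<subseteq> S"
  "!!n. n >= N ==> conv eta (moll n) : test_functions S"
  "!!n z. n >= N ==> z \<notin> K' ==> conv eta (moll n) z = 0"
  "B >= 0" "!!n z. \<bar>conv eta (moll n) z\<bar> <= B"
  "!!n z v. \<bar>fd (conv eta (moll n)) z v\<bar> <= B * norm v"
  "!!z. (%n. conv eta (moll n) z) ~~> eta z"
  "!!z v. (%n. fd (conv eta (moll n)) z v) ~~> fd eta z v"
proof -
 obtain K B where K: "C_k 1 eta" "compact K" "K \<subseteq> S" "!!z. z \<notin> K ==> eta z = 0"
  "!!z. z \<notin> K ==> fd eta z = (%v. 0)" "B >= 0" "!!z. \<bar>eta z\<bar> <= B"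
  "!!z v. \<bar>fd eta z v\<bar> <= B * norm v" "!!z. linear (fd eta z)"
  by (rule C1_testsE[OF eta]) (rule that)
 obtain K' e where K': "e > 0" "compact K'" "K' \<subseteq> S" "K \<subseteq> K'" "!!z y. z : K ==> norm (y - z) <= e ==> y : K'"
  by (rule compact_neighbourhood[OF K(2) S K(3)]) (rule that)
 obtain R where "\<forall>z\<in>K. norm z <= R"
  using compact_imp_bounded[OF K(2)] unfolding bounded_iff by blast
 hence R: "norm z > R ==> eta z = 0" "norm z > R ==> fd eta z v = 0" for z v
  using K(4)[of z] K(5)[of z] by force+
 have cont: "conton eta" "conton (%z. fd eta z v)" for v
  using C_k_imp_continuous_on[OF K(1)] K(1) by auto
 have i: "L1 eta" "L1 (%z. fd eta z v)" for v
  using C_0_integrable_lebesgue[OF cont(1) R(1)] C_0_integrable_lebesgue[OF cont(2) R(2)] by auto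
 have wd: "has_weak_deriv UNIV v eta (%z. fd eta z v)" for v
  unfolding has_weak_deriv_def
 proof (intro conjI ballI)
  show "locally_integrable UNIV eta" "locally_integrable UNIV (%z. fd eta z v)"
   unfolding locally_integrable_def
   by (auto intro!: compact_imp_closed lebesgue_closedin[of UNIV, simplified]
    integrable_mult_indicator[OF _ i(1), folded set_integrable_def]
    integrable_mult_indicator[OF _ i(2), folded set_integrable_def])
  fix \<phi> :: "'a => real" assume "\<phi> : test_functions UNIV"
  hence "C_k 1 \<phi>" by (simp add: test_functions_iff del: C_k.simps)
  from C_1_integration_by_parts[OF K(1) this R(1)]
  show "(LI z. eta z * fd \<phi> z v) =
   - (LI z. fd eta z v * \<phi> z)" by simp
 qed
 have D: "fd (conv eta (moll n)) z v = conv (%z. fd eta z v) (moll n) z" for n z v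
 proof -
  \<comment> \<open>This ball contains both the support of eta and the unit ball around z, so its
    indicator is invisible.\<close>
  have "(%y. indicator (cball 0 (max R (norm z + 1))) y * eta y) = eta"
   "(%y. indicator (cball 0 (max R (norm z + 1))) y * fd eta y v) =
    (%y. fd eta y v)"
   using R by (auto simp: indicator_def not_le fun_eq_iff)
  moreover have "norm (y - z) <= 1 / real (Suc n) ==> y : cball 0 (max R (norm z + 1))" for y
  proof -
   assume "norm (y - z) <= 1 / real (Suc n)"
   moreover have "1 / real (Suc n) <= 1" by simp
   moreover have "norm y <= norm z + norm (y - z)" using norm_triangle_sub by blast
   ultimately have "norm y <= norm z + 1" by linarith
   thus ?thesis by simp
  qed
  ultimately show ?thesis
   using frechet_derivative_conv_indicator[OF wd compact_cball subset_UNIV, of z n 0 "max R (norm z + 1)" v]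
   by (simp only:)
 qed
 have "\<forall>\<^sub>F n in sequentially. 1 / real (Suc n) < e"
  using LIMSEQ_Suc[OF lim_1_over_n] K'(1) by (intro order_tendstoD(2)) auto
 then obtain N where N: "!!n. n >= N ==> 1 / real (Suc n) < e" by (auto simp: eventually_sequentially)
 have zero: "conv eta (moll n) z = 0" if n: "n >= N" and z: "z \<notin> K'" for n z
 proof -
  have "eta y * moll n (z - y) = 0" for y
  proof (cases "y : K")
   case True
   hence "norm (z - y) > e" using K'(5)[of y z] z by linarith
   thus ?thesis using N[OF n] by (simp add: moll_eq_0)
  qed (simp add: K(4))
  thus ?thesis unfolding conv_def by (simp only: Bochner_Integration.integral_zero)
 qed
 have smooth: "C_k k (conv eta (moll n))" for k n
  using C_k_conv[OF i(1) C_k_moll, of 1 n k] moll_eq_0_1 by blast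
 have lim: "(%n. conv h (moll n) z) ~~> h z"
  if h: "conton h" "!!z. norm z > R ==> h z = 0" for h and z :: 'a
 proof (rule LIMSEQ_I)
  fix r :: real assume "r > 0"
  hence "\<forall>\<^sub>F n in sequentially. \<forall>z. \<bar>conv h (moll n) z - h z\<bar> <= r / 2"
   using conv_moll_uniform[of h R "r / 2"] h by auto
  hence "\<forall>\<^sub>F n in sequentially. norm (conv h (moll n) z - h z) < r"
   by (rule eventually_mono) (use \<open>r > 0\<close> in \<open>auto dest: spec[of _ z]\<close>)
  thus "\<exists>no. \<forall>n\<ge>no. norm (conv h (moll n) z - h z) < r" by (simp add: eventually_sequentially)
 qed
 show ?thesis
 proof (rule that[of K' N B])
  show "conv eta (moll n) : test_functions S" if "n >= N" for n
   unfolding test_functions_iff using smooth K' zero[OF that] by blast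
  show "\<bar>conv eta (moll n) z\<bar> <= B" for n z
   using conv_moll_bound[OF i(1), of z n 0 B] K(7) by simp
  show "\<bar>fd (conv eta (moll n)) z v\<bar> <= B * norm v" for n z v
   unfolding D using conv_moll_bound[OF i(2), of z n v 0 "B * norm v"] K(8) by simp
  show "(%n. conv eta (moll n) z) ~~> eta z" for z using lim[OF cont(1) R(1)] .
  show "(%n. fd (conv eta (moll n)) z v) ~~> fd eta z v" for z v
   unfolding D using lim[OF cont(2) R(2)] .
 qed (use K' zero K(6) in auto)
qed

lemma conv_nonneg:
 assumes "!!z. u z >= 0" shows "conv u (moll n) z >= 0"
 unfolding conv_def using assms by (intro integral_nonneg_AE) (simp add: moll_nonneg)

section \<open>Functions of class one on an open set and their products with tests\<close>

definition C1_on :: "'b::euclidean_space set => ('b => real) => bool" where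
 "C1_on S g \<longleftrightarrow> (\<forall>z\<in>S. g differentiable (at z)) \<and>
  (\<forall>v. continuous_on S (%z. fd g z v))"

lemma C1_on_I:
 assumes "!!z. z : S ==> (g has_derivative g' z) (at z)" and "!!v. continuous_on S (%z. g' z v)"
 shows "C1_on S g" and "z : S ==> fd g z = g' z"
proof -
 have eq: "fd g z = g' z" if "z : S" for z
  using frechet_derivative_at[OF assms(1)[OF that]] by simp
 thus "z : S ==> fd g z = g' z" .
 have "continuous_on S (%z. fd g z v)" for v
  using assms(2)[of v] by (rule continuous_on_eq) (simp add: eq)
 thus "C1_on S g" using assms(1) unfolding C1_on_def differentiable_def by blast
qed

lemma C1_on_has_derivative:
 "C1_on S g ==> z : S ==> (g has_derivative fd g z) (at z)"
 by (simp add: C1_on_def frechet_derivative_works)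

lemma C1_on_continuous: "C1_on S g ==> continuous_on S g"
 using C1_on_has_derivative has_derivative_continuous continuous_at_imp_continuous_on by metis

lemma C1_on_UNIV: "C1_on UNIV g \<longleftrightarrow> C_k 1 g"
 by (simp add: C1_on_def)

lemma C1_on_subset: "C1_on S g ==> T \<subseteq> S ==> C1_on T g"
 unfolding C1_on_def using continuous_on_subset by blast

lemma C1_on_diff:
 assumes f: "C1_on S f" and g: "C1_on S g"
 shows "C1_on S (%z. f z - g z)"
  and "z : S ==> fd (%z. f z - g z) z v =
   fd f z v - fd g z v"
proof -
 have d: "((%z. f z - g z) has_derivative
   (%v. fd f z v - fd g z v)) (at z)" if "z : S" for z
  using that C1_on_has_derivative[OF f] C1_on_has_derivative[OF g] by (intro has_derivative_diff)
 have c: "continuous_on S (%z. fd f z v - fd g z v)" for v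
  using f g by (intro continuous_on_diff) (auto simp: C1_on_def)
 show "C1_on S (%z. f z - g z)" by (rule C1_on_I(1)[OF d c])
 show "fd (%z. f z - g z) z v =
   fd f z v - fd g z v" if "z : S"
  by (simp add: C1_on_I(2)[OF d c that])
qed

lemma C1_on_mult:
 assumes f: "C1_on S f" and g: "C1_on S g"
 shows "C1_on S (%z. f z * g z)"
  and "z : S ==> fd (%z. f z * g z) z v =
   f z * fd g z v + fd f z v * g z"
proof -
 have d: "((%z. f z * g z) has_derivative
   (%v. f z * fd g z v + fd f z v * g z)) (at z)"
  if "z : S" for z
  using that C1_on_has_derivative[OF f] C1_on_has_derivative[OF g] by (intro has_derivative_mult)
 have c: "continuous_on S (%z. f z * fd g z v + fd f z v * g z)" for v
  using f g C1_on_continuous[OF f] C1_on_continuous[OF g]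
  by (intro continuous_on_add continuous_on_mult) (auto simp: C1_on_def)
 show "C1_on S (%z. f z * g z)" by (rule C1_on_I(1)[OF d c])
 show "fd (%z. f z * g z) z v =
   f z * fd g z v + fd f z v * g z" if "z : S"
  by (simp add: C1_on_I(2)[OF d c that])
qed

lemma C1_on_compose:
 assumes g: "C1_on S g" and h: "!!z. z : S ==> (h has_real_derivative h' (g z)) (at (g z))"
  and c: "continuous_on S (%z. h' (g z))"
 shows "C1_on S (%z. h (g z))"
  and "z : S ==> fd (%z. h (g z)) z v = h' (g z) * fd g z v"
proof -
 have d: "((%z. h (g z)) has_derivative (%v. h' (g z) * fd g z v)) (at z)"
  if "z : S" for z
  using has_derivative_compose[OF C1_on_has_derivative[OF g that] h[OF that, unfolded has_field_derivative_def]] .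
 have c': "continuous_on S (%z. h' (g z) * fd g z v)" for v
  using g by (intro continuous_on_mult c) (auto simp: C1_on_def)
 show "C1_on S (%z. h (g z))" by (rule C1_on_I(1)[OF d c'])
 show "fd (%z. h (g z)) z v = h' (g z) * fd g z v" if "z : S"
  by (simp add: C1_on_I(2)[OF d c' that])
qed

text \<open>g is regular on S only, but the product vanishes off a compact K inside S; gluing over
  the open sets S and -K gives class one on the whole space.\<close>

lemma C1_on_mult_test:
 assumes S: "open S" and g: "C1_on S g" and \<xi>: "\<xi> : C1_tests S"
 shows "(%z. g z * \<xi> z) : C1_tests S"
  and "fd (%z. g z * \<xi> z) z v =
   g z * fd \<xi> z v + fd g z v * \<xi> z"
proof -
 obtain K B where K: "C_k 1 \<xi>" "compact K" "K \<subseteq> S" "!!z. z \<notin> K ==> \<xi> z = 0"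
  "!!z. z \<notin> K ==> fd \<xi> z = (%v. 0)" "B >= 0" "!!z. \<bar>\<xi> z\<bar> <= B"
  "!!z v. \<bar>fd \<xi> z v\<bar> <= B * norm v" "!!z. linear (fd \<xi> z)"
  by (rule C1_testsE[OF \<xi>]) (rule that)
 have xS: "C1_on S \<xi>" using K(1) C1_on_UNIV C1_on_subset by blast
 define D where "D z v = g z * fd \<xi> z v + fd g z v * \<xi> z" for z v
 have D0: "z \<notin> K ==> D z = (%v. 0)" for z by (simp add: D_def K(4,5) fun_eq_iff)
 have d: "((%z. g z * \<xi> z) has_derivative D z) (at z)" for z
 proof (cases "z : S")
  case True
  show ?thesis unfolding D_def
   using C1_on_has_derivative[OF g True] C1_on_has_derivative[OF xS True] by (intro has_derivative_mult)
 next
  case False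
  hence z: "z \<notin> K" using K(3) by blast
  have "((%z. g z * \<xi> z) has_derivative (%v. 0)) (at z)"
   by (rule has_derivative_transform_within_open[OF has_derivative_const, of "- K" z])
    (use K(2,4) z in "auto simp: compact_imp_closed")
  thus ?thesis using D0[OF z] by simp
 qed
 have c: "conton (%z. D z v)" for v
 proof -
  have "continuous_on S (%z. D z v)"
   unfolding D_def using g xS C1_on_continuous[OF g] C1_on_continuous[OF xS]
   by (intro continuous_on_add continuous_on_mult) (auto simp: C1_on_def)
  moreover have "continuous_on (- K) (%z. D z v)"
   by (rule continuous_on_eq[OF continuous_on_const[of _ 0]]) (simp add: D0)
  ultimately have "continuous_on (S \<union> - K) (%z. D z v)"
   using S K(2) by (intro continuous_on_open_Un) (auto simp: compact_imp_closed)
  moreover have "S \<union> - K = UNIV" using K(3) by auto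
  ultimately show ?thesis by simp
 qed
 have "C_k 1 (%z. g z * \<xi> z)" using C1_on_I(1)[of UNIV, OF d c] C1_on_UNIV by auto
 thus "(%z. g z * \<xi> z) : C1_tests S"
  unfolding C1_tests_def using K(2-4) by (intro CollectI conjI exI[of _ K]) auto
 show "fd (%z. g z * \<xi> z) z v =
   g z * fd \<xi> z v + fd g z v * \<xi> z"
  using C1_on_I(2)[of UNIV, OF d c] by (simp add: D_def)
qed

text \<open>The dominating function w depends on the test only through K and C, so it serves a whole
  sequence of tests.\<close>

lemma weak_integrand:
 fixes a :: "'b::euclidean_space => real" and B :: "'b => 'b"
 assumes a: "locally_integrable S a" and B: "locally_integrable S B" and K: "compact K" "K \<subseteq> S"
  and eta: "C_k 1 eta" "!!z. z \<notin> K ==> eta z = 0" "!!z. \<bar>eta z\<bar> <= C"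
   "!!z v. \<bar>fd eta z v\<bar> <= C * norm v"
 defines "F \<equiv> %z. a z * eta z + fd eta z (B z)"
  and "w \<equiv> %z. C * (\<bar>indicator K z *\<^sub>R a z\<bar> + norm (indicator K z *\<^sub>R B z))"
 shows "F : lebm" and "L1 w" and "!!z. \<bar>F z\<bar> <= w z"
  and "L1 F"
proof -
 have ia: "L1 (%z. indicator K z *\<^sub>R a z)"
  and iB: "L1 (%z. indicator K z *\<^sub>R B z)"
  using locally_integrableD[OF a K] locally_integrableD[OF B K] by auto
 note [measurable] = borel_measurable_integrable[OF ia] borel_measurable_integrable[OF iB]
 have D0: "z \<notin> K ==> fd eta z v = 0" for z v
  using frechet_derivative_eq_0_outside[OF compact_imp_closed[OF K(1)] eta(2)] by simp
 have lin: "linear (fd eta z)" for z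
  using eta(1) by (intro linear_frechet_derivative) simp
 have F_eq: "F z = (indicator K z *\<^sub>R a z) * eta z +
   (\<Sum>i\<in>Basis. ((indicator K z *\<^sub>R B z) \<bullet> i) * fd eta z i)" for z
 proof (cases "z : K")
  case True
  have "fd eta z (B z) = fd eta z (\<Sum>i\<in>Basis. (B z \<bullet> i) *\<^sub>R i)"
   by (simp add: euclidean_representation)
  also have "... = (\<Sum>i\<in>Basis. (B z \<bullet> i) * fd eta z i)"
   by (simp add: linear_sum[OF lin] linear_scale[OF lin])
  finally show ?thesis using True by (simp add: F_def)
 qed (simp add: F_def eta(2) D0)
 have c: "conton eta" "conton (%z. fd eta z v)" for v
  using C_k_imp_continuous_on[OF eta(1)] eta(1) by auto
 have [measurable]: "eta : lebm"
  "(%z. fd eta z v) : lebm" for v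
  by (auto intro!: borel_measurable_lebesgue borel_measurable_continuous_onI c)
 show F: "F : lebm" unfolding F_eq[abs_def] by measurable
 show w: "L1 w" unfolding w_def
  by (intro integrable_mult_right Lint_add
    integrable_abs[OF ia] integrable_norm[OF iB])
 show b: "\<bar>F z\<bar> <= w z" for z
 proof (cases "z : K")
  case True
  have "\<bar>F z\<bar> <= \<bar>a z\<bar> * \<bar>eta z\<bar> + \<bar>fd eta z (B z)\<bar>"
   unfolding F_def abs_mult[symmetric] by (rule abs_triangle_ineq)
  also have "... <= \<bar>a z\<bar> * C + C * norm (B z)"
   by (intro add_mono mult_left_mono eta) auto
  finally show ?thesis using True by (simp add: w_def algebra_simps)
 qed (simp add: F_def w_def eta(2) D0)
 show "L1 F"
  by (rule Lint_bound[OF w F]) (use b in "auto intro: order_trans[OF _ abs_ge_self]")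
qed

text \<open>Mollified tests are admissible and nonnegative, with common support and common bounds,
  so dominated convergence carries the inequality over.\<close>

lemma weak_inequality_C1_tests:
 fixes a :: "'b::euclidean_space => real" and B :: "'b => 'b"
 assumes S: "open S" and a: "locally_integrable S a" and B: "locally_integrable S B"
  and ineq: "!!eta. eta : test_functions S ==> (!!z. 0 <= eta z) ==>
    0 <= (LI z. a z * eta z + fd eta z (B z))"
  and eta: "eta : C1_tests S" "!!z. 0 <= eta z"
 shows "0 <= (LI z. a z * eta z + fd eta z (B z))"
proof -
 obtain K N C where K: "compact K" "K \<subseteq> S"
  "!!n. n >= N ==> conv eta (moll n) : test_functions S"
  "!!n z. n >= N ==> z \<notin> K ==> conv eta (moll n) z = 0"
  "C >= 0" "!!n z. \<bar>conv eta (moll n) z\<bar> <= C"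
  "!!n z v. \<bar>fd (conv eta (moll n)) z v\<bar> <= C * norm v"
  "!!z. (%n. conv eta (moll n) z) ~~> eta z"
  "!!z v. (%n. fd (conv eta (moll n)) z v) ~~> fd eta z v"
  by (rule conv_C1_tests[OF eta(1) S]) (rule that)
 define F where "F n z = a z * conv eta (moll (n + N)) z + fd (conv eta (moll (n + N))) z (B z)" for n z
 have C1: "C_k 1 (conv eta (moll (n + N)))" for n
  using K(3)[of "n + N"] by (simp add: test_functions_iff del: C_k.simps)
 note wi = weak_integrand[OF a B K(1,2) C1 K(4) K(6) K(7), folded F_def, simplified]
 have lim: "(%n. F n z) ~~> a z * eta z + fd eta z (B z)" for z
  unfolding F_def by (intro tendsto_intros LIMSEQ_ignore_initial_segment[of _ _ N] K)
 have Fm: "F n : lebm" for n using wi(1) unfolding F_def[abs_def] by simp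
 have m: "(%z. a z * eta z + fd eta z (B z)) : lebm"
  by (rule borel_measurable_LIMSEQ_real[OF _ Fm]) (rule lim)
 have "(%n. LI z. F n z) ~~> (LI z. a z * eta z + fd eta z (B z))"
  by (rule integral_dominated_convergence[OF m Fm, where w = "%z. C * (\<bar>indicator K z *\<^sub>R a z\<bar> + norm (indicator K z *\<^sub>R B z))"])
   (use wi(2,3) lim in auto)
 moreover have "0 <= (LI z. F n z)" for n
  unfolding F_def using K(3)[of "n + N"] conv_nonneg[OF eta(2)] by (intro ineq) auto
 ultimately show ?thesis by (intro LIMSEQ_le_const) auto
qed

text \<open>A bound that is linear in mollified functions depends on n, but it converges in L^1 and,
  along r, almost everywhere. This is the form in which the limits for the chain rule and for
  nonlinear tests are taken.\<close>

lemma dominated_convergence_moll: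
 fixes u :: "'j => 'b::euclidean_space => real"
 assumes J: "finite J" "!!j. j : J ==> L1 (u j)" and r: "strict_mono r"
  and conv: "AE z in lebesgue. \<forall>j\<in>J. (%n. conv (u j) (moll (r n)) z) ~~> u j z"
  and c0: "L1 c0" and C: "C >= 0"
  and m: "!!n. F n : lebm" and lim: "AE z in lebesgue. (%n. F n z) ~~> f z"
  and bound: "!!n. AE z in lebesgue. \<bar>F n z\<bar> <= c0 z + C * (\<Sum>j\<in>J. \<bar>conv (u j) (moll (r n)) z\<bar>)"
 shows "L1 f" and "(%n. LI z. F n z) ~~> (LI z. f z)"
proof -
 define G where "G n z = c0 z + C * (\<Sum>j\<in>J. \<bar>conv (u j) (moll (r n)) z\<bar>)" for n z
 define g where "g z = c0 z + C * (\<Sum>j\<in>J. \<bar>u j z\<bar>)" for z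
 have fm: "f : lebm" by (rule borel_measurable_AE_limit[OF m lim])
 have iu: "j : J ==> L1 (conv (u j) (moll n))" for j n using conv_moll_L1(1)[OF J(2)] .
 have iG: "L1 (G n)" for n
  unfolding G_def using iu by (intro Lint_add c0 integrable_mult_right
    Bochner_Integration.integrable_sum integrable_abs) auto
 have ig: "L1 g"
  unfolding g_def using J by (intro Lint_add c0 integrable_mult_right
    Bochner_Integration.integrable_sum integrable_abs) auto
 have id: "j : J ==> L1 (%z. \<bar>conv (u j) (moll n) z - u j z\<bar>)" for j n
  using iu[of j n] J(2)[of j] by auto
 have L1: "(%n. LI z. \<bar>G n z - g z\<bar>) ~~> 0"
 proof (rule Lim_null_comparison)
  have "(%n. C * (\<Sum>j\<in>J. LI z. \<bar>conv (u j) (moll (r n)) z - u j z\<bar>)) ~~> C * (\<Sum>j\<in>J. 0)"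
   using LIMSEQ_subseq_LIMSEQ[OF mollification_L1[OF J(2)] r]
   by (intro tendsto_mult tendsto_const tendsto_sum) (simp add: o_def)
  thus "(%n. C * (\<Sum>j\<in>J. LI z. \<bar>conv (u j) (moll (r n)) z - u j z\<bar>)) ~~> 0" by simp
  show "\<forall>\<^sub>F n in sequentially. norm (LI z. \<bar>G n z - g z\<bar>) \<le>
    C * (\<Sum>j\<in>J. LI z. \<bar>conv (u j) (moll (r n)) z - u j z\<bar>)"
  proof (intro always_eventually allI)
   fix n
   have "(LI z. \<bar>G n z - g z\<bar>) \<le>
     (LI z. C * (\<Sum>j\<in>J. \<bar>conv (u j) (moll (r n)) z - u j z\<bar>))"
   proof (rule integral_mono)
    show "L1 (%z. \<bar>G n z - g z\<bar>)" using iG ig by auto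
    show "L1 (%z. C * (\<Sum>j\<in>J. \<bar>conv (u j) (moll (r n)) z - u j z\<bar>))"
     using id by (intro integrable_mult_right Bochner_Integration.integrable_sum) auto
    fix z
    have "\<bar>G n z - g z\<bar> = C * \<bar>\<Sum>j\<in>J. \<bar>conv (u j) (moll (r n)) z\<bar> - \<bar>u j z\<bar>\<bar>"
     using C by (simp add: G_def g_def sum_subtractf right_diff_distrib[symmetric] abs_mult)
    also have "... <= C * (\<Sum>j\<in>J. \<bar>\<bar>conv (u j) (moll (r n)) z\<bar> - \<bar>u j z\<bar>\<bar>)"
     using C by (intro mult_left_mono sum_abs) auto
    also have "... <= C * (\<Sum>j\<in>J. \<bar>conv (u j) (moll (r n)) z - u j z\<bar>)"
     using C by (intro mult_left_mono sum_mono) auto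
    finally show "\<bar>G n z - g z\<bar> <= C * (\<Sum>j\<in>J. \<bar>conv (u j) (moll (r n)) z - u j z\<bar>)" .
   qed
   also have "... = C * (\<Sum>j\<in>J. LI z. \<bar>conv (u j) (moll (r n)) z - u j z\<bar>)"
    using id by (simp add: Bochner_Integration.integral_sum)
   finally show "norm (LI z. \<bar>G n z - g z\<bar>) \<le>
    C * (\<Sum>j\<in>J. LI z. \<bar>conv (u j) (moll (r n)) z - u j z\<bar>)" by simp
  qed
 qed
 have Gg: "AE z in lebesgue. (%n. G n z) ~~> g z"
  using conv unfolding G_def g_def by eventually_elim (intro tendsto_intros; simp)
 note dct = integral_dominated_convergence_L1[OF fm m ig iG L1 Gg lim bound[folded G_def]]
 show "L1 f" "(%n. LI z. F n z) ~~> (LI z. f z)"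
  by (fact dct)+
qed

lemma eventually_moll_radius_less: "e > 0 ==> \<forall>\<^sub>F n in sequentially. 1 / real (Suc n) < e"
 using LIMSEQ_Suc[OF lim_1_over_n] by (intro order_tendstoD(2)) auto

lemma subseq_moll_radius:
 fixes r :: "nat => nat"
 assumes e: "e > 0" and r: "strict_mono r"
 obtains N where "!!n. n >= N ==> 1 / real (Suc (r n)) < e"
proof -
 obtain N where N: "!!n. n >= N ==> 1 / real (Suc n) < e"
  using eventually_moll_radius_less[OF e] by (auto simp: eventually_sequentially)
 thus ?thesis using that[of N] seq_suble[OF r] order_trans by blast
qed

text \<open>\<alpha> is merely Borel and locally bounded, but constant along v, so it acts as a
  constant in the difference quotients. With v the time direction it can be the weight, or the
  weight times the indicator of a spatial set.\<close>

lemma integral_C1_tests_directional: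
 fixes \<alpha> \<psi> :: "'b::euclidean_space => real"
 assumes \<psi>: "\<psi> : C1_tests UNIV" and \<alpha>: "\<alpha> : borm" "!!z s. \<alpha> (z + s *\<^sub>R v) = \<alpha> z"
  and bd: "!!K. compact K ==> \<exists>C. \<forall>z\<in>K. \<bar>\<alpha> z\<bar> <= C"
 shows "L1 (%z. \<alpha> z * fd \<psi> z v)"
  and "(LI z. \<alpha> z * fd \<psi> z v) = 0"
proof -
 obtain K B where K: "C_k 1 \<psi>" "compact K" "K \<subseteq> UNIV" "!!z. z \<notin> K ==> \<psi> z = 0"
  "!!z. z \<notin> K ==> fd \<psi> z = (%v. 0)" "B >= 0" "!!z. \<bar>\<psi> z\<bar> <= B"
  "!!z v. \<bar>fd \<psi> z v\<bar> <= B * norm v" "!!z. linear (fd \<psi> z)"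
  by (rule C1_testsE[OF \<psi>]) (rule that)
 obtain R where "\<forall>z\<in>K. norm z <= R"
  using compact_imp_bounded[OF K(2)] unfolding bounded_iff by blast
 hence R: "norm z > R ==> \<psi> z = 0" for z using K(4)[of z] by force
 obtain L where L: "L >= 0" "!!x y. \<bar>\<psi> x - \<psi> y\<bar> <= L * norm (x - y)"
  "!!x v. \<bar>fd \<psi> x v\<bar> <= L * norm v"
  by (rule C_1_lipschitz[of \<psi> R, OF K(1)], erule R, rule that)
 obtain C where "\<forall>z\<in>cball 0 (R + norm v). \<bar>\<alpha> z\<bar> <= C" using bd[of "cball 0 (R + norm v)"] by auto
 hence C: "norm z <= R + norm v ==> \<bar>\<alpha> z\<bar> <= \<bar>C\<bar>" for z by force
 have c: "conton \<psi>" using C_k_imp_continuous_on[OF K(1)] .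
 have [measurable]: "\<psi> : borm" "\<alpha> : borm"
  using c \<alpha>(1) by (auto intro: borel_measurable_continuous_onI)
 let ?h = "%z. \<alpha> z * \<psi> z"
 have m: "?h : borm" by measurable
 have i: "integrable lborel ?h"
 proof (rule Lint_bound[of _ "%z. \<bar>C\<bar> * \<psi> z"])
  show "integrable lborel (%z. \<bar>C\<bar> * \<psi> z)"
   using integrable_continuous_bounded_support[OF c R] by auto
  show "AE z in lborel. norm (?h z) <= norm (\<bar>C\<bar> * \<psi> z)"
  proof (intro always_eventually allI)
   fix z
   show "norm (?h z) <= norm (\<bar>C\<bar> * \<psi> z)"
   proof (cases "norm z > R")
    case False
    hence "norm z <= R + norm v" by (simp add: not_less add_increasing2)
    from mult_right_mono[OF C[OF this], of "\<bar>\<psi> z\<bar>"] show ?thesis by (simp add: abs_mult)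
   qed (simp add: R)
  qed
 qed measurable
 have lip: "\<bar>?h (z + s *\<^sub>R v) - ?h z\<bar> <= (\<bar>C\<bar> * L * norm v) * \<bar>s\<bar>" if s: "\<bar>s\<bar> <= 1" for z s
 proof (cases "norm z <= R + norm v")
  case True
  have "\<bar>?h (z + s *\<^sub>R v) - ?h z\<bar> = \<bar>\<alpha> z\<bar> * \<bar>\<psi> (z + s *\<^sub>R v) - \<psi> z\<bar>"
   by (simp add: \<alpha>(2) abs_mult[symmetric] right_diff_distrib)
  also have "... <= \<bar>C\<bar> * (L * norm (s *\<^sub>R v))"
   using L(2)[of "z + s *\<^sub>R v" z] C[OF True] by (intro mult_mono) auto
  finally show ?thesis by (simp add: mult_ac)
 next
  case False
  have "norm (s *\<^sub>R v) <= norm v" using s by (simp add: mult_left_le_one_le)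
  moreover have "norm z <= norm (z + s *\<^sub>R v) + norm (s *\<^sub>R v)"
   using norm_triangle_ineq4[of "z + s *\<^sub>R v" "s *\<^sub>R v"] by simp
  ultimately have "norm (z + s *\<^sub>R v) > R" "norm z > R" using False norm_ge_zero[of v] by linarith+
  thus ?thesis using R L(1) by simp
 qed
 have supp: "norm z > R ==> ?h z = 0" for z using R by simp
 have der: "AE z in lebesgue. ((%s. ?h (z + s *\<^sub>R v)) has_real_derivative
   \<alpha> z * fd \<psi> z v) (at 0)"
  unfolding \<alpha>(2)
  using C_k_Suc_has_derivative[of 0 \<psi>] K(1)
  by (intro always_eventually allI DERIV_cmult has_derivative_imp_directional) simp
 note z = integral_directional_derivative_zero[OF m i supp lip der]
 show "L1 (%z. \<alpha> z * fd \<psi> z v)" by (rule z(1))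
 show "(LI z. \<alpha> z * fd \<psi> z v) = 0" by (rule z(2))
qed

text \<open>Mollify u near the support of eta, where the classical chain rule applies, and pass to
  the limit. Boundedness of k makes \<Phi> grow at most linearly, so mollifications of u and u'
  control everything. The factor \<alpha> carries weight and spatial indicator through the
  integration by parts.\<close>

lemma weak_chain_rule:
 fixes u u' \<alpha> eta :: "'b::euclidean_space => real"
 assumes S: "open S" and wd: "has_weak_deriv S v u u'" and eta: "eta : C1_tests S"
  and \<alpha>: "\<alpha> : borm" "!!z s. \<alpha> (z + s *\<^sub>R v) = \<alpha> z"
  and bd: "!!K. compact K ==> \<exists>C. \<forall>z\<in>K. \<bar>\<alpha> z\<bar> <= C"
  and k: "conton k" "!!s. \<bar>k s\<bar> <= M" "!!s. (\<Phi> has_real_derivative k s) (at s)"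
 shows "L1 (%z. \<alpha> z * eta z * k (u z) * u' z)"
  and "L1 (%z. \<alpha> z * fd eta z v * \<Phi> (u z))"
  and "(LI z. \<alpha> z * eta z * k (u z) * u' z) =
   - (LI z. \<alpha> z * fd eta z v * \<Phi> (u z))"
proof -
 obtain K B where K: "C_k 1 eta" "compact K" "K \<subseteq> S" "!!z. z \<notin> K ==> eta z = 0"
  "!!z. z \<notin> K ==> fd eta z = (%v. 0)" "B >= 0" "!!z. \<bar>eta z\<bar> <= B"
  "!!z v. \<bar>fd eta z v\<bar> <= B * norm v" "!!z. linear (fd eta z)"
  by (rule C1_testsE[OF eta]) (rule that)
 obtain K' e where K': "e > 0" "compact K'" "K' \<subseteq> S" "K \<subseteq> K'" "!!z y. z : K ==> norm (y - z) <= e ==> y : K'"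
  by (rule compact_neighbourhood[OF K(2) S K(3)]) (rule that)
 \<comment> \<open>Both functions are indexed by a boolean so that one subsequence works for
   both.\<close>
 define u1 where "u1 j z = indicator K' z * (if j then u z else u' z)" for j z
 have i1: "L1 (u1 j)" for j
  using locally_integrableD[OF _ K'(2,3), of u] locally_integrableD[OF _ K'(2,3), of u'] wd
  by (cases j) (auto simp: u1_def[abs_def] has_weak_deriv_def)
 obtain r where r: "strict_mono r"
  and AEc: "AE z in lebesgue. \<forall>j\<in>UNIV. (%n. conv (u1 j) (moll (r n)) z) ~~> u1 j z"
  using moll_AE_subseq[of UNIV u1] i1 by auto
 obtain N where N: "!!n. n >= N ==> 1 / real (Suc (r n)) < e"
  using subseq_moll_radius[OF K'(1) r] by blast
 define s where "s n = r (n + N)" for n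
 have s: "strict_mono s" using r by (auto simp: strict_mono_def s_def)
 have AEs: "AE z in lebesgue. \<forall>j\<in>UNIV. (%n. conv (u1 j) (moll (s n)) z) ~~> u1 j z"
  using AEc unfolding s_def by eventually_elim (auto intro: LIMSEQ_ignore_initial_segment)
 define un where "un n = conv (u1 True) (moll (s n))" for n
 have Cun: "C_k k (un n)" for k n
  unfolding un_def using C_k_conv[OF i1 C_k_moll, of 1] moll_eq_0_1 by blast
 have Dun: "fd (un n) z v = conv (u1 False) (moll (s n)) z" if "z : K" for n z
  using frechet_derivative_conv_indicator[OF wd K'(2,3), of z "s n"] K'(5)[OF that] N[of "n + N"]
  by (force simp: un_def u1_def[abs_def] s_def)
 obtain C where "\<forall>z\<in>K. \<bar>\<alpha> z\<bar> <= C" using bd[OF K(2)] by blast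
 hence C: "z : K ==> \<bar>\<alpha> z\<bar> <= \<bar>C\<bar>" for z by force
 have cont: "conton eta" "conton (%z. fd eta z v)"
  using C_k_imp_continuous_on[OF K(1)] K(1) by auto
 have \<Phi>c: "conton \<Phi>"
  using k(3) DERIV_isCont continuous_at_imp_continuous_on by blast
 have \<Phi>b: "\<bar>\<Phi> t\<bar> <= \<bar>\<Phi> 0\<bar> + M * \<bar>t\<bar>" for t
 proof -
  have "norm (\<Phi> t - \<Phi> 0) <= M * norm (t - 0)"
   by (rule differentiable_bound[of UNIV \<Phi> "%s h. k s * h"])
    (use k in "auto simp: has_field_derivative_def abs_mult intro!: onorm_le mult_right_mono")
  thus ?thesis by simp
 qed
 have M0: "M >= 0" using k(2)[of 0] by linarith
 note [measurable] = borel_measurable_lebesgue[OF \<alpha>(1)]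
  borel_measurable_lebesgue[OF borel_measurable_continuous_onI[OF cont(1)]]
  borel_measurable_lebesgue[OF borel_measurable_continuous_onI[OF cont(2)]]
  borel_measurable_continuous_onI[OF k(1)] borel_measurable_continuous_onI[OF \<Phi>c]
  borel_measurable_integrable[OF i1]
 have mun[measurable]: "un n : lebm" for n
  using C_k_imp_continuous_on[OF Cun[of 0 n]]
  by (intro borel_measurable_lebesgue borel_measurable_continuous_onI)
 have mu'n[measurable]: "conv (u1 False) (moll n) : lebm" for n
  using conv_moll_L1(1)[OF i1] by auto
 \<comment> \<open>By the classical chain rule this is \<alpha> times the derivative of \<Phi>(un n)
   eta along v, hence has integral zero.\<close>
 define F where "F n z = \<alpha> z * eta z * k (un n z) * conv (u1 False) (moll (s n)) z +
   \<alpha> z * fd eta z v * \<Phi> (un n z)" for n z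
 have F0: "(LI z. F n z) = 0" for n
 proof -
  have C1\<Phi>: "C1_on UNIV (%z. \<Phi> (un n z))"
   and D\<Phi>: "fd (%z. \<Phi> (un n z)) z v = k (un n z) * fd (un n) z v" for z
   using C1_on_compose[of UNIV "un n" \<Phi> k, OF _ k(3)] Cun[of 1 n] C1_on_UNIV
    continuous_on_compose2[OF k(1) C_k_imp_continuous_on[OF Cun[of 0 n]]] by auto
  have etaU: "eta : C1_tests UNIV" using eta by (auto simp: C1_tests_def simp del: C_k.simps)
  let ?\<psi> = "%z. \<Phi> (un n z) * eta z"
  have \<psi>: "?\<psi> : C1_tests UNIV"
   and D\<psi>: "fd ?\<psi> z v = \<Phi> (un n z) * fd eta z v +
    k (un n z) * fd (un n) z v * eta z" for z
   using C1_on_mult_test[OF open_UNIV C1\<Phi> etaU] D\<Phi> by auto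
  have "F n z = \<alpha> z * fd ?\<psi> z v" for z
   unfolding F_def D\<psi> using Dun[of z n] K(4,5)[of z]
   by (cases "z : K") (auto simp: algebra_simps)
  thus ?thesis using integral_C1_tests_directional(2)[OF \<psi> \<alpha> bd] by simp
 qed
 define f where "f z = \<alpha> z * eta z * k (u1 True z) * u1 False z +
   \<alpha> z * fd eta z v * \<Phi> (u1 True z)" for z
 have lim: "AE z in lebesgue. (%n. F n z) ~~> f z"
  using AEs
 proof eventually_elim
  case (elim z)
  have "(%n. un n z) ~~> u1 True z" using elim unfolding un_def by blast
  hence "(%n. k (un n z)) ~~> k (u1 True z)" "(%n. \<Phi> (un n z)) ~~> \<Phi> (u1 True z)"
   by (auto intro: continuous_on_tendsto_compose[OF k(1)] continuous_on_tendsto_compose[OF \<Phi>c])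
  thus ?case unfolding F_def f_def using elim by (intro tendsto_intros) auto
 qed
 define C' where "C' = \<bar>C\<bar> * B * M + \<bar>C\<bar> * (B * norm v) * M"
 have C'0: "C' >= 0" unfolding C'_def using K(6) M0 by (intro add_nonneg_nonneg mult_nonneg_nonneg) auto
 have bound: "\<bar>F n z\<bar> <= \<bar>C\<bar> * (B * norm v) * \<bar>\<Phi> 0\<bar> * indicator K z + C' * (\<Sum>j\<in>UNIV. \<bar>conv (u1 j) (moll (s n)) z\<bar>)" for n z
 proof (cases "z : K")
  case True
  let ?a = "\<bar>conv (u1 True) (moll (s n)) z\<bar>" and ?b = "\<bar>conv (u1 False) (moll (s n)) z\<bar>"
  have "\<bar>F n z\<bar> <= \<bar>\<alpha> z\<bar> * \<bar>eta z\<bar> * \<bar>k (un n z)\<bar> * ?b + \<bar>\<alpha> z\<bar> * \<bar>fd eta z v\<bar> * \<bar>\<Phi> (un n z)\<bar>"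
   unfolding F_def abs_mult[symmetric] by (rule abs_triangle_ineq)
  also have "... <= \<bar>C\<bar> * B * M * ?b + \<bar>C\<bar> * (B * norm v) * (\<bar>\<Phi> 0\<bar> + M * ?a)"
   using C[OF True] K(6,7,8) k(2) \<Phi>b[of "un n z"] M0
   by (intro add_mono mult_mono) (auto simp: un_def intro!: mult_nonneg_nonneg)
  also have "... <= \<bar>C\<bar> * (B * norm v) * \<bar>\<Phi> 0\<bar> + C' * (?a + ?b)"
  proof -
   have "0 <= \<bar>C\<bar> * B * M * ?a" "0 <= \<bar>C\<bar> * (B * norm v) * M * ?b"
    using K(6) M0 by (auto intro!: mult_nonneg_nonneg)
   thus ?thesis by (simp add: C'_def algebra_simps)
  qed
  finally show ?thesis using True by (simp add: UNIV_bool add.commute)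
 next
  case False
  thus ?thesis using K(4,5)[of z] C'0 by (auto simp: F_def intro!: mult_nonneg_nonneg sum_nonneg)
 qed
 have iK: "L1 (%z. \<bar>C\<bar> * (B * norm v) * \<bar>\<Phi> 0\<bar> * indicator K z)"
  by (intro integrable_mult_right integrable_real_indicator)
   (use K(2) emeasure_compact_finite[OF K(2)] in "auto simp: compact_imp_closed")
 have Fm: "F n : lebm" for n unfolding F_def[abs_def] by measurable
 have "(%n. LI z. F n z) ~~> (LI z. f z)"
  by (rule dominated_convergence_moll(2)[OF _ i1 s AEs iK C'0 Fm lim]) (use bound in auto)
 hence f0: "(LI z. f z) = 0" using F0 by (simp add: LIMSEQ_const_iff)
 have eq1: "(%z. \<alpha> z * eta z * k (u1 True z) * u1 False z) = (%z. \<alpha> z * eta z * k (u z) * u' z)"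
  using K(4) K'(4) by (auto simp: fun_eq_iff u1_def indicator_def)
 have eq2: "(%z. \<alpha> z * fd eta z v * \<Phi> (u1 True z)) =
   (%z. \<alpha> z * fd eta z v * \<Phi> (u z))"
 proof
  show "\<alpha> z * fd eta z v * \<Phi> (u1 True z) =
   \<alpha> z * fd eta z v * \<Phi> (u z)" for z
   using K(5)[of z] K'(4) by (cases "z : K") (auto simp: u1_def indicator_def)
 qed
 have 1: "L1 (%z. \<alpha> z * eta z * k (u1 True z) * u1 False z)"
 proof (rule Lint_bound[of _ "%z. \<bar>C\<bar> * B * M * u1 False z"])
  show "AE z in lebesgue. norm (\<alpha> z * eta z * k (u1 True z) * u1 False z) <= norm (\<bar>C\<bar> * B * M * u1 False z)"
  proof (intro always_eventually allI)
   fix z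
   show "norm (\<alpha> z * eta z * k (u1 True z) * u1 False z) <= norm (\<bar>C\<bar> * B * M * u1 False z)"
   proof (cases "z : K")
    case True
    have "\<bar>\<alpha> z\<bar> * \<bar>eta z\<bar> * \<bar>k (u1 True z)\<bar> * \<bar>u1 False z\<bar> <= \<bar>C\<bar> * B * M * \<bar>u1 False z\<bar>"
     using C[OF True] K(6,7) k(2) M0 by (intro mult_mono) (auto intro!: mult_nonneg_nonneg)
    thus ?thesis using K(6) M0 by (simp add: abs_mult)
   qed (simp add: K(4))
  qed
 qed (use i1 in auto)
 have 2: "L1 (%z. \<alpha> z * fd eta z v * \<Phi> (u1 True z))"
 proof (rule Lint_bound[of _ "%z. \<bar>C\<bar> * (B * norm v) * \<bar>\<Phi> 0\<bar> * indicator K z + \<bar>C\<bar> * (B * norm v) * M * \<bar>u1 True z\<bar>"])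
  show "AE z in lebesgue. norm (\<alpha> z * fd eta z v * \<Phi> (u1 True z)) \<le>
   norm (\<bar>C\<bar> * (B * norm v) * \<bar>\<Phi> 0\<bar> * indicator K z + \<bar>C\<bar> * (B * norm v) * M * \<bar>u1 True z\<bar>)"
  proof (intro always_eventually allI)
   fix z
   show "norm (\<alpha> z * fd eta z v * \<Phi> (u1 True z)) \<le>
    norm (\<bar>C\<bar> * (B * norm v) * \<bar>\<Phi> 0\<bar> * indicator K z + \<bar>C\<bar> * (B * norm v) * M * \<bar>u1 True z\<bar>)"
   proof (cases "z : K")
    case True
    have "\<bar>\<alpha> z\<bar> * \<bar>fd eta z v\<bar> * \<bar>\<Phi> (u1 True z)\<bar> \<le>
      \<bar>C\<bar> * (B * norm v) * (\<bar>\<Phi> 0\<bar> + M * \<bar>u1 True z\<bar>)"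
     using C[OF True] K(6,8) \<Phi>b M0 by (intro mult_mono) (auto intro!: mult_nonneg_nonneg)
    also have "... <= \<bar>\<bar>C\<bar> * (B * norm v) * (\<bar>\<Phi> 0\<bar> + M * \<bar>u1 True z\<bar>)\<bar>" by (rule abs_ge_self)
    finally show ?thesis using True by (simp add: abs_mult algebra_simps)
   qed (simp add: K(5))
  qed
 qed (use i1 iK in auto)
 show "L1 (%z. \<alpha> z * eta z * k (u z) * u' z)" using 1 unfolding eq1 .
 show "L1 (%z. \<alpha> z * fd eta z v * \<Phi> (u z))" using 2 unfolding eq2 .
 have "(LI z. f z) = (LI z. \<alpha> z * eta z * k (u1 True z) * u1 False z) +
   (LI z. \<alpha> z * fd eta z v * \<Phi> (u1 True z))"
  unfolding f_def by (rule Bochner_Integration.integral_add[OF 1 2])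
 thus "(LI z. \<alpha> z * eta z * k (u z) * u' z) =
   - (LI z. \<alpha> z * fd eta z v * \<Phi> (u z))"
  using f0 unfolding eq1 eq2 by simp
qed

section \<open>Tests that depend nonlinearly on a weakly differentiable function\<close>

lemma mult_le_powr_sum:
 fixes x y p :: real
 assumes "p > 1" "x >= 0" "y >= 0"
 shows "x * y <= x powr (p / (p - 1)) + y powr p"
proof -
 have "x * y <= x powr (p / (p - 1)) / (p / (p - 1)) + y powr p / p"
  using assms by (intro Youngs_inequality) (auto simp: field_simps)
 also have "... <= x powr (p / (p - 1)) / 1 + y powr p / 1"
  using assms by (intro add_mono divide_left_mono) (auto simp: field_simps)
 finally show ?thesis by simp
qed

lemma frechet_derivative_Basis_sum:
 assumes "linear (D :: 'b::euclidean_space => real)" and "finite V" and "V \<subseteq> Basis"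
  and "!!j. j : Basis - V ==> B \<bullet> j = 0"
 shows "D B = (\<Sum>j\<in>V. (B \<bullet> j) * D j)"
proof -
 have "D B = D (\<Sum>j\<in>Basis. (B \<bullet> j) *\<^sub>R j)" by (simp add: euclidean_representation)
 also have "... = (\<Sum>j\<in>Basis. (B \<bullet> j) * D j)"
  by (simp add: linear_sum[OF assms(1)] linear_scale[OF assms(1)])
 also have "... = (\<Sum>j\<in>V. (B \<bullet> j) * D j)"
  using assms by (intro sum.mono_neutral_right) auto
 finally show ?thesis .
qed

lemma measurable_C1_on_indicator:
 assumes "C1_on S g" "compact K" "K \<subseteq> S"
 shows "(%z. indicator K z * g z) : lebm"
  and "(%z. indicator K z * fd g z v) : lebm"
 using assms C1_on_continuous[OF assms(1)]
  borel_measurable_continuous_on_indicator[of K g]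
  borel_measurable_continuous_on_indicator[of K "%z. fd g z v"]
 by (auto simp: C1_on_def compact_imp_closed intro: borel_measurable_lebesgue continuous_on_subset)

text \<open>Only w is mollified, since wh is already of class one. V holds the directions in which B
  has components; derivatives of w are asked for in these only. Products of B with the gradient of
  the mollified w are dominated by Young's inequality, |B|^(p/(p-1)) + |W|^p, and Jensen's
  inequality bounds the p-th power of a mollification by the mollified p-th power, which converges
  in L^1.\<close>

lemma weak_inequality_nonlinear_test:
 fixes a w wh :: "'b::euclidean_space => real" and B :: "'b => 'b" and W :: "'b => 'b => real"
 assumes S: "open S" and p: "p > 1" and V: "V \<subseteq> Basis"
  and a: "locally_integrable S a" and B: "locally_integrable S B"
  and Bp: "!!j. j : V ==> locally_integrable S (%z. \<bar>B z \<bullet> j\<bar> powr (p / (p - 1)))"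
  and BV: "!!z j. j : Basis - V ==> B z \<bullet> j = 0"
  and ineq: "!!eta. eta : C1_tests S ==> (!!z. 0 <= eta z) ==>
    0 <= (LI z. a z * eta z + fd eta z (B z))"
  and w: "!!j. j : V ==> has_weak_deriv S j w (W j)" and wl: "locally_integrable S w"
  and Wp: "!!j. j : V ==> locally_integrable S (%z. \<bar>W j z\<bar> powr p)"
  and wh: "C1_on S wh" and \<xi>: "\<xi> : C1_tests S" "!!z. 0 <= \<xi> z"
  and h: "!!s. (h has_real_derivative h' s) (at s)" "conton h'" "!!s. 0 <= h s"
   "!!s. h s <= M" "!!s. \<bar>h' s\<bar> <= M"
 defines "f \<equiv> %z. a z * (h (w z - wh z) * \<xi> z) + (\<Sum>j\<in>V. (B z \<bullet> j) *
   (h' (w z - wh z) * (W j z - fd wh z j) * \<xi> z +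
   h (w z - wh z) * fd \<xi> z j))"
 shows "L1 f" and "0 <= (LI z. f z)"
proof -
 have finV: "finite V" using V finite_Basis finite_subset by blast
 obtain K C\<xi> where K: "C_k 1 \<xi>" "compact K" "K \<subseteq> S" "!!z. z \<notin> K ==> \<xi> z = 0"
  "!!z. z \<notin> K ==> fd \<xi> z = (%v. 0)" "C\<xi> >= 0" "!!z. \<bar>\<xi> z\<bar> <= C\<xi>"
  "!!z v. \<bar>fd \<xi> z v\<bar> <= C\<xi> * norm v" "!!z. linear (fd \<xi> z)"
  by (rule C1_testsE[OF \<xi>(1)]) (rule that)
 obtain K' e where K': "e > 0" "compact K'" "K' \<subseteq> S" "K \<subseteq> K'" "!!z y. z : K ==> norm (y - z) <= e ==> y : K'"
  by (rule compact_neighbourhood[OF K(2) S K(3)]) (rule that)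
 \<comment> \<open>The functions to mollify together: w, its partial derivatives, and the p-th
   powers of those derivatives, which serve in the dominating function.\<close>
 define U where "U l z = indicator K' z * (case l of None => w z | Some (Inl j) => W j z | Some (Inr j) => \<bar>W j z\<bar> powr p)"
  for l :: "('b + 'b) option" and z
 define J where "J = insert None (Some ` (Inl ` V \<union> Inr ` V))"
 have finJ: "finite J" using finV by (simp add: J_def)
 have iU: "L1 (U l)" if lJ: "l : J" for l
 proof -
  consider "l = None" | j where "j : V" "l = Some (Inl j)" | j where "j : V" "l = Some (Inr j)"
   using lJ unfolding J_def by blast
  thus ?thesis
  proof cases
   case 1
   thus ?thesis using locally_integrableD[OF wl K'(2,3)] by (simp add: U_def[abs_def])
  next
   case 2
   hence "locally_integrable S (W j)" using w by (simp add: has_weak_deriv_def)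
   from locally_integrableD[OF this K'(2,3)] 2 show ?thesis by (simp add: U_def[abs_def])
  next
   case 3
   from locally_integrableD[OF Wp[OF 3(1)] K'(2,3)] 3 show ?thesis by (simp add: U_def[abs_def])
  qed
 qed
 have NJ: "None : J" and jJ: "j : V ==> Some (Inl j) : J" "j : V ==> Some (Inr j) : J" for j
  by (auto simp: J_def)
 obtain r where r: "strict_mono r"
  and AEc: "AE z in lebesgue. \<forall>l\<in>J. (%n. conv (U l) (moll (r n)) z) ~~> U l z"
  using moll_AE_subseq[of J U] finJ iU by auto
 obtain N where N: "!!n. n >= N ==> 1 / real (Suc (r n)) < e"
  using subseq_moll_radius[OF K'(1) r] by blast
 define s where "s n = r (n + N)" for n
 have s: "strict_mono s" using r by (auto simp: strict_mono_def s_def)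
 have AEs: "AE z in lebesgue. \<forall>l\<in>J. (%n. conv (U l) (moll (s n)) z) ~~> U l z"
  using AEc unfolding s_def by eventually_elim (auto intro: LIMSEQ_ignore_initial_segment)
 define wn where "wn n = conv (U None) (moll (s n))" for n
 define Wn where "Wn n j = conv (U (Some (Inl j))) (moll (s n))" for n j
 have Cwn: "C_k k (wn n)" for k n
  unfolding wn_def using C_k_conv[OF iU[OF NJ] C_k_moll, of 1] moll_eq_0_1 by blast
 have Dwn: "fd (wn n) z j = Wn n j z" if "z : K" "j : V" for n z j
  using frechet_derivative_conv_indicator[OF w[OF that(2)] K'(2,3), of z "s n"] K'(5)[OF that(1)] N[of "n + N"]
  by (force simp: wn_def Wn_def U_def[abs_def] s_def)
 have Wnp: "\<bar>Wn n j z\<bar> powr p <= \<bar>conv (U (Some (Inr j))) (moll (s n)) z\<bar>" if "j : V" for n j z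
 proof -
  have eq: "(%y. \<bar>U (Some (Inl j)) y\<bar> powr p) = U (Some (Inr j))"
   using p by (auto simp: U_def fun_eq_iff indicator_def)
  have "\<bar>Wn n j z\<bar> powr p <= conv (%y. \<bar>U (Some (Inl j)) y\<bar> powr p) (moll (s n)) z"
   unfolding Wn_def using iU[OF jJ(1)[OF that]] iU[OF jJ(2)[OF that]] p
   by (intro conv_moll_jensen) (auto simp: eq)
  thus ?thesis unfolding eq by linarith
 qed
 have wnp: "conton (wn n)" for n using Cwn C_k_imp_continuous_on by blast
 have hc: "conton h" using h(1) DERIV_isCont continuous_at_imp_continuous_on by blast
 define wh1 where "wh1 z = indicator K z * wh z" for z
 define Dwh where "Dwh j z = indicator K z * fd wh z j" for j z
 define a1 where "a1 z = indicator K z * a z" for z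
 define B1 where "B1 j z = indicator K z * (B z \<bullet> j)" for j z
 have ia: "L1 a1"
  using locally_integrableD[OF a K(2,3)] by (simp add: a1_def[abs_def])
 have iB: "L1 (B1 j)" for j
 proof -
  have "L1 (%z. (indicator K z *\<^sub>R B z) \<bullet> j)"
   using locally_integrableD[OF B K(2,3)] by (rule integrable_inner_left)
  thus ?thesis by (simp add: B1_def[abs_def])
 qed
 have iBp: "L1 (%z. indicator K z * \<bar>B z \<bullet> j\<bar> powr (p / (p - 1)))" if "j : V" for j
  using locally_integrableD[OF Bp[OF that] K(2,3)] by simp
 have "\<exists>C\<ge>0. \<forall>z. \<bar>Dwh j z\<bar> <= C" for j
 proof -
  have "continuous_on K (%z. fd wh z j)"
   using wh K(3) by (auto simp: C1_on_def intro: continuous_on_subset)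
  hence "bounded ((%z. fd wh z j) ` K)"
   by (intro compact_imp_bounded compact_continuous_image K(2))
  then obtain C where "\<forall>z\<in>K. \<bar>fd wh z j\<bar> <= C" by (auto simp: bounded_iff)
  hence "\<bar>Dwh j z\<bar> <= max 0 C" for z by (force simp: Dwh_def indicator_def)
  thus ?thesis by (intro exI[of _ "max 0 C"]) auto
 qed
 then obtain Cw where Cw: "!!j. Cw j >= 0" "!!j z. \<bar>Dwh j z\<bar> <= Cw j" by metis
 have M0: "M >= 0" using h(3,4)[of 0] by linarith
 have c\<xi>: "conton \<xi>" "conton (%z. fd \<xi> z j)" for j
  using C_k_imp_continuous_on[OF K(1)] K(1) by auto
 note [measurable] = borel_measurable_lebesgue[OF borel_measurable_continuous_onI[OF c\<xi>(1)]]
  borel_measurable_lebesgue[OF borel_measurable_continuous_onI[OF c\<xi>(2)]]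
  borel_measurable_continuous_onI[OF hc] borel_measurable_continuous_onI[OF h(2)]
  borel_measurable_integrable[OF ia] borel_measurable_integrable[OF iB]
  borel_measurable_lebesgue[OF borel_measurable_continuous_onI[OF wnp]]
 have [measurable]: "wh1 : lebm" "Dwh j : lebm" for j
  using measurable_C1_on_indicator[OF wh K(2,3)] by (auto simp: wh1_def[abs_def] Dwh_def[abs_def])
 have mWn: "Wn n j : lebm" if "j : V" for n j
  using conv_moll_L1(1)[OF iU[OF jJ(1)[OF that]]] by (auto simp: Wn_def)
 define F where "F n z = a1 z * (h (wn n z - wh1 z) * \<xi> z) + (\<Sum>j\<in>V. B1 j z *
   (h' (wn n z - wh1 z) * (Wn n j z - Dwh j z) * \<xi> z + h (wn n z - wh1 z) * fd \<xi> z j))" for n z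
 have Fm: "F n : lebm" for n
 proof -
  have [measurable]: "(%z. wn n z - wh1 z) : lebm" by measurable
  have hm: "(%z. h (wn n z - wh1 z)) : lebm"
   "(%z. h' (wn n z - wh1 z)) : lebm" by measurable
  have am: "a1 : lebm" "B1 j : lebm"
   "\<xi> : lebm" "(%z. fd \<xi> z j) : lebm"
   "Dwh j : lebm" for j by measurable
  show ?thesis unfolding F_def[abs_def]
   by (intro borel_measurable_add borel_measurable_sum borel_measurable_times borel_measurable_diff
     mWn hm am)
 qed
 have F0: "0 <= (LI z. F n z)" for n
 proof -
  have wnS: "C1_on S (wn n)"
   by (rule C1_on_subset[OF C1_on_UNIV[THEN iffD2, OF Cwn] subset_UNIV])
  have C1d: "C1_on S (%z. wn n z - wh z)"
   and Dd: "z : S ==> fd (%z. wn n z - wh z) z v =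
    fd (wn n) z v - fd wh z v" for z v
   using C1_on_diff[OF wnS wh] by auto
  have C1h: "C1_on S (%z. h (wn n z - wh z))"
   and Dh: "z : S ==> fd (%z. h (wn n z - wh z)) z v =
    h' (wn n z - wh z) * fd (%z. wn n z - wh z) z v" for z v
   using C1_on_compose[OF C1d h(1)] continuous_on_compose2[OF h(2) C1_on_continuous[OF C1d]] by auto
  let ?eta = "%z. h (wn n z - wh z) * \<xi> z"
  have eta: "?eta : C1_tests S"
   and Deta: "fd ?eta z v = h (wn n z - wh z) * fd \<xi> z v +
    fd (%z. h (wn n z - wh z)) z v * \<xi> z" for z v
   using C1_on_mult_test[OF S C1h \<xi>(1)] by auto
  have lin: "linear (fd ?eta z)" for z
   using eta by (intro linear_frechet_derivative) (simp add: C1_tests_def)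
  have "F n z = a z * ?eta z + fd ?eta z (B z)" for z
  proof (cases "z : K")
   case True
   hence zS: "z : S" using K(3) by blast
   have "fd ?eta z (B z) = (\<Sum>j\<in>V. (B z \<bullet> j) * fd ?eta z j)"
    by (rule frechet_derivative_Basis_sum[OF lin finV V BV])
   also have "... = (\<Sum>j\<in>V. (B z \<bullet> j) * (h' (wn n z - wh z) * (Wn n j z - fd wh z j) * \<xi> z +
     h (wn n z - wh z) * fd \<xi> z j))"
    by (rule sum.cong) (auto simp: Deta Dh[OF zS] Dd[OF zS] Dwn[OF True])
   finally show ?thesis using True by (simp add: F_def a1_def B1_def wh1_def Dwh_def)
  next
   case False
   have "fd ?eta z (B z) = 0" using False K(4,5) by (simp add: Deta)
   thus ?thesis using False K(4) by (simp add: F_def a1_def B1_def)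
  qed
  thus ?thesis using ineq[OF eta] h(3) \<xi>(2) by simp
 qed
 define g where "g z = a1 z * (h (U None z - wh1 z) * \<xi> z) + (\<Sum>j\<in>V. B1 j z *
   (h' (U None z - wh1 z) * (U (Some (Inl j)) z - Dwh j z) * \<xi> z +
   h (U None z - wh1 z) * fd \<xi> z j))" for z
 have lim: "AE z in lebesgue. (%n. F n z) ~~> g z"
  using AEs
 proof eventually_elim
  case (elim z)
  have 1: "(%n. wn n z - wh1 z) ~~> U None z - wh1 z"
   using elim NJ unfolding wn_def by (intro tendsto_intros) blast
  have 2: "(%n. h (wn n z - wh1 z)) ~~> h (U None z - wh1 z)"
   "(%n. h' (wn n z - wh1 z)) ~~> h' (U None z - wh1 z)"
   by (auto intro: continuous_on_tendsto_compose[OF hc 1] continuous_on_tendsto_compose[OF h(2) 1])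
  have 3: "j : V ==> (%n. Wn n j z) ~~> U (Some (Inl j)) z" for j
   using elim jJ(1)[of j] unfolding Wn_def by blast
  show ?case unfolding F_def g_def by (intro tendsto_intros 2 3)
 qed
 have gf: "g z = f z" for z
  using K(4,5)[of z] K'(4) by (cases "z : K")
   (auto simp: f_def g_def a1_def B1_def wh1_def Dwh_def U_def indicator_def subset_iff)
 define c0 where "c0 z = M * C\<xi> * \<bar>a1 z\<bar> + (\<Sum>j\<in>V. M * C\<xi> * (indicator K z * \<bar>B z \<bullet> j\<bar> powr (p / (p - 1))) +
   (M * Cw j * C\<xi> + M * C\<xi>) * \<bar>B1 j z\<bar>)" for z
 have ic0: "L1 c0"
  unfolding c0_def by (intro Lint_add Bochner_Integration.integrable_sum
    integrable_mult_right integrable_abs ia iB iBp)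
 have bound: "\<bar>F n z\<bar> <= c0 z + M * C\<xi> * (\<Sum>l\<in>J. \<bar>conv (U l) (moll (s n)) z\<bar>)" for n z
 proof (cases "z : K")
  case True
  let ?h = "h (wn n z - wh1 z)" and ?h' = "h' (wn n z - wh1 z)"
  have hb: "\<bar>?h\<bar> <= M" using h(3,4) by (simp add: abs_le_iff)
  have 1: "\<bar>a1 z * (?h * \<xi> z)\<bar> <= M * C\<xi> * \<bar>a1 z\<bar>"
  proof -
   have "\<bar>?h\<bar> * \<bar>\<xi> z\<bar> <= M * C\<xi>" using hb K(7) M0 by (intro mult_mono) auto
   thus ?thesis by (simp add: abs_mult mult.commute[of "\<bar>a1 z\<bar>"] mult_right_mono)
  qed
  have 2: "\<bar>B1 j z * (?h' * (Wn n j z - Dwh j z) * \<xi> z + ?h * fd \<xi> z j)\<bar> \<le>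
    M * C\<xi> * (indicator K z * \<bar>B z \<bullet> j\<bar> powr (p / (p - 1))) + (M * Cw j * C\<xi> + M * C\<xi>) * \<bar>B1 j z\<bar>
    + M * C\<xi> * \<bar>conv (U (Some (Inr j))) (moll (s n)) z\<bar>" if j: "j : V" for j
  proof -
   have nj: "norm j = 1" using j V by auto
   have i: "\<bar>?h'\<bar> * \<bar>Wn n j z - Dwh j z\<bar> * \<bar>\<xi> z\<bar> <= M * (\<bar>Wn n j z\<bar> + Cw j) * C\<xi>"
    using h(5) K(6,7) Cw(1)[of j] Cw(2)[of j z] M0 by (intro mult_mono) auto
   have ii: "\<bar>?h\<bar> * \<bar>fd \<xi> z j\<bar> <= M * C\<xi>"
    using hb K(8)[of z j] nj M0 by (intro mult_mono) auto
   have "\<bar>?h' * (Wn n j z - Dwh j z) * \<xi> z + ?h * fd \<xi> z j\<bar> \<le>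
     M * (\<bar>Wn n j z\<bar> + Cw j) * C\<xi> + M * C\<xi>"
    using i ii by (intro order_trans[OF abs_triangle_ineq]) (simp add: abs_mult)
   hence "\<bar>B1 j z * (?h' * (Wn n j z - Dwh j z) * \<xi> z + ?h * fd \<xi> z j)\<bar> \<le>
     \<bar>B1 j z\<bar> * (M * (\<bar>Wn n j z\<bar> + Cw j) * C\<xi> + M * C\<xi>)"
    unfolding abs_mult by (rule mult_left_mono) auto
   also have "... = M * C\<xi> * (\<bar>B1 j z\<bar> * \<bar>Wn n j z\<bar>) + (M * Cw j * C\<xi> + M * C\<xi>) * \<bar>B1 j z\<bar>"
    by (simp add: algebra_simps)
   also have "M * C\<xi> * (\<bar>B1 j z\<bar> * \<bar>Wn n j z\<bar>) <= M * C\<xi> * (\<bar>B1 j z\<bar> powr (p / (p - 1)) + \<bar>Wn n j z\<bar> powr p)"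
    using M0 K(6) p by (intro mult_left_mono mult_le_powr_sum) auto
   also have "\<bar>B1 j z\<bar> powr (p / (p - 1)) = indicator K z * \<bar>B z \<bullet> j\<bar> powr (p / (p - 1))"
    using True by (simp add: B1_def)
   also have "M * C\<xi> * (indicator K z * \<bar>B z \<bullet> j\<bar> powr (p / (p - 1)) + \<bar>Wn n j z\<bar> powr p) \<le>
     M * C\<xi> * (indicator K z * \<bar>B z \<bullet> j\<bar> powr (p / (p - 1)) + \<bar>conv (U (Some (Inr j))) (moll (s n)) z\<bar>)"
    using Wnp[OF j] M0 K(6) by (intro mult_left_mono add_left_mono) auto
   finally show ?thesis by (simp add: algebra_simps)
  qed
  have "\<bar>F n z\<bar> <= \<bar>a1 z * (?h * \<xi> z)\<bar> + (\<Sum>j\<in>V. \<bar>B1 j z * (?h' * (Wn n j z - Dwh j z) * \<xi> z + ?h * fd \<xi> z j)\<bar>)"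
   unfolding F_def by (rule order_trans[OF abs_triangle_ineq add_left_mono[OF sum_abs]])
  also have "... <= c0 z + M * C\<xi> * (\<Sum>j\<in>V. \<bar>conv (U (Some (Inr j))) (moll (s n)) z\<bar>)"
  proof -
   have "(\<Sum>j\<in>V. \<bar>B1 j z * (?h' * (Wn n j z - Dwh j z) * \<xi> z + ?h * fd \<xi> z j)\<bar>) \<le>
    (\<Sum>j\<in>V. M * C\<xi> * (indicator K z * \<bar>B z \<bullet> j\<bar> powr (p / (p - 1))) + (M * Cw j * C\<xi> + M * C\<xi>) * \<bar>B1 j z\<bar>
    + M * C\<xi> * \<bar>conv (U (Some (Inr j))) (moll (s n)) z\<bar>)"
    by (rule sum_mono) (rule 2)
   with 1 show ?thesis by (simp add: c0_def sum.distrib sum_distrib_left)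
  qed
  also have "(\<Sum>j\<in>V. \<bar>conv (U (Some (Inr j))) (moll (s n)) z\<bar>) =
    (\<Sum>l\<in>(%j. Some (Inr j)) ` V. \<bar>conv (U l) (moll (s n)) z\<bar>)"
   by (subst sum.reindex) (auto simp: inj_on_def)
  also have "M * C\<xi> * ... <= M * C\<xi> * (\<Sum>l\<in>J. \<bar>conv (U l) (moll (s n)) z\<bar>)"
   using M0 K(6) finJ by (intro mult_left_mono sum_mono2) (auto simp: J_def)
  finally show ?thesis by simp
 next
  case False
  have "0 <= M * C\<xi> * (\<Sum>l\<in>J. \<bar>conv (U l) (moll (s n)) z\<bar>)"
   using M0 K(6) by (intro mult_nonneg_nonneg sum_nonneg) auto
  thus ?thesis using False by (simp add: F_def c0_def a1_def B1_def)
 qed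
 have MC: "M * C\<xi> >= 0" using M0 K(6) by simp
 note dct = dominated_convergence_moll[OF finJ iU s AEs ic0 MC Fm lim, unfolded gf]
 show "L1 f" by (rule dct(1)) (use bound in auto)
 have "(%n. LI z. F n z) ~~> (LI z. f z)"
  by (rule dct(2)) (use bound in auto)
 thus "0 <= (LI z. f z)" using F0 by (intro LIMSEQ_le_const) auto
qed

subsection \<open>Cutoff functions\<close>

text \<open>For s < c the interval \<open>{c..s}\<close> is empty and the integral is 0, which is
  the right value since k vanishes there. To differentiate, the base point is moved to a, left of
  both c and s.\<close>

lemma antiderivative_vanishing_left:
 fixes k :: "real => real"
 assumes k: "conton k" and 0: "!!s. s <= c ==> k s = 0"
 shows "((%s. integral {c..s} k) has_real_derivative k s) (at s)"
proof -
 define a where "a = min c s - 1"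
 have eq: "integral {a..t} k = integral {c..t} k" if "t > a" for t
 proof (cases "c <= t")
  case True
  have "integral {a..c} k + integral {c..t} k = integral {a..t} k"
   using True k by (intro Henstock_Kurzweil_Integration.integral_combine)
    (auto simp: a_def intro!: integrable_continuous_real continuous_on_subset[OF k])
  moreover have "integral {a..c} k = integral {a..c} (%_. 0)"
   using 0 by (intro Henstock_Kurzweil_Integration.integral_cong) auto
  ultimately show ?thesis by simp
 next
  case False
  have "integral {a..t} k = integral {a..t} (%_. 0)"
   using 0 False by (intro Henstock_Kurzweil_Integration.integral_cong) auto
  thus ?thesis using False by simp
 qed
 have "((%t. integral {a..t} k) has_real_derivative k s) (at s within {a..s + 1})"
  by (rule integral_has_real_derivative) (auto simp: a_def intro: continuous_on_subset[OF k])
 hence "((%t. integral {a..t} k) has_real_derivative k s) (at s)"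
  by (subst (asm) at_within_interior) (auto simp: a_def)
 moreover have "s : {a<..}" by (simp add: a_def)
 ultimately show ?thesis
  by (rule has_field_derivative_transform_within_open[OF _ open_greaterThan]) (use eq in auto)
qed

text \<open>The normalised primitive of the truncated parabola
  \<open>max 0 ((s - a) * (b - s))\<close>.\<close>

lemma smooth_step:
 fixes a b :: real
 assumes "a < b"
 obtains \<theta> \<theta>' :: "real => real" and M where
  "!!s. (\<theta> has_real_derivative \<theta>' s) (at s)" "conton \<theta>'"
  "!!s. s <= a ==> \<theta> s = 0" "!!s. s >= b ==> \<theta> s = 1" "!!s. 0 <= \<theta> s" "!!s. \<theta> s <= 1"
  "!!s. 0 <= \<theta>' s" "!!s. \<theta>' s <= M" "!!s. s <= a ==> \<theta>' s = 0" "!!s. s >= b ==> \<theta>' s = 0"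
proof -
 define k where "k s = max 0 ((s - a) * (b - s))" for s
 have kc: "conton k" unfolding k_def by (intro continuous_intros)
 have k0: "k s = 0" if "s <= a" for s
  using that assms by (simp add: k_def mult_nonpos_nonneg)
 have k1: "k s = 0" if "s >= b" for s
  using that assms by (simp add: k_def mult_nonneg_nonpos)
 have kpos: "k s >= 0" for s by (simp add: k_def)
 define A where "A = integral {a..b} k"
 have der: "((%s. integral {a..s} k) has_real_derivative k s) (at s)" for s
  using antiderivative_vanishing_left[OF kc k0] .
 have mono: "integral {a..s} k <= integral {a..t} k" if "s <= t" for s t
  by (rule DERIV_nonneg_imp_nondecreasing[OF that]) (use der kpos in blast)
 have ia: "integral {a..a} k = 0" by simp
 have "A > 0"
 proof -
  have "k ((a + b) / 2) > 0"
  proof -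
   have "((a + b) / 2 - a) * (b - (a + b) / 2) = ((b - a) / 2)\<^sup>2"
    by (simp add: power2_eq_square field_simps)
   thus ?thesis using assms by (simp add: k_def)
  qed
  have "A ~= 0"
  proof
   assume "A = 0"
   hence "!!x. x : {a..b} ==> k x = 0"
    using integral_eq_0_iff[of a b k] assms kpos kc continuous_on_subset[OF kc] by (auto simp: A_def)
   hence "k ((a + b) / 2) = 0" using assms by auto
   with \<open>k ((a + b) / 2) > 0\<close> show False by simp
  qed
  moreover have "A >= 0" using mono[of a b] assms by (simp add: A_def)
  ultimately show ?thesis by simp
 qed
 define \<theta> where "\<theta> s = integral {a..s} k / A" for s
 have const: "integral {a..s} k = A" if "s >= b" for s
 proof -
  have "integral {a..b} k + integral {b..s} k = integral {a..s} k"
   using assms that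
   by (intro Henstock_Kurzweil_Integration.integral_combine)
    (auto intro!: integrable_continuous_real continuous_on_subset[OF kc])
  moreover have "integral {b..s} k = integral {b..s} (%_. 0)"
   using k1 by (intro Henstock_Kurzweil_Integration.integral_cong) auto
  ultimately show ?thesis by (simp add: A_def)
 qed
 have z: "integral {a..s} k = 0" if "s <= a" for s using that by (cases "s = a") auto
 show ?thesis
 proof (rule that[of \<theta> "%s. k s / A" "(b - a)\<^sup>2 / A"])
  show "(\<theta> has_real_derivative k s / A) (at s)" for s
   unfolding \<theta>_def using der by (intro DERIV_cdivide)
  show "conton (%s. k s / A)" using kc \<open>A > 0\<close> by (intro continuous_intros) auto
  show "s <= a ==> \<theta> s = 0" "s >= b ==> \<theta> s = 1" for s using z const \<open>A > 0\<close> by (auto simp: \<theta>_def)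
  show "0 <= \<theta> s" for s
   using mono[of a s] z[of s] \<open>A > 0\<close> by (cases "a <= s") (auto simp: \<theta>_def)
  show "\<theta> s <= 1" for s
   using mono[of s "max s b"] const[of "max s b"] \<open>A > 0\<close> by (auto simp: \<theta>_def)
  show "0 <= k s / A" for s using kpos \<open>A > 0\<close> by simp
  have "k s <= (b - a)\<^sup>2" for s
  proof (cases "a <= s \<and> s <= b")
   case True
   hence "(s - a) * (b - s) <= (b - a) * (b - a)" by (intro mult_mono) auto
   thus ?thesis by (simp add: k_def power2_eq_square)
  qed (use k0[of s] k1[of s] in auto)
  thus "k s / A <= (b - a)\<^sup>2 / A" for s using \<open>A > 0\<close> by (simp add: divide_right_mono)
  show "s <= a ==> k s / A = 0" "s >= b ==> k s / A = 0" for s using k0 k1 by auto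
 qed
qed

definition is_cutoff :: "real => real => real => ('a::euclidean_space => real) => ('a => 'a) => bool" where
 "is_cutoff p L R zt D \<longleftrightarrow> (\<forall>x. (zt has_derivative (%e. D x \<bullet> e)) (at x)) \<and>
  conton D \<and> (\<forall>x. 0 <= zt x \<and> zt x <= 1) \<and> (\<forall>x. norm x <= R --> zt x = 1 \<and> D x = 0) \<and>
  (\<forall>x. norm x >= 2 * R --> zt x = 0 \<and> D x = 0) \<and>
  (\<forall>x. norm (D x) powr p <= (L / R) powr p * zt x powr (p - 1))"

text \<open>The gradient bound is the one that lets the weight absorb the gradient of the cutoff in
 Young's inequality; it is achieved by a high power of a plain cutoff.\<close>

lemma radial_cutoff:
 fixes p :: real
 assumes p: "p > 1"
 obtains L where "L > 0" "!!R::real. R > 0 ==> \<exists>(zt::'a::euclidean_space => real) D. is_cutoff p L R zt D"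
proof -
 obtain \<theta> \<theta>' :: "real => real" and M where
  \<theta>: "!!s. (\<theta> has_real_derivative \<theta>' s) (at s)" "conton \<theta>'"
  "!!s. s <= 1 ==> \<theta> s = 0" "!!s. s >= 4 ==> \<theta> s = 1" "!!s. 0 <= \<theta> s" "!!s. \<theta> s <= 1"
  "!!s. 0 <= \<theta>' s" "!!s. \<theta>' s <= M" "!!s. s <= 1 ==> \<theta>' s = 0" "!!s. s >= 4 ==> \<theta>' s = 0"
  using smooth_step[of 1 4] by (metis (no_types, lifting) one_less_numeral_iff semiring_norm(76))
 \<comment> \<open>The cutoff is the k-th power of a plain cutoff \<tau>, so its gradient carries
   \<tau>^(k-1). The required bound needs (k-1)p >= k(p-1), that is, k >= p.\<close>
 obtain k :: nat where k: "real k >= p" using real_arch_simple by blast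
 hence k2: "k >= 2" using p by linarith
 have M0: "M >= 0" using \<theta>(7,8)[of 0] by linarith
 define L where "L = 4 * real k * (M + 1)"
 have "L > 0" using k2 M0 by (simp add: L_def)
 show ?thesis
 proof (rule that[OF \<open>L > 0\<close>])
  fix R :: real assume R: "R > 0"
  \<comment> \<open>Working with |x|^2 avoids the singularity of the norm at 0; the thresholds 1 and
    4 of \<theta> correspond to |x| = R and |x| = 2R.\<close>
  define s where "s x = (x \<bullet> x) / R\<^sup>2" for x :: 'a
  define zt where "zt x = (1 - \<theta> (s x)) ^ k" for x :: 'a
  define D where "D x = (- (real k * (1 - \<theta> (s x)) ^ (k - 1) * \<theta>' (s x) * (2 / R\<^sup>2))) *\<^sub>R x" for x :: 'a
  have ds: "(s has_derivative (%e. 2 * (x \<bullet> e) / R\<^sup>2)) (at x)" for x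
  proof -
   have "((%x. (x \<bullet> x) * (1 / R\<^sup>2)) has_derivative (%e. (x \<bullet> e + e \<bullet> x) * (1 / R\<^sup>2))) (at x)"
    by (intro has_derivative_mult_left) (auto intro!: derivative_eq_intros)
   thus ?thesis unfolding s_def by (simp add: inner_commute)
  qed
  have der: "(zt has_derivative (%e. D x \<bullet> e)) (at x)" for x
  proof -
   have "((%x. \<theta> (s x)) has_derivative (%e. \<theta>' (s x) * (2 * (x \<bullet> e) / R\<^sup>2))) (at x)"
    using has_derivative_compose[OF ds \<theta>(1)[unfolded has_field_derivative_def]] .
   from has_derivative_power[OF has_derivative_diff[OF has_derivative_const this], of 1 k]
   show ?thesis unfolding zt_def by (rule has_derivative_eq_rhs) (auto simp: D_def fun_eq_iff)
  qed
  have sc: "conton s" unfolding s_def using R by (intro continuous_intros) auto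
  have \<theta>c: "conton \<theta>" using \<theta>(1) DERIV_isCont continuous_at_imp_continuous_on by blast
  have Dc: "conton D"
   unfolding D_def
   by (intro continuous_intros continuous_on_compose2[OF \<theta>c sc] continuous_on_compose2[OF \<theta>(2) sc]) auto
  have s1: "s x <= 1" if "norm x <= R" for x
   using power_mono[OF that, of 2] R by (simp add: s_def power2_norm_eq_inner[symmetric] divide_le_eq)
  have s4: "s x >= 4" if "norm x >= 2 * R" for x
   using power_mono[OF that, of 2] R by (simp add: s_def power2_norm_eq_inner[symmetric] le_divide_eq)
  have bound: "norm (D x) powr p <= (L / R) powr p * zt x powr (p - 1)" for x
  proof (cases "norm x >= 2 * R \<or> \<theta> (s x) = 1")
   case True
   hence "D x = 0"
   proof
    assume "norm x >= 2 * R"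
    thus ?thesis using s4 \<theta>(10) by (simp add: D_def)
   next
    assume "\<theta> (s x) = 1"
    thus ?thesis using k2 by (simp add: D_def power_0_left)
   qed
   thus ?thesis using p by simp
  next
   case False
   define \<tau> where "\<tau> = 1 - \<theta> (s x)"
   have \<tau>: "0 < \<tau>" "\<tau> <= 1" using False \<theta>(5,6)[of "s x"] by (auto simp: \<tau>_def less_le)
   have "norm (D x) = real k * \<tau> ^ (k - 1) * \<theta>' (s x) * (2 / R\<^sup>2) * norm x"
    using \<tau> \<theta>(7)[of "s x"] by (simp add: D_def \<tau>_def abs_mult)
   also have "... <= real k * \<tau> ^ (k - 1) * M * (2 / R\<^sup>2) * (2 * R)"
    using False \<tau> \<theta>(7,8) M0 R by (intro mult_mono) auto
   also have "... = (4 * real k * M / R) * \<tau> ^ (k - 1)" using R by (simp add: power2_eq_square)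
   also have "... <= (L / R) * \<tau> ^ (k - 1)"
    using \<tau> R by (intro mult_right_mono divide_right_mono) (auto simp: L_def intro: mult_left_mono)
   finally have "norm (D x) powr p <= ((L / R) * \<tau> ^ (k - 1)) powr p" using p by (intro powr_mono2) auto
   also have "... = (L / R) powr p * \<tau> powr (real (k - 1) * p)"
    using \<tau> R \<open>L > 0\<close> by (subst powr_mult) (auto simp: powr_realpow[symmetric] powr_powr)
   also have "... <= (L / R) powr p * \<tau> powr (real k * (p - 1))"
    using \<tau> k k2 by (intro mult_left_mono powr_mono') (auto simp: algebra_simps of_nat_diff)
   also have "\<tau> powr (real k * (p - 1)) = zt x powr (p - 1)"
    using \<tau> by (simp add: zt_def \<tau>_def powr_realpow[symmetric] powr_powr)
   finally show ?thesis .
  qed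
  have "\<forall>x. 0 <= zt x \<and> zt x <= 1" using \<theta>(5,6) by (auto simp: zt_def intro!: power_le_one)
  moreover have "\<forall>x. norm x <= R --> zt x = 1 \<and> D x = 0"
   using s1 \<theta>(3,9) by (simp add: zt_def D_def)
  moreover have "\<forall>x. norm x >= 2 * R --> zt x = 0 \<and> D x = 0"
   using s4 \<theta>(4,10) k2 by (simp add: zt_def D_def)
  ultimately show "\<exists>(zt::'a => real) D. is_cutoff p L R zt D"
   unfolding is_cutoff_def using der Dc bound by blast
 qed
qed

lemma product_test_function:
 fixes zt :: "'a::euclidean_space => real" and omg :: "real => real"
 assumes zt: "!!x. (zt has_derivative (%e. D x \<bullet> e)) (at x)" "conton D"
  "!!x. norm x >= R ==> zt x = 0"
  and omg: "!!t. (omg has_real_derivative omg' t) (at t)" "conton omg'"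
  "!!t. t \<notin> {a..b} ==> omg t = 0" and a: "0 < a"
 shows "(%z. zt (fst z) * omg (snd z)) : C1_tests S_inf"
  and "fd (%z. zt (fst z) * omg (snd z)) z (e, s) =
   (D (fst z) \<bullet> e) * omg (snd z) + zt (fst z) * (omg' (snd z) * s)"
proof -
 let ?\<xi> = "%z. zt (fst z) * omg (snd z)"
 let ?D = "%z v. zt (fst z) * (omg' (snd z) * snd v) + (D (fst z) \<bullet> fst v) * omg (snd z)"
 have d1: "((%z. zt (fst z)) has_derivative (%v. D (fst z) \<bullet> fst v)) (at z)" for z :: "'a \<times> real"
  by (rule has_derivative_compose[OF has_derivative_fst[OF has_derivative_ident] zt(1)])
 have d2: "((%z. omg (snd z)) has_derivative (%v. omg' (snd z) * snd v)) (at z)" for z :: "'a \<times> real"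
  by (rule has_derivative_compose[OF has_derivative_snd[OF has_derivative_ident] omg(1)[unfolded has_field_derivative_def]])
 have d: "(?\<xi> has_derivative ?D z) (at z)" for z using has_derivative_mult[OF d1 d2] .
 have c: "conton zt" "conton omg"
  using has_derivative_continuous[OF zt(1)] DERIV_isCont[OF omg(1)]
  by (auto intro: continuous_at_imp_continuous_on)
 have cf: "conton (fst :: 'a \<times> real => 'a)" "conton (snd :: 'a \<times> real => real)"
  by (intro continuous_intros)+
 have dc: "conton (%z. ?D z v)" for v
  by (intro continuous_intros continuous_on_compose2[OF c(1) cf(1)] continuous_on_compose2[OF c(2) cf(2)]
    continuous_on_compose2[OF zt(2) cf(1)] continuous_on_compose2[OF omg(2) cf(2)]) auto
 have C: "C_k 1 ?\<xi>" and D: "fd ?\<xi> z = ?D z"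
  using C1_on_I(1)[of UNIV, OF d dc, folded One_nat_def] C1_on_I(2)[of UNIV, OF d dc, of z]
  unfolding C1_on_UNIV by auto
 have "compact (cball (0::'a) R \<times> {a..b})" by (intro compact_Times) auto
 moreover have "cball (0::'a) R \<times> {a..b} \<subseteq> S_inf" using a by (auto simp: S_inf_def)
 moreover have "?\<xi> z = 0" if "z \<notin> cball 0 R \<times> {a..b}" for z
  using that zt(3)[of "fst z"] omg(3)[of "snd z"] by (cases z) auto
 ultimately show "?\<xi> : C1_tests S_inf" unfolding C1_tests_def using C by blast
 show "fd ?\<xi> z (e, s) = (D (fst z) \<bullet> e) * omg (snd z) + zt (fst z) * (omg' (snd z) * s)"
  unfolding D by simp
qed

text \<open>If y t = Y > 0, take omg rising from 0 to 1 close to time 0, where y < Y/4, and falling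
  back to 0 just after t, where y > Y/2. The integral of omg' y is then at most Y/4 - Y/2 <
  0.\<close>

lemma weakly_nonincreasing_imp_zero:
 fixes y :: "real => real"
 assumes y: "continuous_on {0..} y" "y 0 = 0" "!!t. t >= 0 ==> y t >= 0"
  and mono: "!!omg omg' a b. 0 < a ==> a < b ==> (!!t. (omg has_real_derivative omg' t) (at t)) ==>
   conton omg' ==> (!!t. 0 <= omg t) ==> (!!t. t \<notin> {a..b} ==> omg t = 0 \<and> omg' t = 0) ==>
   0 <= integral {a..b} (%t. omg' t * y t)"
  and t: "t >= 0"
 shows "y t = 0"
proof (rule ccontr)
 assume "y t ~= 0"
 define Y where "Y = y t"
 have Y: "Y > 0" using y(3)[OF t] \<open>y t ~= 0\<close> by (simp add: Y_def)
 have t0: "t > 0" using y(2) \<open>y t ~= 0\<close> t by (cases "t = 0") auto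
 have c0: "continuous (at 0 within {0..}) y" "continuous (at t within {0..}) y"
  using y(1) t by (auto simp: continuous_on_eq_continuous_within)
 obtain d1 where d1: "d1 > 0" "!!s. s >= 0 ==> s < d1 ==> y s < Y / 4"
  using c0(1)[unfolded continuous_within_eps_delta, rule_format, of "Y / 4"] Y y(2) y(3)
  by (force simp: dist_real_def)
 obtain d2 where d2: "d2 > 0" "!!s. s >= 0 ==> \<bar>s - t\<bar> < d2 ==> y s > Y / 2"
 proof -
  obtain d where d: "d > 0" "!!s. s >= 0 ==> \<bar>s - t\<bar> < d ==> \<bar>y s - Y\<bar> < Y / 2"
   using c0(2)[unfolded continuous_within_eps_delta, rule_format, of "Y / 2"] Y
   by (auto simp: dist_real_def Y_def)
  thus ?thesis using that[of d] by (smt (verit) field_sum_of_halves)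
 qed
 define b1 where "b1 = min (d1 / 2) (t / 2)"
 define a1 where "a1 = b1 / 2"
 define b2 where "b2 = t + d2 / 2"
 have o: "0 < a1" "a1 < b1" "b1 < d1" "b1 < t" "t < b2" using d1 d2 t0 by (auto simp: a1_def b1_def b2_def)
 obtain \<theta> \<theta>' :: "real => real" and M where
  \<theta>: "!!s. (\<theta> has_real_derivative \<theta>' s) (at s)" "conton \<theta>'"
  "!!s. s <= a1 ==> \<theta> s = 0" "!!s. s >= b1 ==> \<theta> s = 1" "!!s. 0 <= \<theta> s" "!!s. \<theta> s <= 1"
  "!!s. 0 <= \<theta>' s" "!!s. \<theta>' s <= M" "!!s. s <= a1 ==> \<theta>' s = 0" "!!s. s >= b1 ==> \<theta>' s = 0"
  by (rule smooth_step[OF o(2)]) (rule that)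
 obtain \<phi> \<phi>' :: "real => real" and M' where
  \<phi>: "!!s. (\<phi> has_real_derivative \<phi>' s) (at s)" "conton \<phi>'"
  "!!s. s <= t ==> \<phi> s = 0" "!!s. s >= b2 ==> \<phi> s = 1" "!!s. 0 <= \<phi> s" "!!s. \<phi> s <= 1"
  "!!s. 0 <= \<phi>' s" "!!s. \<phi>' s <= M'" "!!s. s <= t ==> \<phi>' s = 0" "!!s. s >= b2 ==> \<phi>' s = 0"
  by (rule smooth_step[OF o(5)]) (rule that)
 have yc: "continuous_on {a1..b2} y" using o by (intro continuous_on_subset[OF y(1)]) auto
 have i: "(%t. \<theta>' t * y t) integrable_on {a1..b2}" "(%t. \<phi>' t * y t) integrable_on {a1..b2}"
  "\<theta>' integrable_on {a1..b2}" "\<phi>' integrable_on {a1..b2}"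
  by (intro integrable_continuous_real continuous_on_mult yc; intro continuous_on_subset[OF \<theta>(2)]
    continuous_on_subset[OF \<phi>(2)]; simp)+
 have I1: "integral {a1..b2} \<theta>' = 1"
 proof -
  have "(\<theta>' has_integral \<theta> b2 - \<theta> a1) {a1..b2}"
   using o \<theta>(1) by (intro fundamental_theorem_of_calculus)
    (auto simp: has_real_derivative_iff_has_vector_derivative[symmetric] intro: has_field_derivative_at_within)
  thus ?thesis using \<theta>(3)[of a1] \<theta>(4)[of b2] o by (simp add: integral_unique)
 qed
 have I2: "integral {a1..b2} \<phi>' = 1"
 proof -
  have "(\<phi>' has_integral \<phi> b2 - \<phi> a1) {a1..b2}"
   using o \<phi>(1) by (intro fundamental_theorem_of_calculus)
    (auto simp: has_real_derivative_iff_has_vector_derivative[symmetric] intro: has_field_derivative_at_within)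
  thus ?thesis using \<phi>(3)[of a1] \<phi>(4)[of b2] o by (simp add: integral_unique)
 qed
 have "integral {a1..b2} (%t. \<theta>' t * y t) <= integral {a1..b2} (%t. \<theta>' t * (Y / 4))"
 proof (rule integral_le)
  show "(%t. \<theta>' t * (Y / 4)) integrable_on {a1..b2}" using i(3) by (rule integrable_on_mult_left)
  fix s assume s: "s : {a1..b2}"
  show "\<theta>' s * y s <= \<theta>' s * (Y / 4)"
  proof (cases "s >= b1")
   case False
   hence "y s <= Y / 4" using d1(2)[of s] s o by auto
   thus ?thesis using \<theta>(7) by (rule mult_left_mono)
  qed (simp add: \<theta>(10))
 qed (rule i)
 also have "... = Y / 4" using I1 by simp
 finally have 1: "integral {a1..b2} (%t. \<theta>' t * y t) <= Y / 4" .
 have "integral {a1..b2} (%t. \<phi>' t * (Y / 2)) <= integral {a1..b2} (%t. \<phi>' t * y t)"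
 proof (rule integral_le)
  show "(%t. \<phi>' t * (Y / 2)) integrable_on {a1..b2}" using i(4) by (rule integrable_on_mult_left)
  fix s assume s: "s : {a1..b2}"
  have "\<bar>s - t\<bar> < d2" if "s > t" using that s d2(1) by (auto simp: b2_def)
  hence "Y / 2 <= y s" if "s > t" using d2(2)[of s] s o that by auto
  thus "\<phi>' s * (Y / 2) <= \<phi>' s * y s"
   using mult_left_mono[OF _ \<phi>(7)[of s], of "Y / 2" "y s"] \<phi>(9)[of s] by (cases "s <= t") auto
 qed (rule i)
 hence 2: "Y / 2 <= integral {a1..b2} (%t. \<phi>' t * y t)" using I2 by simp
 have "0 <= integral {a1..b2} (%t. (\<theta>' t - \<phi>' t) * y t)"
 proof (rule mono[of a1 b2 "%t. \<theta> t - \<phi> t"])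
  show "((%t. \<theta> t - \<phi> t) has_real_derivative \<theta>' s - \<phi>' s) (at s)" for s
   using \<theta>(1) \<phi>(1) by (rule DERIV_diff)
  show "conton (%t. \<theta>' t - \<phi>' t)" using \<theta>(2) \<phi>(2) by (rule continuous_on_diff)
  show "0 <= \<theta> s - \<phi> s" for s
   using \<theta>(4,5)[of s] \<phi>(3,6)[of s] o by (cases "s <= t") auto
  show "s \<notin> {a1..b2} ==> \<theta> s - \<phi> s = 0 \<and> \<theta>' s - \<phi>' s = 0" for s
   using \<theta>(3,4,9,10)[of s] \<phi>(3,4,9,10)[of s] o by (cases "s < a1") auto
 qed (use o in auto)
 also have "... = integral {a1..b2} (%t. \<theta>' t * y t) - integral {a1..b2} (%t. \<phi>' t * y t)"
  using i by (simp add: left_diff_distrib Henstock_Kurzweil_Integration.integral_diff)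
 finally show False using 1 2 Y by simp
qed

subsection \<open>The flux and the weak formulation\<close>

text \<open>The flux u^(m-1) |Du|^(p-2) Du expressed through W, the gradient of u^q: no power of u
  remains, only the distinction between u > 0 and u = 0.\<close>

definition pflux :: "real => real => real => 'a::euclidean_space => 'a" where
 "pflux p q u W = (if u > 0 then (q powr (1 - p) * norm W powr (p - 2)) *\<^sub>R W else 0)"

text \<open>q is the exponent with (m - 1) + (1 - q)(p - 1) = 0, so the powers of u cancel. Where u
  or W vanishes, both sides are 0.\<close>

lemma flux_eq_pflux:
 fixes W :: "'a::euclidean_space \<times> real => 'a"
 assumes p: "p > 1" and q: "q = grad_exponent p m" "q > 0" and u: "u z >= 0"
 shows "(u z powr (m - 1) * norm (grad_from_power q u W z) powr (p - 2)) *\<^sub>R grad_from_power q u W z =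
  pflux p q (u z) (W z)"
proof (cases "u z > 0 \<and> W z ~= 0")
 case True
 define c where "c = u z powr (1 - q) / q"
 have c: "c > 0" using True q(2) by (simp add: c_def)
 have qp: "q * (p - 1) = p + m - 2" using p q(1) by (simp add: grad_exponent_def)
 have e: "(m - 1) + (1 - q) * (p - 1) = 0" using qp by (simp add: algebra_simps)
 have "u z powr (m - 1) * norm (c *\<^sub>R W z) powr (p - 2) * c =
   u z powr (m - 1) * (c powr (p - 2) * c) * norm (W z) powr (p - 2)"
  using c by (simp add: powr_mult)
 also have "c powr (p - 2) * c = c powr (p - 1)"
  using c powr_add[of c "p - 2" 1] by simp
 also have "c powr (p - 1) = u z powr ((1 - q) * (p - 1)) * q powr (1 - p)"
  using True q(2) powr_minus_divide[of q "p - 1"] by (simp add: c_def powr_divide powr_powr)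
 also have "u z powr (m - 1) * (u z powr ((1 - q) * (p - 1)) * q powr (1 - p)) =
   u z powr ((m - 1) + (1 - q) * (p - 1)) * q powr (1 - p)"
  by (simp only: powr_add mult.assoc)
 also have "... = q powr (1 - p)" using True by (simp only: e) simp
 finally have "u z powr (m - 1) * norm (c *\<^sub>R W z) powr (p - 2) * c = q powr (1 - p) * norm (W z) powr (p - 2)" .
 thus ?thesis using True by (simp add: pflux_def grad_from_power_def c_def[symmetric])
next
 case False
 thus ?thesis using u by (auto simp: pflux_def grad_from_power_def)
qed

lemma norm_pflux_le:
 assumes "p > 1"
 shows "norm (pflux p q u W) <= q powr (1 - p) * norm W powr (p - 1)"
proof (cases "W = 0")
 case False
 hence "norm W powr (p - 2) * norm W = norm W powr (p - 1)"
  using powr_add[of "norm W" "p - 2" 1] by simp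
 thus ?thesis by (simp add: pflux_def mult.assoc)
qed (simp add: pflux_def)

text \<open>Cauchy-Schwarz reduces the claim to (|a|^(p-1) - |b|^(p-1)) (|a| - |b|) >= 0.\<close>

lemma plaplace_monotone:
 fixes a b :: "'a::euclidean_space"
 assumes p: "p > 1"
 shows "0 <= (norm a powr (p - 2) *\<^sub>R a - norm b powr (p - 2) *\<^sub>R b) \<bullet> (a - b)"
proof -
 have e: "norm c powr (p - 2) * norm c = norm c powr (p - 1)" for c :: 'a
  using powr_add[of "norm c" "p - 2" 1] p by (cases "c = 0") auto
 have cs: "a \<bullet> b <= norm a * norm b" using norm_cauchy_schwarz by blast
 have "(norm a powr (p - 2) *\<^sub>R a - norm b powr (p - 2) *\<^sub>R b) \<bullet> (a - b) =
   norm a powr (p - 2) * norm a * norm a + norm b powr (p - 2) * norm b * norm b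
   - (norm a powr (p - 2) + norm b powr (p - 2)) * (a \<bullet> b)"
  by (simp add: inner_diff inner_commute power2_norm_eq_inner[symmetric] power2_eq_square algebra_simps)
 also have "... >= norm a powr (p - 2) * norm a * norm a + norm b powr (p - 2) * norm b * norm b
   - (norm a powr (p - 2) + norm b powr (p - 2)) * (norm a * norm b)"
  using cs by (intro diff_left_mono mult_left_mono) auto
 also (xtrans) have "norm a powr (p - 2) * norm a * norm a + norm b powr (p - 2) * norm b * norm b
   - (norm a powr (p - 2) + norm b powr (p - 2)) * (norm a * norm b) =
   (norm a powr (p - 1) - norm b powr (p - 1)) * (norm a - norm b)"
  by (simp add: e[symmetric] algebra_simps)
 also (xtrans) have "... >= 0"
 proof (cases "norm b <= norm a")
  case True
  hence "norm b powr (p - 1) <= norm a powr (p - 1)" using p by (intro powr_mono2) auto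
  thus ?thesis using True by simp
 next
  case False
  hence "norm a powr (p - 1) <= norm b powr (p - 1)" using p by (intro powr_mono2) auto
  thus ?thesis using False by (simp add: mult_nonpos_nonpos)
 qed
 finally show ?thesis .
qed

text \<open>The alternative V = 0 covers points with v = 0: there \<open>pflux\<close> is 0, in
  agreement with the formula for positive v.\<close>

lemma pflux_monotone:
 fixes W V :: "'a::euclidean_space"
 assumes p: "p > 1" and u: "u > 0" and v: "v > 0 \<or> V = 0"
 shows "0 <= (pflux p q u W - pflux p q v V) \<bullet> (W - V)"
proof -
 have "pflux p q v V = q powr (1 - p) *\<^sub>R (norm V powr (p - 2) *\<^sub>R V)"
  using v by (auto simp: pflux_def)
 moreover have "pflux p q u W = q powr (1 - p) *\<^sub>R (norm W powr (p - 2) *\<^sub>R W)"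
  using u by (simp add: pflux_def)
 ultimately have "(pflux p q u W - pflux p q v V) \<bullet> (W - V) =
   q powr (1 - p) * ((norm W powr (p - 2) *\<^sub>R W - norm V powr (p - 2) *\<^sub>R V) \<bullet> (W - V))"
  by (simp add: scaleR_right_diff_distrib[symmetric] del: scaleR_scaleR)
 thus ?thesis using plaplace_monotone[OF p, of W V] by simp
qed

text \<open>Measurability is not assumed: by completeness F and G are both measurable or both not,
  and in the latter case both integrals are 0 by default.\<close>

lemma lebesgue_integral_cong_AE:
 fixes F G :: "'b::euclidean_space => real"
 assumes "AE z in lebesgue. F z = G z"
 shows "(LI z. F z) = (LI z. G z)"
proof (cases "F : lebm")
 case True
 hence "G : lebm" using assms borel_measurable_AE by blast
 thus ?thesis using True assms by (intro integral_cong_AE)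
next
 case False
 have "G \<notin> lebm"
  using False assms borel_measurable_AE[of G F] by (metis (mono_tags, lifting) AE_cong)
 thus ?thesis using False
  by (metis borel_measurable_integrable not_integrable_integral_eq)
qed

lemma lebesgue_integrable_cong_AE:
 fixes F G :: "'b::euclidean_space => real"
 assumes "L1 F" "AE z in lebesgue. F z = G z"
 shows "L1 G"
 using assms borel_measurable_AE[OF borel_measurable_integrable[OF assms(1)] assms(2)]
  integrable_cong_AE[of F lebesgue G] by auto

lemma frechet_derivative_space_time:
 fixes eta :: "'a::euclidean_space \<times> real => real"
 assumes "linear (fd eta z)"
 shows "fd eta z (x, s) = x \<bullet> space_grad eta z + s * time_deriv eta z"
proof -
 let ?D = "fd eta z"
 have "(x, s) = (\<Sum>i\<in>Basis. (x \<bullet> i) *\<^sub>R (i, 0)) + s *\<^sub>R (0, 1)"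
 proof -
  have "(\<Sum>i\<in>Basis. (x \<bullet> i) *\<^sub>R (i, 0 :: real)) = (\<Sum>i\<in>Basis. ((x \<bullet> i) *\<^sub>R i, 0))" by simp
  also have "... = (x, 0)" by (simp add: prod_eq_iff fst_sum snd_sum euclidean_representation)
  finally show ?thesis by simp
 qed
 hence "?D (x, s) = (\<Sum>i\<in>Basis. (x \<bullet> i) * ?D (i, 0)) + s * ?D (0, 1)"
  by (simp only: linear_add[OF assms] linear_sum[OF assms] linear_scale[OF assms] real_scaleR_def)
 thus ?thesis by (simp add: space_grad_def time_deriv_def inner_sum_right mult.commute)
qed

lemma open_S_inf: "open (S_inf :: ('a::euclidean_space \<times> real) set)"
 unfolding S_inf_def by (intro open_Times) auto

lemma sets_S_inf[measurable]: "(S_inf :: ('a::euclidean_space \<times> real) set) : sets lebesgue"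
 using borel_open[OF open_S_inf] by (intro sets_completionI_sets) simp

lemma C1_tests_linear:
 assumes "eta : C1_tests S"
 shows "linear (fd eta z)"
 using assms by (intro linear_frechet_derivative) (simp add: C1_tests_def)

lemma C1_tests_outside:
 assumes "eta : C1_tests S" and "z \<notin> S"
 shows "eta z = 0" and "fd eta z = (%v. 0)"
proof -
 obtain K B where K: "C_k 1 eta" "compact K" "K \<subseteq> S" "!!z. z \<notin> K ==> eta z = 0"
  "!!z. z \<notin> K ==> fd eta z = (%v. 0)" "B >= 0" "!!z. \<bar>eta z\<bar> <= B"
  "!!z v. \<bar>fd eta z v\<bar> <= B * norm v" "!!z. linear (fd eta z)"
  by (rule C1_testsE[OF assms(1)]) (rule that)
 thus "eta z = 0" "fd eta z = (%v. 0)" using assms(2) by blast+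
qed

text \<open>Time and space parts merge into one derivative of eta applied to a space-time vector, so
  the general results on pairings \<open>fd eta z (B z)\<close> apply.\<close>

lemma weak_form_eq:
 fixes u :: "'a::euclidean_space \<times> real => real" and W :: "'a \<times> real => 'a"
 assumes p: "p > 1" and q: "q = grad_exponent p m" "q > 0"
  and u: "AE z in lebesgue. z : S_inf --> 0 <= u z" and eta: "eta : C1_tests S_inf"
 shows "weak_form p m f u (grad_from_power q u W) eta =
  (LI z. fd eta z (f (fst z) *\<^sub>R pflux p q (u z) (W z), - (f (fst z) * u z)))"
 unfolding weak_form_def set_lebesgue_integral_def
proof (rule lebesgue_integral_cong_AE)
 show "AE z in lebesgue. indicat_real S_inf z *\<^sub>R
   ((- u z * time_deriv eta z + (u z powr (m - 1) * norm (grad_from_power q u W z) powr (p - 2)) *\<^sub>R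
    grad_from_power q u W z \<bullet> space_grad eta z) * f (fst z)) =
  fd eta z (f (fst z) *\<^sub>R pflux p q (u z) (W z), - (f (fst z) * u z))"
  using u
 proof eventually_elim
  case (elim z)
  show ?case
  proof (cases "z : S_inf")
   case True
   hence "u z >= 0" using elim by simp
   from flux_eq_pflux[of p q m u z W, OF p q this] True show ?thesis
    by (simp add: frechet_derivative_space_time[OF C1_tests_linear[OF eta]] algebra_simps)
  next
   case False
   thus ?thesis using C1_tests_outside[OF eta] by simp
  qed
 qed
qed

lemma has_weak_time_derivD:
 assumes "has_weak_time_deriv u ut"
 shows "has_weak_deriv S_inf (0, 1) u ut"
 unfolding has_weak_deriv_def
proof (intro conjI ballI)
 show "locally_integrable S_inf u" "locally_integrable S_inf ut"
  using assms by (auto simp: has_weak_time_deriv_def)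
 fix eta :: "'a \<times> real => real" assume eta: "eta : test_functions S_inf"
 note out = C1_tests_outside[OF test_functions_C1_tests[OF eta]]
 have "(LINT z:S_inf|lebesgue. u z * time_deriv eta z) = - (LINT z:S_inf|lebesgue. eta z * ut z)"
  using assms eta by (simp add: has_weak_time_deriv_def)
 moreover have "(LINT z:S_inf|lebesgue. u z * time_deriv eta z) = (LI z. u z * time_deriv eta z)"
  using out by (intro set_lebesgue_integral_eq_UNIV) (simp add: time_deriv_def)
 moreover have "(LINT z:S_inf|lebesgue. eta z * ut z) = (LI z. eta z * ut z)"
  using out by (intro set_lebesgue_integral_eq_UNIV) simp
 ultimately show "(LI z. u z * fd eta z (0, 1)) = - (LI z. ut z * eta z)"
  by (simp add: time_deriv_def mult.commute)
qed

lemma test_functions_grad_integrable: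
 assumes a: "locally_integrable S a" and eta: "eta : C1_tests S"
 shows "L1 (%z. a z * fd eta z v)" and "L1 (%z. a z * eta z)"
proof -
 obtain K B where K: "C_k 1 eta" "compact K" "K \<subseteq> S" "!!z. z \<notin> K ==> eta z = 0"
  "!!z. z \<notin> K ==> fd eta z = (%v. 0)" "B >= 0" "!!z. \<bar>eta z\<bar> <= B"
  "!!z v. \<bar>fd eta z v\<bar> <= B * norm v" "!!z. linear (fd eta z)"
  by (rule C1_testsE[OF eta]) (rule that)
 have c: "conton eta" "conton (%z. fd eta z v)"
  using C_k_imp_continuous_on[OF K(1)] K(1) by auto
 show "L1 (%z. a z * fd eta z v)"
  by (rule locally_integrable_mult[OF a K(2,3) _ K(8)])
   (use K(5) c in "auto intro: borel_measurable_lebesgue borel_measurable_continuous_onI")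
 show "L1 (%z. a z * eta z)"
  by (rule locally_integrable_mult[OF a K(2,3) _ K(7) K(4)])
   (use c in "auto intro: borel_measurable_lebesgue borel_measurable_continuous_onI")
qed

lemma has_weak_space_gradD:
 fixes w :: "'a::euclidean_space \<times> real => real"
 assumes "has_weak_space_grad w W" and i: "i : Basis"
 shows "has_weak_deriv S_inf (i, 0) w (%z. W z \<bullet> i)"
 unfolding has_weak_deriv_def
proof (intro conjI ballI)
 show w: "locally_integrable S_inf w" using assms by (auto simp: has_weak_space_grad_def)
 have W: "locally_integrable S_inf W" using assms by (auto simp: has_weak_space_grad_def)
 show Wi: "locally_integrable S_inf (%z. W z \<bullet> j)" for j
  unfolding locally_integrable_def
 proof (intro allI impI)
  fix K :: "('a \<times> real) set" assume "compact K \<and> K \<subseteq> S_inf"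
  hence "L1 (%z. indicator K z *\<^sub>R W z)" using locally_integrableD[OF W] by blast
  from integrable_inner_left[OF this, of j] show "(%z. W z \<bullet> j) absolutely_integrable_on K"
   by (simp add: set_integrable_def)
 qed
 fix eta :: "'a \<times> real => real" assume eta: "eta : test_functions S_inf"
 have eta1: "eta : C1_tests S_inf" using test_functions_C1_tests[OF eta] .
 note out = C1_tests_outside[OF eta1]
 have "(LINT z:S_inf|lebesgue. w z *\<^sub>R space_grad eta z) = - (LINT z:S_inf|lebesgue. eta z *\<^sub>R W z)"
  using assms eta by (simp add: has_weak_space_grad_def)
 moreover have "(LINT z:S_inf|lebesgue. w z *\<^sub>R space_grad eta z) = (LI z. w z *\<^sub>R space_grad eta z)"
  using out by (intro set_lebesgue_integral_eq_UNIV) (simp add: space_grad_def)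
 moreover have "(LINT z:S_inf|lebesgue. eta z *\<^sub>R W z) = (LI z. eta z *\<^sub>R W z)"
  using out by (intro set_lebesgue_integral_eq_UNIV) simp
 ultimately have eq: "(LI z. w z *\<^sub>R space_grad eta z) \<bullet> i = - ((LI z. eta z *\<^sub>R W z) \<bullet> i)"
  by simp
 have comp: "v = (\<Sum>j\<in>Basis. (v \<bullet> j) *\<^sub>R j)" for v :: 'a by (simp add: euclidean_representation)
 have i1: "L1 (%z. w z *\<^sub>R space_grad eta z)"
  unfolding space_grad_def scaleR_sum_right scaleR_scaleR
  by (intro Bochner_Integration.integrable_sum integrable_scaleR_left test_functions_grad_integrable[OF w eta1])
 have i2: "L1 (%z. eta z *\<^sub>R W z)"
 proof -
  have "L1 (%z. \<Sum>j\<in>Basis. ((W z \<bullet> j) * eta z) *\<^sub>R j)"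
   by (intro Bochner_Integration.integrable_sum integrable_scaleR_left test_functions_grad_integrable[OF Wi eta1])
  moreover have "(%z. \<Sum>j\<in>Basis. ((W z \<bullet> j) * eta z) *\<^sub>R j) = (%z. eta z *\<^sub>R W z)"
   by (subst (2) comp[of "W _"]) (simp add: scaleR_sum_right mult.commute)
  ultimately show ?thesis by simp
 qed
 have si: "space_grad eta z \<bullet> i = fd eta z (i, 0)" for z
  using i by (simp add: space_grad_def inner_sum_left inner_Basis if_distrib sum.delta cong: if_cong)
 have "(LI z. w z *\<^sub>R space_grad eta z) \<bullet> i = (LI z. (w z *\<^sub>R space_grad eta z) \<bullet> i)"
  using i1 by (intro integral_inner_left[symmetric])
 moreover have "(LI z. eta z *\<^sub>R W z) \<bullet> i = (LI z. (eta z *\<^sub>R W z) \<bullet> i)"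
  using i2 by (intro integral_inner_left[symmetric])
 ultimately show "(LI z. w z * fd eta z (i, 0)) = - (LI z. (W z \<bullet> i) * eta z)"
  using eq by (simp add: si mult.commute)
qed

section \<open>Local integrability of the weighted flux, and the time derivative moved off the
  test\<close>

lemma locally_integrable_measurable:
 assumes "locally_integrable S B" "compact K" "K \<subseteq> S"
 shows "(%z. indicator K z *\<^sub>R B z) : lebm"
 using locally_integrableD[OF assms] by auto

lemma locally_integrable_real_measurable:
 fixes a :: "'b::euclidean_space => real"
 assumes "locally_integrable S a" "compact K" "K \<subseteq> S"
 shows "(%z. indicator K z * a z) : lebm"
 using locally_integrable_measurable[OF assms] by simp

lemma sets_lebesgue_compact: "compact K ==> (K :: 'b::euclidean_space set) : sets lebesgue"
 by (intro sets_completionI_sets) (simp add: borel_compact)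

lemma locally_integrable_bound:
 fixes B :: "'b::euclidean_space => 'c::euclidean_space" and g :: "'b => real"
 assumes g: "!!K. compact K ==> K \<subseteq> S ==> L1 (%z. indicator K z * g z)"
  and m: "!!K. compact K ==> K \<subseteq> S ==> (%z. indicator K z *\<^sub>R B z) : lebm"
  and b: "!!K. compact K ==> K \<subseteq> S ==> \<exists>C\<ge>0. \<forall>z\<in>K. norm (B z) <= C * g z"
 shows "locally_integrable S B"
 unfolding locally_integrable_def set_integrable_def
proof (intro allI impI, elim conjE)
 fix K assume K: "compact K" "K \<subseteq> S"
 obtain C where C: "!!z. z : K ==> norm (B z) <= C * g z" using b[OF K] by blast
 show "L1 (%z. indicator K z *\<^sub>R B z)"
 proof (rule Lint_bound[of _ "%z. C * (indicator K z * g z)"])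
  show "L1 (%z. C * (indicator K z * g z))" using g[OF K] by simp
  show "AE z in lebesgue. norm (indicat_real K z *\<^sub>R B z) <= norm (C * (indicator K z * g z))"
  proof (intro always_eventually allI)
   fix z
   show "norm (indicat_real K z *\<^sub>R B z) <= norm (C * (indicator K z * g z))"
    using C[of z] abs_ge_self[of "C * g z"] by (cases "z : K") (auto simp: abs_mult)
  qed
 qed (rule m[OF K])
qed

lemma integrable_indicator_compact:
 "compact K ==> L1 (%z::'b::euclidean_space. indicator K z * (c :: real))"
proof (intro integrable_mult_left integrable_real_indicator)
 assume "compact K"
 thus "K : sets lebesgue" "emeasure lebesgue K < \<infinity>"
  using sets_lebesgue_compact[of K] emeasure_compact_finite[of K]
  by (auto simp: emeasure_completion borel_compact)
qed

lemma locally_integrable_abs_add: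
 fixes a b :: "'b::euclidean_space => real"
 assumes "locally_integrable S a" "locally_integrable S b" "compact K" "K \<subseteq> S"
 shows "L1 (%z. indicator K z * (\<bar>a z\<bar> + \<bar>b z\<bar>))"
proof -
 have "L1 (%z. \<bar>indicator K z *\<^sub>R a z\<bar> + \<bar>indicator K z *\<^sub>R b z\<bar>)"
  by (intro Lint_add integrable_abs locally_integrableD[OF assms(1,3,4)]
    locally_integrableD[OF assms(2,3,4)])
 moreover have "(%z. \<bar>indicator K z *\<^sub>R a z\<bar> + \<bar>indicator K z *\<^sub>R b z\<bar>) = (%z. indicator K z * (\<bar>a z\<bar> + \<bar>b z\<bar>))"
  by (auto simp: fun_eq_iff abs_mult distrib_left)
 ultimately show ?thesis by simp
qed

lemma space_weight_bounded:
 fixes f :: "'a::euclidean_space => real"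
 assumes f: "conton f" and K: "compact (K :: ('a \<times> real) set)"
 obtains C where "C >= 0" "!!z. z : K ==> \<bar>f (fst z)\<bar> <= C"
proof -
 have "continuous_on K (%z. f (fst z))"
  by (intro continuous_on_compose2[OF f] continuous_intros) auto
 hence "bounded ((%z. f (fst z)) ` K)" by (intro compact_imp_bounded compact_continuous_image K)
 then obtain C where "\<forall>z\<in>K. \<bar>f (fst z)\<bar> <= C" by (auto simp: bounded_iff)
 hence "\<bar>f (fst z)\<bar> <= max 0 C" if "z : K" for z using that by (force simp: max_def)
 thus ?thesis using that[of "max 0 C"] by simp
qed

lemma space_weight_measurable:
 fixes f :: "'a::euclidean_space => real"
 assumes "conton f"
 shows "(%z::'a \<times> real. f (fst z)) : borm"
 by (intro borel_measurable_continuous_onI continuous_on_compose2[OF assms] continuous_intros) auto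

lemma locally_integrable_weight:
 fixes f :: "'a::euclidean_space => real" and a :: "'a \<times> real => real"
 assumes f: "conton f" and a: "locally_integrable S a"
 shows "locally_integrable S (%z. f (fst z) * a z)"
proof (rule locally_integrable_bound[where g="%z. \<bar>a z\<bar> + \<bar>a z\<bar>"])
 fix K :: "('a \<times> real) set" assume K: "compact K" "K \<subseteq> S"
 show "L1 (%z. indicator K z * (\<bar>a z\<bar> + \<bar>a z\<bar>))"
  using locally_integrable_abs_add[OF a a K] .
 have "(%z. f (fst z) * (indicator K z * a z)) : lebm"
  using locally_integrable_real_measurable[OF a K] borel_measurable_lebesgue[OF space_weight_measurable[OF f]]
  by measurable
 thus "(%z. indicator K z *\<^sub>R (f (fst z) * a z)) : lebm"
  by (simp add: mult.left_commute)
 obtain C where C: "C >= 0" "!!z. z : K ==> \<bar>f (fst z)\<bar> <= C" by (rule space_weight_bounded[OF f K(1)]) (rule that)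
 have "norm (f (fst z) * a z) <= C * (\<bar>a z\<bar> + \<bar>a z\<bar>)" if "z : K" for z
  using mult_mono[OF C(2)[OF that], of "\<bar>a z\<bar>" "\<bar>a z\<bar> + \<bar>a z\<bar>"] C(1) by (simp add: abs_mult)
 thus "\<exists>C\<ge>0. \<forall>z\<in>K. norm (f (fst z) * a z) <= C * (\<bar>a z\<bar> + \<bar>a z\<bar>)" using C(1) by blast
qed

lemma pflux_measurable:
 fixes W :: "'a::euclidean_space \<times> real => 'a"
 assumes u: "locally_integrable S u" and W: "locally_integrable S W" and K: "compact K" "K \<subseteq> S"
 shows "(%z. indicator K z *\<^sub>R pflux p q (u z) (W z)) : lebm"
proof -
 note [measurable] = locally_integrable_real_measurable[OF u K] locally_integrable_measurable[OF W K]
  sets_lebesgue_compact[OF K(1)]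
 have "(%z. pflux p q (indicator K z * u z) (indicator K z *\<^sub>R W z)) : lebm"
  unfolding pflux_def by measurable
 moreover have "pflux p q (indicator K z * u z) (indicator K z *\<^sub>R W z) = indicator K z *\<^sub>R pflux p q (u z) (W z)" for z
  by (auto simp: pflux_def indicator_def)
 ultimately show ?thesis by simp
qed

text \<open>The flux is of order |W|^(p-1), so its power p/(p-1) is of order |W|^p: this is the dual
  integrability that the nonlinear tests require.\<close>

lemma pflux_locally_integrable:
 fixes W :: "'a::euclidean_space \<times> real => 'a"
 assumes p: "p > 1" and f: "conton f" and u: "locally_integrable S u"
  and W: "locally_integrable S W" and Wp: "locally_integrable S (%z. norm (W z) powr p)"
 shows "locally_integrable S (%z. f (fst z) *\<^sub>R pflux p q (u z) (W z))"
  and "locally_integrable S (%z. norm (f (fst z) *\<^sub>R pflux p q (u z) (W z)) powr (p / (p - 1)))"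
proof -
 have g: "L1 (%z. indicator K z * (1 + norm (W z) powr p))" if K: "compact K" "K \<subseteq> S" for K
  using Lint_add[OF integrable_indicator_compact[OF K(1), of 1] locally_integrableD[OF Wp K]]
  by (simp add: distrib_left)
 have m: "(%z. indicator K z *\<^sub>R (f (fst z) *\<^sub>R pflux p q (u z) (W z))) : lebm"
  if K: "compact K" "K \<subseteq> S" for K
 proof -
  have "(%z. f (fst z) *\<^sub>R (indicat_real K z *\<^sub>R pflux p q (u z) (W z))) : lebm"
   using pflux_measurable[OF u W K] borel_measurable_lebesgue[OF space_weight_measurable[OF f]] by measurable
  thus ?thesis by (simp add: mult.commute)
 qed
 have b1: "norm (f (fst z) *\<^sub>R pflux p q (u z) (W z)) <= C * q powr (1 - p) * norm (W z) powr (p - 1)"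
  if "\<bar>f (fst z)\<bar> <= C" for C z
 proof -
  have "C >= 0" using that by linarith
  with mult_mono[OF that norm_pflux_le[OF p, of q "u z" "W z"]] show ?thesis by (simp add: mult.assoc)
 qed
 show "locally_integrable S (%z. f (fst z) *\<^sub>R pflux p q (u z) (W z))"
 proof (rule locally_integrable_bound[OF g m])
  fix K :: "('a \<times> real) set" assume K: "compact K" "K \<subseteq> S"
  obtain C where C: "C >= 0" "!!z. z : K ==> \<bar>f (fst z)\<bar> <= C" by (rule space_weight_bounded[OF f K(1)]) (rule that)
  have "norm (W z) powr (p - 1) <= 1 + norm (W z) powr p" for z
  proof (cases "norm (W z) <= 1")
   case True
   hence "norm (W z) powr (p - 1) <= 1 powr (p - 1)" using p by (intro powr_mono2) auto
   thus ?thesis by (simp add: add_increasing2)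
  next
   case False
   hence "norm (W z) powr (p - 1) <= norm (W z) powr p" by (intro powr_mono) auto
   thus ?thesis by simp
  qed
  hence "norm (f (fst z) *\<^sub>R pflux p q (u z) (W z)) <= C * q powr (1 - p) * (1 + norm (W z) powr p)" if "z : K" for z
   using C(1) by (intro order_trans[OF b1[OF C(2)[OF that]]] mult_left_mono) auto
  thus "\<exists>C\<ge>0. \<forall>z\<in>K. norm (f (fst z) *\<^sub>R pflux p q (u z) (W z)) <= C * (1 + norm (W z) powr p)"
   using C(1) by (intro exI[of _ "C * q powr (1 - p)"]) auto
 qed
 show "locally_integrable S (%z. norm (f (fst z) *\<^sub>R pflux p q (u z) (W z)) powr (p / (p - 1)))"
 proof (rule locally_integrable_bound[OF g])
  fix K :: "('a \<times> real) set" assume K: "compact K" "K \<subseteq> S"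
  have "(%z. norm (indicat_real K z *\<^sub>R (f (fst z) *\<^sub>R pflux p q (u z) (W z))) powr (p / (p - 1))) : lebm"
   using m[OF K] by measurable
  moreover have "norm (indicat_real K z *\<^sub>R (f (fst z) *\<^sub>R pflux p q (u z) (W z))) powr (p / (p - 1)) =
    indicat_real K z *\<^sub>R (norm (f (fst z) *\<^sub>R pflux p q (u z) (W z)) powr (p / (p - 1)))" for z
   by (cases "z : K") auto
  ultimately show "(%z. indicat_real K z *\<^sub>R (norm (f (fst z) *\<^sub>R pflux p q (u z) (W z)) powr (p / (p - 1)))) : lebm"
   by (simp only:)
  obtain C where C: "C >= 0" "!!z. z : K ==> \<bar>f (fst z)\<bar> <= C" by (rule space_weight_bounded[OF f K(1)]) (rule that)
  let ?c = "C * q powr (1 - p)"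
  have "norm (norm (f (fst z) *\<^sub>R pflux p q (u z) (W z)) powr (p / (p - 1))) <= ?c powr (p / (p - 1)) * (1 + norm (W z) powr p)" if "z : K" for z
  proof -
   have "norm (f (fst z) *\<^sub>R pflux p q (u z) (W z)) powr (p / (p - 1)) <= (?c * norm (W z) powr (p - 1)) powr (p / (p - 1))"
    using b1[OF C(2)[OF that]] p by (intro powr_mono2) auto
   also have "... = ?c powr (p / (p - 1)) * norm (W z) powr p"
    using C(1) p by (subst powr_mult) (auto simp: powr_powr)
   also have "... <= ?c powr (p / (p - 1)) * (1 + norm (W z) powr p)" by (intro mult_left_mono) auto
   finally show ?thesis by simp
  qed
  thus "\<exists>C\<ge>0. \<forall>z\<in>K. norm (norm (f (fst z) *\<^sub>R pflux p q (u z) (W z)) powr (p / (p - 1))) <= C * (1 + norm (W z) powr p)"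
   by (intro exI[of _ "?c powr (p / (p - 1))"]) auto
 qed
qed

lemma locally_integrable_diff:
 fixes A B :: "'b::euclidean_space => 'c::euclidean_space"
 assumes "locally_integrable S A" "locally_integrable S B"
 shows "locally_integrable S (%z. A z - B z)"
 using assms by (auto simp: locally_integrable_def intro: set_integral_diff(1))

lemma locally_integrable_Pair:
 fixes A :: "'b::euclidean_space => 'c::euclidean_space" and b :: "'b => real"
 assumes "locally_integrable S A" "locally_integrable S b"
 shows "locally_integrable S (%z. (A z, b z))"
 unfolding locally_integrable_def set_integrable_def
proof (intro allI impI, elim conjE)
 fix K assume K: "compact K" "K \<subseteq> S"
 note iA = locally_integrableD[OF assms(1) K] and ib = locally_integrableD[OF assms(2) K]
 show "L1 (%z. indicat_real K z *\<^sub>R (A z, b z))"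
 proof (rule Lint_bound[of _ "%z. norm (indicat_real K z *\<^sub>R A z) + norm (indicat_real K z *\<^sub>R b z)"])
  show "L1 (%z. norm (indicat_real K z *\<^sub>R A z) + norm (indicat_real K z *\<^sub>R b z))"
   using iA ib by (intro Lint_add integrable_norm)
  have "(%z. (indicat_real K z *\<^sub>R A z, indicat_real K z *\<^sub>R b z)) : lebm"
   using iA ib by (intro borel_measurable_Pair) auto
  thus "(%z. indicat_real K z *\<^sub>R (A z, b z)) : lebm" by simp
  show "AE z in lebesgue. norm (indicat_real K z *\<^sub>R (A z, b z)) \<le>
    norm (norm (indicat_real K z *\<^sub>R A z) + norm (indicat_real K z *\<^sub>R b z))"
  proof (intro always_eventually allI)
   fix z
   show "norm (indicat_real K z *\<^sub>R (A z, b z)) \<le>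
    norm (norm (indicat_real K z *\<^sub>R A z) + norm (indicat_real K z *\<^sub>R b z))"
    using norm_Pair_le[of "indicat_real K z *\<^sub>R A z" "indicat_real K z *\<^sub>R b z"] by simp
  qed
 qed
qed

lemma locally_integrable_const_mult:
 "locally_integrable S a ==> locally_integrable S (%z. - a z)"
 by (auto simp: locally_integrable_def set_integrable_def)

lemma locally_integrable_zero: "locally_integrable S (%z. 0)"
 by (auto simp: locally_integrable_def set_integrable_def)

text \<open>The sign \<sigma> treats both directions of the inequality together. A locally
  integrable u_t lets the time derivative move from eta to u; afterwards eta is differentiated in
  space only, which is what tests built from u can afford.\<close>

lemma weak_form_time_derivative:
 fixes u :: "'a::euclidean_space \<times> real => real" and W :: "'a \<times> real => 'a"
 assumes p: "p > 1" and q: "q = grad_exponent p m" "q > 0" and f: "conton f"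
  and u: "AE z in lebesgue. z : S_inf --> 0 <= u z" and ut: "has_weak_time_deriv u ut"
  and W: "locally_integrable S_inf W" and Wp: "locally_integrable S_inf (%z. norm (W z) powr p)"
  and \<sigma>: "\<bar>\<sigma>\<bar> = 1"
  and ineq: "!!eta. eta : test_functions S_inf ==> (!!z. 0 <= eta z) ==>
   0 <= \<sigma> * weak_form p m f u (grad_from_power q u W) eta"
  and eta: "eta : C1_tests S_inf" "!!z. 0 <= eta z"
 shows "L1 (%z. f (fst z) * ut z * eta z + fd eta z (f (fst z) *\<^sub>R pflux p q (u z) (W z), 0))"
  and "0 <= \<sigma> * (LI z. f (fst z) * ut z * eta z + fd eta z (f (fst z) *\<^sub>R pflux p q (u z) (W z), 0))"
proof -
 have wd: "has_weak_deriv S_inf (0, 1) u ut" using has_weak_time_derivD[OF ut] .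
 have ul: "locally_integrable S_inf u" "locally_integrable S_inf ut" using wd by (auto simp: has_weak_deriv_def)
 let ?F = "%z. f (fst z) *\<^sub>R pflux p q (u z) (W z)"
 have Fl: "locally_integrable S_inf ?F" using pflux_locally_integrable(1)[OF p f ul(1) W Wp] .
 have fu: "locally_integrable S_inf (%z. f (fst z) * u z)" using locally_integrable_weight[OF f ul(1)] .
 define B where "B z = \<sigma> *\<^sub>R (?F z, - (f (fst z) * u z))" for z
 have lin: "linear (fd eta z)" if "eta : C1_tests S_inf" for eta :: "'a \<times> real => real" and z
  using C1_tests_linear[OF that] .
 have Bl: "locally_integrable S_inf B"
  using locally_integrable_Pair[OF Fl locally_integrable_const_mult[OF fu]]
  unfolding B_def by (auto simp: locally_integrable_def simp del: scaleR_Pair)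
 \<comment> \<open>The time derivative of eta is paired with the last component of B, so the
   coefficient of order zero is 0.\<close>
 have ineq': "0 <= (LI z. 0 * eta z + fd eta z (B z))"
  if "eta : test_functions S_inf" "!!z. 0 <= eta z" for eta
 proof -
  have "eta : C1_tests S_inf" using test_functions_C1_tests[OF that(1)] .
  thus ?thesis using ineq[OF that] weak_form_eq[OF p q u \<open>eta : C1_tests S_inf\<close>, of f W]
   by (simp add: B_def linear_scale[OF lin] del: scaleR_Pair)
 qed
 have "0 <= (LI z. 0 * eta z + fd eta z (B z))"
  by (rule weak_inequality_C1_tests[OF open_S_inf locally_integrable_zero Bl ineq' eta])
 hence 1: "0 <= \<sigma> * (LI z. fd eta z (?F z, - (f (fst z) * u z)))"
  by (simp add: B_def linear_scale[OF lin[OF eta(1)]] del: scaleR_Pair)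
 have split: "fd eta z (x, s) = fd eta z (x, 0) + s * fd eta z (0, 1)" for x s z
  using linear_add[OF lin[OF eta(1)], of z "(x, 0)" "s *\<^sub>R (0, 1)"] linear_scale[OF lin[OF eta(1)], of z s "(0, 1)"] by simp
 have iF: "L1 (%z. fd eta z (?F z, 0))"
 proof -
  obtain K B where K: "C_k 1 eta" "compact K" "K \<subseteq> S_inf" "!!z. z \<notin> K ==> eta z = 0"
   "!!z. z \<notin> K ==> fd eta z = (%v. 0)" "B >= 0" "!!z. \<bar>eta z\<bar> <= B"
   "!!z v. \<bar>fd eta z v\<bar> <= B * norm v" "!!z. linear (fd eta z)"
   by (rule C1_testsE[OF eta(1)]) (rule that)
  from weak_integrand(4)[OF locally_integrable_zero locally_integrable_Pair[OF Fl locally_integrable_zero] K(2,3,1,4,7,8)]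
  show ?thesis by simp
 qed
 note chain = weak_chain_rule[OF open_S_inf wd eta(1) space_weight_measurable[OF f], where k="%_. 1" and M=1 and \<Phi>="%s. s"]
 have bdf: "\<exists>C. \<forall>z\<in>K. \<bar>f (fst z)\<bar> <= C" if "compact K" for K :: "('a \<times> real) set"
  using space_weight_bounded[OF f that] by metis
 have iu: "L1 (%z. f (fst z) * eta z * 1 * ut z)"
  "L1 (%z. f (fst z) * fd eta z (0, 1) * u z)"
  "(LI z. f (fst z) * eta z * 1 * ut z) = - (LI z. f (fst z) * fd eta z (0, 1) * u z)"
  using chain bdf by auto
 have i1: "L1 (%z. f (fst z) * ut z * eta z)" using iu(1) by (simp add: mult_ac)
 show "L1 (%z. f (fst z) * ut z * eta z + fd eta z (?F z, 0))"
  using i1 iF by (rule Lint_add)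
 have "(LI z. fd eta z (?F z, - (f (fst z) * u z))) =
   (LI z. fd eta z (?F z, 0) - f (fst z) * fd eta z (0, 1) * u z)"
  by (subst split) (simp add: mult_ac)
 also have "... = (LI z. fd eta z (?F z, 0)) -
   (LI z. f (fst z) * fd eta z (0, 1) * u z)"
  using iF iu(2) by (rule Bochner_Integration.integral_diff)
 also have "... = (LI z. f (fst z) * ut z * eta z) + (LI z. fd eta z (?F z, 0))"
  using iu(3) by (simp add: mult_ac)
 also have "... = (LI z. f (fst z) * ut z * eta z + fd eta z (?F z, 0))"
  using i1 iF by (rule Bochner_Integration.integral_add[symmetric])
 finally show "0 <= \<sigma> * (LI z. f (fst z) * ut z * eta z + fd eta z (?F z, 0))"
  using 1 by simp
qed

subsection \<open>Approximation of the positive sign function\<close>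

text \<open>For s > 0 it equals its derivative times s (1 + s^2) / 2. Hence h^p / (h')^(p-1), the
  quantity that Young's inequality leaves behind, is of order s^(p+1) near 0.\<close>

definition sgn_approx :: "real => real" where
 "sgn_approx s = (max 0 s)\<^sup>2 / (1 + (max 0 s)\<^sup>2)"

definition sgn_approx' :: "real => real" where
 "sgn_approx' s = 2 * max 0 s / (1 + (max 0 s)\<^sup>2)\<^sup>2"

lemma max_0_square_has_derivative: "((%s::real. (max 0 s)\<^sup>2) has_real_derivative 2 * max 0 s) (at s)"
proof (cases s "0 :: real" rule: linorder_cases)
 case less
 have "((%s::real. 0) has_real_derivative 0) (at s)" by simp
 hence "((%s::real. (max 0 s)\<^sup>2) has_real_derivative 0) (at s)"
  by (rule has_field_derivative_transform_within_open[of _ _ _ "{..<0}"]) (use less in auto)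
 thus ?thesis using less by simp
next
 case greater
 have "((%s::real. s\<^sup>2) has_real_derivative 2 * s) (at s)" by (auto intro!: derivative_eq_intros)
 hence "((%s::real. (max 0 s)\<^sup>2) has_real_derivative 2 * s) (at s)"
  by (rule has_field_derivative_transform_within_open[of _ _ _ "{0<..}"]) (use greater in auto)
 thus ?thesis using greater by simp
next
 case equal
 have "(%h::real. ((max 0 (0 + h))\<^sup>2 - (max 0 0)\<^sup>2) / h) \<midarrow>0\<rightarrow> 0"
 proof (rule Lim_null_comparison)
  show "((%h::real. \<bar>h\<bar>) \<longlongrightarrow> 0) (at 0)" by (auto intro!: tendsto_eq_intros)
  show "\<forall>\<^sub>F h in at 0. norm (((max 0 (0 + h))\<^sup>2 - (max 0 0)\<^sup>2) / h) <= \<bar>h :: real\<bar>"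
   by (intro always_eventually allI) (auto simp: max_def power2_eq_square)
 qed
 thus ?thesis using equal by (simp add: DERIV_def)
qed

lemma one_plus_square_neq_0: "1 + (x::real)\<^sup>2 ~= 0"
 by (metis add_pos_nonneg less_numeral_extra(1,3) zero_le_power2)

lemma sgn_approx_has_derivative: "(sgn_approx has_real_derivative sgn_approx' s) (at s)"
proof -
 have "((%s. (max 0 s)\<^sup>2 / (1 + (max 0 s)\<^sup>2)) has_real_derivative
   ((2 * max 0 s) * (1 + (max 0 s)\<^sup>2) - (max 0 s)\<^sup>2 * (0 + 2 * max 0 s)) / ((1 + (max 0 s)\<^sup>2) * (1 + (max 0 s)\<^sup>2))) (at s)"
  by (intro DERIV_divide DERIV_add DERIV_const max_0_square_has_derivative one_plus_square_neq_0)
 also have "((2 * max 0 s) * (1 + (max 0 s)\<^sup>2) - (max 0 s)\<^sup>2 * (0 + 2 * max 0 s)) / ((1 + (max 0 s)\<^sup>2) * (1 + (max 0 s)\<^sup>2)) = sgn_approx' s"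
  by (simp add: sgn_approx'_def power2_eq_square algebra_simps)
 finally show ?thesis unfolding sgn_approx_def[abs_def] .
qed

lemma sgn_approx'_continuous: "continuous_on A sgn_approx'"
 unfolding sgn_approx'_def[abs_def]
 using one_plus_square_neq_0 by (intro continuous_intros) auto

lemma sgn_approx_range: "0 <= sgn_approx s" "sgn_approx s <= 1"
 by (auto simp: sgn_approx_def divide_le_eq add_pos_nonneg)

lemma sgn_approx_nonpos: "s <= 0 ==> sgn_approx s = 0" "s <= 0 ==> sgn_approx' s = 0"
 by (auto simp: sgn_approx_def sgn_approx'_def)

lemma sgn_approx'_range: "0 <= sgn_approx' s" "sgn_approx' s <= 2"
proof -
 show "0 <= sgn_approx' s" by (simp add: sgn_approx'_def)
 define y where "y = max 0 s"
 have "y * 2 <= 1 + y\<^sup>2" using sum_squares_bound[of y 1] by (simp add: power2_eq_square)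
 also have "1 + y\<^sup>2 <= (1 + y\<^sup>2)\<^sup>2" by (rule self_le_power) auto
 finally have "2 * y <= 2 * (1 + y\<^sup>2)\<^sup>2" by (simp add: y_def)
 thus "sgn_approx' s <= 2" by (simp add: sgn_approx'_def y_def[symmetric] divide_le_eq add_pos_nonneg)
qed

lemma sgn_approx_eq: "s > 0 ==> sgn_approx s = sgn_approx' s * (s * (1 + s\<^sup>2) / 2)"
 using one_plus_square_neq_0[of s]
 by (simp add: sgn_approx_def sgn_approx'_def power2_eq_square divide_simps)

lemma sgn_approx_le_square: "s >= 0 ==> sgn_approx s <= s\<^sup>2"
 by (simp add: sgn_approx_def divide_le_eq add_pos_nonneg mult_le_cancel_left1)

definition sgn_eps :: "nat => real => real" where
 "sgn_eps n s = sgn_approx (real (Suc n) * s)"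

definition sgn_eps' :: "nat => real => real" where
 "sgn_eps' n s = real (Suc n) * sgn_approx' (real (Suc n) * s)"

lemma sgn_eps_has_derivative: "(sgn_eps n has_real_derivative sgn_eps' n s) (at s)"
proof -
 have "((%s. real (Suc n) * s) has_real_derivative real (Suc n)) (at s)"
  by (auto intro!: derivative_eq_intros)
 from DERIV_chain2[OF sgn_approx_has_derivative this]
 show ?thesis by (simp add: sgn_eps_def[abs_def] sgn_eps'_def mult.commute)
qed

lemma sgn_eps'_continuous: "conton (sgn_eps' n)"
 unfolding sgn_eps'_def[abs_def]
 by (intro continuous_intros continuous_on_compose2[OF sgn_approx'_continuous[of UNIV]]) auto

lemma sgn_eps_continuous: "conton (sgn_eps n)"
 using sgn_eps_has_derivative DERIV_isCont continuous_at_imp_continuous_on by blast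

lemma sgn_eps_range: "0 <= sgn_eps n s" "sgn_eps n s <= 1" "0 <= sgn_eps' n s"
 "\<bar>sgn_eps' n s\<bar> <= 2 * real (Suc n)" "\<bar>sgn_eps n s\<bar> <= 1"
 using sgn_approx_range[of "real (Suc n) * s"] sgn_approx'_range[of "real (Suc n) * s"]
  mult_left_mono[of "sgn_approx' (real (Suc n) * s)" 2 "real (Suc n)"]
 by (auto simp: sgn_eps_def sgn_eps'_def abs_mult)

lemma sgn_eps_nonpos: "s <= 0 ==> sgn_eps n s = 0" "s <= 0 ==> sgn_eps' n s = 0"
 by (auto simp: sgn_eps_def sgn_eps'_def mult_nonneg_nonpos intro!: sgn_approx_nonpos)

lemma sgn_eps_tendsto: "(%n. sgn_eps n s) ~~> (if s > 0 then 1 else 0)"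
proof (cases "s > 0")
 case True
 have "(%n. 1 - sgn_eps n s) ~~> 0"
 proof (rule Lim_null_comparison)
  show "(%n. (1 / s) * (1 / real (Suc n))) ~~> 0"
   using tendsto_mult_right_zero[OF LIMSEQ_Suc[OF lim_1_over_n], of "1 / s"] by simp
  show "\<forall>\<^sub>F n in sequentially. norm (1 - sgn_eps n s) <= (1 / s) * (1 / real (Suc n))"
  proof (intro always_eventually allI)
   fix n
   define y where "y = real (Suc n) * s"
   have y: "y > 0" using True by (simp add: y_def)
   have "1 - sgn_eps n s = 1 / (1 + y\<^sup>2)"
    unfolding sgn_eps_def sgn_approx_def y_def[symmetric]
    using y one_plus_square_neq_0[of y] by (simp add: divide_simps)
   also have "... <= 1 / y"
   proof (rule divide_left_mono)
    show "y <= 1 + y\<^sup>2" using sum_squares_bound[of y 1] y by (simp add: power2_eq_square)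
    show "0 < (1 + y\<^sup>2) * y" using y by (intro mult_pos_pos) (auto simp: add_pos_nonneg)
   qed simp
   finally show "norm (1 - sgn_eps n s) <= (1 / s) * (1 / real (Suc n))"
    using sgn_eps_range(2)[of n s] True by (simp add: y_def field_simps)
  qed
 qed
 from tendsto_diff[OF tendsto_const[of 1] this] show ?thesis using True by simp
qed (simp add: sgn_eps_nonpos)

text \<open>Instead of optimising constants, split into b <= X a, where the first term suffices, and
  X < b/a, where the second does.\<close>

lemma young_absorb:
 fixes X a b p :: real
 assumes p: "p > 1" and X: "X >= 0" and a: "a > 0" and b: "b >= 0"
 shows "X powr (p - 1) * b <= X powr p * a + b powr p / a powr (p - 1)"
proof (cases "b <= X * a")
 case True
 have "X powr (p - 1) * b <= X powr (p - 1) * (X * a)" using True by (intro mult_left_mono) auto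
 also have "... = X powr p * a"
  using X p powr_add[of X "p - 1" 1] by (cases "X = 0") auto
 finally show ?thesis using b a by (simp add: add_increasing2)
next
 case False
 hence "X <= b / a" using a by (simp add: pos_le_divide_eq)
 hence "X powr (p - 1) * b <= (b / a) powr (p - 1) * b"
  using X p b by (intro mult_right_mono powr_mono2) auto
 also have "... = b powr p / a powr (p - 1)"
  using b a p powr_add[of b "p - 1" 1] by (cases "b = 0") (auto simp: powr_divide)
 finally show ?thesis using X a by (simp add: add_increasing)
qed

text \<open>The choice of the approximation of the sign makes the remainder of Young's inequality
 integrable: it is of the order of \<open>u\<close> although the weight of the cutoff region is huge.\<close>

lemma flux_cutoff_bound:
 assumes p: "p > 1" and q: "q > 0" "p * q >= 1" and U: "U > 0" and A: "A >= 0"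
 obtains C where "C >= 0" "!!u (W::'a::euclidean_space) D zt c. 0 < u ==> u <= U ==> 0 <= zt ==> 0 <= c ==>
  norm D powr p <= c * zt powr (p - 1) ==>
  - (C * c * u) <= pflux p q u W \<bullet> ((sgn_eps' n (u powr q) * zt) *\<^sub>R W + sgn_eps n (u powr q) *\<^sub>R D)"
proof -
 define N where "N = real (Suc n)"
 have N: "N >= 1" by (simp add: N_def)
 \<comment> \<open>The largest value that y = N u^q can take for u <= U.\<close>
 define Y where "Y = N * U powr q"
 have Y: "Y > 0" using N U by (simp add: Y_def)
 define C1 where "C1 = Y * ((1 + Y\<^sup>2) / 2) powr (p - 1) * N powr p * U powr (p * q - 1)"
 have C1: "C1 >= 0" using Y by (simp add: C1_def)
 show ?thesis
 proof (rule that[of "q powr (1 - p) * C1"])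
  show "q powr (1 - p) * C1 >= 0" using C1 by simp
  fix u zt c :: real and W D :: 'a
  assume u: "0 < u" "u <= U" and zt: "0 <= zt" and c: "0 <= c" and D: "norm D powr p <= c * zt powr (p - 1)"
  let ?h = "sgn_eps n (u powr q)" and ?h' = "sgn_eps' n (u powr q)"
  define y where "y = N * u powr q"
  have y: "0 < y" "y <= Y" using N u q by (auto simp: y_def Y_def intro!: mult_left_mono powr_mono2)
  have h: "?h = sgn_approx y" "?h' = N * sgn_approx' y" by (auto simp: sgn_eps_def sgn_eps'_def y_def N_def)
  have h'pos: "sgn_approx' y > 0" unfolding sgn_approx'_def
   using y by (intro divide_pos_pos zero_less_power) (auto simp: add_pos_nonneg)
  show "- (q powr (1 - p) * C1 * c * u) <= pflux p q u W \<bullet> ((?h' * zt) *\<^sub>R W + ?h *\<^sub>R D)"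
  proof (cases "zt = 0")
   case True
   hence "D = 0" using D p by (auto simp: powr_eq_0_iff)
   thus ?thesis using True C1 c u by (simp add: mult_nonneg_nonneg)
  next
   case False
   hence zt0: "zt > 0" using zt by simp
   \<comment> \<open>The quotient is at most a constant times y^p = N^p u^(pq), and pq >= 1 lets all
     but one factor u be absorbed into U^(pq-1).\<close>
   have ratio: "?h powr p / ?h' powr (p - 1) <= C1 * u"
   proof -
    have "?h powr p = sgn_approx y * sgn_approx y powr (p - 1)"
     using powr_add[of "sgn_approx y" 1 "p - 1"] sgn_approx_range[of y] unfolding h
     by (cases "sgn_approx y = 0") auto
    also have "sgn_approx y powr (p - 1) = sgn_approx' y powr (p - 1) * (y * (1 + y\<^sup>2) / 2) powr (p - 1)"
     by (subst sgn_approx_eq[OF y(1)]) (rule powr_mult)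
    finally have "?h powr p / sgn_approx' y powr (p - 1) = sgn_approx y * (y * (1 + y\<^sup>2) / 2) powr (p - 1)"
     using h'pos by simp
    moreover have "?h powr p / ?h' powr (p - 1) <= ?h powr p / sgn_approx' y powr (p - 1)"
     unfolding h using h'pos N p
     by (intro divide_left_mono powr_mono2 mult_pos_pos) (auto simp: mult_le_cancel_right1)
    ultimately have "?h powr p / ?h' powr (p - 1) <= sgn_approx y * (y * (1 + y\<^sup>2) / 2) powr (p - 1)" by simp
    also have "... <= (Y * y) * (y powr (p - 1) * ((1 + Y\<^sup>2) / 2) powr (p - 1))"
    proof (rule mult_mono)
     have "sgn_approx y <= y\<^sup>2" using sgn_approx_le_square y by simp
     also have "... <= Y * y" using y by (simp add: power2_eq_square mult_right_mono)
     finally show "sgn_approx y <= Y * y" .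
     have "(y * (1 + y\<^sup>2) / 2) powr (p - 1) = y powr (p - 1) * ((1 + y\<^sup>2) / 2) powr (p - 1)"
      using y powr_mult[of y "(1 + y\<^sup>2) / 2" "p - 1"] by simp
     also have "... <= y powr (p - 1) * ((1 + Y\<^sup>2) / 2) powr (p - 1)"
      using y p by (intro mult_left_mono powr_mono2 divide_right_mono add_left_mono power_mono) auto
     finally show "(y * (1 + y\<^sup>2) / 2) powr (p - 1) <= y powr (p - 1) * ((1 + Y\<^sup>2) / 2) powr (p - 1)" .
    qed (use y Y sgn_approx_range in auto)
    also have "... = Y * ((1 + Y\<^sup>2) / 2) powr (p - 1) * y powr p"
     using y powr_add[of y 1 "p - 1"] by simp
    also have "y powr p = N powr p * u powr (p * q - 1) * u"
    proof -
     have "u powr (p * q) = u powr (p * q - 1) * u" using u powr_add[of u "p * q - 1" 1] by simp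
     thus ?thesis using N u by (simp add: y_def powr_mult powr_powr mult.commute)
    qed
    also have "Y * ((1 + Y\<^sup>2) / 2) powr (p - 1) * (N powr p * u powr (p * q - 1) * u) \<le>
      Y * ((1 + Y\<^sup>2) / 2) powr (p - 1) * (N powr p * U powr (p * q - 1) * u)"
     using u q Y by (intro mult_left_mono mult_right_mono powr_mono2) auto
    finally show ?thesis by (simp add: C1_def mult_ac)
   qed
   have a: "?h' * zt > 0" using h'pos N zt0 by (simp add: h)
   have hn: "?h >= 0" by (rule sgn_eps_range)
   have "(?h * norm D) powr p / (?h' * zt) powr (p - 1) = (?h powr p / ?h' powr (p - 1)) * (norm D powr p / zt powr (p - 1))"
    using a hn zt0 sgn_eps_range(3) by (simp add: powr_mult)
   also have "... <= (C1 * u) * c"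
    using D zt0 ratio C1 u c by (intro mult_mono) (auto simp: divide_le_eq)
   finally have rem: "(?h * norm D) powr p / (?h' * zt) powr (p - 1) <= C1 * u * c" .
   have "norm W powr (p - 1) * (?h * norm D) <= norm W powr p * (?h' * zt) + C1 * u * c"
    using young_absorb[OF p norm_ge_zero a, of "?h * norm D" W] hn rem by simp
   moreover have "pflux p q u W \<bullet> W = q powr (1 - p) * norm W powr p"
   proof -
    have "norm W powr (p - 2) * (norm W)\<^sup>2 = norm W powr p"
     using powr_add[of "norm W" "p - 2" 2] p by (cases "W = 0") (auto simp: powr_numeral)
    thus ?thesis using u by (simp add: pflux_def power2_norm_eq_inner[symmetric] mult.assoc)
   qed
   moreover have "pflux p q u W \<bullet> D >= - (q powr (1 - p) * (norm W powr (p - 1) * norm D))"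
   proof -
    have "\<bar>pflux p q u W \<bullet> D\<bar> <= norm (pflux p q u W) * norm D" by (rule Cauchy_Schwarz_ineq2)
    also have "... <= q powr (1 - p) * norm W powr (p - 1) * norm D"
     by (intro mult_right_mono norm_pflux_le p) auto
    finally show ?thesis by (simp add: mult.assoc)
   qed
   moreover have "pflux p q u W \<bullet> ((?h' * zt) *\<^sub>R W + ?h *\<^sub>R D) = (?h' * zt) * (pflux p q u W \<bullet> W) + ?h * (pflux p q u W \<bullet> D)"
    by (simp add: inner_add_right)
   ultimately have "pflux p q u W \<bullet> ((?h' * zt) *\<^sub>R W + ?h *\<^sub>R D) \<ge>
     (?h' * zt) * (q powr (1 - p) * norm W powr p) - ?h * (q powr (1 - p) * (norm W powr (p - 1) * norm D))"
    using mult_left_mono[OF _ hn, of "- (q powr (1 - p) * (norm W powr (p - 1) * norm D))" "pflux p q u W \<bullet> D"] by simp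
   also have "(?h' * zt) * (q powr (1 - p) * norm W powr p) - ?h * (q powr (1 - p) * (norm W powr (p - 1) * norm D)) =
     q powr (1 - p) * (norm W powr p * (?h' * zt) - norm W powr (p - 1) * (?h * norm D))"
    by (simp add: algebra_simps)
   also (xtrans) have "... >= q powr (1 - p) * (- (C1 * u * c))"
    using \<open>norm W powr (p - 1) * (?h * norm D) <= norm W powr p * (?h' * zt) + C1 * u * c\<close>
    by (intro mult_left_mono) auto
   finally show ?thesis by (simp add: mult_ac)
  qed
 qed
qed

subsection \<open>Integration over time slices\<close>

lemma AE_time_slices:
 fixes P :: "'a::euclidean_space \<times> real => bool"
 assumes "AE z in lebesgue. P z"
 shows "AE t in lborel. AE x in lborel. P (x, t)"
proof -
 have "AE z in lborel. P z" using assms by (simp add: AE_completion_iff)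
 then obtain N where N: "{z : space lborel. \<not> P z} \<subseteq> N" "emeasure lborel N = 0" "N : sets lborel"
  by (auto elim: AE_E)
 have "AE z in lborel \<Otimes>\<^sub>M lborel. z \<notin> N"
  using N by (intro AE_not_in) (auto simp: lborel_prod null_sets_def)
 hence "AE x in lborel. AE t in lborel. (x, t) \<notin> N"
  by (rule lborel_pair.AE_pair)
 moreover have [measurable]: "N : sets (lborel \<Otimes>\<^sub>M lborel)" by (subst lborel_prod) (rule N(3))
 have "(AE x in lborel. AE t in lborel. (x, t) \<notin> N) \<longleftrightarrow> (AE t in lborel. AE x in lborel. (x, t) \<notin> N)"
  by (rule lborel_pair.AE_commute) measurable
 ultimately have "AE t in lborel. AE x in lborel. (x, t) \<notin> N" by blast
 thus ?thesis
 proof eventually_elim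
  case (elim t)
  thus ?case by (rule eventually_mono) (use N(1) in auto)
 qed
qed

text \<open>Fubini's theorem for a Lebesgue measurable function: a Borel representative agrees with
  \<Phi> on almost every slice, and the uniform bound on slices over a bounded time interval gives
  integrability.\<close>

lemma slab_integral:
 fixes \<Phi> :: "'a::euclidean_space \<times> real => real"
 assumes \<Phi>: "\<Phi> : lebm"
  and sl: "!!t. t : {a..b} ==> L1 (%x. \<Phi> (x, t))"
  and bd: "!!t. t : {a..b} ==> (LI x. \<bar>\<Phi> (x, t)\<bar>) <= M"
  and 0: "!!x t. t \<notin> {a..b} ==> \<Phi> (x, t) = 0"
 shows "L1 \<Phi>"
  and "(LI z. \<Phi> z) = (LI t. LI x. \<Phi> (x, t))"
proof -
 obtain \<Psi> where \<Psi>b: "\<Psi> : borm" and eq: "AE z in lebesgue. \<Phi> z = \<Psi> z"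
  by (rule integrable_lebesgue_borel_representative[OF \<Phi>]) (rule that)
 have [measurable]: "\<Psi> : borm" by fact
 have [measurable]: "\<Psi> : borel_measurable (lborel \<Otimes>\<^sub>M lborel)" by (simp add: lborel_prod)
 have sl': "AE t in lborel. AE x in lborel. \<Phi> (x, t) = \<Psi> (x, t)" using AE_time_slices[OF eq] .
 have mt: "(%x. \<Psi> (x, t)) : borm" for t by measurable
 have sl1: "L1 (%x. \<Phi> (x, t))" and sl2: "(LI x. \<bar>\<Phi> (x, t)\<bar>) <= \<bar>M\<bar> * indicator {a..b} t" for t
  using sl[of t] bd[of t] 0[of t] by (cases "t : {a..b}"; force)+
 have "(\<integral>\<^sup>+z. ennreal (norm (\<Psi> z)) \<partial>(lborel \<Otimes>\<^sub>M lborel)) = (\<integral>\<^sup>+t. (\<integral>\<^sup>+x. ennreal (norm (\<Psi> (x, t))) \<partial>lborel) \<partial>lborel)"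
  by (rule lborel_pair.nn_integral_snd[symmetric]) measurable
 also have "... <= (\<integral>\<^sup>+t. ennreal (\<bar>M\<bar> * indicator {a..b} t) \<partial>lborel)"
 proof (rule nn_integral_mono_AE)
  show "AE t in lborel. (\<integral>\<^sup>+x. ennreal (norm (\<Psi> (x, t))) \<partial>lborel) <= ennreal (\<bar>M\<bar> * indicator {a..b} t)"
   using sl'
  proof eventually_elim
   case (elim t)
   hence e: "AE x in lebesgue. \<Phi> (x, t) = \<Psi> (x, t)" by (rule AE_completion)
   have "(\<integral>\<^sup>+x. ennreal (norm (\<Psi> (x, t))) \<partial>lborel) = (\<integral>\<^sup>+x. ennreal (norm (\<Psi> (x, t))) \<partial>lebesgue)"
    using mt by (intro nn_integral_completion[symmetric]) measurable
   also have "... = (\<integral>\<^sup>+x. ennreal (norm (\<Phi> (x, t))) \<partial>lebesgue)"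
    using e by (intro nn_integral_cong_AE) auto
   also have "... = ennreal (LI x. \<bar>\<Phi> (x, t)\<bar>)"
    using sl1[of t] by (subst nn_integral_eq_integral) auto
   finally show ?case using sl2[of t] by (simp add: ennreal_leI)
  qed
 qed
 also have "... = ennreal \<bar>M\<bar> * emeasure lborel {a..b}"
  by (simp add: ennreal_mult' nn_integral_cmult ennreal_indicator)
 also have "... < \<infinity>" using emeasure_compact_finite[of "{a..b}"] by (simp add: ennreal_mult_less_top)
 finally have i\<Psi>: "integrable (lborel \<Otimes>\<^sub>M lborel) \<Psi>" by (intro integrableI_bounded) auto
 hence i\<Psi>': "L1 \<Psi>" using integrable_lebesgue_of_borel(1)[OF \<Psi>b] by (simp add: lborel_prod)
 show "L1 \<Phi>"
  by (rule lebesgue_integrable_cong_AE[OF i\<Psi>']) (use eq in auto)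
 have "(LI z. \<Phi> z) = (LI z. \<Psi> z)" using eq by (rule lebesgue_integral_cong_AE)
 also have "... = (LINT z|(lborel \<Otimes>\<^sub>M lborel). \<Psi> z)"
  using integrable_lebesgue_of_borel(2)[OF \<Psi>b] by (simp add: lborel_prod)
 also have "... = (LINT t|lborel. LINT x|lborel. \<Psi> (x, t))"
  using lborel_pair.integral_snd[of "%x t. \<Psi> (x, t)"] i\<Psi> by simp
 also have "... = (LI t. LINT x|lborel. \<Psi> (x, t))"
  by (rule integrable_lebesgue_of_borel(2)[symmetric]) measurable
 also have "... = (LI t. LI x. \<Phi> (x, t))"
 proof (rule lebesgue_integral_cong_AE)
  have "AE t in lebesgue. AE x in lborel. \<Phi> (x, t) = \<Psi> (x, t)" using sl' by (rule AE_completion)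
  thus "AE t in lebesgue. (LINT x|lborel. \<Psi> (x, t)) = (LI x. \<Phi> (x, t))"
  proof eventually_elim
   case (elim t)
   have "(LINT x|lborel. \<Psi> (x, t)) = (LI x. \<Psi> (x, t))"
    using integrable_lebesgue_of_borel(2)[OF mt] by simp
   also have "... = (LI x. \<Phi> (x, t))"
    using AE_completion[OF elim] by (intro lebesgue_integral_cong_AE) auto
   finally show ?case .
  qed
 qed
 finally show "(LI z. \<Phi> z) = (LI t. LI x. \<Phi> (x, t))" .
qed

lemma integral_le_tendsto_max:
 fixes k :: "nat => real => real"
 assumes k: "!!n. conton (k n)" "!!n s. 0 <= k n s" "!!n s. k n s <= 1"
  and lim: "!!s. s > 0 ==> (%n. k n s) ~~> 1" and 0: "!!n. k n 0 = 0"
 shows "0 <= integral {0..s} (k n)" and "integral {0..s} (k n) <= max 0 s"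
  and "(%n. integral {0..s} (k n)) ~~> max 0 s"
proof -
 have i: "k n integrable_on {0..s}" for n
  by (intro integrable_continuous_real continuous_on_subset[OF k(1)]) auto
 show "0 <= integral {0..s} (k n)" by (rule integral_nonneg[OF i]) (use k in auto)
 have "integral {0..s} (k n) <= integral {0..s} (%_. 1)"
  by (rule integral_le[OF i]) (use k in auto)
 thus "integral {0..s} (k n) <= max 0 s" by (cases "0 <= s") auto
 have "(%n. integral {0..s} (k n)) ~~> integral {0..s} (%\<sigma>. if \<sigma> > 0 then 1 else 0)"
  by (rule dominated_convergence(2)[where h="%_. 1"]) (use i k lim 0 in "auto simp: not_less")
 moreover have "integral {0..s} (%\<sigma>. if \<sigma> > 0 then 1 else 0) = integral {0..s} (%_. 1 :: real)"
  by (rule integral_spike[of "{0}"]) auto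
 moreover have "integral {0..s} (%_. 1 :: real) = max 0 s" by (cases "0 <= s") auto
 ultimately show "(%n. integral {0..s} (k n)) ~~> max 0 s" by simp
qed

subsection \<open>Weighted slices\<close>

lemma weighted_integrable_iff:
 fixes f g :: "'a::euclidean_space => real"
 assumes f: "conton f" "!!x. 0 < f x" and g: "g : lebm"
 shows "integrable (weighted f) g \<longleftrightarrow> L1 (%x. f x * g x)"
  and "(LINT x|weighted f. g x) = (LI x. f x * g x)"
proof -
 have m: "f : lebm"
  by (intro borel_measurable_lebesgue borel_measurable_continuous_onI f)
 show "integrable (weighted f) g \<longleftrightarrow> L1 (%x. f x * g x)"
  unfolding weighted_def using f(2) m g by (subst integrable_density) (auto intro: less_imp_le)
 show "(LINT x|weighted f. g x) = (LI x. f x * g x)"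
  unfolding weighted_def using f(2) m g by (subst integral_density) (auto intro: less_imp_le)
qed

lemma weighted_measurable: "integrable (weighted f) g ==> g : lebm"
 using borel_measurable_integrable[of "weighted f" g] by (simp add: weighted_def)

lemma continuous_into_L1_slices:
 fixes f :: "'a::euclidean_space => real"
 assumes f: "conton f" "!!x. 0 < f x" and u: "continuous_into_L1 f u" and t: "t >= 0"
 shows "(%x. u (x, t)) : lebm" and "L1 (%x. f x * u (x, t))"
proof -
 have "integrable (weighted f) (%x. u (x, t))" using u t by (simp add: continuous_into_L1_def)
 thus "(%x. u (x, t)) : lebm" by (rule weighted_measurable)
 thus "L1 (%x. f x * u (x, t))"
  using weighted_integrable_iff[OF f] \<open>integrable (weighted f) (%x. u (x, t))\<close> by blast
qed

lemma continuous_into_L1_tendsto: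
 fixes f :: "'a::euclidean_space => real"
 assumes f: "conton f" "!!x. 0 < f x" and u: "continuous_into_L1 f u" and t: "t >= 0"
 shows "((%s. LI x. f x * \<bar>u (x, s) - u (x, t)\<bar>) \<longlongrightarrow> 0) (at t within {0..})"
proof -
 have "((%s. LINT x|weighted f. \<bar>u (x, s) - u (x, t)\<bar>) \<longlongrightarrow> 0) (at t within {0..})"
  using u t by (simp add: continuous_into_L1_def)
 moreover have "\<forall>\<^sub>F s in at t within {0..}. (LINT x|weighted f. \<bar>u (x, s) - u (x, t)\<bar>) =
   (LI x. f x * \<bar>u (x, s) - u (x, t)\<bar>)"
  unfolding eventually_at_filter
 proof (intro always_eventually allI impI)
  fix s :: real assume "s : {0..}"
  hence s: "s >= 0" by simp
  have "(%x. \<bar>u (x, s) - u (x, t)\<bar>) : lebm"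
   by (intro borel_measurable_abs borel_measurable_diff continuous_into_L1_slices(1)[OF f u] s t)
  thus "(LINT x|weighted f. \<bar>u (x, s) - u (x, t)\<bar>) = (LI x. f x * \<bar>u (x, s) - u (x, t)\<bar>)"
   by (rule weighted_integrable_iff(2)[OF f])
 qed
 ultimately show ?thesis using tendsto_cong by fast
qed

text \<open>The Lipschitz condition on h transfers the L^1-continuity in time of u and v to the
  integral. The instance that matters is max 0 (a - b).\<close>

lemma continuous_weighted_integral:
 fixes f :: "'a::euclidean_space => real" and h :: "real => real => real"
 assumes f: "conton f" "!!x. 0 < f x" and u: "continuous_into_L1 f u" and v: "continuous_into_L1 f v"
  and h: "!!a b c d. \<bar>h a b - h c d\<bar> <= \<bar>a - c\<bar> + \<bar>b - d\<bar>"
  and hm: "(%s. h (fst s) (snd s)) : borm" and h0: "h 0 0 = 0"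
 shows "!!t. t >= 0 ==> L1 (%x. f x * h (u (x, t)) (v (x, t)))"
  and "continuous_on {0..} (%t. LI x. f x * h (u (x, t)) (v (x, t)))"
proof -
 note us = continuous_into_L1_slices[OF f u] and vs = continuous_into_L1_slices[OF f v]
 have fm[measurable]: "f : lebm"
  by (intro borel_measurable_lebesgue borel_measurable_continuous_onI f)
 have m: "(%x. h (u (x, t)) (v (x, t))) : lebm" if "t >= 0" for t
  using measurable_compose[OF borel_measurable_Pair[OF us(1)[OF that] vs(1)[OF that]] hm] by simp
 have i: "L1 (%x. f x * h (u (x, t)) (v (x, t)))" if t: "t >= 0" for t
 proof (rule Lint_bound[of _ "%x. \<bar>f x * u (x, t)\<bar> + \<bar>f x * v (x, t)\<bar>"])
  show "L1 (%x. \<bar>f x * u (x, t)\<bar> + \<bar>f x * v (x, t)\<bar>)"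
   using us(2)[OF t] vs(2)[OF t] by auto
  show "(%x. f x * h (u (x, t)) (v (x, t))) : lebm" using m[OF t] by measurable
  show "AE x in lebesgue. norm (f x * h (u (x, t)) (v (x, t))) <= norm (\<bar>f x * u (x, t)\<bar> + \<bar>f x * v (x, t)\<bar>)"
  proof (intro always_eventually allI)
   fix x
   have "\<bar>h (u (x, t)) (v (x, t))\<bar> <= \<bar>u (x, t)\<bar> + \<bar>v (x, t)\<bar>"
    using h[of "u (x, t)" "v (x, t)" 0 0] h0 by simp
   thus "norm (f x * h (u (x, t)) (v (x, t))) <= norm (\<bar>f x * u (x, t)\<bar> + \<bar>f x * v (x, t)\<bar>)"
    using mult_left_mono[of _ _ "f x"] f(2)[of x] by (fastforce simp: abs_mult distrib_left)
  qed
 qed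
 thus "!!t. t >= 0 ==> L1 (%x. f x * h (u (x, t)) (v (x, t)))" .
 show "continuous_on {0..} (%t. LI x. f x * h (u (x, t)) (v (x, t)))"
  unfolding continuous_on_def
 proof
  fix t :: real assume "t : {0..}"
  hence t: "t >= 0" by simp
  let ?y = "%t. LI x. f x * h (u (x, t)) (v (x, t))"
  let ?d = "%u s. LI x. f x * \<bar>u (x, s) - u (x, t)\<bar>"
  have "((%s. ?y s - ?y t) \<longlongrightarrow> 0) (at t within {0..})"
  proof (rule Lim_null_comparison)
   show "((%s. ?d u s + ?d v s) \<longlongrightarrow> 0) (at t within {0..})"
    using tendsto_add[OF continuous_into_L1_tendsto[OF f u t] continuous_into_L1_tendsto[OF f v t]] by simp
   show "\<forall>\<^sub>F s in at t within {0..}. norm (?y s - ?y t) <= ?d u s + ?d v s"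
    unfolding eventually_at_filter
   proof (intro always_eventually allI impI)
    fix s assume "s : {0::real..}"
    hence s: "s >= 0" by simp
    have id: "L1 (%x. f x * \<bar>w (x, s) - w (x, t)\<bar>)"
     if ws: "!!t. t >= 0 ==> L1 (%x. f x * w (x, t))" for w
    proof -
     have "L1 (%x. \<bar>f x * w (x, s) - f x * w (x, t)\<bar>)"
      using ws[OF s] ws[OF t] by auto
     moreover have "\<bar>f x * w (x, s) - f x * w (x, t)\<bar> = f x * \<bar>w (x, s) - w (x, t)\<bar>" for x
      using f(2)[of x] by (simp add: right_diff_distrib[symmetric] abs_mult)
     ultimately show ?thesis by simp
    qed
    have "norm (?y s - ?y t) = norm (LI x. f x * h (u (x, s)) (v (x, s)) - f x * h (u (x, t)) (v (x, t)))"
     using i[OF s] i[OF t] by simp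
    also have "... <= (LI x. norm (f x * h (u (x, s)) (v (x, s)) - f x * h (u (x, t)) (v (x, t))))"
     by (rule integral_norm_bound)
    also have "... <= (LI x. f x * \<bar>u (x, s) - u (x, t)\<bar> + f x * \<bar>v (x, s) - v (x, t)\<bar>)"
    proof (rule integral_mono)
     show "L1 (%x. norm (f x * h (u (x, s)) (v (x, s)) - f x * h (u (x, t)) (v (x, t))))"
      using i[OF s] i[OF t] by auto
     show "L1 (%x. f x * \<bar>u (x, s) - u (x, t)\<bar> + f x * \<bar>v (x, s) - v (x, t)\<bar>)"
      using id[OF us(2)] id[OF vs(2)] by auto
     fix x
     have "norm (f x * h (u (x, s)) (v (x, s)) - f x * h (u (x, t)) (v (x, t))) =
       f x * \<bar>h (u (x, s)) (v (x, s)) - h (u (x, t)) (v (x, t))\<bar>"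
      using f(2)[of x] by (simp add: right_diff_distrib[symmetric] abs_mult)
     also have "... <= f x * (\<bar>u (x, s) - u (x, t)\<bar> + \<bar>v (x, s) - v (x, t)\<bar>)"
      using f(2)[of x] by (intro mult_left_mono h) auto
     finally show "norm (f x * h (u (x, s)) (v (x, s)) - f x * h (u (x, t)) (v (x, t))) \<le>
      f x * \<bar>u (x, s) - u (x, t)\<bar> + f x * \<bar>v (x, s) - v (x, t)\<bar>" by (simp add: distrib_left)
    qed
    also have "... = ?d u s + ?d v s" using id[OF us(2)] id[OF vs(2)] by (intro Bochner_Integration.integral_add)
    finally show "norm (?y s - ?y t) <= ?d u s + ?d v s" .
   qed
  qed
  thus "(?y \<longlongrightarrow> ?y t) (at t within {0..})" by (simp add: LIM_zero_iff)
 qed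
qed

lemma slab_weighted_integral:
 fixes f :: "'a::euclidean_space => real" and h :: "real => real => real"
 assumes f: "conton f" "!!x. 0 < f x" and u: "continuous_into_L1 f u" and v: "continuous_into_L1 f v"
  and h: "!!a b c d. \<bar>h a b - h c d\<bar> <= \<bar>a - c\<bar> + \<bar>b - d\<bar>"
  and hm: "(%s. h (fst s) (snd s)) : borm" and h0: "h 0 0 = 0"
  and um: "(%z. indicator S_inf z * u z) : lebm"
  and vm: "(%z. indicator S_inf z * v z) : lebm"
  and omg: "conton omg" "!!t. t \<notin> {a..b} ==> omg t = 0" and a: "0 < a" "a < b"
 shows "L1 (%z. f (fst z) * (omg (snd z) * h (u z) (v z)))"
  and "(LI z. f (fst z) * (omg (snd z) * h (u z) (v z))) =
   integral {a..b} (%t. omg t * (LI x. f x * h (u (x, t)) (v (x, t))))"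
proof -
 note c = continuous_weighted_integral[OF f u v h hm h0]
 let ?h2 = "%a b. \<bar>h a b\<bar>"
 have c2: "continuous_on {0..} (%t. LI x. f x * ?h2 (u (x, t)) (v (x, t)))"
  "!!t. t >= 0 ==> L1 (%x. f x * ?h2 (u (x, t)) (v (x, t)))"
  by (rule continuous_weighted_integral[OF f u v]; use h0 hm in "auto intro!: order_trans[OF abs_triangle_ineq3 h]")+
 have "continuous_on {a..b} (%t. omg t * (LI x. f x * ?h2 (u (x, t)) (v (x, t))))"
  using a by (intro continuous_on_mult continuous_on_subset[OF omg(1)] continuous_on_subset[OF c2(1)]) auto
 hence "bounded ((%t. omg t * (LI x. f x * ?h2 (u (x, t)) (v (x, t)))) ` {a..b})"
  by (intro compact_imp_bounded compact_continuous_image) auto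
 then obtain M where M: "\<forall>t\<in>{a..b}. \<bar>omg t * (LI x. f x * ?h2 (u (x, t)) (v (x, t)))\<bar> <= M"
  by (auto simp: bounded_iff)
 let ?\<Phi> = "%z. f (fst z) * (omg (snd z) * h (u z) (v z))"
 \<comment> \<open>omg vanishes outside [a, b], which lies in positive times, and only there are u
   and v known to be jointly measurable.\<close>
 have eq: "?\<Phi> = (%z. f (fst z) * (omg (snd z) * h (indicator S_inf z * u z) (indicator S_inf z * v z)))"
 proof
  fix z :: "'a \<times> real"
  show "?\<Phi> z = f (fst z) * (omg (snd z) * h (indicator S_inf z * u z) (indicator S_inf z * v z))"
   using omg(2)[of "snd z"] a by (cases z; cases "z : S_inf") (auto simp: S_inf_def)
 qed
 have m: "?\<Phi> : lebm"
 proof -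
  have 1: "(%z::'a \<times> real. f (fst z)) : lebm"
   by (intro borel_measurable_lebesgue space_weight_measurable f)
  have 2: "(%z::'a \<times> real. omg (snd z)) : lebm"
   by (intro borel_measurable_lebesgue borel_measurable_continuous_onI continuous_on_compose2[OF omg(1)] continuous_intros) auto
  have 3: "(%z. h (indicator S_inf z * u z) (indicator S_inf z * v z)) : lebm"
   using measurable_compose[OF borel_measurable_Pair[OF um vm] hm] by simp
  show ?thesis unfolding eq by (intro borel_measurable_times 1 2 3)
 qed
 have e: "f x * (omg t * h (u (x, t)) (v (x, t))) = omg t * (f x * h (u (x, t)) (v (x, t)))" for x t by simp
 have sl: "L1 (%x. ?\<Phi> (x, t))" if "t : {a..b}" for t
  using c(1)[of t] that a by (simp add: e)
 have bd: "(LI x. \<bar>?\<Phi> (x, t)\<bar>) <= M" if t: "t : {a..b}" for t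
 proof -
  have "\<bar>?\<Phi> (x, t)\<bar> = \<bar>omg t\<bar> * (f x * ?h2 (u (x, t)) (v (x, t)))" for x
   using f(2)[of x] by (simp add: abs_mult)
  hence "(LI x. \<bar>?\<Phi> (x, t)\<bar>) = \<bar>omg t\<bar> * (LI x. f x * ?h2 (u (x, t)) (v (x, t)))" by simp
  also have "... = \<bar>omg t * (LI x. f x * ?h2 (u (x, t)) (v (x, t)))\<bar>"
   using f(2) by (simp add: abs_mult integral_nonneg_AE less_imp_le)
  finally show ?thesis using M t by simp
 qed
 have 0: "?\<Phi> (x, t) = 0" if "t \<notin> {a..b}" for x t using omg(2)[OF that] by simp
 note s = slab_integral[OF m sl bd 0]
 show "L1 ?\<Phi>" using s(1) .
 have "(LI z. ?\<Phi> z) = (LI t. omg t * (LI x. f x * h (u (x, t)) (v (x, t))))"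
  using s(2) by (simp add: e)
 also have "... = (LINT t:{a..b}|lebesgue. omg t * (LI x. f x * h (u (x, t)) (v (x, t))))"
  using omg(2) by (intro set_lebesgue_integral_eq_UNIV[symmetric]) simp
 also have "... = integral {a..b} (%t. omg t * (LI x. f x * h (u (x, t)) (v (x, t))))"
 proof (rule set_lebesgue_integral_eq_integral(2))
  show "(%t. omg t * (LI x. f x * h (u (x, t)) (v (x, t)))) absolutely_integrable_on {a..b}"
   using a by (intro absolutely_integrable_continuous_real continuous_on_mult continuous_on_subset[OF omg(1)]
     continuous_on_subset[OF c(2)]) auto
 qed
 finally show "(LI z. ?\<Phi> z) = integral {a..b} (%t. omg t * (LI x. f x * h (u (x, t)) (v (x, t))))" .
qed

text \<open>The solution class gives measurability on each slab of times above a positive bound;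
  these slabs exhaust the half space.\<close>

lemma bounded_after_measurable:
 fixes u :: "'a::euclidean_space \<times> real => real"
 assumes "bounded_after_positive_times u"
 shows "(%z. indicator S_inf z * u z) : lebm"
proof -
 define T where "T n = (UNIV :: 'a set) \<times> {1 / real (Suc n)<..}" for n
 have To: "open (T n)" for n unfolding T_def by (intro open_Times) auto
 have Tm: "T n : sets lebesgue" for n
  using borel_open[OF To] by (intro sets_completionI_sets) simp
 have m: "(%z. indicator (T n) z * u z) : lebm" for n
 proof -
  have "u : borel_measurable (lebesgue_on (T n))"
   using assms unfolding bounded_after_positive_times_def T_def by simp
  hence "(%z. if z : T n then u z else 0) : lebm"
   using borel_measurable_if[OF Tm] by blast
  moreover have "(%z. if z : T n then u z else 0) = (%z. indicator (T n) z * u z)"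
   by (auto simp: fun_eq_iff indicator_def)
  ultimately show ?thesis by simp
 qed
 show ?thesis
 proof (rule borel_measurable_LIMSEQ_real[OF _ m])
  fix z :: "'a \<times> real"
  show "(%n. indicator (T n) z * u z) ~~> indicator S_inf z * u z"
  proof (cases "z : S_inf")
   case True
   hence "snd z > 0" by (auto simp: S_inf_def)
   from eventually_moll_radius_less[OF this]
   have "\<forall>\<^sub>F n in sequentially. indicator (T n) z * u z = indicator S_inf z * u z"
    by eventually_elim (use True in "auto simp: T_def indicator_def mem_Times_iff")
   thus ?thesis by (rule tendsto_eventually)
  next
   case False
   have "z \<notin> T n" for n
   proof
    assume "z : T n"
    hence "1 / real (Suc n) < snd z" by (auto simp: T_def)
    moreover have "0 < 1 / real (Suc n)" by simp
    ultimately have "0 < snd z" by (rule less_trans[rotated])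
    thus False using False by (auto simp: S_inf_def mem_Times_iff)
   qed
   thus ?thesis using False by simp
  qed
 qed
qed

text \<open>The exceptional null set in space depends on t; collecting these sets into a null set of
  space-time is Fubini's theorem for a Borel representative.\<close>

lemma AE_nonneg_space_time:
 fixes u :: "'a::euclidean_space \<times> real => real"
 assumes m: "(%z. indicator S_inf z * u z) : lebm"
  and sl: "!!t. t >= 0 ==> AE x in lebesgue. 0 <= u (x, t)"
 shows "AE z in lebesgue. z : S_inf --> 0 <= u z"
proof -
 obtain \<Psi> where \<Psi>b: "\<Psi> : borm" and eq: "AE z in lebesgue. indicator S_inf z * u z = \<Psi> z"
  by (rule integrable_lebesgue_borel_representative[OF m]) (rule that)
 have [measurable]: "\<Psi> : borm" by fact
 have [measurable]: "\<Psi> : borel_measurable (lborel \<Otimes>\<^sub>M lborel)" by (simp add: lborel_prod)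
 have "AE t in lborel. AE x in lborel. 0 <= \<Psi> (x, t)"
  using AE_time_slices[OF eq]
 proof eventually_elim
  case (elim t)
  have "AE x in lborel. 0 <= indicator S_inf (x, t) * u (x, t)"
  proof (cases "t > 0")
   case True
   hence "AE x in lborel. 0 <= u (x, t)" using sl[of t] by (simp add: AE_completion_iff)
   thus ?thesis by eventually_elim simp
  qed (simp add: S_inf_def)
  with elim show ?case by eventually_elim simp
 qed
 moreover have "(AE x in lborel. AE t in lborel. 0 <= \<Psi> (x, t)) \<longleftrightarrow> (AE t in lborel. AE x in lborel. 0 <= \<Psi> (x, t))"
  by (rule lborel_pair.AE_commute) measurable
 ultimately have "AE x in lborel. AE t in lborel. 0 <= \<Psi> (x, t)" by blast
 hence "AE z in lborel \<Otimes>\<^sub>M lborel. 0 <= \<Psi> z"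
 proof (intro lborel_pair.AE_pair_measure)
  show "{z : space (lborel \<Otimes>\<^sub>M lborel). 0 <= \<Psi> z} : sets (lborel \<Otimes>\<^sub>M lborel)" by measurable
 qed auto
 hence "AE z in lborel. 0 <= \<Psi> z" by (simp only: lborel_prod)
 hence "AE z in lebesgue. 0 <= \<Psi> z" by (rule AE_completion)
 with eq show ?thesis by eventually_elim (auto simp: indicator_def split: if_splits)
qed

subsection \<open>The comparison principle\<close>

text \<open>The two functions enter asymmetrically. u is an arbitrary strong solution; v has the
  regularity of the barrier: nonnegative everywhere, v^q of class one, and zero outside a ball on
  bounded time intervals, which confines the interaction of the two to that ball.\<close>

locale comparison =
 fixes p m q :: real and f :: "'a::euclidean_space => real"
  and u v ut vt :: "'a \<times> real => real" and W Wv :: "'a \<times> real => 'a"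
 assumes p: "p > 1" and q: "q = grad_exponent p m" "q > 0" and pq: "p * q >= 1"
  and f: "conton f" "!!x. 0 < f x"
  and uS: "solution_class p m f u W"
  and uW: "!!eta. eta : test_functions S_inf ==> weak_form p m f u (grad_from_power q u W) eta = 0"
  and ut: "has_weak_time_deriv u ut"
  and v0: "!!z. 0 <= v z" and vL: "continuous_into_L1 f v"
  and vm: "(%z. indicator S_inf z * v z) : lebm"
  and vt: "has_weak_time_deriv v vt" "!!z. z : S_inf ==> v z = 0 ==> vt z = 0"
  and wv: "C1_on S_inf (%z. v z powr q)"
  and Wvl: "locally_integrable S_inf Wv" "locally_integrable S_inf (%z. norm (Wv z) powr p)"
  and Wv: "!!z. z : S_inf ==> Wv z = space_grad (%z. v z powr q) z"
  and vW: "!!eta. eta : test_functions S_inf ==> (!!z. 0 <= eta z) ==>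
   0 <= weak_form p m f v (grad_from_power q v Wv) eta"
  and vs: "!!T. \<exists>R. \<forall>x t. 0 <= t --> t <= T --> R <= norm x --> v (x, t) = 0"
  and init: "AE x in lebesgue. u (x, 0) <= v (x, 0)"
begin

lemma um: "(%z. indicator S_inf z * u z) : lebm"
 using uS by (intro bounded_after_measurable) (simp add: solution_class_def)

lemma u0: "AE z in lebesgue. z : S_inf --> 0 <= u z"
 using uS by (intro AE_nonneg_space_time[OF um]) (simp add: solution_class_def)

lemma uL: "continuous_into_L1 f u" using uS by (simp add: solution_class_def)

lemma u_weak: "has_weak_space_grad (%z. u z powr q) W" "locally_integrable S_inf (%z. norm (W z) powr p)"
 "locally_integrable S_inf W" "locally_integrable S_inf (%z. u z powr q)"
 using uS q by (auto simp: solution_class_def has_weak_space_grad_def)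

lemma wd: "has_weak_deriv S_inf (0, 1) u ut" "has_weak_deriv S_inf (0, 1) v vt"
 using has_weak_time_derivD ut vt(1) by auto

lemma loc: "locally_integrable S_inf u" "locally_integrable S_inf ut"
 "locally_integrable S_inf v" "locally_integrable S_inf vt"
 using wd by (auto simp: has_weak_deriv_def)

text \<open>v^q attains its minimum 0 at such a point.\<close>

lemma Wv_zero:
 assumes z: "z : S_inf" and "v z = 0"
 shows "Wv z = 0"
proof -
 let ?w = "%z. v z powr q"
 have "fd ?w z = (%v. 0)"
  using C1_on_has_derivative[OF wv z]
  by (rule differential_zero_maxmin[OF z open_S_inf]) (use assms q in auto)
 thus ?thesis using Wv[OF z] by (simp add: space_grad_def)
qed

definition A :: "'a \<times> real => real" where "A z = f (fst z) * vt z - f (fst z) * ut z"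

definition Bf :: "'a \<times> real => 'a" where
 "Bf z = f (fst z) *\<^sub>R pflux p q (v z) (Wv z) - f (fst z) *\<^sub>R pflux p q (u z) (W z)"

lemma A_loc: "locally_integrable S_inf A"
 unfolding A_def by (intro locally_integrable_diff locally_integrable_weight f loc)

lemma Bf_loc: "locally_integrable S_inf Bf"
 unfolding Bf_def
 by (intro locally_integrable_diff pflux_locally_integrable(1) p f loc Wvl u_weak)

lemma Bf_powr_loc: "locally_integrable S_inf (%z. \<bar>Bf z \<bullet> i\<bar> powr (p / (p - 1)))" if i: "i : Basis"
proof -
 let ?F = "%z. f (fst z) *\<^sub>R pflux p q (u z) (W z)" and ?G = "%z. f (fst z) *\<^sub>R pflux p q (v z) (Wv z)"
 let ?r = "p / (p - 1)"
 have r: "?r > 0" using p by simp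
 note lF = pflux_locally_integrable(2)[OF p f(1) loc(1) u_weak(3,2), of q]
 note lG = pflux_locally_integrable(2)[OF p f(1) loc(3) Wvl, of q]
 show ?thesis
 proof (rule locally_integrable_bound[OF locally_integrable_abs_add[OF lF lG]])
  fix K :: "('a \<times> real) set" assume K: "compact K" "K \<subseteq> S_inf"
  have "(%z. \<bar>(indicator K z *\<^sub>R Bf z) \<bullet> i\<bar> powr ?r) : lebm"
   using locally_integrable_measurable[OF Bf_loc K] by measurable
  moreover have "\<bar>(indicat_real K z *\<^sub>R Bf z) \<bullet> i\<bar> powr ?r = indicator K z *\<^sub>R (\<bar>Bf z \<bullet> i\<bar> powr ?r)" for z
   by (cases "z : K") auto
  ultimately show "(%z. indicat_real K z *\<^sub>R (\<bar>Bf z \<bullet> i\<bar> powr ?r)) : lebm" by (simp only:)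
  have "norm (\<bar>Bf z \<bullet> i\<bar> powr ?r) <= 2 powr ?r * (\<bar>norm (?F z) powr ?r\<bar> + \<bar>norm (?G z) powr ?r\<bar>)" for z
  proof -
   have "\<bar>Bf z \<bullet> i\<bar> <= norm (Bf z)" using i by (rule Basis_le_norm)
   also have "... <= norm (?G z) + norm (?F z)" unfolding Bf_def by (rule norm_triangle_ineq4)
   also have "... <= 2 * max (norm (?F z)) (norm (?G z))" by linarith
   finally have "\<bar>Bf z \<bullet> i\<bar> powr ?r <= (2 * max (norm (?F z)) (norm (?G z))) powr ?r"
    using r by (intro powr_mono2) auto
   also have "... = 2 powr ?r * max (norm (?F z)) (norm (?G z)) powr ?r" by (simp add: powr_mult)
   also have "max (norm (?F z)) (norm (?G z)) powr ?r <= \<bar>norm (?F z) powr ?r\<bar> + \<bar>norm (?G z) powr ?r\<bar>"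
    by (simp add: max_def)
   finally show ?thesis by simp
  qed
  thus "\<exists>C\<ge>0. \<forall>z\<in>K. norm (\<bar>Bf z \<bullet> i\<bar> powr ?r) <= C * (\<bar>norm (?F z) powr ?r\<bar> + \<bar>norm (?G z) powr ?r\<bar>)"
   by (intro exI[of _ "2 powr ?r"]) auto
 qed
qed

lemma difference_inequality:
 assumes eta: "eta : C1_tests S_inf" "!!z. 0 <= eta z"
 shows "0 <= (LI z. A z * eta z + fd eta z (Bf z, 0))"
proof -
 have v0': "AE z in lebesgue. z : S_inf --> 0 <= v z" using v0 by simp
 note U = weak_form_time_derivative[OF p q f(1) u0 ut u_weak(3,2), of "-1", OF _ _ eta]
 note V = weak_form_time_derivative[OF p q f(1) v0' vt(1) Wvl, of 1, OF _ _ eta]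
 let ?I = "%ut u W z. f (fst z) * ut z * eta z + fd eta z (f (fst z) *\<^sub>R pflux p q (u z) (W z), 0)"
 have 1: "L1 (?I ut u W)" "(LI z. ?I ut u W z) <= 0"
  using U uW by auto
 have 2: "L1 (?I vt v Wv)" "0 <= (LI z. ?I vt v Wv z)"
  using V vW by auto
 have lin: "linear (fd eta z)" for z using C1_tests_linear[OF eta(1)] .
 have "(LI z. A z * eta z + fd eta z (Bf z, 0)) =
   (LI z. ?I vt v Wv z - ?I ut u W z)"
 proof (rule Lint_cong[OF refl])
  fix z
  have "fd eta z (Bf z, 0) =
    fd eta z (f (fst z) *\<^sub>R pflux p q (v z) (Wv z), 0) -
    fd eta z (f (fst z) *\<^sub>R pflux p q (u z) (W z), 0)"
   using linear_diff[OF lin, of z "(f (fst z) *\<^sub>R pflux p q (v z) (Wv z), 0)" "(f (fst z) *\<^sub>R pflux p q (u z) (W z), 0)"]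
   by (simp add: Bf_def)
  thus "A z * eta z + fd eta z (Bf z, 0) = ?I vt v Wv z - ?I ut u W z"
   by (simp add: A_def algebra_simps)
 qed
 also have "... = (LI z. ?I vt v Wv z) - (LI z. ?I ut u W z)"
  using 2(1) 1(1) by (rule Bochner_Integration.integral_diff)
 finally show ?thesis using 1 2 by simp
qed

abbreviation hn :: "nat => 'a \<times> real => real" where
 "hn n z \<equiv> sgn_eps n (u z powr q - v z powr q)"

lemma hn_measurable:
 assumes "compact K" "K \<subseteq> S_inf"
 shows "(%z. indicator K z * hn n z) : lebm"
proof -
 have "(%z. indicator K z * (u z powr q - v z powr q)) : lebm"
  unfolding right_diff_distrib
  by (intro borel_measurable_diff locally_integrable_real_measurable[OF u_weak(4) assms] measurable_C1_on_indicator(1)[OF wv assms])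
 from measurable_compose[OF this borel_measurable_continuous_onI[OF sgn_eps_continuous]]
 have "(%z. sgn_eps n (indicator K z * (u z powr q - v z powr q))) : lebm" .
 moreover have "sgn_eps n (indicator K z * (u z powr q - v z powr q)) = indicator K z * hn n z" for z
  by (cases "z : K") (auto simp: sgn_eps_nonpos)
 ultimately show ?thesis by (simp only:)
qed

text \<open>The field \<open>(Bf z, 0)\<close> has no time component, so V consists of the spatial
  basis directions and the test is never differentiated in time.\<close>

lemma spatial_test:
 fixes n :: nat
 assumes \<xi>: "\<xi> : C1_tests S_inf" "!!z. 0 <= \<xi> z"
 defines "F \<equiv> %z. A z * (hn n z * \<xi> z) + Bf z \<bullet>
  ((sgn_eps' n (u z powr q - v z powr q) * \<xi> z) *\<^sub>R (W z - space_grad (%z. v z powr q) z) + hn n z *\<^sub>R space_grad \<xi> z)"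
 shows "L1 F" and "0 <= (LI z. F z)"
proof -
 define V where "V = (%i::'a. (i, 0::real)) ` Basis"
 have V: "V \<subseteq> Basis" by (auto simp: V_def Basis_prod_def)
 have BV: "(Bf z, 0) \<bullet> j = 0" if "j : Basis - V" for z j
  using that by (auto simp: V_def Basis_prod_def)
 have loc0: "locally_integrable S_inf (%z. (Bf z, 0 :: real))"
  by (rule locally_integrable_Pair[OF Bf_loc locally_integrable_zero])
 have Bp: "locally_integrable S_inf (%z. \<bar>(Bf z, 0::real) \<bullet> j\<bar> powr (p / (p - 1)))" if "j : V" for j
  using that Bf_powr_loc by (auto simp: V_def)
 have w: "has_weak_deriv S_inf j (%z. u z powr q) (%z. W z \<bullet> fst j)" if "j : V" for j
  using that has_weak_space_gradD[OF u_weak(1)] by (auto simp: V_def)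
 have Wp: "locally_integrable S_inf (%z. \<bar>W z \<bullet> fst j\<bar> powr p)" if j: "j : V" for j
 proof (rule locally_integrable_bound)
  fix K :: "('a \<times> real) set" assume K: "compact K" "K \<subseteq> S_inf"
  show "L1 (%z. indicator K z * (norm (W z) powr p))"
   using locally_integrableD[OF u_weak(2) K] by simp
  have "(%z. \<bar>(indicator K z *\<^sub>R W z) \<bullet> fst j\<bar> powr p) : lebm"
   using locally_integrable_measurable[OF u_weak(3) K] by measurable
  moreover have "\<bar>(indicat_real K z *\<^sub>R W z) \<bullet> fst j\<bar> powr p = indicator K z *\<^sub>R (\<bar>W z \<bullet> fst j\<bar> powr p)" for z
   using p by (cases "z : K") auto
  ultimately show "(%z. indicat_real K z *\<^sub>R (\<bar>W z \<bullet> fst j\<bar> powr p)) : lebm" by (simp only:)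
  have "norm (\<bar>W z \<bullet> fst j\<bar> powr p) <= 1 * norm (W z) powr p" for z
   using j p Basis_le_norm[of "fst j" "W z"] by (auto simp: V_def intro!: powr_mono2)
  thus "\<exists>C\<ge>0. \<forall>z\<in>K. norm (\<bar>W z \<bullet> fst j\<bar> powr p) <= C * norm (W z) powr p"
   by (intro exI[of _ 1]) auto
 qed
 have M: "sgn_eps n s <= 2 * real (Suc n)" for s using sgn_eps_range(2)[of n s] by simp
 note T = weak_inequality_nonlinear_test[OF open_S_inf p V A_loc loc0 Bp BV difference_inequality
   w u_weak(4) Wp wv \<xi> sgn_eps_has_derivative sgn_eps'_continuous sgn_eps_range(1) M sgn_eps_range(4)]
 have F_eq: "F = (%z. A z * (hn n z * \<xi> z) + (\<Sum>j\<in>V. ((Bf z, 0) \<bullet> j) *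
   (sgn_eps' n (u z powr q - v z powr q) * (W z \<bullet> fst j - fd (%z. v z powr q) z j) * \<xi> z +
   hn n z * fd \<xi> z j)))"
 proof
  fix z
  have sg: "space_grad h z \<bullet> i = fd h z (i, 0)" if "i : Basis" for h :: "'a \<times> real => real" and i
   using that by (simp add: space_grad_def inner_sum_left inner_Basis if_distrib sum.delta cong: if_cong)
  have inj: "inj_on (%i::'a. (i, 0::real)) Basis" by (auto simp: inj_on_def)
  show "F z = A z * (hn n z * \<xi> z) + (\<Sum>j\<in>V. ((Bf z, 0) \<bullet> j) *
   (sgn_eps' n (u z powr q - v z powr q) * (W z \<bullet> fst j - fd (%z. v z powr q) z j) * \<xi> z +
   hn n z * fd \<xi> z j))"
   unfolding F_def V_def sum.reindex[OF inj]
   by (subst euclidean_inner) (auto simp: inner_add_left inner_diff_left sg algebra_simps intro!: sum.cong)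
 qed
 show "L1 F" "0 <= (LI z. F z)" unfolding F_eq by (rule T; assumption)+
qed

text \<open>C depends on n but not on the cutoff or its radius. For |x| <= R the cutoff is 1 and
  monotonicity gives the sign; for |x| > R >= R0 both v and its flux vanish and
  \<open>flux_cutoff_bound\<close> applies with c = (L/R)^p.\<close>

lemma cutoff_inequality:
 fixes n :: nat
 assumes omg: "!!t. (omg has_real_derivative omg' t) (at t)" "conton omg'" "!!t. 0 <= omg t"
   "!!t. t \<notin> {a..b} ==> omg t = 0" and a: "0 < a"
  and R0: "0 < R0" "!!x t. 0 <= t ==> t <= b ==> R0 <= norm x ==> v (x, t) = 0"
 obtains C where "C >= 0" "!!L R zt D. R >= R0 ==> is_cutoff p L R zt D ==>
  0 <= (LI z. A z * (hn n z * (zt (fst z) * omg (snd z)))) +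
   C * (L / R) powr p * (LI z. f (fst z) * (omg (snd z) * u z))"
  "!!L R zt D. R >= R0 ==> is_cutoff p L R zt D ==>
   L1 (%z. A z * (hn n z * (zt (fst z) * omg (snd z))))"
proof -
 obtain U where U: "AE z in lebesgue. a <= snd z --> \<bar>u z\<bar> <= U" "U > 0"
 proof -
  have "a / 2 > 0" using a by simp
  moreover have "bounded_after_positive_times u" using uS by (simp add: solution_class_def)
  ultimately obtain C where C: "AE z in lebesgue_on (UNIV \<times> {a / 2<..}). \<bar>u z\<bar> <= C"
   unfolding bounded_after_positive_times_def by blast
  have "open ((UNIV :: 'a set) \<times> {a / 2<..})" by (intro open_Times) auto
  hence "(UNIV :: 'a set) \<times> {a / 2<..} : sets lebesgue"
   using borel_open by (intro sets_completionI_sets) simp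
  with C have "AE z in lebesgue. z : UNIV \<times> {a / 2<..} --> \<bar>u z\<bar> <= C"
   by (simp add: AE_restrict_space_iff)
  hence "AE z in lebesgue. a <= snd z --> \<bar>u z\<bar> <= max C 1"
   by eventually_elim (use a in "auto simp: mem_Times_iff")
  thus ?thesis using that[of "max C 1"] by simp
 qed
 obtain C where C: "C >= 0" "!!u (W::'a) D zt c. 0 < u ==> u <= U ==> 0 <= zt ==> 0 <= c ==>
  norm D powr p <= c * zt powr (p - 1) ==>
  - (C * c * u) <= pflux p q u W \<bullet> ((sgn_eps' n (u powr q) * zt) *\<^sub>R W + sgn_eps n (u powr q) *\<^sub>R D)"
  by (rule flux_cutoff_bound[OF p q(2) pq U(2) order_refl, of n]) (rule that)
 have id: "(%s. fst s :: real) : borel_measurable (borel :: (real \<times> real) measure)"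
  by (intro borel_measurable_continuous_onI continuous_intros)
 have omgc: "conton omg" using omg(1) DERIV_isCont continuous_at_imp_continuous_on by blast
 have fu: "L1 (%z. f (fst z) * (omg (snd z) * u z))"
 proof (cases "a < b")
  case True
  show ?thesis
   by (rule slab_weighted_integral(1)[OF f uL uL _ id _ um um omgc omg(4) a True]) auto
 next
  case False
  \<comment> \<open>For a >= b the interval has at most one point, so continuity forces omg to
    vanish.\<close>
  have "omg t = 0" for t
  proof (rule ccontr)
   assume nz: "omg t ~= 0"
   hence "t = a" using omg(4)[of t] False by (cases "t : {a..b}") auto
   have "isCont omg t" using omg(1) DERIV_isCont by blast
   hence "(%n. omg (t + 1 / real (Suc n))) ~~> omg (t + 0)"
    by (intro isCont_tendsto_compose[of "t + 0" omg] tendsto_intros LIMSEQ_Suc[OF lim_1_over_n]) simp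
   moreover have "t + 1 / real (Suc n) \<notin> {a..b}" for n
    using \<open>t = a\<close> False by (simp add: not_less) (smt (verit) divide_pos_pos of_nat_0_le_iff)
   ultimately have "(%n::nat. 0) ~~> omg t" using omg(4) by simp
   thus False using nz by (simp add: LIMSEQ_const_iff)
  qed
  thus ?thesis by simp
 qed
 show ?thesis
 proof (rule that[OF C(1)])
  fix L R zt D assume R: "R0 <= R" and cut: "is_cutoff p L R zt (D :: 'a => 'a)"
  let ?\<xi> = "%z. zt (fst z) * omg (snd z)"
  have zt: "!!x. (zt has_derivative (%e. D x \<bullet> e)) (at x)" "conton D"
   "!!x. 0 <= zt x" "!!x. norm x >= 2 * R ==> zt x = 0" "!!x. norm x <= R ==> zt x = 1" "!!x. norm x <= R ==> D x = 0"
   "!!x. norm (D x) powr p <= (L / R) powr p * zt x powr (p - 1)" "!!x. zt x <= 1"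
   using cut unfolding is_cutoff_def by blast+
  have \<xi>: "?\<xi> : C1_tests S_inf"
   by (rule product_test_function(1)[OF zt(1,2,4) omg(1,2,4) a])
  have D\<xi>: "fd ?\<xi> z (e, s) = (D (fst z) \<bullet> e) * omg (snd z) + zt (fst z) * (omg' (snd z) * s)" for z e s
   by (rule product_test_function(2)[OF zt(1,2,4) omg(1,2,4) a])
  have sg: "space_grad ?\<xi> z = omg (snd z) *\<^sub>R D (fst z)" for z
  proof -
   have "space_grad ?\<xi> z = (\<Sum>i\<in>Basis. ((D (fst z) \<bullet> i) * omg (snd z)) *\<^sub>R i)"
    by (simp add: space_grad_def D\<xi>)
   also have "... = omg (snd z) *\<^sub>R (\<Sum>i\<in>Basis. (D (fst z) \<bullet> i) *\<^sub>R i)"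
    by (simp add: scaleR_sum_right mult.commute)
   finally show ?thesis by (simp add: euclidean_representation)
  qed
  let ?h' = "%z. sgn_eps' n (u z powr q - v z powr q)"
  have K: "compact (cball (0::'a) (2 * R) \<times> {a..b})" "cball (0::'a) (2 * R) \<times> {a..b} \<subseteq> S_inf"
   using a by (auto intro!: compact_Times simp: S_inf_def)
  have \<xi>0: "z \<notin> cball 0 (2 * R) \<times> {a..b} ==> ?\<xi> z = 0" for z
   using zt(4)[of "fst z"] omg(4)[of "snd z"] by (cases z) auto
  obtain B where B: "!!z. \<bar>?\<xi> z\<bar> <= B"
   by (rule C1_testsE[OF \<xi>]) blast
  have \<xi>c: "conton ?\<xi>" using \<xi> C_k_imp_continuous_on by (auto simp: C1_tests_def simp del: C_k.simps)
  have hm: "(%z. hn n z * ?\<xi> z) : lebm"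
  proof -
   have "(%z. (indicator (cball 0 (2 * R) \<times> {a..b}) z * hn n z) * ?\<xi> z) : lebm"
    by (intro borel_measurable_times hn_measurable K borel_measurable_lebesgue borel_measurable_continuous_onI \<xi>c)
   moreover have "(%z. (indicator (cball 0 (2 * R) \<times> {a..b}) z * hn n z) * ?\<xi> z) = (%z. hn n z * ?\<xi> z)"
    using \<xi>0 by (force simp: fun_eq_iff indicator_def)
   ultimately show ?thesis by simp
  qed
  show iA: "L1 (%z. A z * (hn n z * ?\<xi> z))"
  proof (rule locally_integrable_mult[OF A_loc K hm, of B])
   show "\<bar>hn n z * ?\<xi> z\<bar> <= B" for z
    using mult_mono[OF sgn_eps_range(5) B[of z], of n "u z powr q - v z powr q"] by (simp add: abs_mult)
  qed (use \<xi>0 in auto)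
  let ?F = "%z. A z * (hn n z * ?\<xi> z) + Bf z \<bullet>
   ((?h' z * ?\<xi> z) *\<^sub>R (W z - space_grad (%z. v z powr q) z) + hn n z *\<^sub>R space_grad ?\<xi> z)"
  have F: "L1 ?F" "0 <= (LI z. ?F z)"
   using spatial_test[OF \<xi>] zt(3) omg(3) by auto
  have "(LI z. ?F z) <= (LI z. A z * (hn n z * ?\<xi> z) +
    C * (L / R) powr p * (f (fst z) * (omg (snd z) * u z)))"
  proof (rule integral_mono_AE[OF F(1)])
   show "L1 (%z. A z * (hn n z * ?\<xi> z) + C * (L / R) powr p * (f (fst z) * (omg (snd z) * u z)))"
    by (intro Lint_add iA integrable_mult_right fu)
   show "AE z in lebesgue. ?F z <= A z * (hn n z * ?\<xi> z) + C * (L / R) powr p * (f (fst z) * (omg (snd z) * u z))"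
    using U(1) u0
   proof eventually_elim
    case (elim z)
    obtain x t where z: "z = (x, t)" by (cases z)
    have "Bf z \<bullet> ((?h' z * ?\<xi> z) *\<^sub>R (W z - space_grad (%z. v z powr q) z) + hn n z *\<^sub>R space_grad ?\<xi> z)
      <= C * (L / R) powr p * (f x * (omg t * u z))"
    proof (cases "t : {a..b}")
     case False
     thus ?thesis using omg(4) by (simp add: z sg)
    next
     case True
     hence zS: "z : S_inf" and t: "0 <= t" "t <= b" using a by (auto simp: z S_inf_def)
     have uz: "0 <= u z" "u z <= U" using elim zS True by (auto simp: z)
     note gW = Wv[OF zS, symmetric]
     have "- (C * (L / R) powr p * u z) <= (pflux p q (u z) (W z) - pflux p q (v z) (Wv z)) \<bullet>
       ((?h' z * zt x) *\<^sub>R (W z - Wv z) + hn n z *\<^sub>R D x)"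
     proof (cases "norm x <= R")
      case x: True
      have "0 <= (pflux p q (u z) (W z) - pflux p q (v z) (Wv z)) \<bullet> (?h' z *\<^sub>R (W z - Wv z))"
      proof (cases "u z powr q > v z powr q")
       case True
       hence "u z > 0" using uz q(2) by (cases "u z = 0") auto
       moreover have "v z > 0 \<or> Wv z = 0" using Wv_zero[OF zS] v0[of z] by fastforce
       ultimately show ?thesis
        using pflux_monotone[OF p, of "u z" "v z" "Wv z" q "W z"] sgn_eps_range(3) by simp
      qed (simp add: sgn_eps_nonpos)
      moreover have "0 <= C * (L / R) powr p * u z" using C(1) uz by simp
      ultimately show ?thesis using zt(5,6)[OF x] by simp
     next
      case False
      hence vz: "v z = 0" using R0(2)[OF t] R by (simp add: z)
      have Wz: "Wv z = 0" using Wv_zero[OF zS vz] .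
      show ?thesis
      proof (cases "u z > 0")
       case True
       thus ?thesis using C(2)[OF True uz(2) zt(3) _ zt(7), where W="W z"] vz Wz
        by (simp add: pflux_def)
      next
       case False
       hence "u z = 0" using uz by simp
       thus ?thesis using vz Wz by (simp add: pflux_def)
      qed
     qed
     from mult_left_mono[OF this, of "f x * omg t"] f(2)[of x] omg(3)[of t]
     have "- (C * (L / R) powr p * (f x * (omg t * u z))) <= (f x * omg t) *
      ((pflux p q (u z) (W z) - pflux p q (v z) (Wv z)) \<bullet> ((?h' z * zt x) *\<^sub>R (W z - Wv z) + hn n z *\<^sub>R D x))"
      by (simp add: mult_ac)
     also have "... = - (Bf z \<bullet> ((?h' z * ?\<xi> z) *\<^sub>R (W z - Wv z) + hn n z *\<^sub>R space_grad ?\<xi> z))"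
      unfolding sg Bf_def by (simp add: z inner_add_right inner_diff_left algebra_simps)
     finally show ?thesis using gW by simp
    qed
    thus ?case by (simp add: z)
   qed
  qed
  also have "... = (LI z. A z * (hn n z * ?\<xi> z)) +
    C * (L / R) powr p * (LI z. f (fst z) * (omg (snd z) * u z))"
   using iA fu by (simp add: Bochner_Integration.integral_add)
  finally show "0 <= (LI z. A z * (hn n z * ?\<xi> z)) +
    C * (L / R) powr p * (LI z. f (fst z) * (omg (snd z) * u z))"
   using F(2) by linarith
 qed
qed

end

context comparison
begin

text \<open>The value of \<open>hn n\<close> where v = 0, as a function of u alone. Its primitive
  \<open>\<Phi>n\<close> allows integration by parts in time far out.\<close>

definition kn :: "nat => real => real" where "kn n s = sgn_eps n (max 0 s powr q)"

lemma kn_continuous: "conton (kn n)"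
proof -
 have "conton (%s::real. max 0 s powr q)"
  using q(2) by (intro continuous_on_powr' continuous_intros) auto
 thus ?thesis unfolding kn_def[abs_def] by (intro continuous_on_compose2[OF sgn_eps_continuous]) auto
qed

lemma kn_range: "0 <= kn n s" "kn n s <= 1" "\<bar>kn n s\<bar> <= 1"
 using sgn_eps_range by (auto simp: kn_def)

lemma kn_nonpos: "s <= 0 ==> kn n s = 0"
 using q(2) by (simp add: kn_def sgn_eps_nonpos)

lemma kn_tendsto: "s > 0 ==> (%n. kn n s) ~~> 1"
 using sgn_eps_tendsto[of "s powr q"] by (simp add: kn_def)

definition \<Phi>n :: "nat => real => real" where "\<Phi>n n s = integral {0..s} (kn n)"

lemma \<Phi>n_derivative: "(\<Phi>n n has_real_derivative kn n s) (at s)"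
 unfolding \<Phi>n_def[abs_def] by (rule antiderivative_vanishing_left[OF kn_continuous kn_nonpos])

lemma \<Phi>n_range: "0 <= \<Phi>n n s" "\<Phi>n n s <= max 0 s" "(%n. \<Phi>n n s) ~~> max 0 s"
 unfolding \<Phi>n_def using integral_le_tendsto_max[of kn, OF kn_continuous kn_range(1,2) kn_tendsto] kn_nonpos by auto

lemma \<Phi>n_measurable: "\<Phi>n n : borm"
 using \<Phi>n_derivative DERIV_isCont by (intro borel_measurable_continuous_onI continuous_at_imp_continuous_on) blast

definition \<Psi>n :: "nat => real => real" where "\<Psi>n n s = integral {0..s} (sgn_eps n)"

lemma \<Psi>n_derivative: "(\<Psi>n n has_real_derivative sgn_eps n s) (at s)"
 unfolding \<Psi>n_def[abs_def] by (rule antiderivative_vanishing_left[OF sgn_eps_continuous sgn_eps_nonpos(1)])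

lemma \<Psi>n_range: "0 <= \<Psi>n n s" "\<Psi>n n s <= max 0 s" "(%n. \<Psi>n n s) ~~> max 0 s"
proof -
 have "s > 0 ==> (%n. sgn_eps n s) ~~> 1" for s using sgn_eps_tendsto[of s] by simp
 from integral_le_tendsto_max[of sgn_eps, OF sgn_eps_continuous sgn_eps_range(1,2) this]
 show "0 <= \<Psi>n n s" "\<Psi>n n s <= max 0 s" "(%n. \<Psi>n n s) ~~> max 0 s"
  unfolding \<Psi>n_def using sgn_eps_nonpos(1) by auto
qed

lemma powr_less_iff: "0 <= s ==> 0 <= t ==> s powr q < t powr q \<longleftrightarrow> s < t"
 using q(2) powr_less_mono2[of q s t] powr_mono2[of q t s] by linarith

abbreviation U1 :: "'a \<times> real => real" where "U1 z \<equiv> indicator S_inf z * u z"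

text \<open>Far out, where v = 0, the test is \<open>kn n\<close> of u and the time derivative is
  integrated by parts through the primitive \<open>\<Phi>n\<close> before the cutoff is removed.
  Inside the ball of radius R0 the test depends on u^q - v^q, to which the chain rule for u - v does
  not apply; but its limit, the indicator of u > v, is also the limit of tests in u - v, for which
  the chain rule works. The radius goes to infinity first because the constant of the cutoff
  estimate depends on n.\<close>

lemma main_inequality:
 assumes omg: "!!t. (omg has_real_derivative omg' t) (at t)" "conton omg'" "!!t. 0 <= omg t"
   "!!t. t \<notin> {a..b} ==> omg t = 0" "!!t. t \<notin> {a..b} ==> omg' t = 0" and a: "0 < a" "a < b"
 shows "0 <= integral {a..b} (%t. omg' t * (LI x. f x * max 0 (u (x, t) - v (x, t))))"
proof -
 obtain R1 where R1: "!!x t. 0 <= t ==> t <= b ==> R1 <= norm x ==> v (x, t) = 0" using vs[of b] by blast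
 define R0 where "R0 = max R1 1"
 have R0: "R0 > 0" "!!x t. 0 <= t ==> t <= b ==> R0 <= norm x ==> v (x, t) = 0"
  using R1 by (auto simp: R0_def)
 obtain L where L: "L > 0" "!!R::real. R > 0 ==> \<exists>(zt::'a => real) D. is_cutoff p L R zt D"
  by (rule radial_cutoff[OF p, where 'a='a]) (rule that)
 define Rj where "Rj j = R0 + real j" for j
 have Rj: "Rj j >= R0" "Rj j > 0" for j using R0(1) by (auto simp: Rj_def)
 have "\<forall>j. \<exists>zt D. is_cutoff p L (Rj j) (zt :: 'a => real) D" using L(2) Rj(2) by blast
 then obtain zt :: "nat => 'a => real" and D where cut: "!!j. is_cutoff p L (Rj j) (zt j) (D j)" by metis
 have zt: "(zt j has_derivative (%e. D j x \<bullet> e)) (at x)" "conton (D j)"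
   "0 <= zt j x" "norm x >= 2 * Rj j ==> zt j x = 0" "norm x <= Rj j ==> zt j x = 1" "zt j x <= 1" for j x
  using cut[of j] unfolding is_cutoff_def by blast+
 have ztc: "conton (zt j)" for j
  using has_derivative_continuous[OF zt(1)] by (auto intro: continuous_at_imp_continuous_on)
 have omgc: "conton omg" using omg(1) DERIV_isCont continuous_at_imp_continuous_on by blast
 let ?in = "%z::'a \<times> real. indicat_real (cball (0::'a) R0) (fst z)"
 let ?out = "%z::'a \<times> real. indicat_real (- cball (0::'a) R0) (fst z)"
 have fstm: "fst : borel_measurable (borel :: ('a \<times> real) measure)"
  and sndm: "snd : borel_measurable (borel :: ('a \<times> real) measure)"
  by (auto intro!: borel_measurable_continuous_onI continuous_intros)
 have inm: "?in : borm" and outm: "?out : borm"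
  using measurable_compose[OF fstm borel_measurable_indicator[of "cball (0::'a) R0" borel]]
   measurable_compose[OF fstm borel_measurable_indicator[of "- cball (0::'a) R0" borel]]
  by (auto intro!: borel_closed borel_comp)
 have fm: "(%z::'a \<times> real. f (fst z)) : borm" using space_weight_measurable[OF f(1)] .
 note bl = borel_measurable_lebesgue
 have ztm: "(%z::'a \<times> real. zt j (fst z)) : lebm" for j
  by (rule bl[OF measurable_compose[OF fstm borel_measurable_continuous_onI[OF ztc]]])
 have omgm: "(%z::'a \<times> real. omg (snd z)) : lebm" "(%z::'a \<times> real. omg' (snd z)) : lebm"
  using bl[OF measurable_compose[OF sndm borel_measurable_continuous_onI[OF omgc]]]
   bl[OF measurable_compose[OF sndm borel_measurable_continuous_onI[OF omg(2)]]] by auto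
 have uv0: "AE z in lebesgue. z : S_inf --> 0 <= u z" using u0 .
 have S: "t : {a..b} ==> (x, t) : S_inf" for x :: 'a and t using a by (auto simp: S_inf_def)
 have vout: "v (x, t) = 0" "vt (x, t) = 0" if "t : {a..b}" "norm x > R0" for x t
  using R0(2)[of t x] that a vt(2)[OF S[OF that(1)], of x] by auto
 define K0 where "K0 = cball (0::'a) R0 \<times> {a..b}"
 have K0: "compact K0" "K0 \<subseteq> S_inf"
  using a by (auto simp: K0_def S_inf_def intro!: compact_Times)
 obtain B where B: "!!t. \<bar>omg t\<bar> <= B"
 proof -
  have z: "norm t > max \<bar>a\<bar> \<bar>b\<bar> ==> omg t = 0" for t
   by (rule omg(4)) (auto simp: abs_if split: if_splits)
  show ?thesis
   by (rule continuous_bounded_support_bounded[OF omgc, of "max \<bar>a\<bar> \<bar>b\<bar>"], erule z, rule that)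
 qed
 have idm: "(%s. fst s :: real) : borel_measurable (borel :: (real \<times> real) measure)"
  by (intro borel_measurable_continuous_onI continuous_intros)
 have iu': "L1 (%z. f (fst z) * (omg' (snd z) * u z))"
  by (rule slab_weighted_integral(1)[OF f uL uL _ idm _ um um omg(2,5) a]) auto
 have absm: "(%s. \<bar>fst s\<bar> :: real) : borel_measurable (borel :: (real \<times> real) measure)"
  by (intro borel_measurable_continuous_onI continuous_intros)
 have iu'a: "L1 (%z. \<bar>f (fst z) * (omg' (snd z) * u z)\<bar>)" using iu' by auto

 have inner_meas: "(%z. indicator K0 z * hn n z) : lebm" for n
  by (rule hn_measurable[OF K0])
 define I where "I n = (LI z. A z * (?in z * (hn n z * omg (snd z))))" for n
 have im: "(%z. ?in z * (hn n z * omg (snd z))) : lebm" for n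
 proof -
  have "(%z. (indicator K0 z * hn n z) * omg (snd z)) : lebm"
   by (intro borel_measurable_times inner_meas omgm)
  moreover have "(%z. (indicator K0 z * hn n z) * omg (snd z)) = (%z. ?in z * (hn n z * omg (snd z)))"
   using omg(4) by (auto simp: fun_eq_iff K0_def indicator_def)
  ultimately show ?thesis by simp
 qed
 have ib: "\<bar>?in z * (hn n z * omg (snd z))\<bar> <= B" for z n
 proof -
  have "\<bar>hn n z\<bar> * \<bar>omg (snd z)\<bar> <= 1 * B" using sgn_eps_range(5) B by (intro mult_mono) auto
  moreover have "0 <= B" using B[of 0] by linarith
  ultimately show ?thesis by (auto simp: abs_mult indicator_def)
 qed
 have i0: "z \<notin> K0 ==> ?in z * (hn n z * omg (snd z)) = 0" for z n
  using omg(4) by (cases z) (auto simp: K0_def indicator_def)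
 have iI: "L1 (%z. A z * (?in z * (hn n z * omg (snd z))))" for n
  by (rule locally_integrable_mult[OF A_loc K0 im ib i0])

 have outer: "0 <= I n + (LI z. ?out z * (f (fst z) * (omg' (snd z) * \<Phi>n n (u z))))"
  and outer_int: "L1 (%z. ?out z * (f (fst z) * (omg' (snd z) * \<Phi>n n (u z))))" for n
 proof -
  obtain C where C: "C >= 0" "!!L R zt D. R >= R0 ==> is_cutoff p L R zt D ==>
   0 <= (LI z. A z * (hn n z * (zt (fst z) * omg (snd z)))) +
    C * (L / R) powr p * (LI z. f (fst z) * (omg (snd z) * u z))"
   "!!L R zt D. R >= R0 ==> is_cutoff p L R zt D ==>
    L1 (%z. A z * (hn n z * (zt (fst z) * omg (snd z))))"
   by (rule cutoff_inequality[OF omg(1-3) _ a(1) R0(1), where n=n and b=b], erule omg(4), erule (2) R0(2), rule that)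
  \<comment> \<open>Off the ball A is -f u_t. Only this part is integrated by parts, with the
    indicator of the outside carried along as a factor constant in time.\<close>
  have split: "(LI z. A z * (hn n z * (zt j (fst z) * omg (snd z)))) =
    I n + (LI z. ?out z * (f (fst z) * (zt j (fst z) * (omg' (snd z) * \<Phi>n n (u z)))))" for j
  proof -
   let ?eta = "%z. zt j (fst z) * omg (snd z)"
   have eta: "?eta : C1_tests S_inf"
    by (rule product_test_function(1)[OF zt(1,2,4) omg(1,2,4) a(1)])
   have Deta: "fd ?eta z (0, 1) = zt j (fst z) * omg' (snd z)" for z
    using product_test_function(2)[where zt="zt j" and D="D j" and R="2 * Rj j" and z=z and e=0 and s=1,
     OF zt(1,2,4) omg(1,2,4) a(1)] by simp
   have bdd: "\<exists>C. \<forall>z\<in>K. \<bar>?out z * f (fst z)\<bar> <= C" if K: "compact K" for K :: "('a \<times> real) set"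
   proof -
    obtain C where "C >= 0" "!!z. z : K ==> \<bar>f (fst z)\<bar> <= C" by (rule space_weight_bounded[OF f(1) K]) (rule that)
    thus ?thesis by (intro exI[of _ C]) (auto simp: indicator_def)
   qed
   have om: "(%z. ?out z * f (fst z)) : borm" by (intro borel_measurable_times outm fm)
   note ch = weak_chain_rule[OF open_S_inf wd(1) eta om _ bdd kn_continuous kn_range(3) \<Phi>n_derivative]
   have i1: "L1 (%z. ?out z * f (fst z) * ?eta z * kn n (u z) * ut z)"
    and e1: "(LI z. ?out z * f (fst z) * ?eta z * kn n (u z) * ut z) =
     - (LI z. ?out z * f (fst z) * fd ?eta z (0, 1) * \<Phi>n n (u z))"
    by (rule ch; simp)+
   have "(LI z. A z * (hn n z * (zt j (fst z) * omg (snd z)))) =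
     (LI z. A z * (?in z * (hn n z * omg (snd z))) - ?out z * f (fst z) * ?eta z * kn n (u z) * ut z)"
   proof (rule lebesgue_integral_cong_AE)
    show "AE z in lebesgue. A z * (hn n z * (zt j (fst z) * omg (snd z))) =
      A z * (?in z * (hn n z * omg (snd z))) - ?out z * f (fst z) * ?eta z * kn n (u z) * ut z"
     using u0
    proof eventually_elim
     case (elim z)
     obtain x t where z: "z = (x, t)" by (cases z)
     show ?case
     proof (cases "t : {a..b}")
      case True
      hence uz: "0 <= u (x, t)" using elim S[OF True, of x] by (simp add: z)
      show ?thesis
      proof (cases "norm x <= R0")
       case True
       hence "zt j x = 1" using zt(5)[of x j] Rj(1)[of j] by auto
       thus ?thesis using True by (simp add: z)
      next
       case False
       hence "v (x, t) = 0" "vt (x, t) = 0" using vout[OF True, of x] by auto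
       thus ?thesis using False uz by (simp add: z A_def kn_def max_def)
      qed
     qed (simp add: z omg(4))
    qed
   qed
   also have "... = I n - (LI z. ?out z * f (fst z) * ?eta z * kn n (u z) * ut z)"
    unfolding I_def using iI i1 by (rule Bochner_Integration.integral_diff)
   also have "... = I n + (LI z. ?out z * f (fst z) * (zt j (fst z) * omg' (snd z)) * \<Phi>n n (u z))"
    unfolding e1 Deta by simp
   finally show ?thesis by (simp only: mult.assoc)
  qed
  have bd: "\<bar>?out z * (f (fst z) * (c * (omg' (snd z) * \<Phi>n n (u z))))\<bar> <= \<bar>f (fst z) * (omg' (snd z) * u z)\<bar>"
   if "0 <= c" "c <= 1" for z c
  proof -
   have 1: "\<bar>\<Phi>n n (u z)\<bar> <= \<bar>u z\<bar>" using \<Phi>n_range(1,2)[of n "u z"] by linarith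
   have "\<bar>?out z * (f (fst z) * (c * (omg' (snd z) * \<Phi>n n (u z))))\<bar> =
     (?out z * c) * (\<bar>f (fst z)\<bar> * (\<bar>omg' (snd z)\<bar> * \<bar>\<Phi>n n (u z)\<bar>))"
    using that by (simp add: abs_mult indicator_def)
   also have "... <= 1 * (\<bar>f (fst z)\<bar> * (\<bar>omg' (snd z)\<bar> * \<bar>u z\<bar>))"
    using that 1 by (intro mult_mono) (auto simp: indicator_def)
   finally show ?thesis by (simp add: abs_mult)
  qed
  have um': "(%z. omg' (snd z) * \<Phi>n n (u z)) : lebm"
  proof -
   have "(%z. omg' (snd z) * \<Phi>n n (U1 z)) : lebm"
    by (intro borel_measurable_times omgm measurable_compose[OF um \<Phi>n_measurable])
   moreover have "(%z. omg' (snd z) * \<Phi>n n (U1 z)) = (%z. omg' (snd z) * \<Phi>n n (u z))"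
   proof
    fix z :: "'a \<times> real"
    show "omg' (snd z) * \<Phi>n n (U1 z) = omg' (snd z) * \<Phi>n n (u z)"
     using omg(5)[of "snd z"] S[of "snd z" "fst z"] by (cases "snd z : {a..b}") auto
   qed
   ultimately show ?thesis by simp
  qed
  have gm: "(%z. ?out z * (f (fst z) * (omg' (snd z) * \<Phi>n n (u z)))) : lebm"
   by (intro borel_measurable_times bl[OF outm] bl[OF fm] um')
  have gjm: "(%z. ?out z * (f (fst z) * (zt j (fst z) * (omg' (snd z) * \<Phi>n n (u z))))) : lebm" for j
   by (intro borel_measurable_times bl[OF outm] bl[OF fm] um' ztm)
  show "L1 (%z. ?out z * (f (fst z) * (omg' (snd z) * \<Phi>n n (u z))))"
   by (rule Lint_bound[OF iu'a gm]) (use bd[of 1] in auto)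
  have l1: "(%j. LI z. ?out z * (f (fst z) * (zt j (fst z) * (omg' (snd z) * \<Phi>n n (u z))))) ~~>
    (LI z. ?out z * (f (fst z) * (omg' (snd z) * \<Phi>n n (u z))))"
  proof (rule integral_dominated_convergence[OF gm gjm iu'a])
   show "AE z in lebesgue. (%j. ?out z * (f (fst z) * (zt j (fst z) * (omg' (snd z) * \<Phi>n n (u z))))) ~~>
     ?out z * (f (fst z) * (omg' (snd z) * \<Phi>n n (u z)))"
   proof (intro always_eventually allI)
    fix z :: "'a \<times> real"
    obtain J :: nat where J: "real J >= norm (fst z)" using real_arch_simple by blast
    have "zt j (fst z) = 1" if "j >= J" for j
    proof (rule zt(5))
     have "real j >= real J" using that by simp
     thus "norm (fst z) <= Rj j" using J R0(1) unfolding Rj_def by linarith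
    qed
    hence "\<forall>\<^sub>F j in sequentially. ?out z * (f (fst z) * (zt j (fst z) * (omg' (snd z) * \<Phi>n n (u z)))) =
      ?out z * (f (fst z) * (omg' (snd z) * \<Phi>n n (u z)))"
     by (intro eventually_sequentiallyI[of J]) simp
    thus "(%j. ?out z * (f (fst z) * (zt j (fst z) * (omg' (snd z) * \<Phi>n n (u z))))) ~~>
     ?out z * (f (fst z) * (omg' (snd z) * \<Phi>n n (u z)))" by (rule tendsto_eventually)
   qed
   show "AE z in lebesgue. norm (?out z * (f (fst z) * (zt j (fst z) * (omg' (snd z) * \<Phi>n n (u z))))) \<le>
     \<bar>f (fst z) * (omg' (snd z) * u z)\<bar>" for j
    using bd[OF zt(3,6)] by simp
  qed
  have l2: "(%j. (L / Rj j) powr p) ~~> 0"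
  proof -
   have "filterlim (%j. Rj j) at_top sequentially"
    unfolding Rj_def by (intro filterlim_tendsto_add_at_top[OF tendsto_const] filterlim_real_sequentially)
   hence "(%j. L / Rj j) ~~> 0"
    by (intro tendsto_divide_0[OF tendsto_const] filterlim_at_top_imp_at_infinity)
   hence "(%j. (L / Rj j) powr p) ~~> 0 powr p"
    using p L(1) Rj(2) by (intro tendsto_powr' tendsto_const) (auto intro!: always_eventually divide_nonneg_nonneg less_imp_le)
   thus ?thesis by simp
  qed
  have "(%j. (I n + (LI z. ?out z * (f (fst z) * (zt j (fst z) * (omg' (snd z) * \<Phi>n n (u z)))))) +
    C * (L / Rj j) powr p * (LI z. f (fst z) * (omg (snd z) * u z))) ~~>
    (I n + (LI z. ?out z * (f (fst z) * (omg' (snd z) * \<Phi>n n (u z))))) +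
    C * 0 * (LI z. f (fst z) * (omg (snd z) * u z))"
   by (intro tendsto_intros l1 l2)
  moreover have "0 <= (I n + (LI z. ?out z * (f (fst z) * (zt j (fst z) * (omg' (snd z) * \<Phi>n n (u z)))))) +
    C * (L / Rj j) powr p * (LI z. f (fst z) * (omg (snd z) * u z))" for j
   using C(2)[OF Rj(1) cut, of j] unfolding split .
  ultimately have "0 <= (I n + (LI z. ?out z * (f (fst z) * (omg' (snd z) * \<Phi>n n (u z))))) +
    C * 0 * (LI z. f (fst z) * (omg (snd z) * u z))"
   by (intro LIMSEQ_le_const) auto
  thus "0 <= I n + (LI z. ?out z * (f (fst z) * (omg' (snd z) * \<Phi>n n (u z))))" by simp
 qed

 let ?pos = "%z. if u z > v z then 1 else 0 :: real"
 have wA: "L1 (%z. B * \<bar>indicator K0 z * A z\<bar>)"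
  using locally_integrableD[OF A_loc K0] by auto
 have dom: "\<bar>A z * (?in z * (c * omg (snd z)))\<bar> <= B * \<bar>indicator K0 z * A z\<bar>" if "\<bar>c\<bar> <= 1" for c z
 proof (cases "z : K0")
  case True
  have "\<bar>c\<bar> * \<bar>omg (snd z)\<bar> <= 1 * B" using that B by (intro mult_mono) auto
  hence "\<bar>A z\<bar> * (\<bar>c\<bar> * \<bar>omg (snd z)\<bar>) <= \<bar>A z\<bar> * B" by (intro mult_left_mono) auto
  thus ?thesis using True by (simp add: abs_mult K0_def mem_Times_iff mult.commute)
 next
  case False
  hence "?in z = 0 \<or> omg (snd z) = 0" using omg(4) by (cases z) (auto simp: K0_def indicator_def)
  thus ?thesis using False by auto
 qed
 \<comment> \<open>For nonnegative values u^q > v^q is the same as u > v, so the tests in u^q - v^q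
   and those in u - v have the same limit.\<close>
 have AE_lim: "AE z in lebesgue. (%n. A z * (?in z * (hn n z * omg (snd z)))) ~~> A z * (?in z * (?pos z * omg (snd z)))"
  using u0
 proof eventually_elim
  case (elim z)
  show ?case
  proof (cases "snd z : {a..b}")
   case True
   hence "0 <= u z" using elim S[of "snd z" "fst z"] by simp
   hence "(if u z powr q - v z powr q > 0 then 1 else 0) = ?pos z" using powr_less_iff[OF v0] by simp
   hence "(%n. hn n z) ~~> ?pos z" using sgn_eps_tendsto[of "u z powr q - v z powr q"] by simp
   thus ?thesis by (intro tendsto_intros)
  qed (simp add: omg(4))
 qed
 have mI: "(%z. A z * (?in z * (hn n z * omg (snd z)))) : lebm" for n using iI by auto
 have mlim: "(%z. A z * (?in z * (?pos z * omg (snd z)))) : lebm"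
  by (rule borel_measurable_AE_limit[OF mI AE_lim])
 have I_lim: "I ~~> (LI z. A z * (?in z * (?pos z * omg (snd z))))"
  unfolding I_def
  by (rule integral_dominated_convergence[OF mlim mI wA AE_lim]) (use dom[OF sgn_eps_range(5)] in simp)
 have out_lim: "(%n. LI z. ?out z * (f (fst z) * (omg' (snd z) * \<Phi>n n (u z)))) ~~>
   (LI z. ?out z * (f (fst z) * (omg' (snd z) * max 0 (u z))))"
  and out_int: "L1 (%z. ?out z * (f (fst z) * (omg' (snd z) * max 0 (u z))))"
 proof -
  have l: "AE z in lebesgue. (%n. ?out z * (f (fst z) * (omg' (snd z) * \<Phi>n n (u z)))) ~~>
    ?out z * (f (fst z) * (omg' (snd z) * max 0 (u z)))"
   by (intro always_eventually allI tendsto_intros \<Phi>n_range)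
  have mm: "(%z. ?out z * (f (fst z) * (omg' (snd z) * \<Phi>n n (u z)))) : lebm" for n
   using outer_int[of n] by auto
  have m: "(%z. ?out z * (f (fst z) * (omg' (snd z) * max 0 (u z)))) : lebm"
   by (rule borel_measurable_AE_limit[OF mm l])
  have b: "\<bar>?out z * (f (fst z) * (omg' (snd z) * c))\<bar> <= \<bar>f (fst z) * (omg' (snd z) * u z)\<bar>" if "\<bar>c\<bar> <= \<bar>u z\<bar>" for z c
   using that by (auto simp: abs_mult indicator_def intro!: mult_left_mono)
  have c: "\<bar>\<Phi>n n (u z)\<bar> <= \<bar>u z\<bar>" "\<bar>max 0 (u z)\<bar> <= \<bar>u z\<bar>" for n z using \<Phi>n_range(1,2)[of n "u z"] by linarith+
  show "(%n. LI z. ?out z * (f (fst z) * (omg' (snd z) * \<Phi>n n (u z)))) ~~>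
   (LI z. ?out z * (f (fst z) * (omg' (snd z) * max 0 (u z))))"
   by (rule integral_dominated_convergence[OF m mm iu'a l]) (use b[OF c(1)] in simp)
  show "L1 (%z. ?out z * (f (fst z) * (omg' (snd z) * max 0 (u z))))"
   by (rule Lint_bound[OF iu'a m]) (use b[OF c(2)] in simp)
 qed
 have step1: "0 <= (LI z. A z * (?in z * (?pos z * omg (snd z)))) +
   (LI z. ?out z * (f (fst z) * (omg' (snd z) * max 0 (u z))))"
  using tendsto_add[OF I_lim out_lim] outer by (intro LIMSEQ_le_const) auto

 \<comment> \<open>Second route to the same limit: inside the ball use the test
   \<open>sgn_eps n (u z - v z)\<close> and its primitive \<open>\<Psi>n\<close>.\<close>
 have wdd: "has_weak_deriv S_inf (0, 1) (%z. u z - v z) (%z. ut z - vt z)"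
  unfolding has_weak_deriv_def
 proof (intro conjI ballI locally_integrable_diff loc)
  fix eta :: "'a \<times> real => real" assume eta: "eta : test_functions S_inf"
  have eta1: "eta : C1_tests S_inf" using test_functions_C1_tests[OF eta] .
  note i = test_functions_grad_integrable(1)[OF _ eta1, of _ "(0, 1)"] test_functions_grad_integrable(2)[OF _ eta1]
  show "(LI z. (u z - v z) * fd eta z (0, 1)) = - (LI z. (ut z - vt z) * eta z)"
   using wd eta i[OF loc(1)] i[OF loc(2)] i[OF loc(3)] i[OF loc(4)] i(2)[OF loc(1)]
    test_functions_grad_integrable[OF loc(2) eta1] test_functions_grad_integrable[OF loc(4) eta1]
   by (simp add: has_weak_deriv_def left_diff_distrib)
 qed
 let ?eta = "%z. zt 0 (fst z) * omg (snd z)"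
 have eta: "?eta : C1_tests S_inf"
  by (rule product_test_function(1)[OF zt(1,2,4) omg(1,2,4) a(1)])
 have Deta: "fd ?eta z (0, 1) = zt 0 (fst z) * omg' (snd z)" for z
  using product_test_function(2)[where zt="zt 0" and D="D 0" and R="2 * Rj 0" and z=z and e=0 and s=1,
     OF zt(1,2,4) omg(1,2,4) a(1)] by simp
 have bdd: "\<exists>C. \<forall>z\<in>K. \<bar>?in z * f (fst z)\<bar> <= C" if K: "compact K" for K :: "('a \<times> real) set"
 proof -
  obtain C where "C >= 0" "!!z. z : K ==> \<bar>f (fst z)\<bar> <= C" by (rule space_weight_bounded[OF f(1) K]) (rule that)
  thus ?thesis by (intro exI[of _ C]) (auto simp: indicator_def)
 qed
 have inf_m: "(%z. ?in z * f (fst z)) : borm" by (intro borel_measurable_times inm fm)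
 have ch: "L1 (%z. ?in z * f (fst z) * ?eta z * sgn_eps n (u z - v z) * (ut z - vt z))"
  "L1 (%z. ?in z * f (fst z) * fd ?eta z (0, 1) * \<Psi>n n (u z - v z))"
  "(LI z. ?in z * f (fst z) * ?eta z * sgn_eps n (u z - v z) * (ut z - vt z)) =
   - (LI z. ?in z * f (fst z) * fd ?eta z (0, 1) * \<Psi>n n (u z - v z))" for n
  by (rule weak_chain_rule[OF open_S_inf wdd eta inf_m _ bdd sgn_eps_continuous sgn_eps_range(5) \<Psi>n_derivative]; simp)+
 have e1: "?in z * f (fst z) * ?eta z * sgn_eps n (u z - v z) * (ut z - vt z) =
   - (A z * (?in z * (sgn_eps n (u z - v z) * omg (snd z))))" for z n
  using zt(5)[of "fst z" 0] by (auto simp: Rj_def indicator_def A_def algebra_simps)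
 have e2: "?in z * f (fst z) * fd ?eta z (0, 1) * \<Psi>n n (u z - v z) =
   ?in z * (f (fst z) * (omg' (snd z) * \<Psi>n n (u z - v z)))" for z n
  unfolding Deta using zt(5)[of "fst z" 0] by (auto simp: Rj_def indicator_def)
 have ch': "(LI z. A z * (?in z * (sgn_eps n (u z - v z) * omg (snd z)))) =
   (LI z. ?in z * (f (fst z) * (omg' (snd z) * \<Psi>n n (u z - v z))))" for n
  using ch(3)[of n] unfolding e1 e2 by simp
 have chi: "L1 (%z. A z * (?in z * (sgn_eps n (u z - v z) * omg (snd z))))"
  "L1 (%z. ?in z * (f (fst z) * (omg' (snd z) * \<Psi>n n (u z - v z))))" for n
  using ch(1)[of n] ch(2)[of n] unfolding e1 e2 by auto
 have maxm: "(%s. max 0 (fst s - snd s) :: real) : borel_measurable (borel :: (real \<times> real) measure)"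
  by (intro borel_measurable_continuous_onI continuous_intros)
 note sw = slab_weighted_integral[where h="%a b. max 0 (a - b)", OF f uL vL _ maxm _ um vm omg(2,5) a]
 have swi: "L1 (%z. f (fst z) * (omg' (snd z) * max 0 (u z - v z)))" by (rule sw(1)) auto
 have swe: "(LI z. f (fst z) * (omg' (snd z) * max 0 (u z - v z))) =
   integral {a..b} (%t. omg' t * (LI x. f x * max 0 (u (x, t) - v (x, t))))"
  by (rule sw(2)) auto
 have lim1: "(%n. LI z. A z * (?in z * (sgn_eps n (u z - v z) * omg (snd z)))) ~~>
   (LI z. A z * (?in z * (?pos z * omg (snd z))))"
 proof (rule integral_dominated_convergence[OF mlim _ wA])
  show "AE z in lebesgue. (%n. A z * (?in z * (sgn_eps n (u z - v z) * omg (snd z)))) ~~> A z * (?in z * (?pos z * omg (snd z)))"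
  proof (intro always_eventually allI tendsto_intros)
   show "(%n. sgn_eps n (u z - v z)) ~~> ?pos z" for z using sgn_eps_tendsto[of "u z - v z"] by simp
  qed
 qed (use chi(1) dom[OF sgn_eps_range(5)] in auto)
 have l2: "AE z in lebesgue. (%n. ?in z * (f (fst z) * (omg' (snd z) * \<Psi>n n (u z - v z)))) ~~>
   ?in z * (f (fst z) * (omg' (snd z) * max 0 (u z - v z)))"
  by (intro always_eventually allI tendsto_intros \<Psi>n_range)
 have m2: "(%z. ?in z * (f (fst z) * (omg' (snd z) * \<Psi>n n (u z - v z)))) : lebm" for n
  using chi(2)[of n] by auto
 have m3: "(%z. ?in z * (f (fst z) * (omg' (snd z) * max 0 (u z - v z)))) : lebm"
  by (rule borel_measurable_AE_limit[OF m2 l2])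
 have swia: "L1 (%z. \<bar>f (fst z) * (omg' (snd z) * max 0 (u z - v z))\<bar>)" using swi by auto
 have b2: "\<bar>?in z * (f (fst z) * (omg' (snd z) * c))\<bar> <= \<bar>f (fst z) * (omg' (snd z) * max 0 (u z - v z))\<bar>"
  if "\<bar>c\<bar> <= max 0 (u z - v z)" for z c
  using that by (auto simp: abs_mult indicator_def intro!: mult_left_mono)
 have c2: "\<bar>\<Psi>n n s\<bar> <= max 0 s" for n s using \<Psi>n_range(1,2)[of n s] by simp
 have lim2: "(%n. LI z. ?in z * (f (fst z) * (omg' (snd z) * \<Psi>n n (u z - v z)))) ~~>
   (LI z. ?in z * (f (fst z) * (omg' (snd z) * max 0 (u z - v z))))"
  by (rule integral_dominated_convergence[OF m3 m2 swia l2]) (use b2[OF c2] in simp)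
 have in_int: "L1 (%z. ?in z * (f (fst z) * (omg' (snd z) * max 0 (u z - v z))))"
  by (rule Lint_bound[OF swia m3]) (use b2 in simp)
 have step2: "(LI z. A z * (?in z * (?pos z * omg (snd z)))) =
   (LI z. ?in z * (f (fst z) * (omg' (snd z) * max 0 (u z - v z))))"
  using LIMSEQ_unique[OF lim1 lim2[folded ch']] .
 have "(LI z. ?in z * (f (fst z) * (omg' (snd z) * max 0 (u z - v z)))) +
   (LI z. ?out z * (f (fst z) * (omg' (snd z) * max 0 (u z)))) =
   (LI z. ?in z * (f (fst z) * (omg' (snd z) * max 0 (u z - v z))) +
    ?out z * (f (fst z) * (omg' (snd z) * max 0 (u z))))"
  using in_int out_int by (rule Bochner_Integration.integral_add[symmetric])
 also have "... = (LI z. f (fst z) * (omg' (snd z) * max 0 (u z - v z)))"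
 proof (rule Lint_cong[OF refl])
  fix z :: "'a \<times> real"
  obtain x t where z: "z = (x, t)" by (cases z)
  show "?in z * (f (fst z) * (omg' (snd z) * max 0 (u z - v z))) + ?out z * (f (fst z) * (omg' (snd z) * max 0 (u z))) =
    f (fst z) * (omg' (snd z) * max 0 (u z - v z))"
   using vout(1)[of t x] omg(5)[of t] by (cases "t : {a..b}"; cases "norm x <= R0") (auto simp: z)
 qed
 finally show ?thesis using step1 unfolding step2 swe by simp
qed

theorem comparison_principle:
 assumes t: "t >= 0"
 shows "AE x in lebesgue. u (x, t) <= v (x, t)"
proof -
 let ?y = "%t. LI x. f x * max 0 (u (x, t) - v (x, t))"
 have maxm: "(%s. max 0 (fst s - snd s) :: real) : borel_measurable (borel :: (real \<times> real) measure)"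
  by (intro borel_measurable_continuous_onI continuous_intros)
 have c: "continuous_on {0..} ?y" and i: "!!t. t >= 0 ==> L1 (%x. f x * max 0 (u (x, t) - v (x, t)))"
  by (rule continuous_weighted_integral[where h="%a b. max 0 (a - b)", OF f uL vL _ maxm]; auto)+
 have nn: "0 <= f x * max 0 (u (x, t) - v (x, t))" for x t using f(2)[of x] by simp
 have y0: "?y 0 = 0"
 proof -
  have "AE x in lebesgue. f x * max 0 (u (x, 0) - v (x, 0)) = 0"
   using init by eventually_elim simp
  hence "?y 0 = (LINT x|(lebesgue::'a measure). 0)" by (rule lebesgue_integral_cong_AE)
  thus ?thesis by simp
 qed
 have "?y t = 0"
 proof (rule weakly_nonincreasing_imp_zero[OF c y0 _ _ t])
  show "0 <= ?y t" for t by (rule integral_nonneg_AE) (simp add: nn)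
  fix omg omg' :: "real => real" and a b :: real
  assume "0 < a" "a < b" "!!t. (omg has_real_derivative omg' t) (at t)" "conton omg'"
   "!!t. 0 <= omg t" "!!t. t \<notin> {a..b} ==> omg t = 0 \<and> omg' t = 0"
  thus "0 <= integral {a..b} (%t. omg' t * ?y t)" by (intro main_inequality[of omg]) auto
 qed
 hence "AE x in lebesgue. f x * max 0 (u (x, t) - v (x, t)) = 0"
  using integral_nonneg_eq_0_iff_AE[OF i[OF t]] nn by simp
 thus ?thesis
 proof eventually_elim
  case (elim x)
  thus ?case using f(2)[of x] by (auto simp: max_def split: if_splits)
 qed
qed

end

subsection \<open>Growth functions and their primitives\<close>

text \<open>F / s^\<alpha> has logarithmic derivative F'/F - \<alpha>/s, whose sign is the
  hypothesis. It is applied to g, to G and to the profile Y.\<close>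

lemma powr_quotient_mono:
 fixes F F' :: "real => real"
 assumes F: "!!s. s > 0 ==> F s > 0" "!!s. s > 0 ==> (F has_real_derivative F' s) (at s)" and st: "0 < s" "s <= t"
 shows "(!!s. s > 0 ==> \<alpha> * (F s / s) <= F' s) ==> F s / s powr \<alpha> <= F t / t powr \<alpha>"
  and "(!!s. s > 0 ==> F' s <= \<alpha> * (F s / s)) ==> F t / t powr \<alpha> <= F s / s powr \<alpha>"
proof -
 let ?L = "%s. ln (F s) - \<alpha> * ln s"
 have d: "(?L has_real_derivative F' s / F s - \<alpha> / s) (at s)" if "s > 0" for s
  using F(1)[OF that] F(2)[OF that] that by (auto intro!: derivative_eq_intros simp: field_simps)
 have e: "F s / s powr \<alpha> = exp (?L s)" if "s > 0" for s
  using F(1)[OF that] that by (simp add: exp_diff powr_def)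
 show "F s / s powr \<alpha> <= F t / t powr \<alpha>" if h: "!!s. s > 0 ==> \<alpha> * (F s / s) <= F' s"
 proof -
  have "?L s <= ?L t"
  proof (rule DERIV_nonneg_imp_nondecreasing[OF st(2)])
   fix x assume "s <= x" "x <= t"
   hence x: "x > 0" using st by simp
   show "\<exists>y. (?L has_real_derivative y) (at x) \<and> 0 <= y"
    using d[OF x] h[OF x] F(1)[OF x] x by (intro exI[of _ "F' x / F x - \<alpha> / x"]) (simp add: field_simps)
  qed
  thus ?thesis using st by (simp add: e del: ln_div)
 qed
 show "F t / t powr \<alpha> <= F s / s powr \<alpha>" if h: "!!s. s > 0 ==> F' s <= \<alpha> * (F s / s)"
 proof -
  have "?L t <= ?L s"
  proof (rule DERIV_nonpos_imp_nonincreasing[OF st(2)])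
   fix x assume "s <= x" "x <= t"
   hence x: "x > 0" using st by simp
   show "\<exists>y. (?L has_real_derivative y) (at x) \<and> y <= 0"
    using d[OF x] h[OF x] F(1)[OF x] x by (intro exI[of _ "F' x / F x - \<alpha> / x"]) (simp add: field_simps)
  qed
  thus ?thesis using st by (simp add: e del: ln_div)
 qed
qed

lemma inverse_on_halfline_props:
 assumes h: "continuous_on {0..} h" "!!s t. 0 <= s ==> s < t ==> h s < h t" "h 0 = 0" "!!M. \<exists>s\<ge>0. M <= h s"
 shows "0 <= \<tau> ==> 0 <= inverse_on_halfline h \<tau>" and "0 <= \<tau> ==> h (inverse_on_halfline h \<tau>) = \<tau>"
  and "0 <= s ==> inverse_on_halfline h (h s) = s"
proof -
 have inj: "inj_on h {0..}"
  by (rule linorder_inj_onI) (use h(2) in "auto simp: less_imp_neq")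
 show "0 <= s ==> inverse_on_halfline h (h s) = s"
  using inj by (simp add: inverse_on_halfline_def the_inv_into_f_f)
 have ran: "\<tau> : h ` {0..}" if "0 <= \<tau>" for \<tau>
 proof -
  obtain s where s: "s >= 0" "\<tau> <= h s" using h(4) by blast
  have "\<exists>x\<ge>0. x <= s \<and> h x = \<tau>"
   by (rule IVT') (use s that h(3) in "auto intro: continuous_on_subset[OF h(1)]")
  thus ?thesis by auto
 qed
 show "0 <= \<tau> ==> h (inverse_on_halfline h \<tau>) = \<tau>"
  using f_the_inv_into_f[OF inj ran] by (simp add: inverse_on_halfline_def)
 show "0 <= \<tau> ==> 0 <= inverse_on_halfline h \<tau>"
  using the_inv_into_into[OF inj ran subset_refl] by (simp add: inverse_on_halfline_def)
qed

locale growth =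
 fixes p \<alpha>1 \<alpha>2 :: real and g :: "real => real"
 assumes p: "p > 1" and \<alpha>: "0 < \<alpha>1" "\<alpha>1 <= \<alpha>2" "\<alpha>2 < p"
  and gc: "continuous_on {0..} g" and gC1: "g C1_differentiable_on {0<..}"
  and g0: "g 0 = 0" and gpos: "!!s. s > 0 ==> g s > 0"
  and g': "!!s. s > 0 ==> \<alpha>1 * (g s / s) <= deriv g s \<and> deriv g s <= \<alpha>2 * (g s / s)"
begin

lemma gd: "s > 0 ==> (g has_real_derivative deriv g s) (at s)"
proof -
 assume "s > 0"
 then obtain D where "(g has_vector_derivative D) (at s)"
  using gC1 unfolding C1_differentiable_on_def by auto
 thus ?thesis by (simp add: DERIV_imp_deriv has_real_derivative_iff_has_vector_derivative[symmetric])
qed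

lemma g'_pos: "s > 0 ==> deriv g s > 0"
 using g'[of s] gpos[of s] \<alpha>(1) by (smt (verit) divide_pos_pos mult_pos_pos)

lemma increasing_halfline:
 assumes "continuous_on {0..} F" "!!s. s > 0 ==> (F has_real_derivative F' s) (at s)" "!!s. s > 0 ==> 0 < F' s"
  and "0 <= s" "s < t"
 shows "F s < (F t :: real)"
proof (rule DERIV_pos_imp_increasing_open[OF assms(5)])
 show "continuous_on {s..t} F" using assms(4) by (intro continuous_on_subset[OF assms(1)]) auto
 show "\<exists>y. (F has_real_derivative y) (at x) \<and> 0 < y" if "s < x" for x
  using assms(2,3)[of x] assms(4) that by auto
qed

lemma g_less: "0 <= s ==> s < t ==> g s < g t"
 by (rule increasing_halfline[OF gc gd g'_pos])

lemma g_mono: "0 <= s ==> s <= t ==> g s <= g t"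
 using g_less[of s t] by (cases "s = t") auto

lemma g_nonneg: "0 <= s ==> 0 <= g s" using g_mono[of 0 s] g0 by simp

lemma g_powr: "0 < s ==> s <= t ==> g s * (t / s) powr \<alpha>1 <= g t"
 using powr_quotient_mono(1)[OF gpos gd, of s t \<alpha>1] g' by (simp add: powr_divide field_simps)

lemma g_unbounded: "\<exists>s\<ge>0. M <= g s"
proof -
 \<comment> \<open>The second entry solves g 1 s^\<alpha>1 = max M 0; s must be at least 1 for the
   lower power bound.\<close>
 define s where "s = max 1 ((max M 0 / g 1) powr (1 / \<alpha>1))"
 have "max M 0 / g 1 = ((max M 0 / g 1) powr (1 / \<alpha>1)) powr \<alpha>1"
  using \<alpha> gpos[of 1] by (simp add: powr_powr)
 also have "... <= s powr \<alpha>1" using \<alpha> by (intro powr_mono2) (auto simp: s_def)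
 finally have "max M 0 <= g 1 * s powr \<alpha>1" using gpos[of 1] by (simp add: field_simps)
 hence "M <= g 1 * s powr \<alpha>1" by simp
 also have "... <= g s" using g_powr[of 1 s] by (simp add: s_def)
 finally show ?thesis by (intro exI[of _ s]) (auto simp: s_def)
qed

abbreviation "gi \<equiv> inverse_on_halfline g"
lemmas gi = inverse_on_halfline_props[OF gc g_less g0 g_unbounded]

abbreviation "G \<equiv> barrier_G g"

lemma quotient_continuous: "continuous_on {0<..} (%s. g s / s)"
 by (intro continuous_intros continuous_on_subset[OF gc]) auto

text \<open>The lower growth condition gives g(s)/s <= g'(s)/\<alpha>1, and g' is integrable up to 0
  because g is continuous there; so the integrand of G is integrable. Integrating the two growth
  conditions compares G with g.\<close>

lemma G_props:
 assumes r: "r >= 0"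
 shows "(%s. g s / s) absolutely_integrable_on {0..r}" and "G r = integral {0..r} (%s. g s / s)"
  and "\<alpha>1 * G r <= g r" and "g r <= \<alpha>2 * G r"
proof -
 have I: "(deriv g has_integral g r - g 0) {0..r}"
  using r gd by (intro fundamental_theorem_of_calculus_interior)
   (auto simp: has_real_derivative_iff_has_vector_derivative[symmetric] intro: continuous_on_subset[OF gc])
 \<comment> \<open>\<open>deriv g\<close> is replaced by 0 at the end point 0, where the growth
   conditions say nothing; one point does not affect the integral.\<close>
 define d where "d s = (if s > 0 then deriv g s else 0)" for s
 have I': "(d has_integral g r) {0..r}"
  by (rule has_integral_spike[OF negligible_sing[of 0] _ I[unfolded g0 diff_zero]]) (auto simp: d_def)
 have le: "\<bar>g s / s\<bar> <= d s / \<alpha>1" "g s / s >= 0" if "s : {0..r}" for s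
  using that g'[of s] gpos[of s] \<alpha>(1) by (cases "s = 0"; force simp: d_def field_simps)+
 have m: "(%s. g s / s) : borel_measurable (lebesgue_on {0..r})"
 proof -
  have "continuous_on {0..r} g" by (rule continuous_on_subset[OF gc]) auto
  hence "g : borel_measurable (lebesgue_on {0..r})" by (rule continuous_imp_measurable_on_sets_lebesgue) simp
  moreover have "(%s. s) : borel_measurable (lebesgue_on {0..r})"
   by (rule continuous_imp_measurable_on_sets_lebesgue) auto
  ultimately show ?thesis by measurable
 qed
 have id: "(%s. d s / \<alpha>1) integrable_on {0..r}" using I' by (auto simp: divide_inverse intro!: integrable_on_mult_left)
 show ai: "(%s. g s / s) absolutely_integrable_on {0..r}"
  by (rule measurable_bounded_by_integrable_imp_absolutely_integrable[OF m _ id]) (use le in auto)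
 hence io: "(%s. g s / s) integrable_on {0..r}" using set_lebesgue_integral_eq_integral(1) by blast
 have mb: "(%s. indicat_real {0..r} s *\<^sub>R (g s / s)) : borm"
 proof -
  have "(%s. indicator {0<..} s *\<^sub>R (g s / s)) : borm"
   by (rule borel_measurable_continuous_on_indicator[OF _ quotient_continuous]) auto
  hence "(%s. indicator {..r} s * (indicator {0<..} s *\<^sub>R (g s / s))) : borm" by measurable
  moreover have "(%s. indicator {..r} s * (indicator {0<..} s *\<^sub>R (g s / s))) = (%s. indicat_real {0..r} s *\<^sub>R (g s / s))"
   by (auto simp: fun_eq_iff indicator_def)
  ultimately show ?thesis by simp
 qed
 have "G r = (LINT s:{0..r}|lebesgue. g s / s)"
  unfolding barrier_G_def set_lebesgue_integral_def using integrable_lebesgue_of_borel(2)[OF mb] by simp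
 also have "... = integral {0..r} (%s. g s / s)" by (rule set_lebesgue_integral_eq_integral(2)[OF ai])
 finally show G: "G r = integral {0..r} (%s. g s / s)" .
 have "integral {0..r} (%s. g s / s) <= integral {0..r} (%s. d s / \<alpha>1)"
  by (intro integral_le io id order_trans[OF abs_ge_self le(1)])
 also have "... = g r / \<alpha>1" using I' by (simp add: integral_unique)
 finally show "\<alpha>1 * G r <= g r" using \<alpha>(1) by (simp add: G field_simps)
 have "g r = integral {0..r} d" using I' by (simp add: integral_unique)
 also have "... <= integral {0..r} (%s. \<alpha>2 * (g s / s))"
 proof (rule integral_le)
  show "d integrable_on {0..r}" using I' by blast
  show "(%s. \<alpha>2 * (g s / s)) integrable_on {0..r}" using integrable_on_cmult_left[OF io, of \<alpha>2] by simp
  show "d s <= \<alpha>2 * (g s / s)" if "s : {0..r}" for s using that g'[of s] by (cases "s = 0") (auto simp: d_def)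
 qed
 also have "... = \<alpha>2 * G r" unfolding G by (rule integral_mult_right)
 finally show "g r <= \<alpha>2 * G r" .
qed

lemma G0: "G 0 = 0" using G_props(2)[of 0] by simp

lemma G_pos: "r > 0 ==> G r > 0"
 using G_props(4)[of r] gpos[of r] \<alpha> by (smt (verit) mult_nonneg_nonpos)

lemma Gd:
 assumes r: "r > 0" shows "(G has_real_derivative g r / r) (at r)"
proof -
 have io: "(%s. g s / s) integrable_on {0..t}" if "t >= 0" for t
  using G_props(1)[OF that] set_lebesgue_integral_eq_integral(1) by blast
 have "((%t. integral {r/2..t} (%s. g s / s)) has_real_derivative g r / r) (at r within {r/2..r+1})"
  using r by (intro integral_has_real_derivative continuous_on_subset[OF quotient_continuous]) auto
 hence "((%t. integral {r/2..t} (%s. g s / s)) has_real_derivative g r / r) (at r)"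
  using r by (subst (asm) at_within_interior) auto
 hence "((%t. G (r/2) + integral {r/2..t} (%s. g s / s)) has_real_derivative 0 + g r / r) (at r)"
  by (intro DERIV_add DERIV_const)
 hence "((%t. G (r/2) + integral {r/2..t} (%s. g s / s)) has_real_derivative g r / r) (at r)" by simp
 thus ?thesis
 proof (rule has_field_derivative_transform_within_open[OF _ open_greaterThan[of "r/2"]])
  fix t assume "t : {r/2<..}"
  thus "G (r/2) + integral {r/2..t} (%s. g s / s) = G t"
   using r by (simp add: G_props(2) Henstock_Kurzweil_Integration.integral_combine[OF _ _ io])
 qed (use r in auto)
qed

text \<open>At 0, G is squeezed between 0 and g/\<alpha>1.\<close>

lemma Gc: "continuous_on {0..} G"
proof -
 have "continuous (at r within {0..}) G" if "r >= 0" for r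
 proof (cases "r = 0")
  case True
  have "(G \<longlongrightarrow> 0) (at 0 within {0..})"
  proof (rule tendsto_sandwich[where f="%_. 0" and h="%r. g r / \<alpha>1"])
   have "((%r. g r / \<alpha>1) \<longlongrightarrow> g 0 / \<alpha>1) (at 0 within {0..})"
    using gc \<alpha> by (intro tendsto_intros) (auto simp: continuous_on_def)
   thus "((%r. g r / \<alpha>1) \<longlongrightarrow> 0) (at 0 within {0..})" by (simp add: g0)
   show "\<forall>\<^sub>F r in at 0 within {0..}. 0 <= G r"
    by (auto simp: eventually_at_filter intro!: always_eventually less_imp_le G_pos)
   show "\<forall>\<^sub>F r in at 0 within {0..}. G r <= g r / \<alpha>1"
    using G_props(3) \<alpha> by (auto simp: eventually_at_filter field_simps intro!: always_eventually)
  qed auto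
  thus ?thesis using True G0 by (simp add: continuous_within)
 next
  case False
  thus ?thesis using that DERIV_isCont[OF Gd[of r]] by (simp add: continuous_at_imp_continuous_at_within)
 qed
 thus ?thesis by (simp add: continuous_on_eq_continuous_within)
qed

lemma G_less: "0 <= s ==> s < t ==> G s < G t"
 by (rule increasing_halfline[OF Gc Gd]) (auto intro: divide_pos_pos gpos)

lemma G_lower: "r >= 1 ==> g 1 / \<alpha>2 * r powr \<alpha>1 <= G r"
 using g_powr[of 1 r] G_props(4)[of r] \<alpha> by (simp add: field_simps)

lemma G_unbounded: "\<exists>s\<ge>0. M <= G s"
proof -
 obtain s where "s >= 0" "\<alpha>2 * max M 0 <= g s" using g_unbounded by blast
 moreover from this(1) have "g s <= \<alpha>2 * G s" by (rule G_props(4))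
 ultimately have "max M 0 <= G s" using \<alpha> by (smt (verit) mult_less_cancel_left_pos)
 thus ?thesis using \<open>s >= 0\<close> by (intro exI[of _ s]) simp
qed

abbreviation "Gi \<equiv> inverse_on_halfline G"
lemmas Gi = inverse_on_halfline_props[OF Gc G_less G0 G_unbounded]

lemma Gi_pos: "\<tau> > 0 ==> Gi \<tau> > 0"
 using Gi(1,2)[of \<tau>] G0 by (cases "Gi \<tau> = 0") auto

lemma Gi_mono: "0 <= s ==> s <= t ==> Gi s <= Gi t"
 using G_less[of "Gi t" "Gi s"] Gi(1,2)[of s] Gi(1,2)[of t] by (cases "Gi s <= Gi t") auto

lemma Gi_derivative:
 assumes "\<tau> > 0" shows "(Gi has_real_derivative Gi \<tau> / g (Gi \<tau>)) (at \<tau>)"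
proof -
 let ?\<rho> = "Gi \<tau>"
 have \<rho>: "?\<rho> > 0" using Gi_pos assms by simp
 have "isCont Gi (G ?\<rho>)"
 proof (rule isCont_inverse_function[where d="?\<rho> / 2" and f=G and x="?\<rho>"])
  fix z assume "\<bar>z - ?\<rho>\<bar> <= ?\<rho> / 2"
  hence "z > 0" using \<rho> by linarith
  thus "Gi (G z) = z" "isCont G z" using Gi(3) DERIV_isCont[OF Gd] by auto
 qed (use \<rho> in simp)
 hence c: "isCont Gi \<tau>" using Gi(2) assms by simp
 have "(Gi has_real_derivative inverse (g ?\<rho> / ?\<rho>)) (at \<tau>)"
  by (rule DERIV_inverse_function[OF Gd[OF \<rho>] _ _ _ _ c, of 0 "\<tau> + 1"])
   (use gpos[OF \<rho>] \<rho> assms Gi(2) in auto)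
 thus ?thesis by simp
qed

text \<open>The scale invariant logarithmic derivative r G'(r) / G(r). In terms of it the prescribed
  \<nu> of the barrier is 1 - lam r0 / p.\<close>

definition lam :: "real => real" where "lam r = g r / G r"

lemma lam: "r > 0 ==> \<alpha>1 <= lam r" "r > 0 ==> lam r <= \<alpha>2" "r > 0 ==> 0 < p - lam r"
proof -
 show 1: "r > 0 ==> \<alpha>1 <= lam r" "r > 0 ==> lam r <= \<alpha>2"
  using G_props(3,4)[of r] G_pos[of r] by (auto simp: lam_def field_simps)
 show "r > 0 ==> 0 < p - lam r" using 1(2) \<alpha>(3) by linarith
qed

lemma G_powr:
 assumes "0 < s" "s <= t"
 shows "G t <= G s * (t / s) powr \<alpha>2"
 using powr_quotient_mono(2)[OF G_pos Gd assms, of \<alpha>2] G_props(4) \<alpha> assms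
 by (simp add: powr_divide field_simps)

text \<open>\<open>J\<close> to the power \<open>1 / (p - 1)\<close>, the radial profile of the barrier outside the core.\<close>

definition Y :: "real => real" where "Y r = barrier_J p g r powr (1 / (p - 1))"

definition dY :: "real => real" where "dY r = Y r * (p - lam r) / ((p - 1) * r)"

lemma J_pos: "r > 0 ==> barrier_J p g r > 0" by (simp add: barrier_J_def G_pos)

lemma Y_pos: "r > 0 ==> Y r > 0" using J_pos[of r] by (simp add: Y_def)

lemma Y_powr: "r > 0 ==> Y r powr (p - 1) = r powr p / G r"
 using J_pos[of r] p by (simp add: Y_def powr_powr) (simp add: barrier_J_def)

lemma Y_derivative:
 assumes r: "r > 0" shows "(Y has_real_derivative dY r) (at r)"
proof -
 have "((%r. r powr p / G r) has_real_derivative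
   (p * r powr (p - 1) * G r - r powr p * (g r / r)) / (G r * G r)) (at r)"
  using r G_pos[OF r] by (intro DERIV_divide Gd) (auto intro!: derivative_eq_intros)
 moreover have "(p * r powr (p - 1) * G r - r powr p * (g r / r)) / (G r * G r) =
   barrier_J p g r * (p - lam r) / r"
  using r G_pos[OF r] by (simp add: barrier_J_def lam_def powr_diff field_simps)
 ultimately have J: "(barrier_J p g has_real_derivative barrier_J p g r * (p - lam r) / r) (at r)"
  unfolding barrier_J_def[abs_def] by simp
 have "((%r. barrier_J p g r powr (1 / (p - 1))) has_real_derivative
   (1 / (p - 1)) * barrier_J p g r powr (1 / (p - 1) - 1) * (barrier_J p g r * (p - lam r) / r)) (at r)"
  using DERIV_fun_powr[OF J J_pos[OF r], of "1 / (p - 1)"] by simp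
 moreover have "(1 / (p - 1)) * barrier_J p g r powr (1 / (p - 1) - 1) * (barrier_J p g r * (p - lam r) / r) = dY r"
  using J_pos[OF r] r p by (simp add: dY_def Y_def powr_diff)
 ultimately show ?thesis unfolding Y_def[abs_def] by simp
qed

lemma dY_pos: "r > 0 ==> dY r > 0"
 using Y_pos[of r] lam(3)[of r] p by (simp add: dY_def)

lemma Y_less:
 assumes "0 < s" "s < t" shows "Y s < Y t"
proof (rule DERIV_pos_imp_increasing[OF assms(2)])
 show "\<exists>y. (Y has_real_derivative y) (at x) \<and> 0 < y" if "s <= x" for x
  using Y_derivative[of x] dY_pos[of x] assms(1) that by auto
qed

lemma Y_mono: "0 < s ==> s <= t ==> Y s <= Y t"
 using Y_less[of s t] by (cases "s = t") auto

text \<open>Chosen so that Y'(r)^(p-1) = \<kappa> r H(r): the p-Laplacian flux of the radial profile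
  is then a scalar \<kappa> H(|x|) times x.\<close>

definition H :: "real => real" where "H r = (p - lam r) powr (p - 1) / G r"

definition \<kappa> :: real where "\<kappa> = (p - 1) powr (1 - p)"

lemma \<kappa>_pos: "\<kappa> > 0" using p by (simp add: \<kappa>_def)

lemma H_pos: "r > 0 ==> H r > 0" using lam(3)[of r] G_pos[of r] by (simp add: H_def)

lemma dY_powr:
 assumes r: "r > 0" shows "dY r powr (p - 1) = \<kappa> * r * H r"
proof -
 have "dY r powr (p - 1) = Y r powr (p - 1) * (p - lam r) powr (p - 1) / ((p - 1) powr (p - 1) * r powr (p - 1))"
  using Y_pos[OF r] lam(3)[OF r] p r by (simp add: dY_def powr_mult powr_divide)
 also have "... = (r powr p / r powr (p - 1)) * (1 / (p - 1) powr (p - 1)) * H r"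
  using r by (simp add: Y_powr H_def)
 also have "r powr p / r powr (p - 1) = r" using r by (simp add: powr_diff[symmetric])
 also have "1 / (p - 1) powr (p - 1) = \<kappa>" using powr_minus_divide[of "p - 1" "p - 1"] by (simp add: \<kappa>_def)
 finally show ?thesis by (simp add: mult_ac)
qed

definition KH :: real where "KH = \<alpha>2 + (p - 1) * \<alpha>2 * \<alpha>2 / (p - \<alpha>2)"

lemma KH_pos: "KH > 0" using p \<alpha> unfolding KH_def by (intro add_pos_nonneg divide_nonneg_nonneg mult_nonneg_nonneg) auto

text \<open>With \<mu> = r g'/g, which also lies between \<alpha>1 and \<alpha>2, one finds r H'/H =
  -(lam + (p-1) lam (\<mu> - lam)/(p - lam)), and \<open>KH\<close> bounds its absolute
  value.\<close>

lemma H_derivative: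
 assumes r: "r > 0"
 obtains D where "(H has_real_derivative D) (at r)" "\<bar>D\<bar> * r <= KH * H r"
proof -
 define \<mu> where "\<mu> = deriv g r * r / g r"
 have \<mu>: "\<alpha>1 <= \<mu>" "\<mu> <= \<alpha>2" using g'[OF r] gpos[OF r] r by (auto simp: \<mu>_def field_simps)
 have dlam: "(lam has_real_derivative lam r * (\<mu> - lam r) / r) (at r)"
 proof -
  have "((%r. g r / G r) has_real_derivative (deriv g r * G r - g r * (g r / r)) / (G r * G r)) (at r)"
   using G_pos[OF r] by (intro DERIV_divide Gd gd r) auto
  moreover have "(deriv g r * G r - g r * (g r / r)) / (G r * G r) = lam r * (\<mu> - lam r) / r"
   using r G_pos[OF r] gpos[OF r] by (simp add: lam_def \<mu>_def field_simps)
  ultimately show ?thesis unfolding lam_def[abs_def] by simp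
 qed
 let ?l = "p - lam r"
 let ?D = "- H r * (lam r + (p - 1) * lam r * (\<mu> - lam r) / ?l) / r"
 have dl: "((%r. p - lam r) has_real_derivative - (lam r * (\<mu> - lam r) / r)) (at r)"
  using DERIV_diff[OF DERIV_const dlam, of p] by simp
 have "((%r. (p - lam r) powr (p - 1) / G r) has_real_derivative
   ((p - 1) * ?l powr (p - 1 - 1) * (- (lam r * (\<mu> - lam r) / r)) * G r - ?l powr (p - 1) * (g r / r)) / (G r * G r)) (at r)"
  using DERIV_fun_powr[OF dl lam(3)[OF r], of "p - 1"] G_pos[OF r]
  by (intro DERIV_divide Gd r) auto
 moreover have "((p - 1) * ?l powr (p - 1 - 1) * (- (lam r * (\<mu> - lam r) / r)) * G r - ?l powr (p - 1) * (g r / r)) / (G r * G r) = ?D"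
 proof -
  have e: "?l powr (p - 1 - 1) = ?l powr (p - 1) / ?l" using lam(3)[OF r] powr_diff[of ?l "p - 1" 1] by simp
  have gl: "g r = lam r * G r" using G_pos[OF r] by (simp add: lam_def)
  show ?thesis unfolding e gl H_def using r G_pos[OF r] lam(3)[OF r] by (simp add: divide_simps) (simp add: algebra_simps)
 qed
 ultimately have d: "(H has_real_derivative ?D) (at r)" unfolding H_def[abs_def] by simp
 have "\<bar>lam r + (p - 1) * lam r * (\<mu> - lam r) / ?l\<bar> <= KH"
 proof -
  have "\<bar>(p - 1) * lam r * (\<mu> - lam r) / ?l\<bar> <= (p - 1) * \<alpha>2 * \<alpha>2 / (p - \<alpha>2)"
   unfolding abs_divide abs_mult using p \<alpha> \<mu> lam[OF r]
   by (intro frac_le mult_mono) (auto intro!: mult_nonneg_nonneg)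
  thus ?thesis using lam[OF r] \<alpha> unfolding KH_def by linarith
 qed
 hence "H r * \<bar>lam r + (p - 1) * lam r * (\<mu> - lam r) / ?l\<bar> <= H r * KH"
  using H_pos[OF r] by (intro mult_left_mono) auto
 moreover have "\<bar>?D\<bar> * r = H r * \<bar>lam r + (p - 1) * lam r * (\<mu> - lam r) / ?l\<bar>"
  using r H_pos[OF r] by (simp add: abs_mult)
 ultimately show ?thesis using that[OF d] by (simp add: mult.commute)
qed

end

subsection \<open>The barrier as a continuously differentiable function\<close>

locale barrier_parameters = growth +
 fixes m t0 C r0 \<Gamma> :: real
 assumes pm: "p + m - 3 > 0" and t0: "t0 > 1" and C: "C > 0" and r0: "r0 > 0" and \<Gamma>: "\<Gamma> > 0"
begin

definition k where "k = 1 / (p + m - 3)"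
definition b where "b = (p - 1) / (p + m - 3)"
definition q where "q = grad_exponent p m"

text \<open>b q = 1 + k exceeds 1, so v^q is of class one even when v is not; p q >= 1 is the
  condition for the flux estimate in the comparison principle.\<close>

lemma exponents: "k > 0" "b > 0" "q > 0" "b * q = 1 + k" "b = (p - 1) * k" "p * q >= 1" "q * (p - 1) = p + m - 2"
proof -
 show "k > 0" "b > 0" "q > 0" using p pm by (auto simp: k_def b_def q_def grad_exponent_def)
 have "b * q = (p + m - 2) / (p + m - 3)" using p by (simp add: b_def q_def grad_exponent_def)
 also have "... = 1 + k" using pm by (simp add: k_def field_simps)
 finally show "b * q = 1 + k" .
 show "b = (p - 1) * k" by (simp add: k_def b_def)
 show e: "q * (p - 1) = p + m - 2" using p by (simp add: q_def grad_exponent_def)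
 have "p * 1 <= p * (p + m - 2)" using p pm by (intro mult_left_mono) auto
 hence "p - 1 <= p * (p + m - 2)" by linarith
 also have "... = (p - 1) * (p * q)" unfolding e[symmetric] by simp
 finally show "p * q >= 1" using p by simp
qed

definition profile :: "real => real" where "profile r = (if r >= r0 then Y r else barrier_I p g r0 r)"

text \<open>In the core the profile has the slope formula of Y with H frozen at r0, so
  \<open>max r r0\<close> covers both branches.\<close>

definition dprofile :: "real => real" where "dprofile r = (\<kappa> * r * H (max r r0)) powr (1 / (p - 1))"

lemma dY_eq: "r > 0 ==> dY r = (\<kappa> * r * H r) powr (1 / (p - 1))"
 using p dY_pos[of r] by (simp add: dY_powr[symmetric] powr_powr)

lemma H_max_pos [simp]: "H (max r r0) > 0" using H_pos r0 by simp

lemma dprofile_powr: "r >= 0 ==> dprofile r powr (p - 1) = \<kappa> * r * H (max r r0)"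
 using p \<kappa>_pos H_max_pos[of r] by (simp add: dprofile_def powr_powr del: H_max_pos)

lemma inner_coefficient:
 "(p - lam r0) / (p - 1) * (1 / G r0) powr (1 / (p - 1)) * r powr (1 / (p - 1)) = (\<kappa> * r * H r0) powr (1 / (p - 1))"
proof -
 have \<kappa>: "\<kappa> powr (1 / (p - 1)) = 1 / (p - 1)"
 proof -
  have "(1 - p) * (1 / (p - 1)) = - 1" using p by (simp add: field_simps)
  thus ?thesis using p by (simp add: \<kappa>_def powr_powr powr_minus_divide)
 qed
 show ?thesis using lam(3)[OF r0] G_pos[OF r0] p
  by (simp add: H_def powr_mult \<kappa> powr_powr powr_divide)
qed

text \<open>\<open>barrier_nu\<close> equals 1 - lam r0 / p because r0 G'(r0) = g r0.\<close>

lemma I_eq: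
 assumes "r >= 0"
 shows "barrier_I p g r0 r = (1 - lam r0 / p) * (1 / G r0) powr (1 / (p - 1)) * r powr (p / (p - 1)) + lam r0 / p * Y r0"
proof -
 have "deriv G r0 = g r0 / r0" by (rule DERIV_imp_deriv[OF Gd[OF r0]])
 hence "barrier_nu p g r0 = 1 - lam r0 / p" using r0 by (simp add: barrier_nu_def lam_def)
 thus ?thesis using assms by (simp add: barrier_I_def Y_def powr_powr powr_divide)
qed

lemma I_r0: "barrier_I p g r0 r0 = Y r0"
 by (simp add: barrier_I_def Y_def barrier_J_def[symmetric] ring_distribs(2)[symmetric])

lemma I_derivative:
 assumes r: "r > 0" shows "(barrier_I p g r0 has_real_derivative (\<kappa> * r * H r0) powr (1 / (p - 1))) (at r)"
proof -
 have e: "p / (p - 1) - 1 = 1 / (p - 1)" using p by (simp add: field_simps)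
 have pp: "p / (p - 1) * (1 - lam r0 / p) = (p - lam r0) / (p - 1)" using p by (simp add: field_simps)
 have "((%r. (1 - lam r0 / p) * (1 / G r0) powr (1 / (p - 1)) * r powr (p / (p - 1)) + lam r0 / p * Y r0)
  has_real_derivative (1 - lam r0 / p) * (1 / G r0) powr (1 / (p - 1)) * (p / (p - 1) * r powr (p / (p - 1) - 1)) + 0) (at r)"
  using r by (intro DERIV_add DERIV_const DERIV_cmult has_real_derivative_powr)
 moreover have "(1 - lam r0 / p) * (1 / G r0) powr (1 / (p - 1)) * (p / (p - 1) * r powr (p / (p - 1) - 1)) + 0
  = (\<kappa> * r * H r0) powr (1 / (p - 1))"
  unfolding e inner_coefficient[symmetric] pp[symmetric] by (simp add: mult_ac)
 ultimately have "((%r. (1 - lam r0 / p) * (1 / G r0) powr (1 / (p - 1)) * r powr (p / (p - 1)) + lam r0 / p * Y r0)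
  has_real_derivative (\<kappa> * r * H r0) powr (1 / (p - 1))) (at r)" by simp
 thus ?thesis
  by (rule has_field_derivative_transform_within_open[of _ _ _ "{0<..}"]) (use r I_eq in auto)
qed

text \<open>At r0 the difference quotients of the two branches have the same limit, which is what
  the value of \<nu> is made for.\<close>

lemma profile_derivative:
 assumes r: "r > 0" shows "(profile has_real_derivative dprofile r) (at r)"
proof -
 consider "r < r0" | "r = r0" | "r > r0" by linarith
 thus ?thesis
 proof cases
  case 1
  have "(barrier_I p g r0 has_real_derivative dprofile r) (at r)" using I_derivative[OF r] 1 by (simp add: dprofile_def)
  thus ?thesis
   by (rule has_field_derivative_transform_within_open[of _ _ _ "{..<r0}"]) (use 1 in "auto simp: profile_def")
 next
  case 3
  have "(Y has_real_derivative dprofile r) (at r)" using Y_derivative[OF r] 3 dY_eq[OF r] by (simp add: dprofile_def)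
  thus ?thesis
   by (rule has_field_derivative_transform_within_open[of _ _ _ "{r0<..}"]) (use 3 in "auto simp: profile_def")
 next
  case 2
  have 1: "((%y. (barrier_I p g r0 y - Y r0) / (y - r0)) \<longlongrightarrow> dprofile r0) (at r0)"
   using I_derivative[OF r0] by (simp add: has_field_derivative_iff I_r0 dprofile_def)
  have 2: "((%y. (Y y - Y r0) / (y - r0)) \<longlongrightarrow> dprofile r0) (at r0)"
   using Y_derivative[OF r0] dY_eq[OF r0] by (simp add: has_field_derivative_iff dprofile_def)
  have "((%y. if y >= r0 then (Y y - Y r0) / (y - r0) else (barrier_I p g r0 y - Y r0) / (y - r0)) \<longlongrightarrow> dprofile r0) (at r0)"
   by (rule filterlim_If) (rule tendsto_mono[OF _ 2] tendsto_mono[OF _ 1], simp)+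
  hence "((%y. (profile y - profile r0) / (y - r0)) \<longlongrightarrow> dprofile r0) (at r0)"
   by (rule tendsto_cong[THEN iffD1, rotated]) (simp add: profile_def)
  thus ?thesis using \<open>r = r0\<close> by (simp add: has_field_derivative_iff)
 qed
qed

lemma lam_continuous: "continuous_on {0<..} lam"
 unfolding lam_def[abs_def] using G_pos
 by (intro continuous_on_divide continuous_on_subset[OF gc] continuous_on_subset[OF Gc]) force+

lemma H_continuous: "continuous_on {0<..} H"
 unfolding H_def[abs_def] using lam(3) G_pos p
 by (intro continuous_on_divide continuous_on_powr' continuous_on_diff continuous_on_const lam_continuous continuous_on_subset[OF Gc]) force+

lemma Y_continuous: "continuous_on {0<..} Y"
 using Y_derivative by (intro DERIV_continuous_on) (auto intro: has_field_derivative_at_within)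

lemma dY_continuous: "continuous_on {0<..} dY"
 unfolding dY_def[abs_def] using p
 by (intro continuous_intros lam_continuous Y_continuous) auto

lemma H_max_continuous: "conton (%r. H (max r r0))"
 by (rule continuous_on_compose2[OF H_continuous]) (use r0 in "auto intro!: continuous_intros")

lemma dprofile_continuous: "continuous_on {0..} dprofile"
 unfolding dprofile_def[abs_def]
proof (intro continuous_on_powr' continuous_on_mult continuous_on_const continuous_on_id continuous_on_subset[OF H_max_continuous] ballI conjI impI)
 show "0 <= \<kappa> * r * H (max r r0)" if "r : {0..}" for r
  using that \<kappa>_pos less_imp_le[OF H_max_pos] by (intro mult_nonneg_nonneg) auto
qed (use p in auto)

lemma dprofile_0: "dprofile 0 = 0" by (simp add: dprofile_def)

lemma dprofile_nonneg: "0 <= dprofile r" by (simp add: dprofile_def)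

text \<open>At the origin the inner branch is a constant plus a multiple of r^(p/(p-1)), whose
  exponent exceeds 1, so the gradient is 0.\<close>

lemma profile_has_derivative:
 fixes x :: "'a::euclidean_space"
 shows "((%x. profile (norm x)) has_derivative (%h. (dprofile (norm x) *\<^sub>R sgn x) \<bullet> h)) (at x)"
proof (cases "x = 0")
 case False
 have "(norm has_derivative (%h. sgn x \<bullet> h)) (at x)" using has_derivative_norm[OF False] by (simp add: inner_commute)
 from has_derivative_compose[OF this, of profile "(*) (dprofile (norm x))"]
 show ?thesis using profile_derivative[of "norm x"] False
  by (simp add: has_field_derivative_def)
next
 case True
 let ?c = "(1 - lam r0 / p) * (1 / G r0) powr (1 / (p - 1))"
 have e: "1 + 1 / (p - 1) = p / (p - 1)" using p by (simp add: field_simps)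
 have "((%h::'a. profile (norm h)) has_derivative (%h. 0)) (at 0)"
  unfolding has_derivative_at
 proof
  have "((%h::'a. \<bar>?c\<bar> * norm h powr (1 / (p - 1))) \<longlongrightarrow> \<bar>?c\<bar> * norm (0::'a) powr (1 / (p - 1))) (at 0)"
   using p by (intro tendsto_mult tendsto_const tendsto_powr' tendsto_norm tendsto_ident_at) auto
  hence l: "((%h::'a. \<bar>?c\<bar> * norm h powr (1 / (p - 1))) \<longlongrightarrow> 0) (at 0)" by simp
  have "\<forall>\<^sub>F h::'a in at 0. \<bar>?c\<bar> * norm h powr (1 / (p - 1)) = norm (profile (norm (0 + h)) - profile (norm (0::'a)) - 0) / norm h"
   unfolding eventually_at
  proof (intro exI[of _ r0] conjI ballI impI r0)
   fix h :: 'a assume "h ~= 0 \<and> dist h 0 < r0"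
   hence h: "0 < norm h" "norm h < r0" by auto
   have "profile (norm h) - profile 0 = ?c * norm h powr (p / (p - 1))"
    using h r0 I_eq[of "norm h"] I_eq[of 0] by (simp add: profile_def)
   also have "... = ?c * norm h powr (1 / (p - 1)) * norm h"
    using h by (simp add: powr_add flip: e)
   finally show "\<bar>?c\<bar> * norm h powr (1 / (p - 1)) = norm (profile (norm (0 + h)) - profile (norm (0::'a)) - 0) / norm h"
    using h by (simp add: abs_mult)
  qed
  thus "(%h::'a. norm (profile (norm (0 + h)) - profile (norm (0::'a)) - 0) / norm h) \<midarrow>0\<rightarrow> 0"
   by (rule Lim_transform_eventually[OF l])
 qed simp
 thus ?thesis using True by simp
qed

text \<open>\<open>sgn\<close> jumps at 0, but its factor \<open>dprofile\<close> vanishes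
  there.\<close>

lemma profile_gradient_continuous: "conton (%x::'a::euclidean_space. dprofile (norm x) *\<^sub>R sgn x)"
 unfolding continuous_on_eq_continuous_within
proof
 fix x :: 'a
 show "continuous (at x) (%x. dprofile (norm x) *\<^sub>R sgn x)"
 proof (cases "x = 0")
  case True
  have "conton (%x::'a. dprofile (norm x))"
   by (rule continuous_on_compose2[OF dprofile_continuous]) (auto intro: continuous_intros)
  hence "((%x::'a. dprofile (norm x)) \<longlongrightarrow> 0) (at 0)"
   by (auto simp: continuous_on_def dprofile_0 dest: spec[of _ "0::'a"])
  hence "((%x::'a. dprofile (norm x) *\<^sub>R sgn x) \<longlongrightarrow> 0) (at 0)"
   by (rule Lim_null_comparison[rotated]) (auto intro!: always_eventually simp: norm_sgn dprofile_nonneg)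
  thus ?thesis using True by (simp add: continuous_at)
 next
  case False
  have "continuous_on (- {0}) (%x::'a. dprofile (norm x) *\<^sub>R sgn x)"
   by (intro continuous_intros continuous_on_compose2[OF dprofile_continuous]) auto
  thus ?thesis using False by (simp add: continuous_on_eq_continuous_at open_Compl)
 qed
qed

text \<open>The radius at which J equals E(\<tau>), hence the free boundary once it has passed r0;
  the first term of the bracket in the barrier is Y(front t). Facts about it are stated for t > 1 -
  t0, where the logarithm is positive, an open set containing t = 0.\<close>

definition front :: "real => real" where "front t = Gi (\<Gamma> * ln (t + t0))"
definition height :: "real => real" where "height t = Y (front t)"
definition dheight :: "real => real" where
 "dheight t = dY (front t) * (front t / g (front t)) * (\<Gamma> / (t + t0))"

lemma front_pos: "t > 1 - t0 ==> front t > 0"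
 using Gi_pos[of "\<Gamma> * ln (t + t0)"] \<Gamma> by (simp add: front_def)

lemma front_mono: "1 - t0 < s ==> s <= t ==> front s <= front t"
 unfolding front_def using \<Gamma> by (intro Gi_mono mult_left_mono) auto

lemma G_front: "t > 1 - t0 ==> G (front t) = \<Gamma> * ln (t + t0)"
 unfolding front_def using \<Gamma> by (intro Gi mult_nonneg_nonneg) auto

lemma front_derivative:
 assumes "t > 1 - t0"
 shows "(front has_real_derivative (front t / g (front t)) * (\<Gamma> / (t + t0))) (at t)"
proof -
 have "((%t. \<Gamma> * ln (t + t0)) has_real_derivative \<Gamma> / (t + t0)) (at t)"
  using assms t0 by (auto intro!: derivative_eq_intros)
 from DERIV_chain2[OF Gi_derivative this] show ?thesis
  using assms \<Gamma> by (simp add: front_def[abs_def])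
qed

lemma height_derivative:
 assumes "t > 1 - t0" shows "(height has_real_derivative dheight t) (at t)"
 using DERIV_chain2[OF Y_derivative[OF front_pos[OF assms]] front_derivative[OF assms]]
 by (simp add: height_def[abs_def] dheight_def mult.assoc)

lemma front_continuous: "continuous_on {1 - t0<..} front"
 using front_derivative by (intro DERIV_continuous_on) (auto intro: has_field_derivative_at_within)

lemma height_continuous: "continuous_on {1 - t0<..} height"
 using height_derivative by (intro DERIV_continuous_on) (auto intro: has_field_derivative_at_within)

lemma dheight_continuous: "continuous_on {1 - t0<..} dheight"
proof -
 have g: "continuous_on {1 - t0<..} (%t. g (front t))"
  by (rule continuous_on_compose2[OF gc front_continuous]) (use front_pos in "auto intro: less_imp_le")
 have d: "continuous_on {1 - t0<..} (%t. dY (front t))"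
  by (rule continuous_on_compose2[OF dY_continuous front_continuous]) (use front_pos in auto)
 show ?thesis unfolding dheight_def[abs_def]
  using gpos[OF front_pos] t0 by (intro continuous_intros g d front_continuous) (force simp: less_imp_neq)+
qed

lemma height_pos: "t > 1 - t0 ==> height t > 0" by (simp add: height_def Y_pos front_pos)

lemma dheight_pos: "t > 1 - t0 ==> dheight t > 0"
 using dY_pos[of "front t"] front_pos[of t] gpos[of "front t"] \<Gamma> t0 unfolding dheight_def
 by (intro mult_pos_pos divide_pos_pos) auto

abbreviation gap :: "'a::euclidean_space \<times> real => real" where
 "gap z \<equiv> height (snd z) - profile (norm (fst z))"

lemma fst_C1: "C1_on S_inf (%z::'a::euclidean_space \<times> real. profile (norm (fst z)))"
  "z : S_inf ==> fd (%z::'a \<times> real. profile (norm (fst z))) z = (%v. (dprofile (norm (fst z)) *\<^sub>R sgn (fst z)) \<bullet> fst v)"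
proof -
 have d: "((%z::'a \<times> real. profile (norm (fst z))) has_derivative (%v. (dprofile (norm (fst z)) *\<^sub>R sgn (fst z)) \<bullet> fst v)) (at z)" for z
  using has_derivative_compose[OF has_derivative_fst[OF has_derivative_ident] profile_has_derivative] by simp
 have c: "continuous_on S_inf (%z::'a \<times> real. (dprofile (norm (fst z)) *\<^sub>R sgn (fst z)) \<bullet> fst v)" for v :: "'a \<times> real"
  by (intro continuous_on_inner continuous_on_compose2[OF profile_gradient_continuous] continuous_intros) auto
 show "C1_on S_inf (%z::'a \<times> real. profile (norm (fst z)))"
  "z : S_inf ==> fd (%z::'a \<times> real. profile (norm (fst z))) z = (%v. (dprofile (norm (fst z)) *\<^sub>R sgn (fst z)) \<bullet> fst v)"
  using C1_on_I[OF d c] by blast+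
qed

lemma snd_C1:
 assumes d: "!!t. t > 0 ==> (h has_real_derivative h' t) (at t)" and c: "continuous_on {0<..} h'"
 shows "C1_on S_inf (%z::'a::euclidean_space \<times> real. h (snd z))"
  "z : S_inf ==> fd (%z::'a \<times> real. h (snd z)) z = (%v. h' (snd z) * snd v)"
proof -
 have d: "((%z::'a \<times> real. h (snd z)) has_derivative (%v. h' (snd z) * snd v)) (at z)" if "z : S_inf" for z
  using has_derivative_compose[OF has_derivative_snd[OF has_derivative_ident], of h "%x. h' (snd z) * x" z] d[of "snd z"] that
  by (auto simp: has_field_derivative_def S_inf_def)
 have c: "continuous_on S_inf (%z::'a \<times> real. h' (snd z) * snd v)" for v :: "'a \<times> real"
  by (intro continuous_on_mult continuous_on_compose2[OF c] continuous_intros) (auto simp: S_inf_def)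
 show "C1_on S_inf (%z::'a \<times> real. h (snd z))"
  "z : S_inf ==> fd (%z::'a \<times> real. h (snd z)) z = (%v. h' (snd z) * snd v)"
  using C1_on_I[OF d c] by blast+
qed

lemma dheight_continuous': "continuous_on {0<..} dheight"
 by (rule continuous_on_subset[OF dheight_continuous]) (use t0 in auto)

lemma height_derivative': "t > 0 ==> (height has_real_derivative dheight t) (at t)"
 using height_derivative t0 by simp

lemma height_C1: "C1_on S_inf (%z::'a::euclidean_space \<times> real. height (snd z))"
  "z : S_inf ==> fd (%z::'a \<times> real. height (snd z)) z = (%v. dheight (snd z) * snd v)"
 using snd_C1[OF height_derivative' dheight_continuous'] by blast+

end

section \<open>Powers of positive parts, and the explicit gradient and flux of the barrier\<close>

lemma has_derivative_zero_power_bound: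
 fixes L :: "real => real"
 assumes a: "a > 0" and L: "!!y. \<bar>L y\<bar> <= c * \<bar>y\<bar> powr (1 + a)"
 shows "(L has_real_derivative 0) (at 0)"
proof -
 have L0: "L 0 = 0" using L[of 0] by simp
 have "((%y::real. c * \<bar>y\<bar> powr a) \<longlongrightarrow> c * \<bar>0\<bar> powr a) (at 0)"
  using a by (intro tendsto_mult tendsto_const tendsto_powr' tendsto_rabs tendsto_ident_at) auto
 hence "((%y::real. c * \<bar>y\<bar> powr a) \<longlongrightarrow> 0) (at 0)" by simp
 hence "((%y. L y / y) \<longlongrightarrow> 0) (at 0)"
 proof (rule Lim_null_comparison[rotated], intro eventually_at_filter[THEN iffD2] always_eventually allI impI)
  fix y :: real assume "y ~= 0"
  thus "norm (L y / y) <= c * \<bar>y\<bar> powr a" using L[of y] by (simp add: powr_add field_simps)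
 qed
 thus ?thesis by (simp add: has_field_derivative_iff L0)
qed

text \<open>At 0 the left branch is constant, and the growth bound with exponent above 1 makes the
  right derivative 0 as well.\<close>

lemma positive_part_derivative:
 fixes F F' :: "real => real"
 assumes F: "!!y. y > 0 ==> (F has_real_derivative F' y) (at y)" and a: "a > 0"
  and bd: "!!y. y >= 0 ==> \<bar>F y\<bar> <= c * y powr (1 + a)" and 0: "F' 0 = 0" "c >= 0"
 shows "((%y. F (max 0 y)) has_real_derivative F' (max 0 y)) (at y)"
proof -
 have F0: "F 0 = 0" using bd[of 0] by simp
 consider "y > 0" | "y = 0" | "y < 0" by linarith
 thus ?thesis
 proof cases
  case 1
  hence "(F has_real_derivative F' (max 0 y)) (at y)" using F by simp
  thus ?thesis
   by (rule has_field_derivative_transform_within_open[of _ _ _ "{0<..}"]) (use 1 in auto)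
 next
  case 2
  have "((%y. F (max 0 y)) has_real_derivative 0) (at 0)"
  proof (rule has_derivative_zero_power_bound[OF a])
   show "\<bar>F (max 0 y)\<bar> <= c * \<bar>y\<bar> powr (1 + a)" for y
    using bd[of y] 0(2) F0 by (cases "y >= 0") (auto simp: max_def)
  qed
  thus ?thesis using 2 0 by simp
 next
  case 3
  have "((%y. 0) has_real_derivative F' (max 0 y)) (at y)" using 3 0 by simp
  thus ?thesis
   by (rule has_field_derivative_transform_within_open[of _ _ _ "{..<0}"]) (use 3 F0 in auto)
 qed
qed

context barrier_parameters begin

lemma powr_C1: "C1_on S_inf (%z::'a::euclidean_space \<times> real. (snd z + t0) powr a)"
  "z : S_inf ==> fd (%z::'a \<times> real. (snd z + t0) powr a) z = (%v. a * (snd z + t0) powr (a - 1) * snd v)"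
proof -
 have d: "((%t. (t + t0) powr a) has_real_derivative a * (t + t0) powr (a - 1)) (at t)" if "t > 0" for t
  using that t0 DERIV_fun_powr[of "%t. t + t0" 1 t a] by (auto intro!: derivative_eq_intros)
 have "continuous_on {0<..} (%t. a * (t + t0) powr (a - 1))" using t0 by (intro continuous_intros) auto
 thus "C1_on S_inf (%z::'a::euclidean_space \<times> real. (snd z + t0) powr a)"
  "z : S_inf ==> fd (%z::'a \<times> real. (snd z + t0) powr a) z = (%v. a * (snd z + t0) powr (a - 1) * snd v)"
  using snd_C1[OF d] by blast+
qed

lemma gap_C1: "C1_on S_inf (gap :: 'a::euclidean_space \<times> real => real)"
 "z : S_inf ==> fd gap (z :: 'a \<times> real) e = dheight (snd z) * snd e - (dprofile (norm (fst z)) *\<^sub>R sgn (fst z)) \<bullet> fst e"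
proof -
 show "C1_on S_inf (gap :: 'a::euclidean_space \<times> real => real)" by (rule C1_on_diff(1)[OF height_C1(1) fst_C1(1)])
 assume z: "z : S_inf"
 show "fd gap (z :: 'a \<times> real) e = dheight (snd z) * snd e - (dprofile (norm (fst z)) *\<^sub>R sgn (fst z)) \<bullet> fst e"
  using C1_on_diff(2)[OF height_C1(1) fst_C1(1) z] by (simp add: height_C1(2)[OF z] fst_C1(2)[OF z])
qed

definition v :: "'a::euclidean_space \<times> real => real" where
 "v z = C * (snd z + t0) powr (- k) * max 0 (gap z) powr b"

lemma barrier_eq: "barrier p m g t0 C r0 \<Gamma> z = v z"
 by (simp add: barrier_def v_def split_beta Let_def height_def front_def barrier_E_def Y_def profile_def
   k_def b_def powr_minus_divide)

lemma v_nonneg: "0 <= v z" using C by (simp add: v_def)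

lemma v_powr_q: "v z powr q = C powr q * (snd z + t0) powr (- (k * q)) * max 0 (gap z) powr (1 + k)"
 using exponents(4) by (simp add: v_def powr_mult powr_powr)

lemma gap_powr_C1:
 assumes "a > 0"
 shows "C1_on S_inf (%z::'a::euclidean_space \<times> real. max 0 (gap z) powr (1 + a))"
  and "z : S_inf ==> fd (%z::'a \<times> real. max 0 (gap z) powr (1 + a)) z e =
   (1 + a) * max 0 (gap z) powr a * fd gap z e"
proof -
 have d0: "((%y. y powr (1 + a)) has_real_derivative (1 + a) * y powr a) (at y)" if "y > 0" for y
  using has_real_derivative_powr[OF that, of "1 + a"] by simp
 have d: "((%y. max 0 y powr (1 + a)) has_real_derivative (1 + a) * max 0 y powr a) (at y)" for y
  by (rule positive_part_derivative[where F="%y. y powr (1 + a)" and F'="%y. (1 + a) * y powr a" and a=a and c=1, OF d0])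
   (use assms in auto)
 have "continuous_on S_inf (%z::'a \<times> real. (1 + a) * max 0 (gap z) powr a)"
  using assms C1_on_continuous[OF gap_C1(1)]
  by (intro continuous_on_mult continuous_on_powr' continuous_on_max continuous_on_const) auto
 from C1_on_compose[OF gap_C1(1) d this]
 show "C1_on S_inf (%z::'a::euclidean_space \<times> real. max 0 (gap z) powr (1 + a))"
  and "z : S_inf ==> fd (%z::'a \<times> real. max 0 (gap z) powr (1 + a)) z e =
   (1 + a) * max 0 (gap z) powr a * fd gap z e" by auto
qed

lemma v_powr_C1: "C1_on S_inf (%z::'a::euclidean_space \<times> real. v z powr q)"
proof -
 have c: "C1_on S_inf (%z::'a \<times> real. C powr q)" by (rule C1_on_I[where g'="%_ _. 0"]) auto
 show ?thesis unfolding v_powr_q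
  using C1_on_mult(1)[OF C1_on_mult(1)[OF c powr_C1(1)] gap_powr_C1(1)[OF exponents(1)]] by simp
qed

abbreviation Wv :: "'a::euclidean_space \<times> real => 'a" where "Wv \<equiv> space_grad (%z. v z powr q)"

lemma Wv_eq:
 fixes z :: "'a::euclidean_space \<times> real"
 assumes z: "z : S_inf"
 shows "Wv z = - (C powr q * (snd z + t0) powr (- (k * q)) * ((1 + k) * max 0 (gap z) powr k) * dprofile (norm (fst z))) *\<^sub>R sgn (fst z)"
proof -
 have c: "C1_on S_inf (%z::'a \<times> real. C powr q)" "fd (%z::'a \<times> real. C powr q) z e = 0" for e
  using C1_on_I[where g'="%_ _. 0" and g="%z::'a \<times> real. C powr q", of UNIV] by (auto simp: C1_on_def)
 let ?c = "C powr q * (snd z + t0) powr (- (k * q)) * ((1 + k) * max 0 (gap z) powr k) * dprofile (norm (fst z))"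
 have "fd (%z. v z powr q) z (i, 0) = - ?c * (sgn (fst z) \<bullet> i)" for i
  unfolding v_powr_q
  unfolding C1_on_mult(2)[OF C1_on_mult(1)[OF c(1) powr_C1(1)] gap_powr_C1(1)[OF exponents(1)] z]
   C1_on_mult(2)[OF c(1) powr_C1(1) z] gap_powr_C1(2)[OF exponents(1) z] gap_C1(2)[OF z] powr_C1(2)[OF z] c(2)
  by (simp add: mult_ac)
 hence "Wv z = (\<Sum>i\<in>Basis. (- ?c * (sgn (fst z) \<bullet> i)) *\<^sub>R i)" by (simp add: space_grad_def)
 also have "... = - ?c *\<^sub>R (\<Sum>i\<in>Basis. (sgn (fst z) \<bullet> i) *\<^sub>R i)"
  by (simp add: scaleR_sum_right sum_negf mult_ac)
 also have "... = - ?c *\<^sub>R sgn (fst z)" by (simp add: euclidean_representation)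
 finally show ?thesis .
qed

text \<open>The p-Laplacian flux of the profile: by \<open>dprofile_powr\<close> it is slope^(p-1)
  in the outward radial direction.\<close>

definition field :: "'a::euclidean_space => 'a" where
 "field x = (\<kappa> * H (max (norm x) r0)) *\<^sub>R x"

text \<open>The exponents match: k q (p-1) = 1 + k for the time factor, k (p-1) = b for the gap, q
  (p-1) = p + m - 2 for C, and q^(1-p) cancels against (1 + k)^(p-1) = (q b)^(p-1).\<close>

lemma pflux_v:
 fixes z :: "'a::euclidean_space \<times> real"
 assumes z: "z : S_inf"
 shows "pflux p q (v z) (Wv z) =
  - (b powr (p - 1) * C powr (p + m - 2) * (snd z + t0) powr (- 1 - k) * max 0 (gap z) powr b) *\<^sub>R field (fst z)"
proof (cases "gap z > 0 \<and> fst z ~= 0")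
 case False
 thus ?thesis
 proof (cases "gap z > 0")
  case True
  with False have "fst z = 0" by simp
  hence "Wv z = 0" unfolding Wv_eq[OF z] by simp
  thus ?thesis using \<open>fst z = 0\<close> by (simp add: pflux_def field_def)
 next
  case False
  hence "v z = 0" by (simp add: v_def)
  thus ?thesis using False by (simp add: pflux_def)
 qed
next
 case True
 have s: "snd z + t0 > 0" using z t0 by (auto simp: S_inf_def)
 let ?X = "gap z" let ?r = "norm (fst z)"
 define c where "c = C powr q * (snd z + t0) powr (- (k * q)) * ((1 + k) * ?X powr k)"
 have c0: "c > 0" using C s True exponents(1) by (simp add: c_def)
 have r: "?r > 0" using True by simp
 have d0: "dprofile ?r > 0" using r \<kappa>_pos H_max_pos[of ?r] by (simp add: dprofile_def less_imp_neq[symmetric] del: H_max_pos)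
 have W: "Wv z = - (c * dprofile ?r) *\<^sub>R sgn (fst z)" using True by (simp add: Wv_eq[OF z] c_def)
 have nW: "norm (Wv z) = c * dprofile ?r" using c0 d0 True by (simp add: W norm_sgn)
 have e1: "(1 + k) powr (p - 1) = q powr (p - 1) * b powr (p - 1)"
  using exponents by (simp add: powr_mult[symmetric] mult.commute)
 have e2: "k * q * (p - 1) = 1 + k"
 proof -
  have "k * q * (p - 1) = k * (p + m - 2)" using exponents(7) by simp
  also have "... = 1 + k" using pm by (simp add: k_def field_simps)
  finally show ?thesis .
 qed
 have cp: "c powr (p - 1) = q powr (p - 1) * (b powr (p - 1) * C powr (p + m - 2) * (snd z + t0) powr (- 1 - k) * ?X powr b)"
  using exponents(5,7) e2 by (simp add: c_def powr_mult powr_powr e1 mult_ac)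
 have v0: "v z > 0" using C s True by (simp add: v_def)
 have "pflux p q (v z) (Wv z) = (q powr (1 - p) * (c * dprofile ?r) powr (p - 2) * - (c * dprofile ?r)) *\<^sub>R sgn (fst z)"
  using v0 by (simp add: pflux_def nW) (simp add: W)
 also have "q powr (1 - p) * (c * dprofile ?r) powr (p - 2) * - (c * dprofile ?r) = - (q powr (1 - p) * (c * dprofile ?r) powr (p - 1))"
  using c0 d0 powr_add[of "c * dprofile ?r" "p - 2" 1] by simp
 also have "(c * dprofile ?r) powr (p - 1) = c powr (p - 1) * (\<kappa> * ?r * H (max ?r r0))"
  by (simp add: powr_mult dprofile_powr)
 also have "q powr (1 - p) * (c powr (p - 1) * (\<kappa> * ?r * H (max ?r r0))) =
   b powr (p - 1) * C powr (p + m - 2) * (snd z + t0) powr (- 1 - k) * ?X powr b * (\<kappa> * H (max ?r r0)) * ?r"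
  unfolding cp using exponents(3) powr_add[of q "1 - p" "p - 1"] by (simp add: mult_ac)
 finally show ?thesis using True by (simp add: field_def sgn_div_norm mult_ac)
qed

lemma Wv_continuous: "continuous_on S_inf (Wv :: 'a::euclidean_space \<times> real => 'a)"
 using v_powr_C1 unfolding space_grad_def C1_on_def by (intro continuous_intros) auto

text \<open>A regularisation of y_+^b from below. Unlike y_+^b it is always of class one, since it
  behaves like the power 1 + b at 0; \<open>l\<close> is its derivative.\<close>

definition L :: "real => real => real" where
 "L \<delta> y = max 0 y powr (1 + b) / (max 0 y + \<delta>)"

definition l :: "real => real => real" where
 "l \<delta> y = max 0 y powr b * (b * max 0 y + (b + 1) * \<delta>) / (max 0 y + \<delta>)\<^sup>2"

lemma L_derivative:
 assumes \<delta>: "\<delta> > 0" shows "(L \<delta> has_real_derivative l \<delta> y) (at y)"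
 unfolding L_def l_def
proof (rule positive_part_derivative[of "%y. y powr (1 + b) / (y + \<delta>)" "%y. y powr b * (b * y + (b + 1) * \<delta>) / (y + \<delta>)\<^sup>2" b "1 / \<delta>"])
 show "((%y. y powr (1 + b) / (y + \<delta>)) has_real_derivative y powr b * (b * y + (b + 1) * \<delta>) / (y + \<delta>)\<^sup>2) (at y)" if y: "y > 0" for y
 proof -
  have "((%y. y powr (1 + b) / (y + \<delta>)) has_real_derivative ((1 + b) * y powr (1 + b - 1) * (y + \<delta>) - y powr (1 + b) * 1) / ((y + \<delta>) * (y + \<delta>))) (at y)"
   using y \<delta> by (intro DERIV_divide has_real_derivative_powr) (auto intro!: derivative_eq_intros)
  moreover have "(1 + b) * y powr (1 + b - 1) * (y + \<delta>) - y powr (1 + b) * 1 = y powr b * (b * y + (b + 1) * \<delta>)"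
   using y by (simp add: powr_add algebra_simps)
  ultimately show ?thesis by (simp add: power2_eq_square)
 qed
 show "\<bar>y powr (1 + b) / (y + \<delta>)\<bar> <= 1 / \<delta> * y powr (1 + b)" if "y >= 0" for y
  using that \<delta> by (simp add: frac_le)
qed (use \<delta> exponents(2) in auto)

lemma L_l_nonneg: "\<delta> > 0 ==> 0 <= L \<delta> y" "\<delta> > 0 ==> 0 <= l \<delta> y"
 using exponents(2) by (auto simp: L_def l_def intro!: divide_nonneg_nonneg mult_nonneg_nonneg add_nonneg_nonneg)

lemma L_continuous: "\<delta> > 0 ==> conton (L \<delta>)"
 using L_derivative by (intro DERIV_continuous_on) auto

lemma l_continuous: "\<delta> > 0 ==> conton (l \<delta>)"
 unfolding l_def[abs_def] using exponents(2)
 by (intro continuous_on_divide continuous_on_mult continuous_on_powr' continuous_on_max continuous_on_add continuous_on_power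
   continuous_on_const continuous_on_id) (auto simp: add_nonneg_eq_0_iff max_def)

text \<open>The factor \<open>b + \<delta> / (y + \<delta>)\<close> lies between \<open>b\<close> and \<open>b + 1\<close>, which makes the sign of
 \<open>L A + L' B\<close> independent of \<open>\<delta>\<close>.\<close>

lemma l_eq:
 assumes "\<delta> > 0" "y > 0" shows "l \<delta> y = L \<delta> y / y * (b + \<delta> / (y + \<delta>))"
proof -
 have "b * y + (b + 1) * \<delta> = (b + \<delta> / (y + \<delta>)) * (y + \<delta>)" using assms by (simp add: field_simps)
 thus ?thesis using assms by (simp add: l_def L_def powr_add power2_eq_square)
qed

text \<open>A negative B is worst with its coefficient at the upper end b + 1; the second
  alternative covers exactly this case, independently of \<delta>.\<close>

lemma L_l_combination_nonneg:
 assumes \<delta>: "\<delta> > 0" and A: "A >= 0" and B: "y > 0 ==> B >= 0 \<or> y * A + (b + 1) * B >= 0"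
 shows "0 <= L \<delta> y * A + l \<delta> y * B"
proof (cases "y > 0")
 case False
 thus ?thesis by (simp add: L_def l_def)
next
 case y: True
 define \<theta> where "\<theta> = \<delta> / (y + \<delta>)"
 have \<theta>: "0 <= \<theta>" "\<theta> <= 1" using \<delta> y by (auto simp: \<theta>_def)
 have "0 <= y * A + (b + \<theta>) * B"
 proof (cases "B >= 0")
  case True
  thus ?thesis using A y \<theta> exponents(2) by (intro add_nonneg_nonneg mult_nonneg_nonneg) auto
 next
  case False
  hence "(b + \<theta>) * B >= (b + 1) * B" using \<theta> by (intro mult_right_mono_neg) auto
  thus ?thesis using B[OF y] False by linarith
 qed
 hence "0 <= L \<delta> y / y * (y * A + (b + \<theta>) * B)" using L_l_nonneg(1)[OF \<delta>] y by (intro mult_nonneg_nonneg) auto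
 thus ?thesis using y by (simp add: l_eq[OF \<delta> y] \<theta>_def[symmetric] distrib_left mult.assoc[symmetric])
qed

lemma L_le: "\<delta> > 0 ==> L \<delta> y <= max 0 y powr b"
 by (auto simp: L_def powr_add field_simps max_def mult_left_mono)

lemma l_bounds:
 assumes "\<delta> > 0" "y > 0" shows "l \<delta> y <= (b + 1) * y powr (b - 1)"
proof -
 have t: "\<delta> / (y + \<delta>) <= 1" using assms by simp
 have "L \<delta> y / y <= y powr b / y" using L_le[OF assms(1), of y] assms(2) by (simp add: divide_right_mono)
 also have "... = y powr (b - 1)" using assms by (simp add: powr_diff)
 finally have "L \<delta> y / y <= y powr (b - 1)" .
 hence "L \<delta> y / y * (b + \<delta> / (y + \<delta>)) <= y powr (b - 1) * (b + 1)"
  using t exponents(2) L_l_nonneg(1)[OF assms(1), of y] assms by (intro mult_mono) auto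
 thus ?thesis by (simp add: l_eq[OF assms] mult.commute)
qed

lemma L_l_limits:
 assumes "!!n. \<delta> n > 0" "\<delta> ~~> 0"
 shows "(%n. L (\<delta> n) y) ~~> max 0 y powr b"
  and "y > 0 ==> (%n. l (\<delta> n) y) ~~> b * y powr (b - 1)"
proof -
 have 1: "(%n. L (\<delta> n) y) ~~> y powr b" if "y > 0"
 proof -
  have "(%n. y powr (1 + b) / (y + \<delta> n)) ~~> y powr (1 + b) / (y + 0)"
   using assms(2) that by (intro tendsto_intros) auto
  thus ?thesis using that by (simp add: L_def powr_add)
 qed
 show "(%n. L (\<delta> n) y) ~~> max 0 y powr b"
  using 1 by (cases "y > 0") (auto simp: L_def max_def)
 show "(%n. l (\<delta> n) y) ~~> b * y powr (b - 1)" if y: "y > 0"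
 proof -
  have "(%n. L (\<delta> n) y / y * (b + \<delta> n / (y + \<delta> n))) ~~> y powr b / y * (b + 0 / (y + 0))"
   using assms(2) y by (intro tendsto_intros 1) auto
  thus ?thesis using y by (simp add: l_eq[OF assms(1) y] powr_diff mult.commute)
 qed
qed

end

subsection \<open>The barrier is a supersolution\<close>

lemma locally_integrable_continuous:
 fixes h :: "'b::euclidean_space => 'c::euclidean_space"
 assumes h: "continuous_on S h" shows "locally_integrable S h"
proof (rule locally_integrable_bound[where g="%_. 1"])
 fix K assume K: "compact K" "K \<subseteq> S"
 have c: "continuous_on K h" by (rule continuous_on_subset[OF h K(2)])
 show "L1 (%z. indicator K z * (1::real))" by (rule integrable_indicator_compact[OF K(1)])
 show "(%z. indicator K z *\<^sub>R h z) : lebm"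
  by (intro borel_measurable_lebesgue borel_measurable_continuous_on_indicator c) (simp add: borel_compact K(1))
 have "bounded (h ` K)" by (intro compact_imp_bounded compact_continuous_image c K)
 then obtain B where "\<forall>z\<in>K. norm (h z) <= B" by (auto simp: bounded_iff)
 thus "\<exists>C\<ge>0. \<forall>z\<in>K. norm (h z) <= C * 1" by (intro exI[of _ "max 0 B"]) force
qed

lemma C1_tests_pairing_integrable:
 fixes A :: "'b::euclidean_space => 'b"
 assumes A: "locally_integrable S A" and eta: "eta : C1_tests S"
 shows "L1 (%z. fd eta z (A z))"
proof -
 have Ai: "locally_integrable S (%z. A z \<bullet> i)" for i
  unfolding locally_integrable_def set_integrable_def
 proof (intro allI impI, elim conjE)
  fix K assume "compact K" "K \<subseteq> S"
  from integrable_inner_left[OF locally_integrableD[OF A this], of i]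
  show "L1 (%z. indicator K z *\<^sub>R (A z \<bullet> i))" by simp
 qed
 have "fd eta z (A z) = (\<Sum>i\<in>Basis. (A z \<bullet> i) * fd eta z i)" for z
  using Linear_Algebra.linear_componentwise[OF C1_tests_linear[OF eta], of z "A z" 1] by simp
 thus ?thesis using test_functions_grad_integrable(1)[OF Ai eta] by simp
qed

text \<open>Serves to discard the axis x = 0 and the interface |x| = r0, where the radial
  coefficients need not be differentiable.\<close>

lemma AE_norm_fst_neq: "AE z in lebesgue. norm (fst (z :: 'a::euclidean_space \<times> real)) ~= c"
proof -
 have "negligible {x::'a. norm x = c}" using negligible_sphere[of "0::'a" c] by (simp add: sphere_def)
 hence "AE x::'a in lborel. norm x ~= c"
  using AE_not_in[of "{x::'a. norm x = c}" lebesgue] by (simp add: negligible_iff_null_sets AE_completion_iff)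
 hence "AE z::'a \<times> real in lborel \<Otimes>\<^sub>M lborel. norm (fst z) ~= c"
 proof (intro lborel_pair.AE_pair_measure)
  show "{z : space (lborel \<Otimes>\<^sub>M lborel). norm (fst (z :: 'a \<times> real)) ~= c} : sets (lborel \<Otimes>\<^sub>M lborel)" by measurable
 qed auto
 hence "AE z::'a \<times> real in lborel. norm (fst z) ~= c" unfolding lborel_prod .
 thus ?thesis by (simp add: AE_completion_iff)
qed

text \<open>The increment of A is weighted by the smaller radius s: this tolerates a derivative of A
  as large as 1/r near the origin, where g' may be unbounded. Splitting the difference with y the
  shorter vector produces exactly this weight.\<close>

lemma radial_field_lipschitz:
 fixes x y :: "'a::real_inner"
 assumes M: "!!r. 0 <= r ==> r <= R ==> \<bar>A r\<bar> <= M"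
  and L: "!!s r. 0 < s ==> s <= r ==> r <= R ==> s * \<bar>A r - A s\<bar> <= K * (r - s)" and K: "0 <= K"
  and xy: "norm x <= R" "norm y <= R"
 shows "norm (A (norm x) *\<^sub>R x - A (norm y) *\<^sub>R y) <= (M + K) * norm (x - y)"
 using xy
proof (induction "norm y" "norm x" arbitrary: x y rule: linorder_wlog)
 case le
 have "A (norm x) *\<^sub>R x - A (norm y) *\<^sub>R y = A (norm x) *\<^sub>R (x - y) + (A (norm x) - A (norm y)) *\<^sub>R y"
  by (simp add: algebra_simps)
 also have "norm ... <= \<bar>A (norm x)\<bar> * norm (x - y) + norm y * \<bar>A (norm x) - A (norm y)\<bar>"
  by (rule order_trans[OF norm_triangle_ineq]) simp
 also have "\<bar>A (norm x)\<bar> * norm (x - y) <= M * norm (x - y)"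
  using M[of "norm x"] le by (intro mult_right_mono) auto
 also have "norm y * \<bar>A (norm x) - A (norm y)\<bar> <= K * norm (x - y)"
 proof (cases "y = 0")
  case False
  hence "norm y * \<bar>A (norm x) - A (norm y)\<bar> <= K * (norm x - norm y)" using le by (intro L) auto
  also have "... <= K * norm (x - y)" using K norm_triangle_ineq2 by (intro mult_left_mono) auto
  finally show ?thesis .
 qed (use K in simp)
 finally show ?case by (simp add: distrib_right)
next
 case (sym y x)
 thus ?case by (metis norm_minus_commute)
qed

text \<open>The identity div(A(|x|) x) = N A + r A' in tested form, with a kink of A allowed at r0.
  Each component A(|x|) x_i \<phi> is Lipschitz along direction i, so its directional derivative
  integrates to zero; the sum over the basis is the divergence.\<close>

lemma radial_divergence:
 fixes A A' :: "real => real" and \<phi> :: "'a::euclidean_space \<times> real => real"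
 assumes Ac: "continuous_on {0..} A" and Ad: "!!r. r > 0 ==> r ~= r0 ==> (A has_real_derivative A' r) (at r)"
  and lip: "!!R. R > 0 ==> \<exists>K\<ge>0. \<forall>s r. 0 < s --> s <= r --> r <= R --> s * \<bar>A r - A s\<bar> <= K * (r - s)"
  and \<phi>: "\<phi> : C1_tests UNIV"
 defines "D \<equiv> %z. \<phi> z * (real DIM('a) * A (norm (fst z)) + norm (fst z) * A' (norm (fst z))) +
   A (norm (fst z)) * fd \<phi> z (fst z, 0)"
 shows "L1 D" and "(LI z. D z) = 0"
proof -
 obtain K B where K: "C_k 1 \<phi>" "compact K" "!!z. z \<notin> K ==> \<phi> z = 0" "B >= 0" "!!z. \<bar>\<phi> z\<bar> <= B"
  "!!z. linear (fd \<phi> z)"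
  by (rule C1_testsE[OF \<phi>]) (rule that)
 obtain R where R: "R > 0" "!!z. z : K ==> norm z <= R"
  using compact_imp_bounded[OF K(2)] by (auto simp: bounded_pos)
 have out: "norm z > R ==> \<phi> z = 0" for z using R(2)[of z] K(3)[of z] by fastforce
 obtain L\<phi> where L\<phi>: "L\<phi> >= 0" "!!x y. \<bar>\<phi> x - \<phi> y\<bar> <= L\<phi> * norm (x - y)"
  by (rule C_1_lipschitz[OF K(1) out]) (assumption, rule that)
 define a where "a x = A (norm x) *\<^sub>R x" for x :: 'a
 have Ac': "conton (%x::'a. A (norm x))"
  by (rule continuous_on_compose2[OF Ac]) (auto intro: continuous_intros)
 have ac: "conton a" unfolding a_def by (intro continuous_intros Ac')
 obtain KA where KA: "KA >= 0" "!!s r. 0 < s ==> s <= r ==> r <= R + 2 ==> s * \<bar>A r - A s\<bar> <= KA * (r - s)"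
  using lip[of "R + 2"] R(1) by auto
 have "bounded (A ` {0..R + 2})"
  by (intro compact_imp_bounded compact_continuous_image continuous_on_subset[OF Ac]) auto
 then obtain MA where "\<forall>r\<in>{0..R + 2}. \<bar>A r\<bar> <= MA" by (auto simp: bounded_iff)
 hence MA: "\<bar>A r\<bar> <= MA" if "0 <= r" "r <= R + 2" for r using that by simp
 have MA0: "MA >= 0" using MA[of 0] R(1) by simp
 have alip: "norm (a x - a y) <= (MA + KA) * norm (x - y)" if "norm x <= R + 2" "norm y <= R + 2" for x y
  unfolding a_def by (rule radial_field_lipschitz[OF MA KA(2,1) that])
 let ?Di = "%i z. \<phi> z * (A (norm (fst z)) + A' (norm (fst z)) * ((sgn (fst z) \<bullet> i) * (fst z \<bullet> i))) +
   fd \<phi> z (i, 0) * (A (norm (fst z)) * (fst z \<bullet> i))"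
 have Di: "L1 (?Di i)" "(LI z. ?Di i z) = 0" if i: "i : Basis" for i :: 'a
 proof -
  let ?\<psi> = "%z. \<phi> z * (a (fst z) \<bullet> i)"
  have ci: "conton (%z::'a \<times> real. a (fst z) \<bullet> i)"
   by (intro continuous_on_inner continuous_on_compose2[OF ac] continuous_intros) auto
  have m: "?\<psi> : borm"
   by (intro borel_measurable_continuous_onI continuous_on_mult C_k_imp_continuous_on[OF K(1)] ci)
  have "L1 (%z. (a (fst z) \<bullet> i) * \<phi> z)"
   by (rule test_functions_grad_integrable(2)[OF locally_integrable_continuous[OF ci] \<phi>])
  hence int: "integrable lborel ?\<psi>"
   using integrable_lebesgue_of_borel(1)[OF m] by (simp add: mult.commute)
  have L: "\<bar>?\<psi> (z + s *\<^sub>R (i, 0)) - ?\<psi> z\<bar> <= (B * (MA + KA) + L\<phi> * (MA * (R + 2))) * \<bar>s\<bar>" if s: "\<bar>s\<bar> <= 1" for z s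
  proof (cases "norm z > R + 1")
   case True
   have "norm z <= norm (z + s *\<^sub>R (i, 0::real)) + norm (s *\<^sub>R (i, 0::real))"
    using norm_triangle_ineq4[of "z + s *\<^sub>R (i, 0)" "s *\<^sub>R (i, 0)"] by simp
   hence "norm (z + s *\<^sub>R (i, 0)) > R" using True s i by (simp add: norm_Pair)
   thus ?thesis using out True K(4) MA0 KA(1) L\<phi>(1) R(1) by simp
  next
   case False
   let ?z = "z + s *\<^sub>R (i, 0)"
   have n: "norm (fst z) <= R + 1" using False norm_fst_le[of "fst z" "snd z"] by simp
   have n': "norm (fst ?z) <= R + 2"
    using norm_triangle_ineq[of "fst z" "s *\<^sub>R i"] n s i by simp
   have "\<bar>?\<psi> ?z - ?\<psi> z\<bar> = \<bar>\<phi> ?z * ((a (fst ?z) - a (fst z)) \<bullet> i) + (\<phi> ?z - \<phi> z) * (a (fst z) \<bullet> i)\<bar>"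
    by (simp add: algebra_simps)
   also have "... <= \<bar>\<phi> ?z\<bar> * \<bar>(a (fst ?z) - a (fst z)) \<bullet> i\<bar> + \<bar>\<phi> ?z - \<phi> z\<bar> * \<bar>a (fst z) \<bullet> i\<bar>"
    by (rule order_trans[OF abs_triangle_ineq]) (simp add: abs_mult)
   also have "... <= B * ((MA + KA) * \<bar>s\<bar>) + (L\<phi> * \<bar>s\<bar>) * (MA * (R + 2))"
   proof (intro add_mono mult_mono)
    show "\<bar>(a (fst ?z) - a (fst z)) \<bullet> i\<bar> <= (MA + KA) * \<bar>s\<bar>"
     using alip[of "fst ?z" "fst z"] n n' i order_trans[OF Basis_le_norm[OF i, of "a (fst ?z) - a (fst z)"]] by simp
    show "\<bar>\<phi> ?z - \<phi> z\<bar> <= L\<phi> * \<bar>s\<bar>" using L\<phi>(2)[of ?z z] i by (simp add: norm_Pair)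
    have "norm (a (fst z)) <= MA * (R + 2)" unfolding a_def norm_scaleR
     using MA[of "norm (fst z)"] n MA0 by (intro mult_mono) auto
    thus "\<bar>a (fst z) \<bullet> i\<bar> <= MA * (R + 2)" using Basis_le_norm[OF i] order_trans by blast
   qed (use K(4,5) L\<phi>(1) in auto)
   finally show ?thesis by (simp add: algebra_simps)
  qed
  have der: "AE z in lebesgue. ((%s. ?\<psi> (z + s *\<^sub>R (i, 0))) has_real_derivative ?Di i z) (at 0)"
   using AE_norm_fst_neq[of 0] AE_norm_fst_neq[of r0]
  proof eventually_elim
   case (elim z)
   let ?x = "fst z"
   have x: "?x ~= 0" using elim by simp
   have "(norm has_derivative (%h. sgn ?x \<bullet> h)) (at ?x)" using has_derivative_norm[OF x] by (simp add: inner_commute)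
   from has_derivative_imp_directional[OF this, of i]
   have "((%s. norm (?x + s *\<^sub>R i)) has_real_derivative (sgn ?x \<bullet> i)) (at 0)" .
   with Ad[of "norm ?x"] elim have 1: "((%s. A (norm (?x + s *\<^sub>R i))) has_real_derivative A' (norm ?x) * (sgn ?x \<bullet> i)) (at 0)"
    by (intro DERIV_chain2) auto
   have 2: "((%s. (?x + s *\<^sub>R i) \<bullet> i) has_real_derivative 1) (at 0)"
    using i by (auto intro!: derivative_eq_intros simp: inner_add_left)
   have "\<phi> differentiable (at z)" using K(1) by (cases z) simp
   hence 3: "((%s. \<phi> (z + s *\<^sub>R (i, 0))) has_real_derivative fd \<phi> z (i, 0)) (at 0)"
    by (intro has_derivative_imp_directional) (simp add: frechet_derivative_works)
   show ?case using DERIV_mult[OF 3 DERIV_mult[OF 1 2]] by (simp add: a_def algebra_simps zero_prod_def[symmetric])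
  qed
  have sup: "norm z > R ==> ?\<psi> z = 0" for z using out by simp
  show "L1 (?Di i)" "(LI z. ?Di i z) = 0"
   by (rule integral_directional_derivative_zero[OF m int sup L der], assumption+)+
 qed
 have D: "D z = (\<Sum>i\<in>Basis. ?Di i z)" for z
 proof -
  have 1: "(\<Sum>i\<in>Basis. (sgn (fst z) \<bullet> i) * (fst z \<bullet> i)) = norm (fst z)"
   unfolding euclidean_inner[symmetric] by (cases "fst z = 0") (simp_all add: sgn_div_norm dot_square_norm power2_eq_square)
  have 2: "fd \<phi> z (fst z, 0) = (\<Sum>i\<in>Basis. fd \<phi> z (i, 0) * (fst z \<bullet> i))"
   unfolding frechet_derivative_space_time[OF K(6)] by (simp add: euclidean_inner[of "fst z"] inner_commute mult.commute)
  have "(\<Sum>i\<in>Basis. ?Di i z) = \<phi> z * (\<Sum>i\<in>Basis. A (norm (fst z)) + A' (norm (fst z)) * ((sgn (fst z) \<bullet> i) * (fst z \<bullet> i))) +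
    A (norm (fst z)) * (\<Sum>i\<in>Basis. fd \<phi> z (i, 0) * (fst z \<bullet> i))"
   by (subst sum.distrib) (simp only: sum_distrib_left mult.left_commute)
  also have "(\<Sum>i\<in>Basis. A (norm (fst z)) + A' (norm (fst z)) * ((sgn (fst z) \<bullet> i) * (fst z \<bullet> i))) =
    real DIM('a) * A (norm (fst z)) + A' (norm (fst z)) * norm (fst z)"
   unfolding sum.distrib sum_distrib_left[symmetric] 1 by simp
  finally show ?thesis unfolding D_def 2 by (simp add: mult.commute)
 qed
 show "L1 D" unfolding D using Di(1) by (intro Bochner_Integration.integrable_sum) auto
 show "(LI z. D z) = 0" unfolding D using Di by (subst Bochner_Integration.integral_sum) auto
qed

context barrier_parameters begin

lemma weight_continuous: "conton (weight g :: 'a::euclidean_space => real)" and weight_pos: "0 < weight g x"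
proof -
 have "conton (%x::'a. g (norm x))"
  by (rule continuous_on_compose2[OF gc]) (auto intro: continuous_intros)
 thus "conton (weight g :: 'a::euclidean_space => real)"
  unfolding weight_def[abs_def] by (intro continuous_intros)
qed (simp add: weight_def)

definition A :: "real => real" where "A r = \<kappa> * (exp (g r) * H (max r r0))"
definition dH :: "real => real" where "dH r = (if r > r0 then deriv H r else 0)"
text \<open>The divergence of f times \<open>field\<close> is \<kappa> f Q. In the core H is frozen,
  so \<open>dH\<close> is 0 there.\<close>

definition Q :: "real => real => real" where
 "Q N r = N * H (max r r0) + r * dH r + r * deriv g r * H (max r r0)"

lemma H_differentiable: "r > 0 ==> (H has_real_derivative deriv H r) (at r)" "r > 0 ==> \<bar>deriv H r\<bar> * r <= KH * H r"
proof -
 assume r: "r > 0"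
 obtain D where D: "(H has_real_derivative D) (at r)" "\<bar>D\<bar> * r <= KH * H r" by (rule H_derivative[OF r])
 thus "(H has_real_derivative deriv H r) (at r)" "\<bar>deriv H r\<bar> * r <= KH * H r"
  using DERIV_imp_deriv[OF D(1)] by auto
qed

lemma A_continuous: "continuous_on {0..} A"
 unfolding A_def[abs_def] by (intro continuous_intros gc continuous_on_subset[OF H_max_continuous]) auto

lemma A_derivative:
 assumes r: "r > 0" "r ~= r0"
 shows "(A has_real_derivative \<kappa> * (exp (g r) * dH r + exp (g r) * deriv g r * H (max r r0))) (at r)"
proof -
 have h: "((%r. H (max r r0)) has_real_derivative dH r) (at r)"
 proof (cases "r > r0")
  case True
  have "(H has_real_derivative dH r) (at r)" using H_differentiable(1) r True by (simp add: dH_def)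
  thus ?thesis by (rule has_field_derivative_transform_within_open[of _ _ _ "{r0<..}"]) (use True in auto)
 next
  case False
  have "((%_. H r0) has_real_derivative dH r) (at r)" using False by (simp add: dH_def)
  thus ?thesis by (rule has_field_derivative_transform_within_open[of _ _ _ "{..<r0}"]) (use False r in auto)
 qed
 have "((%r. exp (g r)) has_real_derivative exp (g r) * deriv g r) (at r)"
  using DERIV_chain2[OF DERIV_exp gd[OF r(1)]] .
 from DERIV_cmult[OF DERIV_mult[OF this h], of \<kappa>] show ?thesis by (simp add: A_def[abs_def] algebra_simps)
qed

lemma A_radial:
 assumes r: "r > 0" "r ~= r0"
 shows "N * A r + r * (\<kappa> * (exp (g r) * dH r + exp (g r) * deriv g r * H (max r r0))) = \<kappa> * exp (g r) * Q N r"
 by (simp add: A_def Q_def algebra_simps)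

text \<open>Near 0 the derivative of exp(g) may be unbounded, but s g'(\<xi>) <= \<xi> g'(\<xi>) <=
  \<alpha>2 g(\<xi>) for s < \<xi>. The other factor is constant below r0, so its derivative only
  matters away from the origin.\<close>

lemma A_lipschitz:
 assumes R: "R > 0"
 shows "\<exists>K\<ge>0. \<forall>s r. 0 < s --> s <= r --> r <= R --> s * \<bar>A r - A s\<bar> <= K * (r - s)"
proof -
 have "bounded ((%r. H (max r r0)) ` {0..R})"
  by (intro compact_imp_bounded compact_continuous_image continuous_on_subset[OF H_max_continuous]) auto
 then obtain MH where "\<forall>r\<in>{0..R}. \<bar>H (max r r0)\<bar> <= MH" by (auto simp: bounded_iff)
 hence MH: "H (max r r0) <= MH" if "0 <= r" "r <= R" for r using that by (meson abs_le_D1 atLeastAtMost_iff)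
 have MH0: "MH >= 0" using MH[of R] less_imp_le[OF H_max_pos[of R]] R by linarith
 define E where "E = exp (g R)"
 have E: "exp (g x) <= E" if "0 <= x" "x <= R" for x using g_mono that by (simp add: E_def)
 have 1: "s * \<bar>exp (g r) - exp (g s)\<bar> <= E * (\<alpha>2 * g R) * (r - s)" if "0 < s" "s <= r" "r <= R" for s r
 proof (cases "s = r")
  case False
  note sr = that
  obtain \<xi> where \<xi>: "s < \<xi>" "\<xi> < r" "exp (g r) - exp (g s) = (r - s) * (exp (g \<xi>) * deriv g \<xi>)"
  proof -
   have "\<exists>z>s. z < r \<and> exp (g r) - exp (g s) = (r - s) * (exp (g z) * deriv g z)"
    by (rule MVT2) (use sr False in "auto intro!: DERIV_chain2[OF DERIV_exp gd]")
   thus thesis using that by blast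
  qed
  have \<xi>0: "\<xi> > 0" using \<xi> that by simp
  have "s * deriv g \<xi> <= \<xi> * deriv g \<xi>" using \<xi> g'_pos[OF \<xi>0] by (intro mult_right_mono) auto
  also have "... <= \<alpha>2 * g \<xi>" using g'[OF \<xi>0] \<xi>0 by (simp add: field_simps)
  also have "... <= \<alpha>2 * g R" using g_mono[of \<xi> R] \<xi> \<xi>0 that \<alpha> by (intro mult_left_mono) auto
  finally have sd: "s * deriv g \<xi> <= \<alpha>2 * g R" .
  have "exp (g \<xi>) * (s * deriv g \<xi>) <= E * (\<alpha>2 * g R)"
   by (rule mult_mono[OF _ sd]) (use E[of \<xi>] \<xi> that \<xi>0 g'_pos[OF \<xi>0] in "auto simp: E_def")
  hence "(exp (g \<xi>) * (s * deriv g \<xi>)) * (r - s) <= E * (\<alpha>2 * g R) * (r - s)" using that by (intro mult_right_mono) auto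
  moreover have "\<bar>exp (g r) - exp (g s)\<bar> = (r - s) * (exp (g \<xi>) * deriv g \<xi>)"
   unfolding \<xi>(3) using that g'_pos[OF \<xi>0] by simp
  ultimately show ?thesis by (simp add: mult_ac)
 qed simp
 have 2: "\<bar>H (max r r0) - H (max s r0)\<bar> <= KH * MH / r0 * (r - s)" if "0 < s" "s <= r" "r <= R" for s r
 proof (cases "max s r0 = max r r0")
  case True
  thus ?thesis using that KH_pos MH0 r0 by simp
 next
  case False
  hence l: "max s r0 < max r r0" "r > r0" using that by (auto simp: max_def split: if_splits)
  obtain \<xi> where \<xi>: "max s r0 < \<xi>" "\<xi> < max r r0" "H (max r r0) - H (max s r0) = (max r r0 - max s r0) * deriv H \<xi>"
   using MVT2[OF l(1), of H "deriv H"] H_differentiable(1) r0 by fastforce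
  have \<xi>0: "\<xi> > r0" "\<xi> > 0" "\<xi> <= R" using \<xi> r0 that l by auto
  have "\<bar>deriv H \<xi>\<bar> <= KH * H \<xi> / \<xi>" using H_differentiable(2)[OF \<xi>0(2)] \<xi>0 by (simp add: field_simps)
  also have "... <= KH * MH / r0"
   using MH[of \<xi>] \<xi>0 r0 KH_pos MH0 by (intro frac_le mult_left_mono mult_nonneg_nonneg) auto
  finally have d: "\<bar>deriv H \<xi>\<bar> <= KH * MH / r0" .
  have "\<bar>H (max r r0) - H (max s r0)\<bar> = (max r r0 - max s r0) * \<bar>deriv H \<xi>\<bar>"
   unfolding \<xi>(3) using l by (simp add: abs_mult)
  also have "... <= (r - s) * (KH * MH / r0)" using d that l by (intro mult_mono) (auto simp: max_def)
  finally show ?thesis by (simp add: mult.commute)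
 qed
 show ?thesis
 proof (intro exI[of _ "\<kappa> * (E * (\<alpha>2 * g R) * MH + E * R * (KH * MH / r0))"] conjI allI impI)
  show "0 <= \<kappa> * (E * (\<alpha>2 * g R) * MH + E * R * (KH * MH / r0))"
   using \<kappa>_pos \<alpha> MH0 KH_pos r0 R g_nonneg[of R] by (auto simp: E_def intro!: mult_nonneg_nonneg add_nonneg_nonneg divide_nonneg_nonneg)
  fix s r assume sr: "0 < s" "s <= r" "r <= R"
  have "A r - A s = \<kappa> * ((exp (g r) - exp (g s)) * H (max r r0) + exp (g s) * (H (max r r0) - H (max s r0)))"
   by (simp add: A_def algebra_simps)
  hence "s * \<bar>A r - A s\<bar> <= s * (\<kappa> * (\<bar>exp (g r) - exp (g s)\<bar> * H (max r r0) + exp (g s) * \<bar>H (max r r0) - H (max s r0)\<bar>))"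
   using sr \<kappa>_pos abs_triangle_ineq[of "(exp (g r) - exp (g s)) * H (max r r0)" "exp (g s) * (H (max r r0) - H (max s r0))"]
    less_imp_le[OF H_max_pos[of r]]
   by (intro mult_left_mono) (auto simp: abs_mult)
  also have "... = \<kappa> * ((s * \<bar>exp (g r) - exp (g s)\<bar>) * H (max r r0) + exp (g s) * s * \<bar>H (max r r0) - H (max s r0)\<bar>)"
   by (simp add: algebra_simps)
  also have "... <= \<kappa> * ((E * (\<alpha>2 * g R) * (r - s)) * MH + E * R * (KH * MH / r0 * (r - s)))"
  proof (intro mult_left_mono add_mono)
   show "(s * \<bar>exp (g r) - exp (g s)\<bar>) * H (max r r0) <= (E * (\<alpha>2 * g R) * (r - s)) * MH"
    by (rule mult_mono[OF 1[OF sr] MH]) (use sr \<alpha> R g_nonneg[of R] less_imp_le[OF H_max_pos[of r]] in "auto simp: E_def")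
   show "exp (g s) * s * \<bar>H (max r r0) - H (max s r0)\<bar> <= E * R * (KH * MH / r0 * (r - s))"
    by (intro mult_mono[OF mult_mono] 2[OF sr] E) (use sr R in "auto simp: E_def")
  qed (use \<kappa>_pos in simp)
  finally show "s * \<bar>A r - A s\<bar> <= \<kappa> * (E * (\<alpha>2 * g R) * MH + E * R * (KH * MH / r0)) * (r - s)"
   by (simp add: algebra_simps)
 qed
qed

end

context barrier_parameters begin

definition c1 :: real where "c1 = b powr (p - 1) * C powr (p + m - 3)"

text \<open>\<open>reaction\<close> and \<open>transport\<close> are the quantities A and B of the
  overview, up to the common factor eta f C (t + t0)^(-1-k). The subtracted k comes from
  differentiating (t + t0)^(-k).\<close>

definition reaction :: "real => real => real" where "reaction N r = c1 * \<kappa> * Q N r - k"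

definition transport :: "real => real => real" where
 "transport r t = (t + t0) * dheight t - c1 * \<kappa> * H (max r r0) * r * dprofile r"

text \<open>The space-time field that is paired with the derivative of the test once X_+^b is
  factored out; v and its flux both carry this same power.\<close>

definition momentum :: "'a::euclidean_space \<times> real => 'a \<times> real" where
 "momentum z = ((- (C * c1 * (snd z + t0) powr (- 1 - k) * weight g (fst z))) *\<^sub>R field (fst z),
  - (C * weight g (fst z) * (snd z + t0) powr (- k)))"

lemma c1_pos: "c1 > 0" using exponents(2) C by (simp add: c1_def)

lemma field_continuous: "conton (field :: 'a::euclidean_space => 'a)"
 unfolding field_def[abs_def]
 by (intro continuous_intros continuous_on_compose2[OF H_max_continuous]) auto

lemma momentum_continuous: "continuous_on S_inf (momentum :: 'a::euclidean_space \<times> real => _)"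
 unfolding momentum_def[abs_def] using t0
 by (intro continuous_intros continuous_on_compose2[OF field_continuous] continuous_on_compose2[OF weight_continuous])
  (auto simp: S_inf_def)

lemma L_gap_C1:
 assumes \<delta>: "\<delta> > 0"
 shows "C1_on S_inf (%z::'a::euclidean_space \<times> real. L \<delta> (gap z))"
  and "z : S_inf ==> fd (%z::'a \<times> real. L \<delta> (gap z)) z e = l \<delta> (gap z) * fd gap z e"
proof -
 have "continuous_on S_inf (%z::'a \<times> real. l \<delta> (gap z))"
  by (rule continuous_on_compose2[OF l_continuous[OF \<delta>] C1_on_continuous[OF gap_C1(1)]]) auto
 from C1_on_compose[OF gap_C1(1) L_derivative[OF \<delta>] this]
 show "C1_on S_inf (%z::'a::euclidean_space \<times> real. L \<delta> (gap z))"
  and "z : S_inf ==> fd (%z::'a \<times> real. L \<delta> (gap z)) z e = l \<delta> (gap z) * fd gap z e"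
  by auto
qed

lemma powr_L_test:
 fixes eta :: "'a::euclidean_space \<times> real => real" and a :: real
 assumes \<delta>: "\<delta> > 0" and eta: "eta : C1_tests S_inf"
 defines "\<phi> \<equiv> %z. ((snd z + t0) powr a * L \<delta> (gap z)) * eta z"
 shows "\<phi> : C1_tests S_inf"
  and "z : S_inf ==> fd \<phi> z e = (snd z + t0) powr a * L \<delta> (gap z) * fd eta z e +
   ((snd z + t0) powr a * (l \<delta> (gap z) * (dheight (snd z) * snd e - (dprofile (norm (fst z)) *\<^sub>R sgn (fst z)) \<bullet> fst e)) +
   a * (snd z + t0) powr (a - 1) * snd e * L \<delta> (gap z)) * eta z"
proof -
 have c: "C1_on S_inf (%z::'a \<times> real. (snd z + t0) powr a * L \<delta> (gap z))"
  by (rule C1_on_mult(1)[OF powr_C1(1) L_gap_C1(1)[OF \<delta>]])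
 show "\<phi> : C1_tests S_inf" unfolding \<phi>_def by (rule C1_on_mult_test(1)[OF open_S_inf c eta])
 assume z: "z : S_inf"
 show "fd \<phi> z e = (snd z + t0) powr a * L \<delta> (gap z) * fd eta z e +
   ((snd z + t0) powr a * (l \<delta> (gap z) * (dheight (snd z) * snd e - (dprofile (norm (fst z)) *\<^sub>R sgn (fst z)) \<bullet> fst e)) +
   a * (snd z + t0) powr (a - 1) * snd e * L \<delta> (gap z)) * eta z"
  unfolding \<phi>_def C1_on_mult_test(2)[OF open_S_inf c eta] C1_on_mult(2)[OF powr_C1(1) L_gap_C1(1)[OF \<delta>] z]
   L_gap_C1(2)[OF \<delta> z] gap_C1(2)[OF z] powr_C1(2)[OF z] ..
qed

lemma C1_tests_UNIV: "eta : C1_tests S ==> eta : C1_tests UNIV"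
 by (auto simp: C1_tests_def)

lemma weight_fst_locally_bounded: "compact K ==> \<exists>B. \<forall>z\<in>K. \<bar>weight g (fst (z :: 'a::euclidean_space \<times> real))\<bar> <= B"
 by (meson space_weight_bounded[OF weight_continuous])

text \<open>Two vanishing integrals are added: the radial divergence tested with (t + t0)^(-1-k) L
  eta, and the weight times the time derivative of (t + t0)^(-k) L eta. The derivatives of eta
  cancel against the weak form, and L reaction + l transport remains, times a nonnegative
  factor.\<close>

lemma regularized_weak_inequality:
 fixes eta :: "'a::euclidean_space \<times> real => real"
 assumes \<delta>: "\<delta> > 0" and eta: "eta : C1_tests S_inf" "!!z. 0 <= eta z"
  and reac: "!!r. r > 0 ==> r ~= r0 ==> 0 <= reaction DIM('a) r"
  and trans: "!!r t. r > 0 ==> r ~= r0 ==> t > 0 ==> profile r < height t ==>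
   0 <= transport r t \<or> 0 <= (height t - profile r) * reaction DIM('a) r + (b + 1) * transport r t"
 shows "0 <= (LI z. L \<delta> (gap z) * fd eta z (momentum z))"
proof -
 let ?A' = "%r. \<kappa> * (exp (g r) * dH r + exp (g r) * deriv g r * H (max r r0))"
 define \<phi> where "\<phi> a z = ((snd z + t0) powr a * L \<delta> (gap z)) * eta z" for a and z :: "'a \<times> real"
 have \<phi>: "\<phi> a : C1_tests S_inf" for a unfolding \<phi>_def by (rule powr_L_test(1)[OF \<delta> eta(1)])
 have \<phi>': "fd (\<phi> a) z e = (snd z + t0) powr a * L \<delta> (gap z) * fd eta z e +
   ((snd z + t0) powr a * (l \<delta> (gap z) * (dheight (snd z) * snd e - (dprofile (norm (fst z)) *\<^sub>R sgn (fst z)) \<bullet> fst e)) +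
   a * (snd z + t0) powr (a - 1) * snd e * L \<delta> (gap z)) * eta z" if "z : S_inf" for z e a
  using powr_L_test(2)[OF \<delta> eta(1) that] unfolding \<phi>_def .
 let ?S = "%z. \<phi> (- 1 - k) z * (real DIM('a) * A (norm (fst z)) + norm (fst z) * ?A' (norm (fst z))) +
   A (norm (fst z)) * fd (\<phi> (- 1 - k)) z (fst z, 0)"
 let ?T = "%z. weight g (fst z) * fd (\<phi> (- k)) z (0, 1)"
 let ?W = "%z. L \<delta> (gap z) * fd eta z (momentum z)"
 have S: "L1 ?S" "(LI z. ?S z) = 0"
  by (rule radial_divergence[OF A_continuous A_derivative A_lipschitz C1_tests_UNIV[OF \<phi>]], assumption+)+
 have T: "L1 ?T" "(LI z. ?T z) = 0"
  using integral_C1_tests_directional[OF C1_tests_UNIV[OF \<phi>] space_weight_measurable[OF weight_continuous] _ weight_fst_locally_bounded]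
  by (auto simp del: C_k.simps)
 have Lc: "continuous_on S_inf (%z::'a \<times> real. L \<delta> (gap z) *\<^sub>R momentum z)"
  by (intro continuous_on_scaleR C1_on_continuous[OF L_gap_C1(1)[OF \<delta>]] momentum_continuous)
 have lin: "fd eta z (c *\<^sub>R e) = c * fd eta z e" for z c e
  using linear_scale[OF C1_tests_linear[OF eta(1)]] by simp
 have W: "L1 ?W"
  using C1_tests_pairing_integrable[OF locally_integrable_continuous[OF Lc] eta(1)] by (simp add: lin)
 have "0 <= (LI z. ?W z + (C * c1) * ?S z + C * ?T z)"
 proof (rule integral_nonneg_AE)
  show "AE z in lebesgue. 0 <= ?W z + (C * c1) * ?S z + C * ?T z"
   using AE_norm_fst_neq[of 0] AE_norm_fst_neq[of r0]
  proof eventually_elim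
   case (elim z)
   show ?case
   proof (cases "z : S_inf")
    case False
    thus ?thesis using C1_tests_outside[OF eta(1) False] C1_tests_outside[OF \<phi> False] by simp
   next
    case z: True
    let ?r = "norm (fst z)" let ?t = "snd z" let ?f = "exp (g (norm (fst z)))"
    define s where "s = ?t + t0"
    have s: "s > 0" "?t > 0" using z t0 by (auto simp: s_def S_inf_def)
    have r: "?r > 0" "?r ~= r0" using elim by auto
    \<comment> \<open>Brings the time part to the common power -1-k; this is the origin of the
      factor t + t0 in \<open>transport\<close>.\<close>
    have sp: "s powr (- k) = s * s powr (- 1 - k)" using s powr_add[of s 1 "- 1 - k"] by simp
    have sp': "- k - 1 = - 1 - k" by simp
    have sg: "sgn (fst z) \<bullet> fst z = ?r" using r by (simp add: sgn_div_norm dot_square_norm power2_eq_square)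
    have mom: "momentum z = (- (C * c1 * s powr (- 1 - k) * A ?r)) *\<^sub>R (fst z, 0) + (- (C * ?f * s powr (- k))) *\<^sub>R (0, 1)"
     by (simp add: momentum_def field_def A_def weight_def s_def)
    have Wz: "fd eta z (momentum z) =
      - (C * c1 * s powr (- 1 - k) * A ?r) * fd eta z (fst z, 0) - C * ?f * s powr (- k) * fd eta z (0, 1)"
     unfolding mom linear_add[OF C1_tests_linear[OF eta(1)]] lin by simp
    have "?W z + (C * c1) * ?S z + C * ?T z =
      eta z * ?f * C * s powr (- 1 - k) * (L \<delta> (gap z) * reaction DIM('a) ?r + l \<delta> (gap z) * transport ?r ?t)"
     unfolding Wz A_radial[OF r] \<phi>'[OF z]
     by (simp add: \<phi>_def s_def[symmetric] sp sp' sg reaction_def transport_def weight_def A_def) (simp add: algebra_simps)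
    moreover have "0 <= L \<delta> (gap z) * reaction DIM('a) ?r + l \<delta> (gap z) * transport ?r ?t"
     by (rule L_l_combination_nonneg[OF \<delta> reac[OF r]]) (use trans[OF r s(2)] in auto)
    ultimately show ?thesis using eta(2)[of z] C s by simp
   qed
  qed
 qed
 also have "... = (LI z. ?W z)" using S T W by simp
 finally show ?thesis .
qed

lemma v_pairing:
 fixes eta :: "'a::euclidean_space \<times> real => real"
 assumes eta: "eta : C1_tests S_inf"
 shows "fd eta z (weight g (fst z) *\<^sub>R pflux p q (v z) (Wv z), - (weight g (fst z) * v z)) =
  max 0 (gap z) powr b * fd eta z (momentum z)"
proof (cases "z : S_inf")
 case True
 have cc: "C powr (p + m - 2) = C * C powr (p + m - 3)" using C powr_add[of C 1 "p + m - 3"] by simp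
 have "(weight g (fst z) *\<^sub>R pflux p q (v z) (Wv z), - (weight g (fst z) * v z)) = (max 0 (gap z) powr b) *\<^sub>R momentum z"
  unfolding pflux_v[OF True] by (simp add: momentum_def c1_def v_def cc mult_ac)
 thus ?thesis using linear_scale[OF C1_tests_linear[OF eta]] by simp
next
 case False
 thus ?thesis using C1_tests_outside[OF eta] by simp
qed

text \<open>As \<delta> tends to 0 the regularised powers stay below X_+^b, so the limit integrand
  itself dominates.\<close>

lemma weak_inequality:
 fixes eta :: "'a::euclidean_space \<times> real => real"
 assumes eta: "eta : C1_tests S_inf" "!!z. 0 <= eta z"
  and reac: "!!r. r > 0 ==> r ~= r0 ==> 0 <= reaction DIM('a) r"
  and trans: "!!r t. r > 0 ==> r ~= r0 ==> t > 0 ==> profile r < height t ==>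
   0 <= transport r t \<or> 0 <= (height t - profile r) * reaction DIM('a) r + (b + 1) * transport r t"
 shows "0 <= weak_form p m (weight g) v (grad_from_power q v Wv) eta"
proof -
 let ?W = "%z. fd eta z (momentum z)"
 define \<delta> where "\<delta> n = 1 / real (Suc n)" for n
 have \<delta>: "\<delta> n > 0" "\<delta> ~~> 0" for n
  unfolding \<delta>_def using LIMSEQ_inverse_real_of_nat by (auto simp: inverse_eq_divide)
 have lin: "fd eta z (c *\<^sub>R e) = c * fd eta z e" for z c e
  using linear_scale[OF C1_tests_linear[OF eta(1)]] by simp
 have int: "L1 (%z. h (gap z) * ?W z)" if h: "conton h" for h
 proof -
  have "continuous_on S_inf (%z::'a \<times> real. h (gap z) *\<^sub>R momentum z)"
   by (intro continuous_on_scaleR continuous_on_compose2[OF h C1_on_continuous[OF gap_C1(1)]] momentum_continuous) auto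
  from C1_tests_pairing_integrable[OF locally_integrable_continuous[OF this] eta(1)] show ?thesis by (simp add: lin)
 qed
 have i0: "L1 (%z. max 0 (gap z) powr b * ?W z)"
  by (rule int, intro continuous_on_powr' continuous_on_max continuous_on_const continuous_on_id) (use exponents(2) in auto)
 have "(%n. LI z. L (\<delta> n) (gap z) * ?W z) ~~> (LI z. max 0 (gap z) powr b * ?W z)"
 proof (rule integral_dominated_convergence[where w="%z. \<bar>max 0 (gap z) powr b * ?W z\<bar>"])
  show "(%z. L (\<delta> n) (gap z) * ?W z) : lebm" for n
   using int[OF L_continuous[OF \<delta>(1)]] by (rule borel_measurable_integrable)
  show "(%z. max 0 (gap z) powr b * ?W z) : lebm"
   using i0 by (rule borel_measurable_integrable)
  show "L1 (%z. \<bar>max 0 (gap z) powr b * ?W z\<bar>)" using i0 by (rule integrable_abs)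
  show "AE z in lebesgue. (%n. L (\<delta> n) (gap z) * ?W z) ~~> max 0 (gap z) powr b * ?W z"
   by (intro always_eventually allI tendsto_mult L_l_limits(1) \<delta> tendsto_const)
  show "AE z in lebesgue. norm (L (\<delta> n) (gap z) * ?W z) <= \<bar>max 0 (gap z) powr b * ?W z\<bar>" for n
   using L_le[OF \<delta>(1)] L_l_nonneg(1)[OF \<delta>(1)] by (auto simp: abs_mult intro!: always_eventually mult_right_mono)
 qed
 moreover have "0 <= (LI z. L (\<delta> n) (gap z) * ?W z)" for n
  by (rule regularized_weak_inequality[OF \<delta>(1) eta reac trans])
 ultimately have "0 <= (LI z. max 0 (gap z) powr b * ?W z)" by (intro LIMSEQ_le_const) auto
 also have "... = weak_form p m (weight g) v (grad_from_power q v Wv) eta"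
 proof -
  have "AE z::'a \<times> real in lebesgue. z : S_inf --> 0 <= v z" by (simp add: v_nonneg)
  from weak_form_eq[OF p q_def exponents(3) this eta(1), of "weight g" Wv]
  show ?thesis by (simp add: v_pairing[OF eta(1)])
 qed
 finally show ?thesis .
qed

end

subsection \<open>Regularity of the barrier\<close>

text \<open>Fatou's lemma, for the time derivative of the barrier, where no dominating function is
  available beforehand.\<close>

lemma integrable_limit_of_bounded_integrals:
 fixes F :: "nat => 'b => real"
 assumes F: "!!n. integrable M (F n)" "!!n x. 0 <= F n x" "!!n. (LINT x|M. F n x) <= B"
  and lim: "!!x. (%n. F n x) ~~> f x"
 shows "integrable M f"
proof (rule integrableI_nonneg)
 show m: "f : borel_measurable M"
  by (rule borel_measurable_LIMSEQ_real[OF lim borel_measurable_integrable[OF F(1)]])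
 have f0: "0 <= f x" for x by (rule LIMSEQ_le_const[OF lim]) (use F(2) in auto)
 thus "AE x in M. 0 <= f x" by simp
 have "(\<integral>\<^sup>+ x. ennreal (f x) \<partial>M) = (\<integral>\<^sup>+ x. liminf (%n. ennreal (F n x)) \<partial>M)"
  by (intro nn_integral_cong lim_imp_Liminf[symmetric] tendsto_ennrealI lim) auto
 also have "... <= liminf (%n. \<integral>\<^sup>+ x. ennreal (F n x) \<partial>M)"
  using F(1) by (intro nn_integral_liminf) auto
 also have "... <= ennreal B"
 proof (rule Liminf_le)
  show "\<forall>\<^sub>F n in sequentially. (\<integral>\<^sup>+ x. ennreal (F n x) \<partial>M) <= ennreal B"
   using F by (intro always_eventually allI) (subst nn_integral_eq_integral, auto intro!: ennreal_leI)
 qed simp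
 finally show "(\<integral>\<^sup>+ x. ennreal (f x) \<partial>M) < \<infinity>" by (rule le_less_trans) simp
qed

lemma compact_in_slab:
 fixes K :: "('a::euclidean_space \<times> real) set"
 assumes "compact K" "K \<subseteq> S_inf"
 obtains R a b where "R > 0" "0 < a" "a < b" "!!z. z : K ==> norm (fst z) <= R \<and> a <= snd z \<and> snd z <= b"
proof -
 obtain B where B: "B > 0" "!!z. z : K ==> norm z <= B"
  using compact_imp_bounded[OF assms(1)] by (auto simp: bounded_pos)
 have c: "compact (insert 1 (snd ` K))"
  by (intro compact_insert compact_continuous_image assms continuous_intros)
 obtain a where a: "a : insert 1 (snd ` K)" "!!t. t : insert 1 (snd ` K) ==> a <= t"
  using compact_attains_inf[OF c] by auto
 have "a > 0" using a(1) assms(2) by (auto simp: S_inf_def)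
 moreover have "norm (fst z) <= B \<and> a <= snd z \<and> snd z <= max B a + 1" if "z : K" for z
  using B(2)[OF that] norm_fst_le[of "fst z" "snd z"] norm_snd_le[of "snd z" "fst z"] a(2)[of "snd z"] that by auto
 ultimately show thesis using that[of B a "max B a + 1"] B(1) by auto
qed

lemma compact_cutoff:
 fixes K :: "('a::euclidean_space \<times> real) set"
 assumes "compact K" "K \<subseteq> S_inf"
 obtains eta where "eta : C1_tests S_inf" "!!z. 0 <= eta z" "!!z. z : K ==> eta z = 1"
proof -
 obtain R a b where R: "R > 0" "0 < a" "a < b" and K: "!!z. z : K ==> norm (fst z) <= R \<and> a <= snd z \<and> snd z <= b"
  by (rule compact_in_slab[OF assms]) (rule that)
 \<comment> \<open>The exponent 2 is an arbitrary choice above 1: here only the regularity, the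
   plateau and the support of the cutoff matter.\<close>
 obtain zt :: "'a => real" and D L where zt: "is_cutoff 2 L R zt D"
  using radial_cutoff[where 'a='a, of 2] R(1) by (metis one_less_numeral_iff semiring_norm(76))
 have "a / 2 < a" using R by auto
 then obtain \<theta>1 \<theta>1' :: "real => real" where
  1: "!!s. (\<theta>1 has_real_derivative \<theta>1' s) (at s)" "conton \<theta>1'" "!!s. s <= a / 2 ==> \<theta>1 s = 0" "!!s. s >= a ==> \<theta>1 s = 1" "!!s. 0 <= \<theta>1 s"
  by (rule smooth_step) blast
 have "b < b + 1" by simp
 then obtain \<theta>2 \<theta>2' :: "real => real" where
  2: "!!s. (\<theta>2 has_real_derivative \<theta>2' s) (at s)" "conton \<theta>2'" "!!s. s <= b ==> \<theta>2 s = 0" "!!s. s >= b + 1 ==> \<theta>2 s = 1" "!!s. \<theta>2 s <= 1"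
  by (rule smooth_step) blast
 let ?omg = "%t. \<theta>1 t * (1 - \<theta>2 t)"
 have c: "conton \<theta>1" "conton \<theta>2"
  using 1(1) 2(1) by (auto intro: DERIV_continuous_on)
 have "(%z. zt (fst z) * ?omg (snd z)) : C1_tests S_inf"
 proof (rule product_test_function(1)[where R="2 * R" and a="a / 2" and b="b + 1" and D=D and omg'="%t. \<theta>1' t * (1 - \<theta>2 t) + (0 - \<theta>2' t) * \<theta>1 t"])
  show "(?omg has_real_derivative \<theta>1' t * (1 - \<theta>2 t) + (0 - \<theta>2' t) * \<theta>1 t) (at t)" for t
   by (intro DERIV_mult DERIV_diff DERIV_const 1 2)
  show "conton (%t. \<theta>1' t * (1 - \<theta>2 t) + (0 - \<theta>2' t) * \<theta>1 t)"
   by (intro continuous_intros 1 2 c)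
  show "\<theta>1 t * (1 - \<theta>2 t) = 0" if "t \<notin> {a / 2..b + 1}" for t using that 1(3)[of t] 2(4)[of t] by auto
 qed (use zt R in "auto simp: is_cutoff_def")
 moreover have "0 <= zt (fst z) * ?omg (snd z)" for z using zt 1(5) 2(5) by (auto simp: is_cutoff_def)
 moreover have "zt (fst z) * ?omg (snd z) = 1" if "z : K" for z
  using K[OF that] zt 1(4) 2(3) by (auto simp: is_cutoff_def)
 ultimately show thesis by (rule that)
qed

context barrier_parameters begin

text \<open>The pointwise time derivative of X_+^b, with the time factor of v. For b < 1 it is
  unbounded at the free boundary.\<close>

definition rate :: "'a::euclidean_space \<times> real => real" where
 "rate z = indicator {z : S_inf. 0 < gap z} z *\<^sub>R ((snd z + t0) powr (- k) * (b * gap z powr (b - 1) * dheight (snd z)))"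

definition vt :: "'a::euclidean_space \<times> real => real" where
 "vt z = C * (rate z - k * ((snd z + t0) powr (- k - 1) * max 0 (gap z) powr b))"

lemma rate_measurable: "(rate :: 'a::euclidean_space \<times> real => real) : borm"
proof -
 have U: "open {z : S_inf. 0 < gap (z::'a \<times> real)}"
  using continuous_open_preimage[OF C1_on_continuous[OF gap_C1(1)] open_S_inf, of "{0<..}"]
  by (auto simp: vimage_def Int_def)
 have g: "continuous_on {z : S_inf. 0 < gap (z::'a \<times> real)} gap"
  by (rule continuous_on_subset[OF C1_on_continuous[OF gap_C1(1)]]) auto
 have "continuous_on {z : S_inf. 0 < gap (z::'a \<times> real)} (%z. (snd z + t0) powr (- k) * (b * gap z powr (b - 1) * dheight (snd z)))"
  by (intro continuous_on_mult continuous_on_const continuous_on_subset[OF C1_on_continuous[OF powr_C1(1)]]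
    continuous_on_powr g continuous_on_compose2[OF dheight_continuous'] continuous_on_snd continuous_on_id) (auto simp: S_inf_def)
 thus ?thesis unfolding rate_def[abs_def]
  by (rule borel_measurable_continuous_on_indicator[rotated]) (rule borel_open[OF U])
qed

lemma powr_pos_part_continuous: "continuous_on S_inf (%z::'a::euclidean_space \<times> real. (snd z + t0) powr a * max 0 (gap z) powr b)"
 using exponents(2) t0
 by (intro continuous_on_mult C1_on_continuous[OF powr_C1(1)] continuous_on_powr' continuous_on_max continuous_on_const
   C1_on_continuous[OF gap_C1(1)]) auto

text \<open>The integrals converge although nothing dominates the integrands yet: integration by
  parts in time replaces l by L, and L lies below X_+^b.\<close>

lemma rate_approximation:
 fixes eta :: "'a::euclidean_space \<times> real => real"
 assumes eta: "eta : C1_tests S_inf" and \<delta>: "!!n. \<delta> n > 0" "\<delta> ~~> 0"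
 defines "F \<equiv> %n z. (snd z + t0) powr (- k) * l (\<delta> n) (gap z) * dheight (snd z) * eta z"
 shows "L1 (F n)"
  and "(%n. LI z. F n z) ~~>
   k * (LI z. (snd z + t0) powr (- k - 1) * max 0 (gap z) powr b * eta z)
   - (LI z. (snd z + t0) powr (- k) * max 0 (gap z) powr b * fd eta z (0, 1))"
  and "(%n. F n z) ~~> rate z * eta z"
proof -
 have Lc: "continuous_on S_inf (%z::'a \<times> real. (snd z + t0) powr a * L (\<delta> n) (gap z))" for a n
  by (intro continuous_on_mult C1_on_continuous[OF powr_C1(1)] C1_on_continuous[OF L_gap_C1(1)[OF \<delta>(1)]])
 have lc: "continuous_on S_inf (%z::'a \<times> real. (snd z + t0) powr (- k) * l (\<delta> n) (gap z) * dheight (snd z))" for n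
  by (intro continuous_on_mult C1_on_continuous[OF powr_C1(1)] continuous_on_compose2[OF l_continuous[OF \<delta>(1)] C1_on_continuous[OF gap_C1(1)]]
    continuous_on_compose2[OF dheight_continuous'] continuous_intros) (auto simp: S_inf_def)
 show iF: "L1 (F n)" for n
  unfolding F_def by (rule test_functions_grad_integrable(2)[OF locally_integrable_continuous[OF lc] eta])
 let ?T1 = "%n z. (snd z + t0) powr (- k) * L (\<delta> n) (gap z) * fd eta z (0, 1)"
 let ?T2 = "%n z. (snd z + t0) powr (- k - 1) * L (\<delta> n) (gap z) * eta z"
 have i1: "L1 (?T1 n)" and i2: "L1 (?T2 n)" for n
  by (rule test_functions_grad_integrable[OF locally_integrable_continuous[OF Lc] eta])+
 have eq: "(LI z. F n z) = k * (LI z. ?T2 n z) - (LI z. ?T1 n z)" for n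
 proof -
  define \<phi> where "\<phi> z = ((snd z + t0) powr (- k) * L (\<delta> n) (gap z)) * eta z" for z
  have \<phi>: "\<phi> : C1_tests S_inf" unfolding \<phi>_def by (rule powr_L_test(1)[OF \<delta>(1) eta])
  have "fd \<phi> z (0, 1) = ?T1 n z + F n z - k * ?T2 n z" for z
  proof (cases "z : S_inf")
   case True
   thus ?thesis unfolding \<phi>_def powr_L_test(2)[OF \<delta>(1) eta True] F_def by (simp add: algebra_simps)
  next
   case False
   thus ?thesis using C1_tests_outside[OF \<phi>] C1_tests_outside[OF eta] by (simp add: F_def)
  qed
  moreover have "(LI z. fd \<phi> z (0, 1)) = 0"
   using integral_C1_tests_directional(2)[OF C1_tests_UNIV[OF \<phi>], of "%_. 1" "(0, 1)"] by (auto simp del: C_k.simps)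
  ultimately have "(LI z. ?T1 n z + F n z - k * ?T2 n z) = 0" by simp
  thus ?thesis using i1 i2 iF by simp
 qed
 have dct: "(%n. LI z. (snd z + t0) powr a * L (\<delta> n) (gap z) * h z) ~~>
   (LI z. (snd z + t0) powr a * max 0 (gap z) powr b * h z)"
  if i: "!!n. L1 (%z. (snd z + t0) powr a * L (\<delta> n) (gap z) * h z)"
   and i': "L1 (%z. (snd z + t0) powr a * max 0 (gap z) powr b * h z)" for a and h :: "'a \<times> real => real"
 proof (rule integral_dominated_convergence[where w="%z. \<bar>(snd z + t0) powr a * max 0 (gap z) powr b * h z\<bar>"])
  show "AE z in lebesgue. (%n. (snd z + t0) powr a * L (\<delta> n) (gap z) * h z) ~~> (snd z + t0) powr a * max 0 (gap z) powr b * h z"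
   by (intro always_eventually allI tendsto_mult L_l_limits(1) \<delta> tendsto_const)
  show "AE z in lebesgue. norm ((snd z + t0) powr a * L (\<delta> n) (gap z) * h z) <= \<bar>(snd z + t0) powr a * max 0 (gap z) powr b * h z\<bar>" for n
   using L_le[OF \<delta>(1)] L_l_nonneg(1)[OF \<delta>(1)]
   by (auto simp: abs_mult intro!: always_eventually mult_right_mono mult_left_mono)
 qed (use i i' in auto)
 have "(%n. k * (LI z. ?T2 n z) - (LI z. ?T1 n z)) ~~>
   k * (LI z. (snd z + t0) powr (- k - 1) * max 0 (gap z) powr b * eta z)
   - (LI z. (snd z + t0) powr (- k) * max 0 (gap z) powr b * fd eta z (0, 1))"
  by (intro tendsto_diff tendsto_mult_left dct i1 i2
    test_functions_grad_integrable[OF locally_integrable_continuous[OF powr_pos_part_continuous] eta])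
 thus "(%n. LI z. F n z) ~~>
   k * (LI z. (snd z + t0) powr (- k - 1) * max 0 (gap z) powr b * eta z)
   - (LI z. (snd z + t0) powr (- k) * max 0 (gap z) powr b * fd eta z (0, 1))"
  by (simp add: eq)
 show "(%n. F n z) ~~> rate z * eta z"
 proof (cases "z : S_inf")
  case True
  show ?thesis
  proof (cases "gap z > 0")
   case g: True
   have "(%n. F n z) ~~> (snd z + t0) powr (- k) * (b * gap z powr (b - 1)) * dheight (snd z) * eta z"
    unfolding F_def by (intro tendsto_mult L_l_limits(2) \<delta> tendsto_const g)
   thus ?thesis using True g by (simp add: rate_def mult.assoc)
  next
   case False
   thus ?thesis by (simp add: rate_def F_def l_def)
  qed
 qed (simp add: F_def C1_tests_outside[OF eta])
qed

text \<open>The approximating integrals converge, hence are bounded, and Fatou's lemma makes the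
  possibly singular limit integrable.\<close>

lemma rate_locally_integrable: "locally_integrable S_inf (rate :: 'a::euclidean_space \<times> real => real)"
 unfolding locally_integrable_def set_integrable_def
proof (intro allI impI, elim conjE)
 fix K :: "('a \<times> real) set" assume K: "compact K" "K \<subseteq> S_inf"
 obtain eta :: "'a \<times> real => real" where eta: "eta : C1_tests S_inf" "!!z. 0 <= eta z" "!!z. z : K ==> eta z = 1"
  by (rule compact_cutoff[OF K]) (rule that)
 define \<delta> where "\<delta> n = 1 / real (Suc n)" for n
 have \<delta>: "\<delta> n > 0" "\<delta> ~~> 0" for n
  unfolding \<delta>_def using LIMSEQ_inverse_real_of_nat by (auto simp: inverse_eq_divide)
 note F = rate_approximation[OF eta(1) \<delta>]
 obtain B where B: "!!n. (LI z. (snd z + t0) powr (- k) * l (\<delta> n) (gap z) * dheight (snd z) * eta z) <= B"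
  using convergent_imp_Bseq[OF convergentI[OF F(2)]] by (auto simp: Bseq_def abs_le_iff)
 have "L1 (%z. rate z * eta z)"
 proof (rule integrable_limit_of_bounded_integrals[OF F(1) _ B F(3)])
  fix n z
  show "0 <= (snd z + t0) powr (- k) * l (\<delta> n) (gap z) * dheight (snd z) * eta z"
   using eta(2) L_l_nonneg(2)[OF \<delta>(1)] dheight_pos[of "snd z"] t0 C1_tests_outside(1)[OF eta(1), of z]
   by (cases "snd z > 0") (auto simp: S_inf_def mem_Times_iff)
 qed
 thus "L1 (%z. indicator K z *\<^sub>R rate z)"
 proof (rule Lint_bound)
  show "(%z. indicator K z *\<^sub>R rate z) : lebm"
   using borel_measurable_lebesgue[OF rate_measurable] sets_lebesgue_compact[OF K(1)] by measurable
  show "AE z in lebesgue. norm (indicat_real K z *\<^sub>R rate z) <= norm (rate z * eta z)"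
   using eta(3) by (intro always_eventually allI) (auto simp: indicator_def)
 qed
qed

text \<open>With \<open>rate\<close> known to be locally integrable, (b + 1)/b times its modulus
  dominates the approximations: l is at most (b + 1) y^(b-1), while the limit is b y^(b-1).\<close>

lemma v_weak_time_deriv: "has_weak_time_deriv (v :: 'a::euclidean_space \<times> real => real) vt"
 unfolding has_weak_time_deriv_def
proof (intro conjI ballI)
 have vc: "continuous_on S_inf (%z::'a \<times> real. C * ((snd z + t0) powr a * max 0 (gap z) powr b))" for a
  by (intro continuous_on_mult continuous_on_const powr_pos_part_continuous)
 show "locally_integrable S_inf (v :: 'a \<times> real => real)"
  using locally_integrable_continuous[OF vc, of "- k"] by (simp add: v_def[abs_def] mult.assoc)
 have "locally_integrable S_inf (%z::'a \<times> real. C * rate z)"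
  using locally_integrable_weight[OF continuous_on_const rate_locally_integrable] by blast
 from locally_integrable_diff[OF this, of "%z. C * (k * ((snd z + t0) powr (- k - 1) * max 0 (gap z) powr b))"]
 show "locally_integrable S_inf (vt :: 'a \<times> real => real)"
  unfolding vt_def right_diff_distrib
  by (simp add: locally_integrable_continuous continuous_on_mult powr_pos_part_continuous)
 fix eta :: "'a \<times> real => real" assume "eta : test_functions S_inf"
 hence eta: "eta : C1_tests S_inf" by (rule test_functions_C1_tests)
 note out = C1_tests_outside[OF eta]
 define \<delta> where "\<delta> n = 1 / real (Suc n)" for n
 have \<delta>: "\<delta> n > 0" "\<delta> ~~> 0" for n
  unfolding \<delta>_def using LIMSEQ_inverse_real_of_nat by (auto simp: inverse_eq_divide)
 note F = rate_approximation[OF eta \<delta>]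
 let ?F = "%n z. (snd z + t0) powr (- k) * l (\<delta> n) (gap z) * dheight (snd z) * eta z"
 let ?T1 = "%z. (snd z + t0) powr (- k) * max 0 (gap z) powr b * fd eta z (0, 1)"
 let ?T2 = "%z. (snd z + t0) powr (- k - 1) * max 0 (gap z) powr b * eta z"
 have iT: "L1 ?T1" "L1 ?T2"
  by (rule test_functions_grad_integrable[OF locally_integrable_continuous[OF powr_pos_part_continuous] eta])+
 have ir: "L1 (%z. rate z * eta z)"
  by (rule test_functions_grad_integrable(2)[OF rate_locally_integrable eta])
 have "(%n. LI z. ?F n z) ~~> (LI z. rate z * eta z)"
 proof (rule integral_dominated_convergence[where w="%z. (b + 1) / b * \<bar>rate z * eta z\<bar>"])
  show "L1 (%z. (b + 1) / b * \<bar>rate z * eta z\<bar>)"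
   by (intro integrable_mult_right integrable_abs ir)
  show "AE z in lebesgue. (%n. ?F n z) ~~> rate z * eta z" using F(3) by simp
  show "AE z in lebesgue. norm (?F n z) <= (b + 1) / b * \<bar>rate z * eta z\<bar>" for n
  proof (intro always_eventually allI)
   fix z :: "'a \<times> real"
   consider "z \<notin> S_inf" | "gap z <= 0" | "z : S_inf" "gap z > 0" by linarith
   thus "norm (?F n z) <= (b + 1) / b * \<bar>rate z * eta z\<bar>"
   proof cases
    case 3
    hence d: "dheight (snd z) > 0" using dheight_pos[of "snd z"] t0 by (auto simp: S_inf_def)
    have "norm (?F n z) = l (\<delta> n) (gap z) * ((snd z + t0) powr (- k) * dheight (snd z) * \<bar>eta z\<bar>)"
     using d L_l_nonneg(2)[OF \<delta>(1)] by (simp add: abs_mult)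
    also have "... <= (b + 1) * gap z powr (b - 1) * ((snd z + t0) powr (- k) * dheight (snd z) * \<bar>eta z\<bar>)"
     using l_bounds[OF \<delta>(1) 3(2)] d by (intro mult_right_mono) auto
    also have "... = (b + 1) / b * \<bar>rate z * eta z\<bar>"
     using 3 d exponents(2) by (simp add: rate_def abs_mult)
    finally show ?thesis .
   qed (use exponents(2) out in "auto simp: l_def")
  qed
 qed (use F(1) ir in auto)
 hence lim: "(LI z. rate z * eta z) = k * (LI z. ?T2 z) - (LI z. ?T1 z)"
  using F(2) LIMSEQ_unique by blast
 have "(LINT z:S_inf|lebesgue. v z * time_deriv eta z) = (LI z. v z * time_deriv eta z)"
  using out by (intro set_lebesgue_integral_eq_UNIV) (simp add: time_deriv_def)
 also have "... = (LI z. C * ?T1 z)" by (simp add: v_def time_deriv_def mult_ac)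
 also have "... = C * (k * (LI z. ?T2 z) - (LI z. rate z * eta z))" by (simp add: lim)
 also have "... = - (LI z. C * (rate z * eta z - k * ?T2 z))" using ir iT by (simp add: right_diff_distrib)
 also have "(LI z. C * (rate z * eta z - k * ?T2 z)) = (LI z. eta z * vt z)"
  by (intro Lint_cong refl) (simp add: vt_def algebra_simps)
 also have "... = (LINT z:S_inf|lebesgue. eta z * vt z)"
  using out by (intro set_lebesgue_integral_eq_UNIV[symmetric]) simp
 finally show "(LINT z:S_inf|lebesgue. v z * time_deriv eta z) = - (LINT z:S_inf|lebesgue. eta z * vt z)" .
qed

lemma vt_zero: "z : S_inf ==> v z = 0 ==> vt z = 0"
 using C t0 by (auto simp: v_def vt_def rate_def S_inf_def indicator_def)

lemma v_weak_space_grad: "has_weak_space_grad (%z. v (z :: 'a::euclidean_space \<times> real) powr q) Wv"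
 unfolding has_weak_space_grad_def
proof (intro conjI ballI)
 let ?w = "%z::'a \<times> real. v z powr q"
 show "locally_integrable S_inf ?w" by (rule locally_integrable_continuous[OF C1_on_continuous[OF v_powr_C1]])
 show "locally_integrable S_inf (Wv :: 'a \<times> real => 'a)" by (rule locally_integrable_continuous[OF Wv_continuous])
 fix eta :: "'a \<times> real => real" assume "eta : test_functions S_inf"
 hence eta: "eta : C1_tests S_inf" by (rule test_functions_C1_tests)
 note out = C1_tests_outside[OF eta]
 let ?a = "%i z. ?w z * fd eta z (i, 0)" and ?b = "%i z. fd ?w z (i, 0) * eta z"
 have i1: "L1 (?a i)" for i
  by (rule test_functions_grad_integrable(1)[OF locally_integrable_continuous[OF C1_on_continuous[OF v_powr_C1]] eta])
 have "continuous_on S_inf (%z. fd ?w z (i, 0))" for i using v_powr_C1 unfolding C1_on_def by blast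
 from test_functions_grad_integrable(2)[OF locally_integrable_continuous[OF this] eta]
 have i2: "L1 (?b i)" for i .
 have eq: "(LI z. ?a i z) = - (LI z. ?b i z)" for i
 proof -
  note m = C1_on_mult_test[OF open_S_inf v_powr_C1 eta]
  have "(LI z. fd (%z. ?w z * eta z) z (i, 0)) = 0"
   using integral_C1_tests_directional(2)[OF C1_tests_UNIV[OF m(1)], of "%_. 1" "(i, 0)"] by (auto simp del: C_k.simps)
  hence "(LI z. ?a i z + ?b i z) = 0" by (simp add: m(2))
  thus ?thesis using i1 i2 by simp
 qed
 have "(LINT z:S_inf|lebesgue. ?w z *\<^sub>R space_grad eta z) = (LI z. ?w z *\<^sub>R space_grad eta z)"
  using out by (intro set_lebesgue_integral_eq_UNIV) (simp add: space_grad_def)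
 also have "... = (LI z. (\<Sum>i\<in>Basis. ?a i z *\<^sub>R i))" by (simp add: space_grad_def scaleR_sum_right)
 also have "... = (\<Sum>i\<in>Basis. (LI z. ?a i z) *\<^sub>R i)"
  using i1 by (subst Bochner_Integration.integral_sum) auto
 also have "... = - (\<Sum>i\<in>Basis. (LI z. ?b i z) *\<^sub>R i)" by (simp add: eq sum_negf)
 also have "(\<Sum>i\<in>Basis. (LI z. ?b i z) *\<^sub>R i) = (LI z. (\<Sum>i\<in>Basis. ?b i z *\<^sub>R i))"
  using i2 by (subst Bochner_Integration.integral_sum) auto
 also have "... = (LI z. eta z *\<^sub>R Wv z)" by (simp add: space_grad_def scaleR_sum_right mult.commute)
 also have "... = (LINT z:S_inf|lebesgue. eta z *\<^sub>R Wv z)"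
  using out by (intro set_lebesgue_integral_eq_UNIV[symmetric]) simp
 finally show "(LINT z:S_inf|lebesgue. ?w z *\<^sub>R space_grad eta z) = - (LINT z:S_inf|lebesgue. eta z *\<^sub>R Wv z)" .
qed

end

context barrier_parameters begin

section \<open>Support, continuity up to the initial time, and boundedness of the barrier\<close>

lemma profile_nonneg: "r >= 0 ==> 0 <= profile r"
proof -
 have "lam r0 / p <= 1" "0 <= lam r0" using lam[OF r0] \<alpha> p by auto
 thus "r >= 0 ==> 0 <= profile r" using p by (auto simp: profile_def I_eq Y_def)
qed

lemma v_outside:
 assumes t: "t >= 0" and x: "norm (x :: 'a::euclidean_space) >= max r0 (front t)"
 shows "v (x, t) = 0"
proof -
 have "front t > 0" using front_pos[of t] t t0 by simp
 hence "height t <= profile (norm x)"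
  using x Y_less[of "front t" "norm x"] by (cases "front t = norm x") (auto simp: height_def profile_def)
 thus ?thesis by (simp add: v_def)
qed

lemma v_continuous: "continuous_on (UNIV \<times> {0..}) (v :: 'a::euclidean_space \<times> real => real)"
proof -
 have pc: "conton (%x::'a. profile (norm x))"
  by (intro continuous_at_imp_continuous_on ballI has_derivative_continuous[OF profile_has_derivative])
 have "continuous_on (UNIV \<times> {0..}) (gap :: 'a \<times> real => real)"
  using t0 by (intro continuous_on_diff continuous_on_compose2[OF height_continuous] continuous_on_compose2[OF pc] continuous_intros) auto
 thus ?thesis unfolding v_def[abs_def] using t0 exponents(2)
  by (intro continuous_on_mult continuous_on_const continuous_on_powr' continuous_on_max continuous_on_add continuous_on_snd continuous_on_id)
   auto
qed

lemma v_slices_bounded: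
 obtains M R where "M >= 0" "!!x t. 0 <= t ==> t <= T ==> v (x::'a::euclidean_space, t) <= M * indicator (cball 0 R) x"
proof -
 define R where "R = max r0 (front (max T 0))"
 have "bounded (v ` (cball 0 R \<times> {0..T} :: ('a \<times> real) set))"
  by (intro compact_imp_bounded compact_continuous_image continuous_on_subset[OF v_continuous] compact_Times) auto
 then obtain M where "\<forall>z\<in>cball 0 R \<times> {0..T}. \<bar>v (z :: 'a \<times> real)\<bar> <= M" unfolding bounded_iff by auto
 hence M: "v (x::'a, t) <= max 0 M" if "norm x <= R" "0 <= t" "t <= T" for x t using that by force
 have "v (x::'a, t) <= max 0 M * indicator (cball 0 R) x" if "0 <= t" "t <= T" for x t
 proof (cases "norm x <= R")
  case False
  hence "max r0 (front t) <= norm x" using that front_mono[of t "max T 0"] t0 by (auto simp: R_def)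
  thus ?thesis using v_outside[OF that(1), of x] False by simp
 qed (use M[of x t] that in simp)
 thus thesis using that[of "max 0 M" R] by simp
qed

text \<open>On bounded times v is bounded with support in a fixed ball, so pointwise continuity in
  time becomes L^1-continuity by dominated convergence.\<close>

lemma v_continuous_into_L1: "continuous_into_L1 (weight g) (v :: 'a::euclidean_space \<times> real => real)"
 unfolding continuous_into_L1_def
proof (intro conjI allI impI)
 note wi = weighted_integrable_iff[OF weight_continuous weight_pos]
 have vx: "conton (%x::'a. v (x, t))" if "t >= 0" for t
  by (rule continuous_on_compose2[OF v_continuous]) (use that in "auto intro: continuous_intros")
 have m: "(%x::'a. v (x, t)) : lebm" if "t >= 0" for t
  by (intro borel_measurable_lebesgue borel_measurable_continuous_onI vx that)
 have wm: "(weight g :: 'a => real) : lebm"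
  by (intro borel_measurable_lebesgue borel_measurable_continuous_onI weight_continuous)
 have dom: "L1 (%x::'a. weight g x * (M * indicator (cball 0 R) x))" for M R
  using integrable_mult_right[OF locally_integrableD[OF locally_integrable_continuous[OF weight_continuous] compact_cball subset_UNIV], of M]
  by (simp add: mult_ac)
 fix t :: real assume t: "t >= 0"
 obtain M R where MR: "M >= 0" "!!x s. 0 <= s ==> s <= t ==> v (x::'a, s) <= M * indicator (cball 0 R) x"
  by (rule v_slices_bounded) (rule that)
 show "integrable (weighted (weight g)) (%x::'a. v (x, t))"
  unfolding wi(1)[OF m[OF t]]
 proof (rule Lint_bound[OF dom[of M R]])
  show "AE x::'a in lebesgue. norm (weight g x * v (x, t)) <= norm (weight g x * (M * indicator (cball 0 R) x))"
  proof (intro always_eventually allI)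
   fix x :: 'a
   show "norm (weight g x * v (x, t)) <= norm (weight g x * (M * indicator (cball 0 R) x))"
    using mult_left_mono[OF MR(2)[OF t order_refl, of x], of "weight g x"] v_nonneg[of "(x, t)"] weight_pos[of x] MR(1)
    by (simp add: abs_mult)
  qed
 qed (use wm m[OF t] in measurable)
 show "((%s. LINT x|weighted (weight g). \<bar>v (x::'a, s) - v (x, t)\<bar>) \<longlongrightarrow> 0) (at t within {0..})"
  unfolding tendsto_at_iff_sequentially comp_def
 proof (intro allI impI)
  fix X :: "nat => real" assume X: "\<forall>i. X i : {0..} - {t}" "X ~~> t"
  have X0: "X i >= 0" for i using X(1) by auto
  obtain T where T: "!!i. X i <= T" using convergent_imp_Bseq[OF convergentI[OF X(2)]] by (auto simp: Bseq_def abs_le_iff)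
  obtain M R where MR: "M >= 0" "!!x s. 0 <= s ==> s <= max T t ==> v (x::'a, s) <= M * indicator (cball 0 R) x"
   by (rule v_slices_bounded) (rule that)
  have md: "(%x::'a. \<bar>v (x, X i) - v (x, t)\<bar>) : lebm" for i using m[OF X0] m[OF t] by measurable
  have "(%i. LI x. weight g x * \<bar>v (x::'a, X i) - v (x, t)\<bar>) ~~> (LI x::'a. 0)"
  proof (rule integral_dominated_convergence[OF _ _ dom[of M R]])
   show "(%x::'a. weight g x * \<bar>v (x, X i) - v (x, t)\<bar>) : lebm" for i using wm md by measurable
   show "AE x::'a in lebesgue. (%i. weight g x * \<bar>v (x, X i) - v (x, t)\<bar>) ~~> 0"
   proof (intro always_eventually allI)
    fix x :: 'a
    have "continuous_on {0..} (%s. v (x, s))" by (rule continuous_on_compose2[OF v_continuous]) (auto intro: continuous_intros)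
    hence "(%i. v (x, X i)) ~~> v (x, t)" by (rule continuous_on_tendsto_compose[OF _ X(2)]) (use X0 t in auto)
    from tendsto_mult_left[OF tendsto_rabs[OF tendsto_diff[OF this tendsto_const]], of "weight g x" "v (x, t)"]
    show "(%i. weight g x * \<bar>v (x, X i) - v (x, t)\<bar>) ~~> 0" by simp
   qed
   show "AE x::'a in lebesgue. norm (weight g x * \<bar>v (x, X i) - v (x, t)\<bar>) <= weight g x * (M * indicator (cball 0 R) x)" for i
   proof (intro always_eventually allI)
    fix x :: 'a
    have "\<bar>v (x, X i) - v (x, t)\<bar> <= M * indicator (cball 0 R) x"
     using MR(2)[OF X0[of i], of x] MR(2)[OF t, of x] T[of i] v_nonneg[of "(x, X i)"] v_nonneg[of "(x, t)"] by (simp add: abs_le_iff le_max_iff_disj)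
    thus "norm (weight g x * \<bar>v (x, X i) - v (x, t)\<bar>) <= weight g x * (M * indicator (cball 0 R) x)"
     using weight_pos[of x] by (simp add: abs_mult)
   qed
  qed simp
  thus "(%i. LINT x|weighted (weight g). \<bar>v (x::'a, X i) - v (x, t)\<bar>) ~~> 0" by (simp add: wi(2)[OF md])
 qed
qed

text \<open>The front is at most a power of a logarithm: G(r) is at least a multiple of r^\<alpha>1
  for r >= 1, and log s <= s^e / e with e = \<alpha>1 / p turns this into linear growth of the p-th
  power.\<close>

lemma front_powr_le:
 assumes t: "t > 0"
 shows "front t powr p <= max 1 ((\<alpha>2 * \<Gamma> * p / (\<alpha>1 * g 1)) powr (p / \<alpha>1)) * (t + t0)"
proof (cases "front t >= 1")
 case False
 hence "front t powr p <= 1" using front_pos[of t] t t0 p powr_mono2[of p "front t" 1] by simp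
 also have "... <= max 1 ((\<alpha>2 * \<Gamma> * p / (\<alpha>1 * g 1)) powr (p / \<alpha>1)) * (t + t0)"
  using t t0 mult_mono[of 1 "max 1 ((\<alpha>2 * \<Gamma> * p / (\<alpha>1 * g 1)) powr (p / \<alpha>1))" 1 "t + t0"] by simp
 finally show ?thesis .
next
 case True
 let ?s = "t + t0" and ?K = "\<alpha>2 * \<Gamma> * p / (\<alpha>1 * g 1)"
 have s: "?s > 1" using t t0 by simp
 have "g 1 / \<alpha>2 * front t powr \<alpha>1 <= \<Gamma> * ln ?s" using G_lower[OF True] G_front[of t] t t0 by simp
 also have "... <= \<Gamma> * (?s powr (\<alpha>1 / p) / (\<alpha>1 / p))"
  using ln_powr_bound[of ?s "\<alpha>1 / p"] s \<alpha> p \<Gamma> by (intro mult_left_mono) auto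
 finally have "front t powr \<alpha>1 <= ?K * ?s powr (\<alpha>1 / p)" using \<alpha> gpos[of 1] by (simp add: field_simps)
 hence "(front t powr \<alpha>1) powr (p / \<alpha>1) <= (?K * ?s powr (\<alpha>1 / p)) powr (p / \<alpha>1)"
  using \<alpha> p by (intro powr_mono2) auto
 hence "front t powr p <= ?K powr (p / \<alpha>1) * ?s" using \<alpha> p s unfolding powr_mult[of ?K] powr_powr by simp
 also have "... <= max 1 (?K powr (p / \<alpha>1)) * ?s" using s by (intro mult_right_mono) auto
 finally show ?thesis .
qed

text \<open>X_+^b is at most height^b = (front^p / G(front))^k, and front^p is at most a multiple of
  t + t0, so the factor (t + t0)^(-k) compensates.\<close>

lemma v_bounded: "\<exists>B. \<forall>z\<in>S_inf. \<bar>v (z :: 'a::euclidean_space \<times> real)\<bar> <= B"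
proof (intro exI ballI)
 let ?K = "max 1 ((\<alpha>2 * \<Gamma> * p / (\<alpha>1 * g 1)) powr (p / \<alpha>1))"
 fix z :: "'a \<times> real" assume "z : S_inf"
 hence t: "snd z > 0" by (auto simp: S_inf_def)
 let ?s = "snd z + t0"
 have s: "?s > t0" using t by simp
 have \<rho>: "front (snd z) > 0" using front_pos[of "snd z"] t t0 by simp
 have G: "G (front (snd z)) = \<Gamma> * ln ?s" using G_front[of "snd z"] t t0 by simp
 have l: "0 < \<Gamma> * ln t0" "\<Gamma> * ln t0 <= \<Gamma> * ln ?s" using t0 \<Gamma> s by auto
 have "max 0 (gap z) powr b <= height (snd z) powr b"
  using profile_nonneg[of "norm (fst z)"] exponents(2) height_pos[of "snd z"] t t0 by (intro powr_mono2) auto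
 also have "... = (front (snd z) powr p / (\<Gamma> * ln ?s)) powr k"
  using Y_powr[OF \<rho>] G exponents(5) by (simp add: height_def powr_powr[symmetric])
 also have "... <= (?K * ?s / (\<Gamma> * ln t0)) powr k"
  using front_powr_le[OF t] l exponents(1) t t0 by (intro powr_mono2 frac_le) auto
 also have "... = (?K / (\<Gamma> * ln t0)) powr k * ?s powr k" by (simp add: powr_mult powr_divide)
 finally have "v z <= C * ?s powr (- k) * ((?K / (\<Gamma> * ln t0)) powr k * ?s powr k)"
  unfolding v_def using C by (intro mult_left_mono) auto
 also have "... = C * (?K / (\<Gamma> * ln t0)) powr k" using s t0 by (simp add: powr_minus field_simps)
 finally show "\<bar>v z\<bar> <= C * (?K / (\<Gamma> * ln t0)) powr k" using v_nonneg[of z] by simp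
qed

lemma v_solution_class: "solution_class p m (weight g) (v :: 'a::euclidean_space \<times> real => real) Wv"
 unfolding solution_class_def
proof (intro conjI)
 show "bounded_after_positive_times (v :: 'a \<times> real => real)"
  unfolding bounded_after_positive_times_def
 proof (intro allI impI conjI)
  fix t :: real assume t: "t > 0"
  show "(v :: 'a \<times> real => real) : borel_measurable (lebesgue_on (UNIV \<times> {t<..}))"
   by (intro continuous_imp_measurable_on_sets_lebesgue continuous_on_subset[OF v_continuous])
    (use t in "auto simp: open_Times")
  obtain B where "\<forall>z\<in>S_inf. \<bar>v (z :: 'a \<times> real)\<bar> <= B" using v_bounded by blast
  thus "\<exists>B. AE z in lebesgue_on (UNIV \<times> {t<..}). \<bar>v (z :: 'a \<times> real)\<bar> <= B"
   using t by (intro exI[of _ B] AE_I2) (auto simp: S_inf_def space_restrict_space)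
 qed
 show "has_weak_space_grad (%z::'a \<times> real. v z powr grad_exponent p m) Wv"
  using v_weak_space_grad by (simp add: q_def)
 show "locally_integrable S_inf (%z::'a \<times> real. norm (Wv z) powr p)"
  using p by (intro locally_integrable_continuous continuous_on_powr' continuous_on_norm Wv_continuous continuous_on_const) auto
qed (use v_nonneg v_continuous_into_L1 in auto)

end

subsection \<open>Choice of the constants\<close>

context growth begin

lemma r_dY: "r > 0 ==> r * dY r = Y r * (p - lam r) / (p - 1)" "r > 0 ==> r * dY r <= Y r * p / (p - 1)"
proof -
 assume r: "r > 0"
 thus e: "r * dY r = Y r * (p - lam r) / (p - 1)" by (simp add: dY_def)
 show "r * dY r <= Y r * p / (p - 1)"
  unfolding e using Y_pos[OF r] lam[OF r] p \<alpha> by (intro divide_right_mono mult_left_mono) auto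
qed

text \<open>r Y'/Y = (p - lam)/(p - 1) is at least (p - \<alpha>2)/(p - 1).\<close>

lemma Y_powr_lower:
 assumes "0 < s" "s <= t" shows "Y s * (t / s) powr ((p - \<alpha>2) / (p - 1)) <= Y t"
proof -
 have "Y s / s powr ((p - \<alpha>2) / (p - 1)) <= Y t / t powr ((p - \<alpha>2) / (p - 1))"
 proof (rule powr_quotient_mono(1)[OF Y_pos Y_derivative assms])
  fix s :: real assume s: "s > 0"
  have "(p - \<alpha>2) / (p - 1) * (Y s / s) = (Y s * (p - \<alpha>2) / (p - 1)) / s" by simp
  also have "... <= (s * dY s) / s"
   unfolding r_dY(1)[OF s] using lam[OF s] Y_pos[OF s] p s by (intro divide_right_mono mult_left_mono) auto
  finally show "(p - \<alpha>2) / (p - 1) * (Y s / s) <= dY s" using s by simp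
 qed
 thus ?thesis using assms by (simp add: powr_divide field_simps)
qed

lemma Y_unbounded: "\<exists>r\<ge>1. E <= Y r"
proof -
 define r where "r = max 1 ((max E 0 / Y 1) powr ((p - 1) / (p - \<alpha>2)))"
 have "max E 0 / Y 1 = ((max E 0 / Y 1) powr ((p - 1) / (p - \<alpha>2))) powr ((p - \<alpha>2) / (p - 1))"
  using p \<alpha> Y_pos[of 1] by (simp add: powr_powr)
 also have "... <= r powr ((p - \<alpha>2) / (p - 1))" using p \<alpha> by (intro powr_mono2) (auto simp: r_def)
 finally have "max E 0 <= Y 1 * r powr ((p - \<alpha>2) / (p - 1))" using Y_pos[of 1] by (simp add: field_simps)
 also have "... <= Y r" using Y_powr_lower[of 1 r] by (simp add: r_def)
 finally show ?thesis by (intro exI[of _ r]) (auto simp: r_def)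
qed

end

context barrier_parameters begin

lemma profile_le_Y: "0 <= r ==> profile r <= Y (max r0 r)"
proof -
 assume r: "0 <= r"
 have "(1 - lam r0 / p) * (1 / G r0) powr (1 / (p - 1)) * r powr (p / (p - 1)) <= (1 - lam r0 / p) * (1 / G r0) powr (1 / (p - 1)) * r0 powr (p / (p - 1))" if "r < r0"
  using that r lam[OF r0] \<alpha> p by (intro mult_left_mono powr_mono2) auto
 thus ?thesis using r r0 I_eq[of r] I_eq[of r0] I_r0 by (auto simp: profile_def max_def)
qed

text \<open>The first summand bounds the profile on the ball of radius R; the second is the gap X
  that solves C t0^(-k) X^b = max M 0.\<close>

lemma initial_domination:
 assumes h: "Y (max r0 R) + (max M 0 / C * t0 powr k) powr (1 / b) <= height 0" and x: "norm x <= R"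
 shows "M <= v (x, 0)"
proof -
 have "profile (norm x) <= Y (max r0 R)"
  using r0 x by (intro order_trans[OF profile_le_Y Y_mono]) auto
 hence "(max M 0 / C * t0 powr k) powr (1 / b) <= max 0 (gap (x, 0))" using h by simp
 hence "((max M 0 / C * t0 powr k) powr (1 / b)) powr b <= max 0 (gap (x, 0)) powr b"
  using exponents(2) by (intro powr_mono2) auto
 hence "max M 0 / C * t0 powr k <= max 0 (gap (x, 0)) powr b" using exponents(2) C t0 by (simp add: powr_powr)
 hence "C * t0 powr (- k) * (max M 0 / C * t0 powr k) <= C * t0 powr (- k) * max 0 (gap (x, 0)) powr b"
  using C by (intro mult_left_mono) auto
 also have "... = v (x, 0)" by (simp add: v_def)
 finally have "C * t0 powr (- k) * (max M 0 / C * t0 powr k) <= v (x, 0)" .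
 moreover have "C * t0 powr (- k) * (max M 0 / C * t0 powr k) = max M 0" using C t0 by (simp add: powr_minus)
 ultimately show ?thesis by simp
qed

text \<open>For t > t0 >= 2 one has t + t0 <= t^2, so ln(t + t0) <= 2 ln t, and g <= \<alpha>2 G
  gives g(front t) <= 2 \<alpha>2 \<Gamma> ln t. A factor \<gamma> >= 1 in the argument of g gains
  \<gamma>^\<alpha>1, which absorbs the constant. The summand r0 / gi (ln t0) takes care of r0, and
  1 makes the inequality strict.\<close>

lemma front_less:
 assumes t0': "t0 >= 2" and t: "t > t0"
 shows "max r0 (front t) < (max 1 ((2 * \<alpha>2 * \<Gamma>) powr (1 / \<alpha>1)) + r0 / gi (ln t0) + 1) * gi (ln t)"
proof -
 have l: "0 < ln t0" "ln t0 <= ln t" using t t0 by auto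
 define s where "s = gi (ln t)"
 define \<gamma> where "\<gamma> = max 1 ((2 * \<alpha>2 * \<Gamma>) powr (1 / \<alpha>1))"
 have g: "g (gi (ln t0)) = ln t0" "g s = ln t" "gi (ln t0) >= 0" "s >= 0" using gi(1,2) l by (auto simp: s_def)
 have a0: "gi (ln t0) > 0" using g(1,3) l g0 by (cases "gi (ln t0) = 0") auto
 have s0: "s >= gi (ln t0)" using g_less[of s "gi (ln t0)"] g l by (cases "gi (ln t0) <= s") auto
 have \<rho>: "front t > 0" using front_pos[of t] t t0 by simp
 have "2 * t <= t * t" using t t0' by (intro mult_right_mono) auto
 hence "t + t0 <= t * t" using t by linarith
 hence "ln (t + t0) <= ln (t * t)" using t t0 by (intro ln_mono) auto
 hence "ln (t + t0) <= 2 * ln t" using t t0 by (simp add: ln_mult)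
 hence "\<alpha>2 * (\<Gamma> * ln (t + t0)) <= \<alpha>2 * (\<Gamma> * (2 * ln t))" using \<alpha> \<Gamma> by (intro mult_left_mono) auto
 hence "g (front t) <= \<alpha>2 * (\<Gamma> * (2 * ln t))"
  using G_props(4)[of "front t"] \<rho> G_front[of t] t t0 by simp
 also have "... = (2 * \<alpha>2 * \<Gamma>) * g s" by (simp add: g)
 also have "2 * \<alpha>2 * \<Gamma> = ((2 * \<alpha>2 * \<Gamma>) powr (1 / \<alpha>1)) powr \<alpha>1" using \<alpha> \<Gamma> by (simp add: powr_powr)
 also have "... * g s <= \<gamma> powr \<alpha>1 * g s" using \<alpha> g l by (intro mult_right_mono powr_mono2) (auto simp: \<gamma>_def)
 also have "... <= g (\<gamma> * s)" using g_powr[of s "\<gamma> * s"] s0 a0 by (simp add: \<gamma>_def mult.commute)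
 finally have "front t <= \<gamma> * s" using g_less[of "\<gamma> * s" "front t"] g(4) by (cases "front t <= \<gamma> * s") (auto simp: \<gamma>_def)
 moreover have "r0 <= r0 / gi (ln t0) * s" using s0 a0 r0 by (simp add: field_simps)
 moreover have "\<gamma> * s >= 0" "r0 / gi (ln t0) * s >= 0" "s > 0" using s0 a0 r0 by (auto simp: \<gamma>_def)
 ultimately show ?thesis unfolding \<gamma>_def[symmetric] s_def[symmetric] by (simp add: distrib_right)
qed

end

text \<open>Purpose of the size conditions: \<open>r0_large\<close> lets r g' H absorb the
  derivative of H, and the radial slope, outside the core; K1 bounds Q below away from r0;
  \<open>c1_large\<close> keeps half of the divergence after subtracting k;
  \<open>height_large\<close> handles the slope in the core and keeps profiles above half the height
  out of it; \<open>\<Gamma>_large\<close> makes the front outrun the slope term.\<close>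

locale barrier_constants = barrier_parameters +
 fixes N K1 :: real
 assumes N: "N > 0"
  and r0_large: "2 * KH <= \<alpha>1 * g r0" "4 * (b + 1) * p / (p - 1) <= \<alpha>1 * g r0"
  and K1: "0 < K1" "K1 <= \<alpha>1 * \<alpha>1 * (p - \<alpha>2) powr (p - 1) / 2" "K1 <= N * H r0"
  and c1_large: "2 * k <= c1 * \<kappa> * K1"
  and height_large: "2 * Y r0 <= height 0" "4 * (b + 1) * p / ((p - 1) * N) * Y r0 <= height 0"
  and \<Gamma>_large: "c1 * (\<kappa> * p powr (p - 1) * (p / (p - 1)) * 2 powr (\<alpha>2 * (p - 1) / (p - \<alpha>2))) <= \<Gamma> * (p - \<alpha>2) / ((p - 1) * \<alpha>2)"
begin

text \<open>G cancels in H g = lam (p - lam)^(p-1), and the growth conditions bound both factors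
  below. This gives a lower bound for Q uniform in r.\<close>

lemma H_g: "r > 0 ==> \<alpha>1 * (p - \<alpha>2) powr (p - 1) <= H r * g r"
proof -
 assume r: "r > 0"
 have "\<alpha>1 * (p - \<alpha>2) powr (p - 1) <= lam r * (p - lam r) powr (p - 1)"
  using lam[OF r] \<alpha> p by (intro mult_mono powr_mono2) auto
 also have "... = H r * g r" by (simp add: H_def lam_def)
 finally show ?thesis .
qed

lemma Q_outer:
 assumes r: "r > r0" shows "\<alpha>1 * g r * H r / 2 <= Q N r"
proof -
 have rp: "r > 0" using r r0 by simp
 have "\<alpha>1 * g r0 <= \<alpha>1 * g r" using g_mono[of r0 r] r r0 \<alpha> by (intro mult_left_mono) auto
 hence "KH * H r <= \<alpha>1 * g r / 2 * H r" using r0_large(1) H_pos[OF rp] by (intro mult_right_mono) auto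
 moreover have "\<bar>r * dH r\<bar> <= KH * H r" using H_differentiable(2)[OF rp] r rp by (simp add: dH_def abs_mult mult.commute)
 moreover have "\<alpha>1 * g r * H r <= r * deriv g r * H r"
  using g'[OF rp] H_pos[OF rp] rp by (intro mult_right_mono) (auto simp: field_simps)
 moreover have "0 <= N * H r" using N H_pos[OF rp] by simp
 moreover have "max r r0 = r" using r by simp
 ultimately show ?thesis unfolding Q_def by (simp add: abs_le_iff)
qed

lemma Q_inner:
 assumes r: "0 < r" "r < r0" shows "N * H r0 <= Q N r"
 using g'_pos[OF r(1)] H_pos[OF r0] r by (simp add: Q_def dH_def max_def)

lemma Q_lower:
 assumes r: "r > 0" "r ~= r0" shows "K1 <= Q N r"
proof (cases "r > r0")
 case True
 have "\<alpha>1 * (\<alpha>1 * (p - \<alpha>2) powr (p - 1)) <= \<alpha>1 * (H r * g r)" using H_g[OF r(1)] \<alpha> by (intro mult_left_mono) auto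
 hence "K1 <= \<alpha>1 * (H r * g r) / 2" using K1(2) by (simp add: mult.assoc)
 thus ?thesis using Q_outer[OF True] by (simp add: mult_ac)
qed (use Q_inner[of r] K1(3) r in auto)

lemma reaction_lower:
 assumes r: "r > 0" "r ~= r0" shows "c1 * \<kappa> * Q N r / 2 <= reaction N r" "0 <= reaction N r"
proof -
 have "c1 * \<kappa> * K1 <= c1 * \<kappa> * Q N r" using Q_lower[OF r] c1_pos \<kappa>_pos by (intro mult_left_mono) auto
 moreover have "0 < c1 * \<kappa> * K1" using c1_pos \<kappa>_pos K1(1) by simp
 ultimately show "c1 * \<kappa> * Q N r / 2 <= reaction N r" "0 <= reaction N r"
  using c1_large unfolding reaction_def by linarith+
qed

lemma height_mono: "t >= 0 ==> height 0 <= height t"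
 unfolding height_def using t0 by (intro Y_mono front_pos front_mono) auto

text \<open>The time part of \<open>transport\<close> is positive and is dropped. Since the gap is
  at least half the height and \<open>reaction\<close> at least half of c1 \<kappa> Q, it suffices
  to bound (b + 1) H r profile' by a quarter of height times Q. Outside the core the size of g r0
  achieves this, inside it the size of the initial height.\<close>

lemma transport_low:
 assumes r: "r > 0" "r ~= r0" and t: "t > 0" and low: "profile r <= height t / 2"
 shows "0 <= (height t - profile r) * reaction N r + (b + 1) * transport r t"
proof -
 let ?B = "(b + 1) * (H (max r r0) * (r * dprofile r))"
 have c: "0 < c1 * \<kappa>" using c1_pos \<kappa>_pos by simp
 have e: "height t > 0" using height_pos[of t] t t0 by simp
 have key: "?B <= height t / 4 * Q N r"
 proof (cases "r > r0")
  case True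
  have "r * dprofile r <= Y r * p / (p - 1)"
   using r_dY(2)[OF r(1)] True dY_eq[OF r(1)] by (simp add: dprofile_def)
  also have "... = Y r * (p / (p - 1))" by simp
  also have "... <= height t / 2 * (p / (p - 1))"
   using low True p by (intro mult_right_mono) (auto simp: profile_def)
  finally have le: "r * dprofile r <= height t / 2 * (p / (p - 1))" .
  have mx: "max r r0 = r" using True by simp
  have "?B <= (b + 1) * (H r * (height t / 2 * (p / (p - 1))))"
   unfolding mx using H_pos[OF r(1)] exponents(2) by (intro mult_left_mono le) auto
  also have "... = (4 * (b + 1) * p / (p - 1)) * (H r * height t / 8)" using p by (simp add: field_simps)
  also have "... <= (\<alpha>1 * g r) * (H r * height t / 8)"
  proof (intro mult_right_mono order_trans[OF r0_large(2)] mult_left_mono)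
   show "g r0 <= g r" using True r0 by (intro g_mono) auto
  qed (use \<alpha> H_pos[OF r(1)] e in auto)
  also have "... = height t / 4 * (\<alpha>1 * g r * H r / 2)" by simp
  also have "... <= height t / 4 * Q N r" using Q_outer[OF True] e by (intro mult_left_mono) auto
  finally show ?thesis .
 next
  case False
  hence rr: "r < r0" using r by simp
  have "r * dprofile r <= r0 * dY r0"
   unfolding dY_eq[OF r0] dprofile_def using rr r(1) H_pos[OF r0] \<kappa>_pos p
   by (intro mult_mono powr_mono2 mult_right_mono mult_left_mono) (auto simp: max_def)
  also have "... <= Y r0 * p / (p - 1)" by (rule r_dY(2)[OF r0])
  finally have le: "r * dprofile r <= Y r0 * p / (p - 1)" .
  have mx: "max r r0 = r0" using rr by simp
  have "?B <= (b + 1) * (H r0 * (Y r0 * p / (p - 1)))"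
   unfolding mx using H_pos[OF r0] exponents(2) by (intro mult_left_mono le) auto
  also have "... = (4 * (b + 1) * p / ((p - 1) * N) * Y r0) * (N * H r0 / 4)" using N p by (simp add: field_simps)
  also have "... <= height t * (N * H r0 / 4)"
   using height_large(2) height_mono[of t] t N H_pos[OF r0] by (intro mult_right_mono) auto
  also have "... <= height t / 4 * Q N r" using Q_inner[OF r(1) rr] e by simp
  finally show ?thesis .
 qed
 have "height t / 2 * (c1 * \<kappa> * Q N r / 2) <= (height t - profile r) * reaction N r"
  using low reaction_lower[OF r] e Q_lower[OF r] K1(1) c by (intro mult_mono) auto
 moreover have "(b + 1) * transport r t >= - (c1 * \<kappa> * ?B)"
  using dheight_pos[of t] t t0 exponents(2) by (simp add: transport_def algebra_simps)
 moreover have "c1 * \<kappa> * ?B <= c1 * \<kappa> * (height t / 4 * Q N r)" using key c by (intro mult_left_mono) auto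
 ultimately show ?thesis by (simp add: mult_ac)
qed

text \<open>A profile above half the height forces r to be comparable with the front, because Y
  grows at least like a power. Then G(r) is comparable with G(front), and the slope term is at most
  a constant times Y(front)/G(front), while the motion of the front contributes at least \<Gamma>
  times such a quotient.\<close>

lemma transport_high:
 assumes r: "r > 0" and t: "t > 0" and high: "height t / 2 < profile r" "profile r < height t"
 shows "0 <= transport r t"
proof -
 have e: "height 0 <= height t" using height_mono t by simp
 \<comment> \<open>In the core the profile is at most Y r0, hence at most half the height.\<close>
 have rr: "r >= r0"
 proof (rule ccontr)
  assume "\<not> r >= r0"
  thus False using profile_le_Y[of r] r high(1) e height_large(1) by simp
 qed
 let ?\<rho> = "front t"
 have \<rho>: "?\<rho> > 0" using front_pos[of t] t t0 by simp
 have hi: "Y r < Y ?\<rho>" "Y ?\<rho> < 2 * Y r" using high rr by (auto simp: profile_def height_def)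
 have r\<rho>: "r < ?\<rho>" using hi(1) Y_mono[OF \<rho>, of r] by linarith
 have "Y r * (?\<rho> / r) powr ((p - \<alpha>2) / (p - 1)) <= Y ?\<rho>" by (rule Y_powr_lower[OF r less_imp_le[OF r\<rho>]])
 hence "Y r * (?\<rho> / r) powr ((p - \<alpha>2) / (p - 1)) <= 2 * Y r" using hi(2) by linarith
 hence "(?\<rho> / r) powr ((p - \<alpha>2) / (p - 1)) <= 2" using Y_pos[OF r] by simp
 hence "((?\<rho> / r) powr ((p - \<alpha>2) / (p - 1))) powr (\<alpha>2 * (p - 1) / (p - \<alpha>2)) <= 2 powr (\<alpha>2 * (p - 1) / (p - \<alpha>2))"
  using \<alpha> p by (intro powr_mono2) auto
 hence "(?\<rho> / r) powr \<alpha>2 <= 2 powr (\<alpha>2 * (p - 1) / (p - \<alpha>2))" using \<alpha> p by (simp add: powr_powr)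
 hence "G ?\<rho> <= G r * 2 powr (\<alpha>2 * (p - 1) / (p - \<alpha>2))"
  using G_powr[OF r less_imp_le[OF r\<rho>]] G_pos[OF r] by (meson order_trans mult_left_mono less_imp_le)
 hence Gr: "1 / G r <= 2 powr (\<alpha>2 * (p - 1) / (p - \<alpha>2)) / G ?\<rho>"
  using G_pos[OF r] G_pos[OF \<rho>] by (simp add: field_simps)
 have "c1 * \<kappa> * H (max r r0) * r * dprofile r = c1 * (\<kappa> * H r * (r * dY r))"
  using rr dY_eq[OF r] by (simp add: dprofile_def max_absorb1)
 also have "... <= c1 * (\<kappa> * (p powr (p - 1) * (2 powr (\<alpha>2 * (p - 1) / (p - \<alpha>2)) / G ?\<rho>)) * (Y ?\<rho> * p / (p - 1)))"
 proof (intro mult_left_mono mult_mono)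
  have "H r = (p - lam r) powr (p - 1) * (1 / G r)" by (simp add: H_def)
  also have "... <= p powr (p - 1) * (2 powr (\<alpha>2 * (p - 1) / (p - \<alpha>2)) / G ?\<rho>)"
   using lam[OF r] \<alpha> p G_pos[OF r] by (intro mult_mono powr_mono2 Gr) auto
  finally show "H r <= p powr (p - 1) * (2 powr (\<alpha>2 * (p - 1) / (p - \<alpha>2)) / G ?\<rho>)" .
  have "Y r * p / (p - 1) <= Y ?\<rho> * p / (p - 1)" using hi p by (intro divide_right_mono mult_right_mono) auto
  thus "r * dY r <= Y ?\<rho> * p / (p - 1)" using r_dY(2)[OF r] by linarith
 qed (use c1_pos \<kappa>_pos G_pos[OF \<rho>] dY_pos[OF r] r in "auto intro!: mult_nonneg_nonneg divide_nonneg_nonneg")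
 also have "... = c1 * (\<kappa> * p powr (p - 1) * (p / (p - 1)) * 2 powr (\<alpha>2 * (p - 1) / (p - \<alpha>2))) * (Y ?\<rho> / G ?\<rho>)" by (simp add: mult_ac)
 also have "... <= \<Gamma> * (p - \<alpha>2) / ((p - 1) * \<alpha>2) * (Y ?\<rho> / G ?\<rho>)"
  using \<Gamma>_large Y_pos[OF \<rho>] G_pos[OF \<rho>] by (intro mult_right_mono) auto
 also have "... = \<Gamma> * (Y ?\<rho> * (p - \<alpha>2) / (p - 1)) / (\<alpha>2 * G ?\<rho>)" by (simp add: mult_ac)
 also have "... <= \<Gamma> * (?\<rho> * dY ?\<rho>) / g ?\<rho>"
  unfolding r_dY(1)[OF \<rho>] using \<Gamma> lam[OF \<rho>] p \<alpha> Y_pos[OF \<rho>] gpos[OF \<rho>] G_props(4)[of ?\<rho>] \<rho>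
  by (intro frac_le mult_left_mono divide_right_mono) (auto intro!: mult_nonneg_nonneg divide_nonneg_nonneg)
 also have "... = (t + t0) * dheight t" using t t0 by (simp add: dheight_def)
 finally show ?thesis by (simp add: transport_def)
qed

lemma transport_alternative:
 assumes "r > 0" "r ~= r0" "t > 0" "profile r < height t"
 shows "0 <= transport r t \<or> 0 <= (height t - profile r) * reaction N r + (b + 1) * transport r t"
 using transport_low[OF assms(1-3)] transport_high[OF assms(1,3)] assms(4) by (cases "profile r <= height t / 2") auto

lemma v_weak_inequality:
 fixes eta :: "'a::euclidean_space \<times> real => real"
 assumes "N = DIM('a)" and "eta : test_functions S_inf" "!!z. 0 <= eta z"
 shows "0 <= weak_form p m (weight g) v (grad_from_power q v Wv) eta"
 using weak_inequality[OF test_functions_C1_tests[OF assms(2)] assms(3)] reaction_lower(2) transport_alternative assms(1) by blast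

lemma comparison_with_v:
 fixes u :: "'a::euclidean_space \<times> real => real"
 assumes N: "N = DIM('a)" and u: "strong_solution p m (weight g) u"
  and init: "AE x in lebesgue. u (x, 0) <= v (x, 0)" and t: "t >= 0"
 shows "AE x in lebesgue. u (x, t) <= v (x, t)"
proof -
 obtain W ut where W: "solution_class p m (weight g) u W"
   "!!eta. eta : test_functions S_inf ==> weak_form p m (weight g) u (grad_from_power q u W) eta = 0"
  and ut: "has_weak_time_deriv u ut"
  using u unfolding strong_solution_def weak_solution_def q_def by blast
 have vm: "(%z::'a \<times> real. indicator S_inf z * v z) : lebm"
 proof -
  have "continuous_on S_inf (v :: 'a \<times> real => real)"
   by (rule continuous_on_subset[OF v_continuous]) (auto simp: S_inf_def)
  from borel_measurable_continuous_on_indicator[OF borel_open[OF open_S_inf] this]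
  show ?thesis by (simp add: borel_measurable_lebesgue)
 qed
 have vs: "\<exists>R. \<forall>(x::'a) t. 0 <= t --> t <= T --> R <= norm x --> v (x, t) = 0" for T
 proof (intro exI[of _ "max r0 (front (max T 0))"] allI impI)
  fix x :: 'a and t assume "0 <= t" "t <= T" "max r0 (front (max T 0)) <= norm x"
  thus "v (x, t) = 0" using front_mono[of t "max T 0"] t0 by (intro v_outside) auto
 qed
 have Wvp: "locally_integrable S_inf (%z::'a \<times> real. norm (Wv z) powr p)"
  using v_solution_class by (auto simp: solution_class_def)
 note Wvl = locally_integrable_continuous[OF Wv_continuous]
 have "comparison p m q (weight g) u v ut vt W Wv"
  by (rule comparison.intro)
   (fact p q_def exponents weight_continuous weight_pos W ut v_nonneg v_continuous_into_L1 vm v_weak_time_deriv vt_zero v_powr_C1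
    Wvl Wvp v_weak_inequality[OF N] vs init | rule refl)+
 thus ?thesis using comparison.comparison_principle t by blast
qed

end

section \<open>Essential supports and the assembly of the theorem\<close>

lemma AE_zero_outside_ess_supp: "AE x in lebesgue. x \<notin> ess_supp h --> h x = 0"
proof -
 let ?F = "{U. open U \<and> (AE x in lebesgue. x : U --> h x = 0)}"
 \<comment> \<open>Lindelof's theorem leaves countably many open sets, so their exceptional null
   sets unite to a null set.\<close>
 obtain F where F: "F \<subseteq> ?F" "countable F" "\<Union>F = \<Union>?F" by (rule Lindelof[of ?F]) auto
 have "AE x in lebesgue. \<forall>U\<in>F. x : U --> h x = 0" using F by (subst AE_ball_countable) auto
 thus ?thesis
 proof eventually_elim
  case (elim x)
  have "- ess_supp h = \<Union>F" unfolding F(3) ess_supp_def by simp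
  thus ?case using elim by auto
 qed
qed

text \<open>The infimum need not be attained, hence the enlargement by 1.\<close>

lemma ess_supp_subset_ball:
 assumes "compact (ess_supp h)" shows "ess_supp h \<subseteq> ball 0 (support_radius h + 1)"
proof -
 obtain B where "B > 0" "\<forall>x\<in>ess_supp h. norm x < B"
  using compact_imp_bounded[OF assms] by (auto simp: bounded_pos_less)
 hence "{r. r > 0 \<and> ess_supp h \<subseteq> ball 0 r} ~= {}" by auto
 from cInf_lessD[OF this, of "support_radius h + 1"]
 obtain r where "ess_supp h \<subseteq> ball 0 r" "r < support_radius h + 1" by (auto simp: support_radius_def)
 thus ?thesis using subset_ball[of r "support_radius h + 1" 0] by auto
qed

lemma ess_supp_subset_cball:
 fixes h :: "'a::euclidean_space => real"
 assumes "AE x in lebesgue. norm x > R --> h x = 0" shows "ess_supp h \<subseteq> cball 0 R"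
proof -
 have "open (- cball (0 :: 'a) R)" by (rule open_Compl[OF closed_cball])
 moreover have "AE x in lebesgue. x : - cball 0 R --> h x = 0" using assms by eventually_elim auto
 ultimately show ?thesis unfolding ess_supp_def by blast
qed

theorem theorem1p3:
  fixes p m \<alpha>1 \<alpha>2 M Rbar :: real and g :: "real \<Rightarrow> real"
  assumes "1 < p" and "p < real DIM('a::euclidean_space)" and "p + m - 3 > 0"
    and "continuous_on {0..} g" and "g C1_differentiable_on {0<..}"
    and "g 0 = 0" and "\<And>s. s > 0 \<Longrightarrow> g s > 0"
    and "0 < \<alpha>1" and "\<alpha>1 \<le> \<alpha>2" and "\<alpha>2 < p"
    and "\<And>s. s > 0 \<Longrightarrow> \<alpha>1 * (g s / s) \<le> deriv g s \<and> deriv g s \<le> \<alpha>2 * (g s / s)"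
  shows "\<exists>t0 C r0 \<Gamma> \<gamma>. t0 > 1 \<and> C > 0 \<and> r0 > 0 \<and> \<Gamma> > 0 \<and> \<gamma> > 0 \<and>
    weak_supersolution p m (weight g) (barrier p m g t0 C r0 \<Gamma> :: 'a \<times> real \<Rightarrow> real) \<and>
    (\<forall>(u0 :: 'a \<Rightarrow> real) (u :: 'a \<times> real \<Rightarrow> real).
       u0 \<in> borel_measurable lebesgue \<and> (AE x in lebesgue. 0 \<le> u0 x) \<and>
       compact (ess_supp u0) \<and>
       esssup lebesgue (\<lambda>x. ereal (u0 x)) = ereal M \<and> support_radius u0 = Rbar \<and>
       strong_Cauchy_solution p m (weight g) u0 u
       \<longrightarrow>
       (\<forall>t>0. AE x in lebesgue. u (x, t) \<le> barrier p m g t0 C r0 \<Gamma> (x, t)) \<and>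
       (\<forall>t>t0. ess_supp (\<lambda>x. u (x, t)) \<subseteq> ball 0 (\<gamma> * inverse_on_halfline g (ln t))))"
proof -
 interpret growth p \<alpha>1 \<alpha>2 g using assms by unfold_locales auto
 let ?N = "real DIM('a)"
 define k b where "k = 1 / (p + m - 3)" and "b = (p - 1) / (p + m - 3)"
 have kb: "k > 0" "b > 0" using assms by (auto simp: k_def b_def)
 \<comment> \<open>g is unbounded, so one r0 meets both size conditions, whose constants depend on
   the parameters alone.\<close>
 obtain r0 where "r0 >= 0" and r0': "max (2 * KH) (4 * (b + 1) * p / (p - 1)) / \<alpha>1 <= g r0" using g_unbounded by blast
 moreover have "max (2 * KH) (4 * (b + 1) * p / (p - 1)) / \<alpha>1 > 0" using KH_pos \<alpha> by (simp add: less_max_iff_disj)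
 ultimately have r0: "r0 > 0" using g0 by (cases "r0 = 0") auto
 have r0_large: "2 * KH <= \<alpha>1 * g r0" "4 * (b + 1) * p / (p - 1) <= \<alpha>1 * g r0"
  using r0' \<alpha> by (auto simp: pos_divide_le_eq mult.commute)
 define K1 where "K1 = min (\<alpha>1 * \<alpha>1 * (p - \<alpha>2) powr (p - 1) / 2) (?N * H r0)"
 have K1: "K1 > 0" using \<alpha> H_pos[OF r0] by (simp add: K1_def)
 \<comment> \<open>Solves c1 \<kappa> K1 = 2k: since k (p + m - 3) = 1, raising C to the power p + m
   - 3 undoes the power k.\<close>
 define C where "C = (2 * k / (\<kappa> * K1 * b powr (p - 1))) powr k"
 have C: "C > 0" using kb \<kappa>_pos K1 by (simp add: C_def)
 define c1 where "c1 = b powr (p - 1) * C powr (p + m - 3)"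
 have "C powr (p + m - 3) = 2 * k / (\<kappa> * K1 * b powr (p - 1))"
  using assms(3) kb \<kappa>_pos K1 by (simp add: C_def powr_powr k_def)
 hence c1: "c1 * \<kappa> * K1 = 2 * k" using kb \<kappa>_pos K1 by (simp add: c1_def)
 \<comment> \<open>The height required at time 0: two structural demands, and domination of the
   level M on the ball of radius Rbar + 1. The factor \<open>exp 1 powr k\<close> is t0^k.\<close>
 define E where "E = max (2 * Y r0) (max (4 * (b + 1) * p / ((p - 1) * ?N) * Y r0)
   (Y (max r0 (Rbar + 1)) + (max M 0 / C * exp 1 powr k) powr (1 / b)))"
 obtain r1 where r1: "r1 >= 1" "E <= Y r1" using Y_unbounded by blast
 define A where "A = c1 * (\<kappa> * p powr (p - 1) * (p / (p - 1)) * 2 powr (\<alpha>2 * (p - 1) / (p - \<alpha>2)))"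
 \<comment> \<open>Because ln t0 = 1, the front starts at the radius where G equals \<Gamma>. The
   first entry puts it beyond r1, where Y >= E; the second entry is the speed condition.\<close>
 define \<Gamma> where "\<Gamma> = max (G r1) (A * ((p - 1) * \<alpha>2) / (p - \<alpha>2))"
 have \<Gamma>': "\<Gamma> > 0" "G r1 <= \<Gamma>" "A * ((p - 1) * \<alpha>2) / (p - \<alpha>2) <= \<Gamma>"
  using G_pos[of r1] r1 by (auto simp: \<Gamma>_def less_max_iff_disj)
 hence \<Gamma>: "\<Gamma> > 0" "G r1 <= \<Gamma>" "A <= \<Gamma> * (p - \<alpha>2) / ((p - 1) * \<alpha>2)"
  using \<alpha> p by (simp_all add: pos_divide_le_eq pos_le_divide_eq)
 \<comment> \<open>With t0 = e the term gi (ln t0) in the support radius becomes gi 1, and t0 >= 2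
   holds as \<open>front_less\<close> requires.\<close>
 interpret P: barrier_parameters p \<alpha>1 \<alpha>2 g m "exp 1" C r0 \<Gamma>
  using assms(3) C r0 \<Gamma> by unfold_locales auto
 have Pd: "P.k = k" "P.b = b" "P.c1 = c1" by (simp_all add: P.k_def k_def P.b_def b_def P.c1_def c1_def)
 have "r1 <= P.front 0" using Gi_mono[OF _ \<Gamma>(2)] Gi(3)[of r1] G_pos[of r1] r1(1) by (simp add: P.front_def)
 hence E: "E <= P.height 0" using r1 Y_mono[of r1 "P.front 0"] by (simp add: P.height_def)
 interpret P: barrier_constants p \<alpha>1 \<alpha>2 g m "exp 1" C r0 \<Gamma> ?N K1
  using r0_large K1 c1 E \<Gamma>(3) by unfold_locales (auto simp: Pd K1_def E_def A_def)
 have barrier: "barrier p m g (exp 1) C r0 \<Gamma> = (P.v :: 'a \<times> real => real)" by (rule ext) (rule P.barrier_eq)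
 have super: "weak_supersolution p m (weight g) (P.v :: 'a \<times> real => real)"
  unfolding weak_supersolution_def using P.v_solution_class P.v_weak_inequality by (auto simp: P.q_def)
 have main: "(\<forall>t>0. AE x in lebesgue. u (x, t) <= P.v (x, t)) \<and>
   (\<forall>t>exp 1. ess_supp (%x. u (x, t)) \<subseteq> ball 0 ((max 1 ((2 * \<alpha>2 * \<Gamma>) powr (1 / \<alpha>1)) + r0 / gi 1 + 1) * gi (ln t)))"
  if u0: "AE x in lebesgue. 0 <= u0 x" "compact (ess_supp u0)" "esssup lebesgue (%x. ereal (u0 x)) = ereal M"
   "support_radius u0 = Rbar" and u: "strong_Cauchy_solution p m (weight g) u0 u" for u0 :: "'a => real" and u
 proof -
  have us: "strong_solution p m (weight g) u" "AE x in lebesgue. u (x, 0) = u0 x"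
   using u by (auto simp: strong_Cauchy_solution_def)
  have "AE x in lebesgue. u0 x <= M" using esssup_AE[of "%x. ereal (u0 x)" lebesgue] u0(3) by simp
  hence init: "AE x in lebesgue. u (x, 0) <= P.v (x, 0)"
   using us(2) AE_zero_outside_ess_supp[of u0]
  proof eventually_elim
   case (elim x)
   show ?case
   proof (cases "x : ess_supp u0")
    case True
    hence "norm x <= Rbar + 1" using ess_supp_subset_ball[OF u0(2)] u0(4) by fastforce
    hence "M <= P.v (x, 0)" using E by (intro P.initial_domination[of "Rbar + 1"]) (simp_all add: Pd E_def)
    thus ?thesis using elim by simp
   qed (use elim P.v_nonneg in simp)
  qed
  have le: "AE x in lebesgue. u (x, t) <= P.v (x, t)" if "t >= 0" for t by (rule P.comparison_with_v[OF refl us(1) init that])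
  have "ess_supp (%x. u (x, t)) \<subseteq> ball 0 ((max 1 ((2 * \<alpha>2 * \<Gamma>) powr (1 / \<alpha>1)) + r0 / gi 1 + 1) * gi (ln t))"
   if t: "t > exp 1" for t
  proof -
   have t': "t >= 0" using t exp_gt_zero[of 1] by linarith
   have "AE x in lebesgue. 0 <= u (x, t)"
    using us(1) t' by (auto simp: strong_solution_def weak_solution_def solution_class_def)
   hence "AE x in lebesgue. norm x > max r0 (P.front t) --> u (x, t) = 0" using le[OF t']
   proof eventually_elim
    case (elim x)
    thus ?case using P.v_outside[OF t', of x] by auto
   qed
   from ess_supp_subset_cball[OF this] show ?thesis
    using P.front_less[OF _ t] exp_ge_add_one_self[of 1] by force
  qed
  thus ?thesis using le by simp
 qed
 show ?thesis
 proof (rule exI[of _ "exp 1"], rule exI[of _ C], rule exI[of _ r0], rule exI[of _ \<Gamma>],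
   rule exI[of _ "max 1 ((2 * \<alpha>2 * \<Gamma>) powr (1 / \<alpha>1)) + r0 / gi 1 + 1"], intro conjI)
  have "0 <= r0 / gi 1" using gi(1)[of 1] r0 by simp
  thus "0 < max 1 ((2 * \<alpha>2 * \<Gamma>) powr (1 / \<alpha>1)) + r0 / gi 1 + 1" by linarith
 qed (unfold barrier, (rule C r0 \<Gamma>(1) super | (intro allI impI, elim conjE, rule main, assumption+) | simp)+)
qed

end
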